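(* Let $0\le\alpha\le1$. For every integer $n\ge2$ there exists an unstable vortex $\bar\Theta\in C_c^\infty(\mathbb{R}^2)\cap U_0$ whose corresponding eigenfunction satisfies $W\in C_c^\infty(\mathbb{R}^2)\cap U_n$; that is, there exist $\bar\Theta\in C_c^\infty\cap U_0$, $\lambda\in\mathbb{C}$ with $\operatorname{Re}\lambda>0$, and $0\ne W\in C_c^\infty\cap U_n$ such that $$L_{0,\bar\Theta}W=\lambda W.$$
   Context: For a function $\Theta$ on $\mathbb{R}^2$, its $\alpha$-Biot–Savart velocity is $V[\Theta]=-\nabla^\perp\Lambda^{\alpha-2}\Theta$ with $\Lambda=(-\Delta)^{1/2}$, i.e. $V[\Theta](X)=C_\alpha\int_{\mathbb{R}^2}\frac{(X-Y)^\perp}{|X-Y|^{2+\alpha}}\Theta(Y)\,dY$, with $(x_1,x_2)^\perp=(-x_2,x_1)$ and $C_\alpha=\frac{2^\alpha}{2\pi}\frac{\Gamma(1+\alpha/2)}{\Gamma(1-\alpha/2)}$ (extended linearly to complex-valued functions). For a radial $\bar\Theta$ (a "vortex"), the linearization of the unforced $\alpha$-SQG equation $\partial_t\theta+V[\theta]\cdot\nabla\theta=0$ around $\bar\Theta$ is $L_{0,\bar\Theta}\Theta=-V[\bar\Theta]\cdot\nabla\Theta-V[\Theta]\cdot\nabla\bar\Theta$. In polar coordinates $X=Re^{i\phi}$: $U_0=\{\bar\Theta\in L^2(\mathbb{R}^2):\bar\Theta(X)=\bar\Theta(R),\ \int_0^\infty\bar\Theta(R)R\,dR=0\}$ and, for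 an integer $n\ne0$, $U_n=\{W\in L^2(\mathbb{R}^2):W(X)=W_n(R)e^{in\phi}\}$. The vortex $\bar\Theta$ is unstable if for some $n\in\mathbb{N}$ there is $0\ne W\in U_n$ with $L_{0,\bar\Theta}W=\lambda W$ and $\operatorname{Re}\lambda>0$. *)

theory Defs
  imports "HOL-Analysis.Analysis"
begin

text \<open>
  The plane is \<^typ>\<open>real^2\<close>. Velocities and gradients of complex-valued functions take values in
  \<^typ>\<open>complex^2\<close>; they are paired by the bilinear dot product (no conjugation), which is the
  complex-linear extension of the real one.
\<close>

fun Ck :: "nat \<Rightarrow> ('a::euclidean_space \<Rightarrow> 'b::real_normed_vector) \<Rightarrow> bool" where
  "Ck 0 f \<longleftrightarrow> continuous_on UNIV f"
| "Ck (Suc k) f \<longleftrightarrow>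
     (\<forall>x. f differentiable (at x)) \<and> (\<forall>v. Ck k (\<lambda>x. frechet_derivative f (at x) v))"

definition Cc_infinity :: "('a::euclidean_space \<Rightarrow> 'b::real_normed_vector) set" where
  "Cc_infinity = {f. (\<forall>k. Ck k f) \<and> compact (closure {x. f x \<noteq> 0})}"

definition square_integrable :: "(real^2 \<Rightarrow> 'b::euclidean_space) \<Rightarrow> bool" where
  "square_integrable f \<longleftrightarrow>
     f \<in> borel_measurable lebesgue \<and> integrable lebesgue (\<lambda>X. (norm (f X))\<^sup>2)"

definition polar :: "real \<Rightarrow> real \<Rightarrow> real^2" where
  "polar R \<phi> = vector [R * cos \<phi>, R * sin \<phi>]"

text \<open>
  The gauge integral over the half line includes convergent improper integrals, so no separate
  integrability assumption on the profile is needed.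
\<close>

definition U0 :: "(real^2 \<Rightarrow> real) set" where
  "U0 = {\<Theta>. square_integrable \<Theta> \<and>
          (\<exists>g. (\<forall>X. \<Theta> X = g (norm X)) \<and> ((\<lambda>R. g R * R) has_integral 0) {0..})}"

definition U :: "int \<Rightarrow> (real^2 \<Rightarrow> complex) set" where
  "U n = {W. square_integrable W \<and>
          (\<exists>w. \<forall>R>0. \<forall>\<phi>. W (polar R \<phi>) = w R * cis (of_int n * \<phi>))}"

definition perp :: "real^2 \<Rightarrow> real^2" where
  "perp x = vector [- (x $ 2), x $ 1]"

definition C_const :: "real \<Rightarrow> real" where
  "C_const \<alpha> = 2 powr \<alpha> / (2 * pi) * (Gamma (1 + \<alpha> / 2) / Gamma (1 - \<alpha> / 2))"

definition BS_integrand ::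
    "real \<Rightarrow> (real^2 \<Rightarrow> complex) \<Rightarrow> real^2 \<Rightarrow> 2 \<Rightarrow> real^2 \<Rightarrow> complex" where
  "BS_integrand \<alpha> \<Theta> X j Y =
     complex_of_real (perp (X - Y) $ j / norm (X - Y) powr (2 + \<alpha>)) * \<Theta> Y"

text \<open>
  For \<open>\<alpha> = 1\<close> the kernel has the non-integrable order \<open>-2\<close> at the diagonal, so the Biot--Savart
  integral is a principal value. Where the integrand is Lebesgue integrable, in particular for
  test functions when \<open>\<alpha> < 1\<close>, this is the ordinary integral (lemma \<open>velocity_eq_integral\<close>).
\<close>

definition velocity :: "real \<Rightarrow> (real^2 \<Rightarrow> complex) \<Rightarrow> real^2 \<Rightarrow> complex^2" where
  "velocity \<alpha> \<Theta> X = (\<chi> j. complex_of_real (C_const \<alpha>) *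
     Lim (at_right 0) (\<lambda>\<epsilon>. LINT Y:{Y. \<epsilon> < dist X Y}|lebesgue. BS_integrand \<alpha> \<Theta> X j Y))"

definition grad :: "(real^2 \<Rightarrow> complex) \<Rightarrow> real^2 \<Rightarrow> complex^2" where
  "grad f X = (\<chi> j. frechet_derivative f (at X) (axis j 1))"

definition cdot :: "complex^2 \<Rightarrow> complex^2 \<Rightarrow> complex" where
  "cdot a b = (\<Sum>j\<in>UNIV. a $ j * b $ j)"

definition L0 :: "real \<Rightarrow> (real^2 \<Rightarrow> real) \<Rightarrow> (real^2 \<Rightarrow> complex) \<Rightarrow> real^2 \<Rightarrow> complex" where
  "L0 \<alpha> \<Theta>bar \<Theta> X =
     - cdot (velocity \<alpha> (\<lambda>Y. complex_of_real (\<Theta>bar Y)) X) (grad \<Theta> X)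
     - cdot (velocity \<alpha> \<Theta> X) (grad (\<lambda>Y. complex_of_real (\<Theta>bar Y)) X)"

lemma velocity_eq_integral:
  assumes int: "\<And>j. integrable lebesgue (BS_integrand \<alpha> \<Theta> X j)"
  shows "velocity \<alpha> \<Theta> X =
    (\<chi> j. complex_of_real (C_const \<alpha>) * (LINT Y|lebesgue. BS_integrand \<alpha> \<Theta> X j Y))"
proof -
  have "((\<lambda>\<epsilon>. LINT Y:{Y. \<epsilon> < dist X Y}|lebesgue. BS_integrand \<alpha> \<Theta> X j Y)
          \<longlongrightarrow> (LINT Y|lebesgue. BS_integrand \<alpha> \<Theta> X j Y)) (at_right 0)" for j
  proof (rule tendsto_at_right_sequentially[where b = 1])
    fix S :: "nat \<Rightarrow> real"
    assume S: "\<And>n. 0 < S n" "S \<longlonglongrightarrow> 0"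
    let ?f = "BS_integrand \<alpha> \<Theta> X j"
    show "(\<lambda>n. LINT Y:{Y. S n < dist X Y}|lebesgue. ?f Y) \<longlonglongrightarrow> (LINT Y|lebesgue. ?f Y)"
      unfolding set_lebesgue_integral_def
    proof (rule integral_dominated_convergence[where w = "\<lambda>Y. norm (?f Y)"])
      show "?f \<in> borel_measurable lebesgue" using int by auto
      have "{Y. S n < dist X Y} \<in> sets lebesgue" for n
      proof -
        have "open {Y. S n < dist X Y}" by (intro open_Collect_less continuous_intros)
        then show ?thesis by auto
      qed
      then show "(\<lambda>Y. indicat_real {Y. S n < dist X Y} Y *\<^sub>R ?f Y) \<in> borel_measurable lebesgue" for n
        using int by (intro borel_measurable_scaleR borel_measurable_indicator) auto
      show "integrable lebesgue (\<lambda>Y. norm (?f Y))" using int by auto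
      show "AE Y in lebesgue. (\<lambda>n. indicat_real {Y. S n < dist X Y} Y *\<^sub>R ?f Y) \<longlonglongrightarrow> ?f Y"
      proof (intro AE_I2)
        fix Y
        show "(\<lambda>n. indicat_real {Y. S n < dist X Y} Y *\<^sub>R ?f Y) \<longlonglongrightarrow> ?f Y"
        proof (cases "X = Y")
          case True
          then have "perp (X - Y) $ j = 0"
            using exhaust_2[of j] by (auto simp: perp_def)
          then have "?f Y = 0" by (simp add: BS_integrand_def)
          then show ?thesis by simp
        next
          case False
          then have "eventually (\<lambda>n. S n < dist X Y) sequentially"
            by (intro order_tendstoD[OF S(2)]) simp
          then have "eventually (\<lambda>n. indicat_real {Y. S n < dist X Y} Y *\<^sub>R ?f Y = ?f Y) sequentially"
            by eventually_elim simp
          then show ?thesis by (rule tendsto_eventually)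
        qed
      qed
      show "AE Y in lebesgue. norm (indicat_real {Y. S n < dist X Y} Y *\<^sub>R ?f Y) \<le> norm (?f Y)" for n
        by (intro AE_I2) (simp add: indicator_def)
    qed
  qed simp
  from tendsto_Lim[OF _ this] show ?thesis by (simp add: velocity_def)
qed

end

theory Submission
  imports Defs
begin

text \<open>
  Write \<open>R = e^s\<close> and \<open>a = 1 + \<alpha> / 2\<close>, and let
  \<open>k\<^sub>j(u) = \<integral> sin \<theta> sin (j \<theta>) (2 cosh u - 2 cos \<theta>)^-a d\<theta>\<close>
  over one period. An integration by parts in the angle moves the derivative from the Biot--Savart
  kernel to the function and leaves an absolutely convergent integral, for \<open>\<alpha> = 1\<close> too. For a
  vortex with derivative \<open>p(s) e^(-3 s)\<close> in \<open>R\<close> and a perturbation \<open>w(s) e^(-3 s) e^(i n \<phi>)\<close> the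
  equation \<open>L W = \<mu> W\<close> becomes, with \<open>\<mu> = i C c\<close> and the positive constant \<open>C\<close> of the velocity,

    \<open>(\<Omega>(s) - c) w(s) = p(s) \<integral> K(s,t) w(t) dt\<close>,

  where \<open>K(s,t) = e^(-a s) e^(-a t) k\<^sub>n(s - t)\<close> and \<open>\<Omega>(s) = \<integral> e^(-a s) e^(-a t) n k\<^sub>1(s - t) p(t) dt\<close>
  (lemma \<open>L0_eigen_equation\<close>). An unstable vortex is thus a profile \<open>p\<close> of mean zero, which is the
  condition of \<open>U0\<close>, such that this equation has a solution \<open>w \<noteq> 0\<close> with \<open>Im c < 0\<close>.

  Take \<open>p = \<eta>\<^sub>1 - \<eta>\<^sub>2\<close> with two thin bumps of mass one near \<open>-u/2\<close> and \<open>u/2\<close>. The kernels \<open>n k\<^sub>1\<close>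
  and \<open>k\<^sub>n\<close> may be singular at \<open>0\<close>, but their difference is continuous with a positive value \<open>g\<close>
  there. So the self-interaction of a bump nearly cancels against its part of \<open>\<Omega>\<close>: if
  \<open>w = (\<eta>\<^sub>1 - \<eta>\<^sub>2) y\<close> with \<open>y\<close> nearly a constant \<open>y\<^sub>1\<close> or \<open>y\<^sub>2\<close> on each bump, then in the limit of
  thin bumps

    \<open>(m + \<phi> - c) y\<^sub>1 = - G y\<^sub>2\<close>  and  \<open>(m - \<phi> - c) y\<^sub>2 = G y\<^sub>1\<close>,

  where \<open>G = k\<^sub>n(u)\<close>, \<open>m = g sinh (a u)\<close> and \<open>\<phi> = g cosh (a u) - n k\<^sub>1(u)\<close>. Hence
  \<open>(m - c)\<^sup>2 = \<phi>\<^sup>2 - G\<^sup>2\<close>, and \<open>c\<close> is not real as soon as \<open>\<bar>\<phi>\<bar> < G\<close>. The function \<open>\<phi>\<close> is negative for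
  small \<open>u\<close> and positive for large \<open>u\<close>, while \<open>G > 0\<close>; so \<open>0 < \<phi> < G\<close> holds just after the last
  zero of \<open>\<phi>\<close> (lemma \<open>exists_unstable_separation\<close>).

  For bumps of positive width the equation is solved exactly. Because \<open>\<phi> > 0\<close>, the factor \<open>\<Omega> - c\<close>
  exceeds the self-interaction in absolute value on both bumps, with a margin that does not depend
  on their width. After the coupling of the second bump to the first is replaced by a source term,
  the equation is a contraction in the supremum norm for every \<open>c\<close> in a disc around the root
  \<open>m - i sqrt (G\<^sup>2 - \<phi>\<^sup>2)\<close> of the limit problem (lemma \<open>uniform_contraction\<close>). The replacement is
  correct for those \<open>c\<close> that satisfy one scalar equation, and such a \<open>c\<close> exists by Brouwer's theorem
  (lemma \<open>eigenfunction_exists\<close>). The solution is smooth because its derivative solves an equation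
  with the same contraction (lemma \<open>solution_Ck\<close>). It is supported where \<open>p\<close> is, which makes the
  eigenfunction a test function.
\<close>

section \<open>Functions of class Ck\<close>

lemma Ck_cong: "Ck k f \<Longrightarrow> (\<And>x. f x = g x) \<Longrightarrow> Ck k g"
proof -
  assume "Ck k f" "\<And>x. f x = g x"
  then have "f = g" by auto
  with \<open>Ck k f\<close> show ?thesis by simp
qed

lemma Ck_SucI:
  assumes "\<And>x. (f has_derivative f' x) (at x)" and "\<And>v. Ck k (\<lambda>x. f' x v)"
  shows "Ck (Suc k) f"
proof -
  have "frechet_derivative f (at x) = f' x" for x
    using frechet_derivative_at[OF assms(1)[of x]] by simp
  moreover have "f differentiable (at x)" for x
    using assms(1)[of x] by (auto simp: differentiable_def)
  ultimately show ?thesis using assms(2) by simp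
qed

lemma Ck_Suc_vecI:
  fixes f :: "real \<Rightarrow> 'b::real_normed_vector"
  assumes "\<And>x. (f has_vector_derivative f' x) (at x)" and "\<And>v. Ck k (\<lambda>x. v *\<^sub>R f' x)"
  shows "Ck (Suc k) f"
  by (rule Ck_SucI[where f' = "\<lambda>x v. v *\<^sub>R f' x"])
    (use assms in \<open>auto simp: has_vector_derivative_def\<close>)

lemma Ck_imp_continuous: "Ck k f \<Longrightarrow> continuous_on UNIV f"
proof (cases k)
  case (Suc j)
  assume "Ck k f"
  then have "\<forall>x. f differentiable (at x)" using Suc by simp
  then show ?thesis
    by (auto intro!: continuous_at_imp_continuous_on differentiable_imp_continuous_within)
qed simp

lemma Ck_SucD: "Ck (Suc k) f \<Longrightarrow> Ck k f"
proof (induction k arbitrary: f)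
  case 0
  then show ?case using Ck_imp_continuous[OF 0] by simp
qed (simp del: Ck.simps(1))

lemma Ck_SucE:
  assumes "Ck (Suc k) f"
  obtains f' where "\<And>x. (f has_derivative f' x) (at x)" "\<And>v. Ck k (\<lambda>x. f' x v)"
  using assms by (intro that[of "\<lambda>x. frechet_derivative f (at x)"])
    (auto simp: frechet_derivative_works)

lemma Ck_const: "Ck k (\<lambda>x. c)"
proof (induction k arbitrary: c)
  case (Suc k)
  show ?case by (rule Ck_SucI[where f' = "\<lambda>_ _. 0"]) (use Suc[of 0] in auto)
qed simp

lemma Ck_compose_linear:
  assumes "bounded_linear L" "Ck k f" shows "Ck k (\<lambda>x. L (f x))"
  using assms(2)
proof (induction k arbitrary: f)
  case 0
  then show ?case
    using bounded_linear.continuous_on[OF assms(1)] by auto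
next
  case (Suc k)
  from Ck_SucE[OF Suc.prems] obtain f' where
    f': "\<And>x. (f has_derivative f' x) (at x)" "\<And>v. Ck k (\<lambda>x. f' x v)" by metis
  show ?case
    by (rule Ck_SucI[where f' = "\<lambda>x v. L (f' x v)"])
      (auto intro!: bounded_linear.has_derivative[OF assms(1)] f' Suc.IH)
qed

lemma Ck_linear: assumes "bounded_linear L" shows "Ck k L"
proof (cases k)
  case 0 then show ?thesis using bounded_linear.continuous_on[OF assms continuous_on_id] by simp
next
  case (Suc j)
  show ?thesis unfolding Suc
    by (rule Ck_SucI[where f' = "\<lambda>_. L"])
      (use bounded_linear_imp_has_derivative[OF assms] Ck_const in auto)
qed

lemma Ck_add:
  assumes "Ck k f" "Ck k g" shows "Ck k (\<lambda>x. f x + g x)"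
  using assms
proof (induction k arbitrary: f g)
  case 0 then show ?case by (auto intro: continuous_intros)
next
  case (Suc k)
  from Ck_SucE[OF Suc.prems(1)] obtain f' where
    f': "\<And>x. (f has_derivative f' x) (at x)" "\<And>v. Ck k (\<lambda>x. f' x v)" by metis
  from Ck_SucE[OF Suc.prems(2)] obtain g' where
    g': "\<And>x. (g has_derivative g' x) (at x)" "\<And>v. Ck k (\<lambda>x. g' x v)" by metis
  show ?case
    by (rule Ck_SucI[where f' = "\<lambda>x v. f' x v + g' x v"])
      (use f' g' Suc.IH in \<open>auto intro: derivative_intros\<close>)
qed

lemma (in bounded_bilinear) Ck_bilinear:
  assumes "Ck k f" "Ck k g" shows "Ck k (\<lambda>x. prod (f x) (g x))"
  using assms
proof (induction k arbitrary: f g)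
  case 0 then show ?case by (auto intro: continuous_on)
next
  case (Suc k)
  from Ck_SucE[OF Suc.prems(1)] obtain f' where
    f': "\<And>x. (f has_derivative f' x) (at x)" "\<And>v. Ck k (\<lambda>x. f' x v)" by metis
  from Ck_SucE[OF Suc.prems(2)] obtain g' where
    g': "\<And>x. (g has_derivative g' x) (at x)" "\<And>v. Ck k (\<lambda>x. g' x v)" by metis
  show ?case
  proof (rule Ck_SucI[where f' = "\<lambda>x v. prod (f x) (g' x v) + prod (f' x v) (g x)"])
    show "((\<lambda>x. prod (f x) (g x)) has_derivative (\<lambda>v. prod (f x) (g' x v) + prod (f' x v) (g x))) (at x)" for x
      by (rule FDERIV[OF f'(1) g'(1)])
    show "Ck k (\<lambda>x. prod (f x) (g' x v) + prod (f' x v) (g x))" for v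
      by (intro Ck_add Suc.IH f' g') (use Suc.prems Ck_SucD in auto)
  qed
qed

lemmas Ck_mult = bounded_bilinear.Ck_bilinear[OF bounded_bilinear_mult]
lemmas Ck_scaleR = bounded_bilinear.Ck_bilinear[OF bounded_bilinear_scaleR]

lemma Ck_minus: "Ck k f \<Longrightarrow> Ck k (\<lambda>x. - f x)"
  by (rule Ck_compose_linear[OF bounded_linear_minus[OF bounded_linear_ident]])

lemma Ck_diff: "Ck k f \<Longrightarrow> Ck k g \<Longrightarrow> Ck k (\<lambda>x. f x - g x)"
  using Ck_add[OF _ Ck_minus, of k f g] by simp

lemma Ck_of_real: "Ck k f \<Longrightarrow> Ck k (\<lambda>x. of_real (f x) :: 'b::real_normed_algebra_1)"
  by (rule Ck_compose_linear[OF bounded_linear_of_real])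

lemma Ck_power:
  fixes f :: "'a::euclidean_space \<Rightarrow> 'b::real_normed_algebra_1"
  shows "Ck k f \<Longrightarrow> Ck k (\<lambda>x. f x ^ m)"
  by (induction m) (auto intro: Ck_const Ck_mult)

lemma Ck_Suc_vec:
  fixes f :: "real \<Rightarrow> 'b::real_normed_vector"
  assumes "\<And>x. (f has_vector_derivative f' x) (at x)" and "Ck k f'"
  shows "Ck (Suc k) f"
  by (rule Ck_Suc_vecI[OF assms(1)]) (rule Ck_scaleR[OF Ck_const assms(2)])

lemma Ck_Suc_vecE:
  fixes f :: "real \<Rightarrow> 'b::real_normed_vector"
  assumes "Ck (Suc k) f"
  obtains f' where "\<And>x. (f has_vector_derivative f' x) (at x)" "Ck k f'"
proof -
  from Ck_SucE[OF assms] obtain f' where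
    f': "\<And>x. (f has_derivative f' x) (at x)" "\<And>v. Ck k (\<lambda>x. f' x v)" by metis
  show thesis
  proof (rule that[of "\<lambda>x. f' x 1"])
    show "(f has_vector_derivative f' x 1) (at x)" for x
    proof -
      interpret bounded_linear "f' x" using f'(1) by (rule has_derivative_bounded_linear)
      have "f' x = (\<lambda>h. h *\<^sub>R f' x 1)"
        by (rule ext) (metis scale scaleR_one mult.right_neutral real_scaleR_def)
      then show ?thesis using f'(1)[of x] by (simp add: has_vector_derivative_def)
    qed
  qed (rule f')
qed

lemma Ck_derivative:
  fixes f :: "real \<Rightarrow> 'b::real_normed_vector"
  assumes "Ck (Suc k) f" "\<And>x. (f has_vector_derivative f' x) (at x)"
  shows "Ck k f'"
proof -
  from Ck_Suc_vecE[OF assms(1)] obtain g where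
    g: "\<And>x. (f has_vector_derivative g x) (at x)" "Ck k g" by metis
  have "g = f'" using vector_derivative_unique_at[OF g(1) assms(2)] by auto
  then show ?thesis using g by simp
qed

lemma Ck_inverse:
  fixes f :: "real \<Rightarrow> 'b::{real_normed_field}"
  assumes "Ck k f" "\<And>x. f x \<noteq> 0"
  shows "Ck k (\<lambda>x. inverse (f x))"
  using assms(1)
proof (induction k)
  case 0
  then show ?case using assms(2) by (auto intro!: continuous_intros)
next
  case (Suc k)
  from Ck_Suc_vecE[OF Suc.prems] obtain f' where
    f': "\<And>x. (f has_vector_derivative f' x) (at x)" "Ck k f'" by metis
  have d: "((\<lambda>x. inverse (f x)) has_vector_derivative - (inverse (f x) * f' x * inverse (f x))) (at x)" for x
    using Deriv.has_derivative_inverse[OF assms(2) f'(1)[unfolded has_vector_derivative_def], of x]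
    by (auto simp: has_vector_derivative_def elim!: has_derivative_eq_rhs)
  show ?case
    by (rule Ck_Suc_vec[OF d])
      (intro Ck_minus Ck_mult f' Suc.IH Ck_SucD[OF Suc.prems])
qed

lemma Ck_exp: "Ck k (\<lambda>s::real. exp (b * s))"
proof (induction k)
  case (Suc k)
  show ?case
    by (rule Ck_Suc_vec[where f' = "\<lambda>s. b * exp (b * s)"])
      (auto intro!: derivative_eq_intros Ck_mult Ck_const Suc simp: has_real_derivative_iff_has_vector_derivative[symmetric])
qed (auto intro!: continuous_intros)

lemma Ck_affine:
  fixes f :: "real \<Rightarrow> 'b::real_normed_vector"
  assumes "Ck k f" shows "Ck k (\<lambda>x. f (b * x + d))"
  using assms
proof (induction k arbitrary: f)
  case 0
  then show ?case
    by (auto intro!: continuous_on_compose2[of UNIV f] continuous_intros)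
next
  case (Suc k)
  from Ck_Suc_vecE[OF Suc.prems] obtain f' where
    f': "\<And>x. (f has_vector_derivative f' x) (at x)" "Ck k f'" by metis
  have d: "((\<lambda>x. f (b * x + d)) has_vector_derivative b *\<^sub>R f' (b * x + d)) (at x)" for x
  proof -
    have "((f \<circ> (\<lambda>x. b * x + d)) has_vector_derivative b *\<^sub>R f' (b * x + d)) (at x)"
      by (rule vector_diff_chain_at) (auto intro!: f' derivative_eq_intros)
    then show ?thesis by (simp add: o_def)
  qed
  show ?case by (rule Ck_Suc_vec[OF d]) (intro Ck_scaleR Ck_const Suc.IH f')
qed

text \<open>
  The function is constant near the origin. Its derivative in direction \<open>v\<close> is \<open>X \<bullet> v\<close> times the
  function of the same form that belongs to \<open>e^(-2 s) F'(s)\<close>; this is what makes the induction in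
  \<open>Ck_log_radial\<close> possible.
\<close>

lemma has_derivative_log_radial:
  fixes F :: "real \<Rightarrow> 'b::real_normed_vector" and l :: real and X :: "'a::euclidean_space"
  assumes F': "\<And>x. (F has_vector_derivative F' x) (at x)" and F0: "\<And>s. s \<le> l \<Longrightarrow> F s = 0"
  shows "((\<lambda>X. if X = 0 then 0 else F (ln (norm X))) has_derivative
    (\<lambda>v. (X \<bullet> v) *\<^sub>R (if X = 0 then 0 else exp (-2 * ln (norm X)) *\<^sub>R F' (ln (norm X))))) (at X)"
    (is "(?f has_derivative _) _")
proof (cases "X = 0")
  case True
  have "(?f has_derivative (\<lambda>v. 0)) (at X)"
  proof (rule has_derivative_transform_within_open[OF has_derivative_const[of 0], where s = "ball 0 (exp l)"])
    fix X :: 'a assume "X \<in> ball 0 (exp l)"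
    then have "X \<noteq> 0 \<Longrightarrow> ln (norm X) \<le> ln (exp l)" by (subst ln_le_cancel_iff) auto
    then show "0 = ?f X" using F0 by auto
  qed (use True in auto)
  then show ?thesis using True by simp
next
  case False
  have 1: "((\<lambda>X. ln (norm X)) has_derivative (\<lambda>v. (X \<bullet> v) * exp (-2 * ln (norm X)))) (at X)"
  proof -
    have e: "exp (-2 * ln (norm X)) = 1 / (norm X)\<^sup>2"
      using False by (simp add: exp_minus exp_double divide_simps)
    have "((\<lambda>X. ln (norm X)) has_derivative (\<lambda>v. (v \<bullet> sgn X) * inverse (norm X))) (at X)"
      by (rule has_derivative_ln[OF _ has_derivative_norm]) (use False in auto)
    then show ?thesis using False unfolding e
      by (simp add: sgn_div_norm divide_inverse power2_eq_square inner_commute mult_ac)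
  qed
  have "((\<lambda>X. F (ln (norm X))) has_derivative (\<lambda>v. ((X \<bullet> v) * exp (-2 * ln (norm X))) *\<^sub>R F' (ln (norm X)))) (at X)"
    using has_derivative_compose[OF 1 F'[unfolded has_vector_derivative_def]] by simp
  then have "(?f has_derivative (\<lambda>v. ((X \<bullet> v) * exp (-2 * ln (norm X))) *\<^sub>R F' (ln (norm X)))) (at X)"
    by (rule has_derivative_transform_within_open[where s = "-{0}"]) (use False in auto)
  then show ?thesis using False by simp
qed

lemma Ck_log_radial:
  fixes F :: "real \<Rightarrow> 'b::real_normed_vector" and l :: real
  assumes "Ck k F" "\<And>s. s \<le> l \<Longrightarrow> F s = 0"
  shows "Ck k (\<lambda>X::'a::euclidean_space. if X = 0 then 0 else F (ln (norm X)))"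
  using assms
proof (induction k arbitrary: F l)
  case 0
  let ?f = "\<lambda>X::'a. if X = 0 then 0 else F (ln (norm X))"
  have F: "continuous_on UNIV F" using 0 by simp
  have 1: "continuous_on (ball 0 (exp l)) ?f"
  proof (rule continuous_on_eq[OF continuous_on_const[of _ 0]])
    fix X :: 'a assume "X \<in> ball 0 (exp l)"
    then have "X \<noteq> 0 \<Longrightarrow> ln (norm X) \<le> ln (exp l)" by (subst ln_le_cancel_iff) auto
    then show "0 = ?f X" using 0(2) by auto
  qed
  have 2: "continuous_on (-{0}) ?f"
    by (rule continuous_on_eq[where f = "\<lambda>X. F (ln (norm X))"])
      (auto intro!: continuous_on_compose2[OF F] continuous_intros)
  have "continuous_on (ball 0 (exp l) \<union> -{0}) ?f"
    by (rule continuous_on_open_Un[OF _ _ 1 2]) auto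
  moreover have "ball 0 (exp l) \<union> -{0} = (UNIV::'a set)" by auto
  ultimately show ?case by simp
next
  case (Suc k)
  from Ck_Suc_vecE[OF Suc.prems(1)] obtain F' where
    F': "\<And>x. (F has_vector_derivative F' x) (at x)" "Ck k F'" by metis
  have F'0: "F' s = 0" if "s \<le> l - 1" for s
  proof -
    have "((\<lambda>_. 0) has_vector_derivative F' s) (at s)"
      by (rule has_vector_derivative_transform_within_open[OF F'(1), where S = "{..<l}"])
        (use that Suc.prems(2) in auto)
    from vector_derivative_unique_at[OF this has_vector_derivative_const] show ?thesis by simp
  qed
  let ?f = "\<lambda>X::'a. if X = 0 then 0 else F (ln (norm X))"
  let ?g = "\<lambda>X::'a. if X = 0 then 0 else exp (-2 * ln (norm X)) *\<^sub>R F' (ln (norm X))"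
  have d: "(?f has_derivative (\<lambda>v. (X \<bullet> v) *\<^sub>R ?g X)) (at X)" for X
    by (rule has_derivative_log_radial[OF F'(1) Suc.prems(2)])
  have "Ck k ?g"
    by (rule Suc.IH[of "\<lambda>s. exp (-2 * s) *\<^sub>R F' s" "l - 1"])
       (simp_all only: Ck_scaleR[OF Ck_exp F'(2)] F'0 scaleR_zero_right)
  show ?case
    by (rule Ck_SucI[OF d]) (intro Ck_scaleR Ck_linear bounded_linear_inner_left \<open>Ck k ?g\<close>)
qed

section \<open>Smooth cut-offs\<close>

text \<open>
  The derivative of one of these functions is a combination of two others, so all of them are smooth
  by a single induction on the order of differentiability; \<open>flat 0\<close> is the usual flat function
  \<open>exp (- 1 / x)\<close>.
\<close>

definition flat :: "nat \<Rightarrow> real \<Rightarrow> real" where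
  "flat m x = (if x \<le> 0 then 0 else (1 / x) ^ m * exp (- (1 / x)))"

lemma flat_tendsto: "((\<lambda>x. flat m x) \<longlongrightarrow> 0) (at 0)"
proof -
  have "((\<lambda>x. flat m x) \<longlongrightarrow> 0) (at_right 0)"
  proof -
    have "((\<lambda>x::real. x ^ m * exp (- x)) \<longlongrightarrow> 0) at_top"
      using tendsto_power_div_exp_0[of m] by (simp add: exp_minus divide_inverse)
    from filterlim_compose[OF this filterlim_inverse_at_top_right]
    have "((\<lambda>x::real. inverse x ^ m * exp (- inverse x)) \<longlongrightarrow> 0) (at_right 0)" .
    then show ?thesis
      by (rule Lim_transform_eventually)
        (auto simp: eventually_at_right_less flat_def inverse_eq_divide eventually_at_filter)
  qed
  moreover have "((\<lambda>x. flat m x) \<longlongrightarrow> 0) (at_left 0)"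
    by (rule Lim_transform_eventually[OF tendsto_const])
      (auto simp: flat_def eventually_at_filter)
  ultimately show ?thesis by (simp add: filterlim_split_at)
qed

lemma flat_deriv:
  "(flat m has_vector_derivative (flat (m + 2) x - of_nat m * flat (m + 1) x)) (at x)"
proof -
  consider "x > 0" | "x < 0" | "x = 0" by linarith
  then show ?thesis
  proof cases
    case 1
    have "((\<lambda>x. (1 / x) ^ m * exp (- (1 / x))) has_real_derivative
       ((1 / x) ^ (m + 2) * exp (- (1 / x)) - of_nat m * ((1 / x) ^ (m + 1) * exp (- (1 / x))))) (at x)"
    proof -
      have "((\<lambda>x. 1 / x) has_real_derivative - ((1 / x)\<^sup>2)) (at x)"
        using 1 by (auto intro!: derivative_eq_intros simp: power2_eq_square)
      note d = this DERIV_power[OF this, of m]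
      show ?thesis
        by (rule derivative_eq_intros d refl)+ (cases m; simp add: algebra_simps power2_eq_square)
    qed
    then have "((\<lambda>x. (1 / x) ^ m * exp (- (1 / x))) has_vector_derivative (flat (m + 2) x - of_nat m * flat (m + 1) x)) (at x)"
      using 1 by (simp add: has_real_derivative_iff_has_vector_derivative flat_def)
    then show ?thesis
      by (rule has_vector_derivative_transform_within_open[where S = "{0<..}"]) (use 1 in \<open>auto simp: flat_def\<close>)
  next
    case 2
    have "((\<lambda>x. 0) has_vector_derivative 0) (at x)" by (rule has_vector_derivative_const)
    then have "(flat m has_vector_derivative 0) (at x)"
      by (rule has_vector_derivative_transform_within_open[where S = "{..<0}"]) (use 2 in \<open>auto simp: flat_def\<close>)
    then show ?thesis using 2 by (simp add: flat_def)
  next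
    case 3
    have "((\<lambda>h. (flat m (0 + h) - flat m 0) / h) \<longlongrightarrow> 0) (at 0)"
      by (rule Lim_transform_eventually[OF flat_tendsto[of "m + 1"]])
        (auto simp: flat_def eventually_at_filter divide_simps)
    then show ?thesis using 3
      by (simp add: flat_def DERIV_def flip: has_real_derivative_iff_has_vector_derivative)
  qed
qed

lemma Ck_flat: "Ck k (flat m)"
proof (induction k arbitrary: m)
  case 0
  have "continuous (at x) (flat m)" for x
    using flat_deriv has_vector_derivative_continuous by blast
  then show ?case by (simp add: continuous_at_imp_continuous_on)
next
  case (Suc k)
  show ?case
    by (rule Ck_Suc_vec[OF flat_deriv]) (intro Ck_diff Ck_mult Ck_const Suc)
qed

lemma smooth_step:
  obtains H \<eta> :: "real \<Rightarrow> real" where "\<And>k. Ck k H" "\<And>k. Ck k \<eta>"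
    "\<And>x. (H has_vector_derivative \<eta> x) (at x)" "\<And>x. x \<le> -1 \<Longrightarrow> H x = 0" "\<And>x. x \<ge> 1 \<Longrightarrow> H x = 1"
    "\<And>x. 0 \<le> \<eta> x" "\<And>x. \<bar>x\<bar> \<ge> 1 \<Longrightarrow> \<eta> x = 0" "\<And>x. 0 \<le> H x" "\<And>x. H x \<le> 1"
proof -
  \<comment> \<open>The quotient \<open>f / (f + g)\<close> is the standard step; its denominator never vanishes.\<close>
  let ?f = "\<lambda>x. flat 0 (x + 1)" and ?g = "\<lambda>x. flat 0 (1 - x)"
  let ?H = "\<lambda>x. ?f x * inverse (?f x + ?g x)"
  have nn: "flat m x \<ge> 0" for m x by (simp add: flat_def)
  have pos: "?f x + ?g x > 0" for x
  proof -
    have "?f x > 0 \<or> ?g x > 0" by (auto simp: flat_def)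
    then show ?thesis using nn[of 0 "x+1"] nn[of 0 "1-x"] by linarith
  qed
  have Cf: "Ck k ?f" "Ck k ?g" for k
    using Ck_affine[OF Ck_flat[of k 0], of 1 1] Ck_affine[OF Ck_flat[of k 0], of "-1" 1]
    by (simp_all add: algebra_simps)
  have CH: "Ck k ?H" for k
    by (intro Ck_mult Ck_inverse Ck_add Cf) (use pos in \<open>metis less_irrefl\<close>)
  let ?f' = "\<lambda>x. flat 2 (x + 1)" and ?g' = "\<lambda>x. flat 2 (1 - x)"
  let ?e = "\<lambda>x. (?f' x * ?g x + ?f x * ?g' x) / (?f x + ?g x)\<^sup>2"
  have d0: "(flat 0 has_real_derivative flat 2 x) (at x)" for x
    using flat_deriv[of 0 x] by (simp add: has_real_derivative_iff_has_vector_derivative numeral_2_eq_2)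
  have df: "(?f has_real_derivative ?f' x) (at x)" for x
  proof -
    have "((\<lambda>x. x + 1) has_real_derivative 1) (at x)" by (auto intro!: derivative_eq_intros)
    from DERIV_chain2[OF d0 this] show ?thesis by simp
  qed
  have dg: "(?g has_real_derivative - ?g' x) (at x)" for x
  proof -
    have "((\<lambda>x. 1 - x) has_real_derivative -1) (at x)" by (auto intro!: derivative_eq_intros)
    from DERIV_chain2[OF d0 this] show ?thesis by simp
  qed
  have dH: "(?H has_vector_derivative ?e x) (at x)" for x
    unfolding has_real_derivative_iff_has_vector_derivative[symmetric]
    using pos[of x] by (auto intro!: derivative_eq_intros df dg simp: divide_simps power2_eq_square algebra_simps)
  have Ce: "Ck k ?e" for k using Ck_derivative[OF CH dH] by simp
  show thesis
  proof (rule that[OF CH Ce dH])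
    show "?H x = 1" if "x \<ge> 1" for x
      using that pos[of x] by (simp add: flat_def)
    show "?e x = 0" if "\<bar>x\<bar> \<ge> 1" for x
      using that by (auto simp: flat_def abs_if split: if_splits)
    show "?H x \<le> 1" for x using pos[of x] nn[of 0 "1-x"] by (simp add: divide_simps)
    show "0 \<le> ?H x" for x using pos[of x] nn[of 0 "x+1"] by (simp add: divide_simps)
    show "0 \<le> ?e x" for x using nn by (auto intro!: divide_nonneg_nonneg add_nonneg_nonneg mult_nonneg_nonneg)
  qed (auto simp: flat_def)
qed

lemma compactly_supported_antiderivative:
  fixes h :: "real \<Rightarrow> real"
  assumes "continuous_on UNIV h" "\<And>x. \<bar>x\<bar> \<ge> L \<Longrightarrow> h x = 0" "L > 0"
  obtains P where "\<And>x. (P has_vector_derivative h x) (at x)" "\<And>x. x \<le> - L \<Longrightarrow> P x = 0"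
    "\<And>x. x \<ge> L \<Longrightarrow> P x = P L"
proof -
  have int: "h integrable_on {a..b}" for a b
    by (rule integrable_continuous_interval) (use assms in \<open>auto intro: continuous_on_subset\<close>)
  let ?P = "\<lambda>x. integral {-L-1..x} h"
  have P0: "?P x = 0" if "x \<le> -L" for x
  proof -
    have "?P x = integral {-L-1..x} (\<lambda>_. 0)"
      by (rule integral_cong) (use that assms in auto)
    then show ?thesis by simp
  qed
  show thesis
  proof (rule that[of ?P])
    show "(?P has_vector_derivative h x) (at x)" for x
    proof (cases "x < - L")
      case True
      have "((\<lambda>_. 0) has_vector_derivative 0) (at x)" by (rule has_vector_derivative_const)
      then have "(?P has_vector_derivative 0) (at x)"
        by (rule has_vector_derivative_transform_within_open[where S = "{..<-L}"]) (use True P0 in auto)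
      then show ?thesis using assms True by simp
    next
      case False
      have "(?P has_vector_derivative h x) (at x within {-L-1..x+1})"
        by (rule integral_has_vector_derivative) (use assms False in \<open>auto intro: continuous_on_subset\<close>)
      moreover have "at x within {-L-1..x+1} = at x"
        by (rule at_within_interior) (use False in auto)
      ultimately show ?thesis by simp
    qed
    show "?P x = ?P L" if "x \<ge> L" for x
    proof -
      have "?P x = ?P L + integral {L..x} h"
        by (rule Henstock_Kurzweil_Integration.integral_combine[symmetric]) (use that assms int in auto)
      moreover have "integral {L..x} h = integral {L..x} (\<lambda>_. 0)"
        by (rule integral_cong) (use that assms in auto)
      ultimately show ?thesis by simp
    qed
  qed (rule P0)
qed

section \<open>The angular kernels\<close>

text \<open>
  The squared distance of the points with logarithmic radii \<open>s\<close>, \<open>t\<close> and angle \<open>\<theta>\<close> between them is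
  \<open>e^s e^t chord (s - t) \<theta>\<close>, see \<open>norm_polar_diff_sq\<close>.
\<close>

definition chord :: "real \<Rightarrow> real \<Rightarrow> real" where
  "chord u \<theta> = 2 * cosh u - 2 * cos \<theta>"

definition ang_kernel :: "real \<Rightarrow> nat \<Rightarrow> real \<Rightarrow> real \<Rightarrow> real" where
  "ang_kernel a n u \<theta> = indicator {-pi..pi} \<theta> * (sin \<theta> * sin (real n * \<theta>) * chord u \<theta> powr (-a))"

definition mode_kernel :: "real \<Rightarrow> nat \<Rightarrow> real \<Rightarrow> real" where
  "mode_kernel a n u = (LINT \<theta>|lborel. ang_kernel a n u \<theta>)"

text \<open>
  At \<open>u = 0\<close> the two angular integrals can diverge separately, so the difference is taken under the
  integral sign. The combined integrand is bounded uniformly in \<open>u\<close>.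
\<close>

definition diff_kernel :: "real \<Rightarrow> nat \<Rightarrow> real \<Rightarrow> real" where
  "diff_kernel a n u = (LINT \<theta>|lborel. real n * ang_kernel a 1 u \<theta> - ang_kernel a n u \<theta>)"

lemma abs_sin_mult_le: "\<bar>sin (real n * \<theta>)\<bar> \<le> real n * \<bar>sin \<theta>\<bar>"
proof (induction n)
  case (Suc n)
  have "sin (real (Suc n) * \<theta>) = sin (real n * \<theta>) * cos \<theta> + cos (real n * \<theta>) * sin \<theta>"
    by (simp add: algebra_simps sin_add)
  also have "\<bar>\<dots>\<bar> \<le> \<bar>sin (real n * \<theta>)\<bar> * \<bar>cos \<theta>\<bar> + \<bar>cos (real n * \<theta>)\<bar> * \<bar>sin \<theta>\<bar>"
    by (metis abs_mult abs_triangle_ineq)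
  also have "\<dots> \<le> \<bar>sin (real n * \<theta>)\<bar> * 1 + 1 * \<bar>sin \<theta>\<bar>"
    by (intro add_mono mult_mono) auto
  also have "\<dots> \<le> real (Suc n) * \<bar>sin \<theta>\<bar>" using Suc by (simp add: algebra_simps)
  finally show ?case .
qed simp

lemma one_minus_cos_mult_le: "1 - cos (real n * \<theta>) \<le> real n ^ 2 * (1 - cos \<theta>)"
proof -
  have *: "1 - cos x = 2 * sin (x / 2) ^ 2" for x :: real
    using cos_double_sin[of "x/2"] by simp
  have "sin (real n * (\<theta> / 2)) ^ 2 \<le> (real n * \<bar>sin (\<theta> / 2)\<bar>) ^ 2"
    using power_mono[OF abs_sin_mult_le[of n "\<theta> / 2"], of 2] by simp
  then show ?thesis unfolding * by (simp add: power_mult_distrib)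
qed

text \<open>
  The factor \<open>1 - cos \<theta>\<close> is a gain of two orders at \<open>\<theta> = 0\<close> over \<open>abs_sin_mult_le\<close>. It
  compensates the singularity of the kernel in \<open>diff_ang_kernel_bounds\<close>.
\<close>

lemma sin_defect_le: "\<bar>real n * sin \<theta> - sin (real n * \<theta>)\<bar> \<le> real n ^ 3 * \<bar>sin \<theta>\<bar> * (1 - cos \<theta>)"
proof (induction n)
  case (Suc n)
  have eq: "real (Suc n) * sin \<theta> - sin (real (Suc n) * \<theta>) = (real n * sin \<theta> - sin (real n * \<theta>))
     + sin (real n * \<theta>) * (1 - cos \<theta>) + sin \<theta> * (1 - cos (real n * \<theta>))"
    by (simp add: algebra_simps sin_add)
  have "\<bar>real (Suc n) * sin \<theta> - sin (real (Suc n) * \<theta>)\<bar> \<le> \<bar>real n * sin \<theta> - sin (real n * \<theta>)\<bar>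
     + \<bar>sin (real n * \<theta>)\<bar> * (1 - cos \<theta>) + \<bar>sin \<theta>\<bar> * (1 - cos (real n * \<theta>))"
  proof -
    have 1: "\<bar>sin (real n * \<theta>) * (1 - cos \<theta>)\<bar> = \<bar>sin (real n * \<theta>)\<bar> * (1 - cos \<theta>)"
      by (simp add: abs_mult)
    have 2: "\<bar>sin \<theta> * (1 - cos (real n * \<theta>))\<bar> = \<bar>sin \<theta>\<bar> * (1 - cos (real n * \<theta>))"
      by (simp add: abs_mult)
    show ?thesis unfolding eq 1[symmetric] 2[symmetric] by linarith
  qed
  also have "\<dots> \<le> real n ^ 3 * \<bar>sin \<theta>\<bar> * (1 - cos \<theta>) + (real n * \<bar>sin \<theta>\<bar>) * (1 - cos \<theta>)
      + \<bar>sin \<theta>\<bar> * (real n ^ 2 * (1 - cos \<theta>))"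
    by (intro add_mono Suc mult_right_mono mult_left_mono abs_sin_mult_le one_minus_cos_mult_le) auto
  also have "\<dots> = (real n ^ 3 + real n + real n ^ 2) * (\<bar>sin \<theta>\<bar> * (1 - cos \<theta>))"
    by (simp add: algebra_simps)
  also have "\<dots> \<le> real (Suc n) ^ 3 * (\<bar>sin \<theta>\<bar> * (1 - cos \<theta>))"
  proof (rule mult_right_mono)
    show "real n ^ 3 + real n + (real n)\<^sup>2 \<le> real (Suc n) ^ 3"
      by (simp add: power3_eq_cube power2_eq_square algebra_simps)
    show "0 \<le> \<bar>sin \<theta>\<bar> * (1 - cos \<theta>)" by (intro mult_nonneg_nonneg) auto
  qed
  finally show ?case by (simp only: mult.assoc)
qed simp

lemma chord_lower: "u\<^sup>2 + (2 * sin (\<theta> / 2))\<^sup>2 \<le> chord u \<theta>"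
proof -
  have *: "1 - cos \<theta> = 2 * sin (\<theta> / 2) ^ 2"
    using cos_double_sin[of "\<theta>/2"] by simp
  have ch: "cosh u = 1 + 2 * sinh (u / 2) ^ 2"
    using cosh_double[of "u / 2"] cosh_square_eq[of "u/2"] by simp
  have "\<bar>u / 2\<bar> \<le> \<bar>sinh (u / 2)\<bar>"
  proof -
    have "x \<le> sinh x" if "x \<ge> 0" for x :: real
      using real_le_x_sinh[OF that] by (simp add: sinh_field_def exp_minus)
    from this[of "\<bar>u / 2\<bar>"] have "\<bar>u / 2\<bar> \<le> sinh \<bar>u / 2\<bar>" by simp
    also have "sinh \<bar>u / 2\<bar> \<le> \<bar>sinh (u / 2)\<bar>"
      using sinh_minus[of "u / 2"] by (cases "u / 2 \<ge> 0") (simp_all only: abs_of_nonneg abs_if, auto)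
    finally show ?thesis .
  qed
  then have "(u / 2)\<^sup>2 \<le> (sinh (u / 2))\<^sup>2" by (simp only: abs_le_square_iff)
  then show ?thesis using * unfolding chord_def ch by (simp add: power_mult_distrib power_divide)
qed

lemma chord_nonneg: "0 \<le> chord u \<theta>"
  using chord_lower[of u \<theta>] by (meson add_nonneg_nonneg order_trans zero_le_power2)

lemma sin_sq_le_chord: "(sin \<theta>)\<^sup>2 \<le> chord u \<theta>"
proof -
  have "sin \<theta> = 2 * sin (\<theta> / 2) * cos (\<theta> / 2)" using sin_double[of "\<theta> / 2"] by simp
  then have "(sin \<theta>)\<^sup>2 = (2 * sin (\<theta> / 2))\<^sup>2 * (cos (\<theta> / 2))\<^sup>2" by (simp add: power_mult_distrib)
  also have "\<dots> \<le> (2 * sin (\<theta> / 2))\<^sup>2 * 1"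
    by (intro mult_left_mono) (auto simp: abs_square_le_1)
  finally show ?thesis using chord_lower[of u \<theta>] by (smt (verit) zero_le_power2)
qed

lemma abs_half_sin_ge: assumes "\<bar>\<theta>\<bar> \<le> pi" shows "\<bar>\<theta>\<bar> / 2 \<le> \<bar>2 * sin (\<theta> / 2)\<bar>"
proof -
  have *: "x / 2 \<le> sin x" if "0 \<le> x" "x \<le> pi / 2" for x :: real
  proof -
    have "x - x ^ 3 / 6 \<le> sin x"
    proof -
      have "\<bar>sin x - (\<Sum>k<3. sin_coeff k * x ^ k)\<bar> \<le> inverse (fact 3) * \<bar>x\<bar> ^ 3"
        by (rule Maclaurin_sin_bound)
      moreover have "(\<Sum>k<3. sin_coeff k * x ^ k) = x"
        by (simp add: eval_nat_numeral sin_coeff_def)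
      ultimately show ?thesis using that by (simp add: eval_nat_numeral abs_if divide_simps split: if_splits)
    qed
    moreover have "x ^ 3 / 6 \<le> x / 2"
    proof -
      have "x \<le> 1.6" using that pi_approx by simp
      then have "x * x \<le> 1.6 * 1.6" using that by (intro mult_mono) auto
      then have "x * (x * x) \<le> x * 3" using that by (intro mult_left_mono) auto
      then show ?thesis by (simp add: power3_eq_cube)
    qed
    ultimately show ?thesis by simp
  qed
  have "\<bar>\<theta>\<bar> / 2 / 2 \<le> sin (\<bar>\<theta>\<bar> / 2)" by (rule *) (use assms in auto)
  also have "\<dots> \<le> \<bar>sin (\<theta> / 2)\<bar>" by (cases "\<theta> \<ge> 0") auto
  finally show ?thesis by simp
qed

text \<open>
  Together with \<open>majorant_angle\<close> a product majorant of the kernel, integrable in both variables. Near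
  the diagonal the kernel is at most of order \<open>chord powr (-1/2)\<close> because \<open>a \<le> 3/2\<close>, and
  \<open>chord \<ge> 2 \<bar>u\<bar> \<bar>2 sin (\<theta> / 2)\<bar>\<close> splits this into one factor per variable.
\<close>

definition majorant_u :: "real \<Rightarrow> real" where
  "majorant_u u = indicator {-1..1} u * \<bar>u\<bar> powr (-1/2) + indicator (-{-1<..<1}) u * \<bar>u\<bar> powr (-2)"

definition majorant_angle :: "real \<Rightarrow> real" where
  "majorant_angle \<theta> = indicator {-pi..pi} \<theta> * (1 + (\<bar>\<theta>\<bar> / 4) powr (-1/2))"

lemma sin_sq_chord_le:
  assumes a: "1 \<le> a" "a \<le> 3/2" and u: "u \<noteq> 0" and t: "\<theta> \<noteq> 0" "\<bar>\<theta>\<bar> \<le> pi"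
  shows "(sin \<theta>)\<^sup>2 * chord u \<theta> powr (-a) \<le> majorant_u u * majorant_angle \<theta>"
proof (cases "\<bar>u\<bar> \<ge> 1")
  case True
  have "u\<^sup>2 \<le> chord u \<theta>" using chord_lower[of u \<theta>] by (smt (verit) zero_le_power2)
  moreover have u1: "1 \<le> u\<^sup>2" using one_le_power[OF True, of 2] by simp
  ultimately have "chord u \<theta> powr (-a) \<le> (u\<^sup>2) powr (-1)"
  proof -
    have "chord u \<theta> powr (-a) \<le> chord u \<theta> powr (-1)"
      by (rule powr_mono) (use a u1 \<open>u\<^sup>2 \<le> chord u \<theta>\<close> in auto)
    also have "\<dots> \<le> (u\<^sup>2) powr (-1)"
      by (rule powr_mono2') (use u1 \<open>u\<^sup>2 \<le> chord u \<theta>\<close> in auto)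
    finally show ?thesis .
  qed
  then have "(sin \<theta>)\<^sup>2 * chord u \<theta> powr (-a) \<le> 1 * (u\<^sup>2) powr (-1)"
    by (intro mult_mono) (auto simp: abs_square_le_1)
  also have "(u\<^sup>2) powr (-1) = \<bar>u\<bar> powr (-2)"
    using u by (simp add: powr_minus divide_simps powr_numeral)
  also have "1 * \<bar>u\<bar> powr (-2) \<le> majorant_u u * majorant_angle \<theta>"
    using True t by (intro order_trans[OF _ mult_mono[of "\<bar>u\<bar> powr (-2)" "majorant_u u" 1 "majorant_angle \<theta>"]])
      (auto simp: majorant_u_def majorant_angle_def indicator_def)
  finally show ?thesis .
next
  case False
  let ?D = "chord u \<theta>" let ?b = "\<bar>\<theta>\<bar> / 4"
  have D: "?D > 0" using chord_lower[of u \<theta>] u by (smt (verit) zero_less_power2 zero_le_power2)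
  have "(sin \<theta>)\<^sup>2 * ?D powr (-a) \<le> ?D * ?D powr (-a)"
    by (intro mult_right_mono sin_sq_le_chord) auto
  also have "\<dots> = ?D powr (1 - a)" using D by (simp add: powr_diff powr_minus divide_inverse)
  also have "\<dots> \<le> 1 + ?D powr (-1/2)"
  proof (cases "?D \<ge> 1")
    case True
    then have "?D powr (1 - a) \<le> ?D powr 0" by (intro powr_mono) (use a in auto)
    then show ?thesis using D by (simp add: add_increasing2)
  next
    case False
    then have "?D powr (1 - a) \<le> ?D powr (-1/2)"
      using a D by (intro powr_mono') auto
    then show ?thesis by simp
  qed
  also have "?D powr (-1/2) \<le> (\<bar>u\<bar> * ?b) powr (-1/2)"
  proof (rule powr_mono2')
    have "2 * (\<bar>u\<bar> * \<bar>2 * sin (\<theta>/2)\<bar>) \<le> \<bar>u\<bar>\<^sup>2 + \<bar>2 * sin (\<theta>/2)\<bar>\<^sup>2"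
      using sum_squares_bound[of "\<bar>u\<bar>" "\<bar>2 * sin (\<theta>/2)\<bar>"] by simp
    also have "\<dots> \<le> ?D" using chord_lower[of u \<theta>] by simp
    finally have 1: "2 * (\<bar>u\<bar> * \<bar>2 * sin (\<theta>/2)\<bar>) \<le> ?D" .
    have "\<bar>u\<bar> * ?b \<le> 2 * (\<bar>u\<bar> * \<bar>2 * sin (\<theta>/2)\<bar>)"
    proof -
      have "\<bar>u\<bar> * (\<bar>\<theta>\<bar> / 2) \<le> \<bar>u\<bar> * \<bar>2 * sin (\<theta>/2)\<bar>"
        by (intro mult_left_mono abs_half_sin_ge t) auto
      moreover have "\<bar>u\<bar> * ?b \<le> \<bar>u\<bar> * (\<bar>\<theta>\<bar> / 2)" by (intro mult_left_mono) auto
      moreover have "0 \<le> \<bar>u\<bar> * \<bar>2 * sin (\<theta>/2)\<bar>" by (intro mult_nonneg_nonneg) auto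
      ultimately show ?thesis by linarith
    qed
    then show "\<bar>u\<bar> * ?b \<le> ?D" using 1 by simp
  qed (use u t in auto)
  also have "(\<bar>u\<bar> * ?b) powr (-1/2) = \<bar>u\<bar> powr (-1/2) * ?b powr (-1/2)"
    by (rule powr_mult)
  also have "1 + \<bar>u\<bar> powr (-1/2) * ?b powr (-1/2) \<le> \<bar>u\<bar> powr (-1/2) * (1 + ?b powr (-1/2))"
  proof -
    have "1 = 1 powr (-1/2::real)" by simp
    also have "\<dots> \<le> \<bar>u\<bar> powr (-1/2)" by (rule powr_mono2') (use False u in auto)
    finally show ?thesis by (simp add: algebra_simps)
  qed
  also have "\<dots> = majorant_u u * majorant_angle \<theta>" using False t by (auto simp: majorant_u_def majorant_angle_def indicator_def)
  finally show ?thesis by simp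
qed

lemma integrable_abs_powr_half: "integrable lborel (\<lambda>u. indicator {-c..c} u * \<bar>u::real\<bar> powr (-1/2))"
proof (cases "c \<ge> 0")
  case True
  have 0: "set_integrable lborel {0..c} (\<lambda>u. u powr (-1/2))"
  proof -
    have "(\<lambda>u. u powr (-1/2)) absolutely_integrable_on {0..c}"
      by (intro nonnegative_absolutely_integrable_1 integrable_on_powr_from_0) (use True in auto)
    then show ?thesis
      unfolding set_integrable_def by (subst (asm) integrable_completion) auto
  qed
  have 1: "integrable lborel (\<lambda>u. indicator {0..c} u * \<bar>u\<bar> powr (-1/2))"
    by (rule Bochner_Integration.integrable_cong[THEN iffD1, OF refl _ 0[unfolded set_integrable_def]])
      (auto simp: indicator_def)
  have 2: "integrable lborel (\<lambda>u. indicator {0..c} (0 + (-1) * u) * \<bar>0 + (-1) * u\<bar> powr (-1/2))"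
    by (rule lborel_integrable_real_affine[OF 1]) simp
  show ?thesis
    by (rule Bochner_Integration.integrable_bound[OF Bochner_Integration.integrable_add[OF 1 2]])
      (auto simp: indicator_def)
qed (auto simp: indicator_def)

lemma integrable_majorant_u: "integrable lborel majorant_u"
proof -
  have "set_integrable lborel {1..} (\<lambda>u::real. u powr (-2))"
  proof -
    have "(\<lambda>u::real. u powr (-2)) absolutely_integrable_on {1..}"
      using has_integral_powr_to_inf[of "-2" 1]
      by (intro nonnegative_absolutely_integrable_1) (auto simp: integrable_on_def)
    then show ?thesis
      unfolding set_integrable_def by (subst (asm) integrable_completion) auto
  qed
  then have 1: "integrable lborel (\<lambda>u. indicator {1..} u * \<bar>u::real\<bar> powr (-2))"
    unfolding set_integrable_def
    by (rule Bochner_Integration.integrable_cong[THEN iffD1, OF refl _, rotated]) (auto simp: indicator_def)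
  have 2: "integrable lborel (\<lambda>u. indicator {1..} (0 + (-1) * u) * \<bar>0 + (-1) * u::real\<bar> powr (-2))"
    by (rule lborel_integrable_real_affine[OF 1]) simp
  have 3: "integrable lborel (\<lambda>u. indicator (-{-1<..<1}) u * \<bar>u::real\<bar> powr (-2))"
    by (rule Bochner_Integration.integrable_bound[OF Bochner_Integration.integrable_add[OF 1 2]])
      (auto simp: indicator_def)
  show ?thesis unfolding majorant_u_def[abs_def]
    by (rule Bochner_Integration.integrable_add[OF integrable_abs_powr_half 3])
qed

lemma integrable_majorant_angle: "integrable lborel majorant_angle"
proof -
  have eq: "majorant_angle = (\<lambda>\<theta>. indicator {-pi..pi} \<theta> + 2 * (indicator {-pi..pi} \<theta> * \<bar>\<theta>\<bar> powr (-1/2)))"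
  proof
    fix \<theta> :: real
    have "(\<bar>\<theta>\<bar> / 4) powr (-1/2) = 2 * \<bar>\<theta>\<bar> powr (-1/2)"
    proof -
      have 4: "(4::real) powr (- (1/2)) = 1/2"
        by (simp add: powr_minus powr_half_sqrt divide_simps)
      show ?thesis by (simp add: powr_divide 4)
    qed
    then show "majorant_angle \<theta> = indicator {-pi..pi} \<theta> + 2 * (indicator {-pi..pi} \<theta> * \<bar>\<theta>\<bar> powr (-1/2))"
      by (simp add: majorant_angle_def algebra_simps)
  qed
  show ?thesis unfolding eq
    by (intro Bochner_Integration.integrable_add integrable_mult_right integrable_abs_powr_half)
      (simp add: integrable_indicator_iff)
qed

lemma integrable_prod_mult:
  fixes f g :: "real \<Rightarrow> real"
  assumes "integrable lborel f" "integrable lborel g"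
  shows "integrable (lborel \<Otimes>\<^sub>M lborel) (\<lambda>(x,y). f x * g y)"
proof (rule lborel_pair.Fubini_integrable)
  have [measurable]: "f \<in> borel_measurable borel" "g \<in> borel_measurable borel" using assms by auto
  show "(\<lambda>(x, y). f x * g y) \<in> borel_measurable (lborel \<Otimes>\<^sub>M lborel)" by measurable
  show "integrable lborel (\<lambda>x. \<integral>y. norm (case (x, y) of (x, y) \<Rightarrow> f x * g y) \<partial>lborel)"
    using assms by (simp add: abs_mult)
  show "AE x in lborel. integrable lborel (\<lambda>y. case (x, y) of (x, y) \<Rightarrow> f x * g y)"
    using assms by simp
qed

lemma chord_measurable[measurable]: "(\<lambda>x. chord (f x) (g x)) \<in> borel_measurable M"
  if "f \<in> borel_measurable M" "g \<in> borel_measurable M"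
proof -
  have [measurable]: "(cosh :: real \<Rightarrow> real) \<in> borel_measurable borel"
    by (intro borel_measurable_continuous_onI continuous_intros)
  show ?thesis using that unfolding chord_def by measurable
qed

lemma AE_lborel_neq: "AE x in lborel. x \<noteq> (c::real)"
  using AE_lborel_singleton by auto

lemma integrable_sin_sq_chord_pair:
  assumes "1 \<le> a" "a \<le> 3/2"
  shows "integrable (lborel \<Otimes>\<^sub>M lborel)
     (\<lambda>(u,\<theta>). indicator {-pi..pi} \<theta> * ((sin \<theta>)\<^sup>2 * chord u \<theta> powr (-a)))"
proof (rule Bochner_Integration.integrable_bound[OF integrable_prod_mult[OF integrable_majorant_u integrable_majorant_angle]])
  show "(\<lambda>(u,\<theta>). indicator {-pi..pi} \<theta> * ((sin \<theta>)\<^sup>2 * chord u \<theta> powr (-a)))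
      \<in> borel_measurable (lborel \<Otimes>\<^sub>M lborel)" by measurable
  have "AE z in lborel \<Otimes>\<^sub>M lborel. fst z \<noteq> (0::real) \<and> snd z \<noteq> (0::real)"
  proof (rule lborel_pair.AE_pair_measure)
    show "{z \<in> space (lborel \<Otimes>\<^sub>M lborel). fst z \<noteq> (0::real) \<and> snd z \<noteq> (0::real)} \<in> sets (lborel \<Otimes>\<^sub>M lborel)"
      by measurable
    show "AE x in lborel. AE y in lborel. fst (x, y) \<noteq> (0::real) \<and> snd (x, y) \<noteq> (0::real)"
      using AE_lborel_neq[of 0]
    proof eventually_elim
      case (elim x)
      show ?case using AE_lborel_neq[of 0] by eventually_elim (use elim in simp)
    qed
  qed
  then show "AE z in lborel \<Otimes>\<^sub>M lborel. norm (case z of (u,\<theta>) \<Rightarrow> indicator {-pi..pi} \<theta> * ((sin \<theta>)\<^sup>2 * chord u \<theta> powr (-a)))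
       \<le> norm (case z of (u,\<theta>) \<Rightarrow> majorant_u u * majorant_angle \<theta>)"
  proof eventually_elim
    case (elim z)
    obtain u \<theta> where z: "z = (u, \<theta>)" by (cases z)
    show ?case
    proof (cases "\<bar>\<theta>\<bar> \<le> pi")
      case True
      have "0 \<le> (sin \<theta>)\<^sup>2 * chord u \<theta> powr (-a)" by simp
      moreover have "(sin \<theta>)\<^sup>2 * chord u \<theta> powr (-a) \<le> majorant_u u * majorant_angle \<theta>"
        by (rule sin_sq_chord_le[OF assms _ _ True]) (use elim z in auto)
      ultimately show ?thesis using True unfolding z by (auto simp: indicator_def)
    next
      case False
      then have "\<theta> \<notin> {-pi..pi}" by auto
      then show ?thesis unfolding z by simp
    qed
  qed
qed

lemma abs_ang_kernel_le:
  "\<bar>ang_kernel a n u \<theta>\<bar> \<le> real n * (indicator {-pi..pi} \<theta> * ((sin \<theta>)\<^sup>2 * chord u \<theta> powr (-a)))"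
proof -
  have "\<bar>sin \<theta> * sin (real n * \<theta>)\<bar> \<le> \<bar>sin \<theta>\<bar> * (real n * \<bar>sin \<theta>\<bar>)"
    unfolding abs_mult by (intro mult_left_mono abs_sin_mult_le) auto
  also have "\<dots> = real n * (sin \<theta>)\<^sup>2" by (simp add: power2_eq_square)
  finally have "\<bar>sin \<theta> * sin (real n * \<theta>)\<bar> * chord u \<theta> powr (-a) \<le> real n * (sin \<theta>)\<^sup>2 * chord u \<theta> powr (-a)"
    by (rule mult_right_mono) auto
  then show ?thesis by (auto simp: ang_kernel_def indicator_def abs_mult)
qed

lemma ang_kernel_measurable[measurable]: "(\<lambda>x. ang_kernel a n (f x) (g x)) \<in> borel_measurable M"
  if "f \<in> borel_measurable M" "g \<in> borel_measurable M"
  using that unfolding ang_kernel_def by measurable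

lemma integrable_ang_kernel_pair:
  assumes "1 \<le> a" "a \<le> 3/2"
  shows "integrable (lborel \<Otimes>\<^sub>M lborel) (\<lambda>(u,\<theta>). ang_kernel a n u \<theta>)"
proof (rule Bochner_Integration.integrable_bound)
  show "integrable (lborel \<Otimes>\<^sub>M lborel)
     (\<lambda>z. real n * (case z of (u,\<theta>) \<Rightarrow> indicator {-pi..pi} \<theta> * ((sin \<theta>)\<^sup>2 * chord u \<theta> powr (-a))))"
    by (intro integrable_mult_right integrable_sin_sq_chord_pair assms)
  show "(\<lambda>(u, \<theta>). ang_kernel a n u \<theta>) \<in> borel_measurable (lborel \<Otimes>\<^sub>M lborel)" by measurable
  show "AE z in lborel \<Otimes>\<^sub>M lborel. norm (case z of (u, \<theta>) \<Rightarrow> ang_kernel a n u \<theta>)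
     \<le> norm (real n * (case z of (u,\<theta>) \<Rightarrow> indicator {-pi..pi} \<theta> * ((sin \<theta>)\<^sup>2 * chord u \<theta> powr (-a))))"
    by (intro AE_I2) (auto split: prod.split intro!: order_trans[OF abs_ang_kernel_le] simp: abs_mult)
qed

lemma integrable_mode_kernel:
  assumes "1 \<le> a" "a \<le> 3/2" shows "integrable lborel (mode_kernel a n)"
  using lborel_pair.integrable_fst[OF integrable_ang_kernel_pair[OF assms, of n]]
  by (simp add: mode_kernel_def[abs_def])

lemma chord_pos: "u \<noteq> 0 \<Longrightarrow> chord u \<theta> > 0"
  using chord_lower[of u \<theta>] by (smt (verit) zero_less_power2 zero_le_power2)

lemma abs_ang_kernel_le_powr:
  assumes "0 < \<delta>" "\<delta> \<le> \<bar>u\<bar>" "0 \<le> a"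
  shows "\<bar>ang_kernel a n u \<theta>\<bar> \<le> real n * (\<delta>\<^sup>2) powr (-a) * indicator {-pi..pi} \<theta>"
proof -
  have "\<bar>\<delta>\<bar> \<le> \<bar>u\<bar>" using assms by simp
  then have "\<delta>\<^sup>2 \<le> u\<^sup>2" by (simp only: abs_le_square_iff)
  also have "u\<^sup>2 \<le> chord u \<theta>" using chord_lower[of u \<theta>] by (smt (verit) zero_le_power2)
  finally have "chord u \<theta> powr (-a) \<le> (\<delta>\<^sup>2) powr (-a)"
    using assms by (intro powr_mono2') auto
  then have "(sin \<theta>)\<^sup>2 * chord u \<theta> powr (-a) \<le> 1 * (\<delta>\<^sup>2) powr (-a)"
    by (intro mult_mono) (auto simp: abs_square_le_1)
  then have "real n * ((sin \<theta>)\<^sup>2 * chord u \<theta> powr (-a)) \<le> real n * (\<delta>\<^sup>2) powr (-a)"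
    by (simp add: mult_left_mono)
  then show ?thesis
    by (intro order_trans[OF abs_ang_kernel_le]) (auto simp: indicator_def)
qed

lemma integrable_ang_kernel:
  assumes "u \<noteq> 0" "0 \<le> a" shows "integrable lborel (ang_kernel a n u)"
proof (rule Bochner_Integration.integrable_bound)
  show "integrable lborel (\<lambda>\<theta>. real n * (\<bar>u\<bar>\<^sup>2) powr (-a) * indicator {-pi..pi} \<theta>)"
    by (intro integrable_mult_right) (simp add: integrable_indicator_iff)
  show "AE \<theta> in lborel. norm (ang_kernel a n u \<theta>) \<le> norm (real n * (\<bar>u\<bar>\<^sup>2) powr (-a) * indicator {-pi..pi} \<theta>)"
    using abs_ang_kernel_le_powr[of "\<bar>u\<bar>" u a n] assms by (intro AE_I2) (auto simp: abs_mult)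
qed measurable

lemma chord_continuous: "continuous_on UNIV (\<lambda>u. chord u \<theta>)"
  unfolding chord_def by (intro continuous_intros)

lemma continuous_mode_kernel:
  assumes "0 \<le> a" shows "continuous_on (-{0}) (mode_kernel a n)"
proof (rule continuous_at_imp_continuous_on, intro ballI)
  fix u :: real assume u: "u \<in> -{0}"
  show "isCont (mode_kernel a n) u"
  proof (rule continuous_at_sequentiallyI)
    fix x :: "nat \<Rightarrow> real" assume x: "x \<longlonglongrightarrow> u"
    let ?d = "\<bar>u\<bar> / 2"
    have "eventually (\<lambda>i. \<bar>x i\<bar> > ?d) sequentially"
      using order_tendstoD(1)[OF tendsto_rabs[OF x], of ?d] u by auto
    then obtain N where N: "\<And>i. i \<ge> N \<Longrightarrow> \<bar>x i\<bar> > ?d" by (auto simp: eventually_sequentially)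
    have "(\<lambda>i. LINT \<theta>|lborel. ang_kernel a n (x (i + N)) \<theta>) \<longlonglongrightarrow> (LINT \<theta>|lborel. ang_kernel a n u \<theta>)"
    proof (rule integral_dominated_convergence[where w = "\<lambda>\<theta>. real n * (?d\<^sup>2) powr (-a) * indicator {-pi..pi} \<theta>"])
      show "integrable lborel (\<lambda>\<theta>. real n * (?d\<^sup>2) powr (-a) * indicator {-pi..pi} \<theta>)"
        by (intro integrable_mult_right) (simp add: integrable_indicator_iff)
      show "AE \<theta> in lborel. norm (ang_kernel a n (x (i + N)) \<theta>) \<le> real n * (?d\<^sup>2) powr (-a) * indicator {-pi..pi} \<theta>" for i
        using abs_ang_kernel_le_powr[of ?d "x (i + N)" a n] N[of "i + N"] assms u by (intro AE_I2) auto
      have "(\<lambda>i. x (i + N)) \<longlonglongrightarrow> u" using x by (rule LIMSEQ_ignore_initial_segment)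
      then have "(\<lambda>i. chord (x (i + N)) \<theta>) \<longlonglongrightarrow> chord u \<theta>" for \<theta>
        by (rule continuous_on_tendsto_compose[OF chord_continuous]) auto
      then show "AE \<theta> in lborel. (\<lambda>i. ang_kernel a n (x (i + N)) \<theta>) \<longlonglongrightarrow> ang_kernel a n u \<theta>"
        using u chord_pos[of u] unfolding ang_kernel_def
        by (intro AE_I2 tendsto_intros) (auto simp: less_imp_neq[symmetric])
    qed measurable
    then show "(\<lambda>i. mode_kernel a n (x i)) \<longlonglongrightarrow> mode_kernel a n u"
      unfolding mode_kernel_def by (rule LIMSEQ_offset)
  qed
qed

text \<open>
  Since \<open>chord u \<theta> \<ge> 2 (1 - cos \<theta>)\<close>, the two orders won in \<open>sin_defect_le\<close> outweigh the exponent
  \<open>a < 2\<close>, uniformly in \<open>u\<close>. The sign is that of \<open>n sin\<^sup>2 \<theta> - sin \<theta> sin (n \<theta>)\<close>.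
\<close>

lemma diff_ang_kernel_bounds:
  assumes "1 \<le> a" "a \<le> 3/2"
  shows "0 \<le> real n * ang_kernel a 1 u \<theta> - ang_kernel a n u \<theta>"
    and "real n * ang_kernel a 1 u \<theta> - ang_kernel a n u \<theta> \<le> 2 * real n ^ 3 * indicator {-pi..pi} \<theta>"
proof -
  let ?D = "chord u \<theta>"
  have eq: "real n * ang_kernel a 1 u \<theta> - ang_kernel a n u \<theta>
     = indicator {-pi..pi} \<theta> * (sin \<theta> * (real n * sin \<theta> - sin (real n * \<theta>)) * ?D powr (-a))"
    by (simp add: ang_kernel_def algebra_simps)
  have "sin \<theta> * sin (real n * \<theta>) \<le> \<bar>sin \<theta>\<bar> * (real n * \<bar>sin \<theta>\<bar>)"
    by (rule order_trans[OF abs_ge_self]) (auto simp: abs_mult intro!: mult_left_mono abs_sin_mult_le)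
  also have "\<dots> = real n * (sin \<theta> * sin \<theta>)" by simp
  finally have "0 \<le> sin \<theta> * (real n * sin \<theta> - sin (real n * \<theta>))"
    by (simp add: algebra_simps)
  then show "0 \<le> real n * ang_kernel a 1 u \<theta> - ang_kernel a n u \<theta>"
    unfolding eq by (intro mult_nonneg_nonneg[OF _ mult_nonneg_nonneg]) (auto simp: indicator_def)
  have "sin \<theta> * (real n * sin \<theta> - sin (real n * \<theta>)) * ?D powr (-a) \<le> 2 * real n ^ 3"
  proof (cases "cos \<theta> = 1")
    case True
    then have "sin \<theta> = 0" by (metis cos_one_sin_zero)
    then show ?thesis by simp
  next
    case False
    let ?b = "2 * (1 - cos \<theta>)"
    have b: "0 < ?b" "?b \<le> 4"
    proof -
      show "0 < ?b" using False cos_le_one[of \<theta>] by (simp add: less_le)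
      show "?b \<le> 4" using cos_ge_minus_one[of \<theta>] by argo
    qed
    have bD: "?b \<le> ?D" using cosh_real_ge_1[of u] by (simp add: chord_def)
    have sb: "(sin \<theta>)\<^sup>2 \<le> ?b" using sin_sq_le_chord[of \<theta> 0] by (simp add: chord_def)
    have "sin \<theta> * (real n * sin \<theta> - sin (real n * \<theta>)) \<le> \<bar>sin \<theta>\<bar> * (real n ^ 3 * \<bar>sin \<theta>\<bar> * (1 - cos \<theta>))"
      by (rule order_trans[OF abs_ge_self]) (auto simp: abs_mult intro!: mult_left_mono sin_defect_le)
    also have "\<dots> = real n ^ 3 / 2 * ((\<bar>sin \<theta>\<bar> * \<bar>sin \<theta>\<bar>) * ?b)" by argo
    also have "\<dots> = real n ^ 3 / 2 * ((sin \<theta>)\<^sup>2 * ?b)"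
      unfolding abs_mult_self_eq power2_eq_square ..
    also have "\<dots> \<le> real n ^ 3 / 2 * (?b * ?b)" using b
      by (intro mult_left_mono mult_right_mono sb) auto
    finally have "sin \<theta> * (real n * sin \<theta> - sin (real n * \<theta>)) * ?D powr (-a)
        \<le> real n ^ 3 / 2 * (?b * ?b) * ?b powr (-a)"
    proof (rule mult_mono)
      show "?D powr (-a) \<le> ?b powr (-a)" using b bD assms by (intro powr_mono2') auto
    qed (use b in auto)
    also have "\<dots> = real n ^ 3 / 2 * ?b powr (2 - a)"
    proof -
      have "?b * ?b = ?b powr 2" using b(1) by (simp only: powr_numeral less_imp_le power2_eq_square)
      then have "(?b * ?b) * ?b powr (-a) = ?b powr (2 + - a)" by (simp only: powr_add)
      then show ?thesis by (simp only: mult.assoc) simp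
    qed
    also have "?b powr (2 - a) \<le> 4 powr (2 - a)" using b assms by (intro powr_mono2) auto
    also have "4 powr (2 - a) \<le> 4 powr 1" using assms by (intro powr_mono) auto
    finally show ?thesis by (simp add: mult_left_mono)
  qed
  then show "real n * ang_kernel a 1 u \<theta> - ang_kernel a n u \<theta> \<le> 2 * real n ^ 3 * indicator {-pi..pi} \<theta>"
    unfolding eq by (auto simp: indicator_def)
qed

lemma diff_kernel_eq:
  assumes "u \<noteq> 0" "0 \<le> a"
  shows "diff_kernel a n u = real n * mode_kernel a 1 u - mode_kernel a n u"
  unfolding diff_kernel_def mode_kernel_def
  using integrable_ang_kernel[OF assms] by (simp add: Bochner_Integration.integral_diff)

text \<open>
  The cancellation between the two kernels: each of them can be singular at \<open>0\<close>, but the common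
  majorant of the combined integrand lets dominated convergence reach this point.
\<close>

lemma continuous_diff_kernel:
  assumes "1 \<le> a" "a \<le> 3/2" shows "continuous_on UNIV (diff_kernel a n)"
proof (rule continuous_at_imp_continuous_on, safe)
  fix u :: real
  show "isCont (diff_kernel a n) u"
  proof (rule continuous_at_sequentiallyI)
    fix x :: "nat \<Rightarrow> real" assume x: "x \<longlonglongrightarrow> u"
    show "(\<lambda>i. diff_kernel a n (x i)) \<longlonglongrightarrow> diff_kernel a n u"
      unfolding diff_kernel_def
    proof (rule integral_dominated_convergence[where w = "\<lambda>\<theta>. 2 * real n ^ 3 * indicator {-pi..pi} \<theta>"])
      show "integrable lborel (\<lambda>\<theta>. 2 * real n ^ 3 * indicator {-pi..pi} \<theta>)"
        by (intro integrable_mult_right) (simp add: integrable_indicator_iff)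
      show "AE \<theta> in lborel. norm (real n * ang_kernel a 1 (x i) \<theta> - ang_kernel a n (x i) \<theta>) \<le> 2 * real n ^ 3 * indicator {-pi..pi} \<theta>" for i
        using diff_ang_kernel_bounds[OF assms] by (intro AE_I2) auto
      have ch: "(\<lambda>i. chord (x i) \<theta>) \<longlonglongrightarrow> chord u \<theta>" for \<theta>
        by (rule continuous_on_tendsto_compose[OF chord_continuous x]) auto
      show "AE \<theta> in lborel. (\<lambda>i. real n * ang_kernel a 1 (x i) \<theta> - ang_kernel a n (x i) \<theta>)
          \<longlonglongrightarrow> real n * ang_kernel a 1 u \<theta> - ang_kernel a n u \<theta>"
        using AE_lborel_neq[of 0]
      proof eventually_elim
        case (elim \<theta>)
        show ?case
        proof (cases "\<bar>\<theta>\<bar> \<le> pi")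
          case True
          have "0 < (2 * sin (\<theta> / 2))\<^sup>2" using abs_half_sin_ge[OF True] elim by auto
          then have "chord u \<theta> \<noteq> 0" using chord_lower[of u \<theta>] by (smt (verit) zero_le_power2)
          then show ?thesis unfolding ang_kernel_def by (intro tendsto_intros ch) auto
        next
          case False
          then have "\<theta> \<notin> {-pi..pi}" by auto
          then show ?thesis by (simp add: ang_kernel_def)
        qed
      qed
    qed measurable
  qed
qed

section \<open>Positivity of the kernels and the distance of the bumps\<close>

text \<open>
  Up to positive factors, the coefficients of the expansion of the kernels in powers of
  \<open>1 / cosh u\<close>. The recursion in \<open>k\<close> has nonnegative coefficients, so positivity is inherited from
  the orthogonality of the sines.
\<close>

definition cos_moment :: "nat \<Rightarrow> nat \<Rightarrow> real" where
  "cos_moment k n = (LINT \<theta>|lborel. indicator {-pi..pi} \<theta> * (cos \<theta> ^ k * sin \<theta> * sin (real n * \<theta>)))"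

lemma integrable_indicator_continuous:
  fixes f :: "real \<Rightarrow> real"
  assumes "continuous_on UNIV f"
  shows "integrable lborel (\<lambda>\<theta>. indicator {a..b} \<theta> * f \<theta>)"
  using borel_integrable_compact[of "{a..b}" f] assms
  by (auto simp: indicator_times_eq_if intro: continuous_on_subset)

lemma cos_moment_Suc: "cos_moment (Suc k) (Suc n) = (cos_moment k (Suc (Suc n)) + cos_moment k n) / 2"
proof -
  have eq: "cos \<theta> ^ Suc k * sin \<theta> * sin (real (Suc n) * \<theta>)
    = (cos \<theta> ^ k * sin \<theta> * sin (real (Suc (Suc n)) * \<theta>) + cos \<theta> ^ k * sin \<theta> * sin (real n * \<theta>)) / 2" for \<theta>
  proof -
    have "sin (real (Suc (Suc n)) * \<theta>) + sin (real n * \<theta>) = 2 * (cos \<theta> * sin (real (Suc n) * \<theta>))"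
    proof -
      have "real (Suc (Suc n)) * \<theta> = real (Suc n) * \<theta> + \<theta>" "real n * \<theta> = real (Suc n) * \<theta> - \<theta>"
        by (simp_all add: algebra_simps)
      then show ?thesis by (simp only: sin_add sin_diff) simp
    qed
    then have *: "sin (real (Suc (Suc n)) * \<theta>) = 2 * (cos \<theta> * sin (real (Suc n) * \<theta>)) - sin (real n * \<theta>)"
      by simp
    show ?thesis unfolding * by (simp add: algebra_simps)
  qed
  have i: "integrable lborel (\<lambda>\<theta>. indicator {-pi..pi} \<theta> * (cos \<theta> ^ k * sin \<theta> * sin (real m * \<theta>)))" for m
    by (intro integrable_indicator_continuous continuous_intros)
  have "cos_moment (Suc k) (Suc n) = (LINT \<theta>|lborel. (indicator {-pi..pi} \<theta> * (cos \<theta> ^ k * sin \<theta> * sin (real (Suc (Suc n)) * \<theta>))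
     + indicator {-pi..pi} \<theta> * (cos \<theta> ^ k * sin \<theta> * sin (real n * \<theta>))) / 2)"
    unfolding cos_moment_def eq by (simp add: algebra_simps)
  then show ?thesis unfolding cos_moment_def
    using Bochner_Integration.integral_add[OF i[of "Suc (Suc n)"] i[of n]] by simp
qed

lemma cos_moment_zero: "cos_moment k 0 = 0"
  by (simp add: cos_moment_def)

lemma cos_moment_base: "cos_moment 0 (Suc 0) = pi" "cos_moment 0 (Suc (Suc n)) = 0"
proof -
  have *: "cos_moment 0 m = G pi - G (-pi)"
    if "\<And>\<theta>. (G has_real_derivative sin \<theta> * sin (real m * \<theta>)) (at \<theta>)" for G m
  proof -
    have "cos_moment 0 m = (LINT \<theta>|lborel. (sin \<theta> * sin (real m * \<theta>)) * indicator {-pi..pi} \<theta>)"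
      by (simp add: cos_moment_def mult.commute)
    also have "\<dots> = G pi - G (-pi)"
      by (intro integral_FTC_Icc_real that continuous_intros) auto
    finally show ?thesis .
  qed
  have "((\<lambda>\<theta>. (\<theta> - sin \<theta> * cos \<theta>) / 2) has_real_derivative sin \<theta> * sin (real (Suc 0) * \<theta>)) (at \<theta>)" for \<theta>
  proof -
    have 1: "1 - (cos \<theta> * cos \<theta> - sin \<theta> * sin \<theta>) = 2 * (sin \<theta> * sin \<theta>)"
      using sin_cos_squared_add3[of \<theta>] by argo
    have "((\<lambda>\<theta>. (\<theta> - sin \<theta> * cos \<theta>) / 2) has_real_derivative (1 - (cos \<theta> * cos \<theta> - sin \<theta> * sin \<theta>)) / 2) (at \<theta>)"
      by (auto intro!: derivative_eq_intros)
    then show ?thesis unfolding 1 by simp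
  qed
  from *[OF this] show "cos_moment 0 (Suc 0) = pi" by simp
  let ?m = "real (Suc (Suc n))"
  have d: "((\<lambda>\<theta>. sin ((?m - 1) * \<theta>) / (2 * (?m - 1)) - sin ((?m + 1) * \<theta>) / (2 * (?m + 1)))
      has_real_derivative sin \<theta> * sin (?m * \<theta>)) (at \<theta>)" for \<theta>
  proof -
    have 1: "cos ((?m - 1) * \<theta>) / 2 - cos ((?m + 1) * \<theta>) / 2 = sin \<theta> * sin (?m * \<theta>)"
    proof -
      have "(?m - 1) * \<theta> = ?m * \<theta> - \<theta>" "(?m + 1) * \<theta> = ?m * \<theta> + \<theta>" by (simp_all add: algebra_simps)
      then show ?thesis by (simp only: cos_add cos_diff) argo
    qed
    have 2: "((\<lambda>\<theta>. sin (c * \<theta>) / (2 * c)) has_real_derivative cos (c * \<theta>) / 2) (at \<theta>)" if "c \<noteq> 0" for c :: real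
      using that by (auto intro!: derivative_eq_intros)
    show ?thesis unfolding 1[symmetric] by (intro DERIV_diff 2) auto
  qed
  have e: "?m - 1 = real (Suc n)" "?m + 1 = real (Suc (Suc (Suc n)))" by simp_all
  show "cos_moment 0 (Suc (Suc n)) = 0"
    unfolding *[OF d] e by (simp add: sin_npi del: of_nat_Suc)
qed

lemma cos_moment_nonneg: "0 \<le> cos_moment k n"
proof (induction k arbitrary: n)
  case 0
  show ?case using cos_moment_zero cos_moment_base by (cases n; cases "n - 1") auto
next
  case (Suc k)
  show ?case by (cases n) (auto simp: cos_moment_zero cos_moment_Suc Suc)
qed

lemma cos_moment_pos: "0 < cos_moment k (Suc k)"
proof (induction k)
  case (Suc k)
  then show ?case using cos_moment_nonneg[of k "Suc (Suc (Suc k))"] by (simp add: cos_moment_Suc)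
qed (simp add: cos_moment_base)

text \<open>
  The binomial series of \<open>(2 cosh u - 2 cos \<theta>)^-a\<close> in powers of \<open>cos \<theta>\<close>, integrated term by term.
  All its coefficients are positive because the exponent is negative.
\<close>

lemma mode_kernel_sums:
  assumes u: "u \<noteq> 0" and a: "0 < a"
  shows "(\<lambda>k. (pochhammer a k / fact k) * 2 ^ k * (2 * cosh u) powr (- a - real k) * cos_moment k n)
     sums mode_kernel a n u"
proof -
  let ?A = "2 * cosh u"
  define q where "q = 1 / cosh u"
  have c1: "cosh u > 1" using chord_pos[OF u, of 0] by (simp add: chord_def)
  have q: "0 < q" "q < 1" using c1 by (auto simp: q_def)
  let ?c = "\<lambda>k. pochhammer a k / fact k"
  have cpos: "?c k > 0" for k using a by (simp add: pochhammer_pos)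
  have gb: "((-a) gchoose k) * (- x) ^ k = ?c k * x ^ k" for x :: real and k
  proof -
    have 1: "(-1) ^ k * (-1) ^ k = (1::real)" by (simp flip: power_mult_distrib)
    have "((-a) gchoose k) * (- x) ^ k = ((-1) ^ k * pochhammer a k / fact k) * ((-1) ^ k * x ^ k)"
      unfolding power_minus[of x] gbinomial_pochhammer minus_minus ..
    also have "\<dots> = ((-1) ^ k * (-1) ^ k) * (?c k * x ^ k)" by argo
    finally show ?thesis unfolding 1 by simp
  qed
  let ?f = "\<lambda>k \<theta>. indicator {-pi..pi} \<theta> * (cos \<theta> ^ k * sin \<theta> * sin (real n * \<theta>)) * (?c k * 2 ^ k * ?A powr (- a - real k))"
  have pw: "(\<lambda>k. ?f k \<theta>) sums ang_kernel a n u \<theta>" for \<theta>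
  proof -
    have lt: "\<bar>- (2 * cos \<theta>)\<bar> < ?A" using le_less_trans[OF abs_cos_le_one c1, of \<theta>] by (simp add: abs_mult)
    have "(\<lambda>k. ((-a) gchoose k) * (- (2 * cos \<theta>)) ^ k * ?A powr (- a - real k)) sums (- (2 * cos \<theta>) + ?A) powr (- a)"
      by (rule gen_binomial_real'[OF lt])
    then have "(\<lambda>k. ?c k * (2 * cos \<theta>) ^ k * ?A powr (- a - real k)) sums chord u \<theta> powr (- a)"
      unfolding gb by (simp add: chord_def algebra_simps)
    from sums_mult[OF this, of "indicator {-pi..pi} \<theta> * (sin \<theta> * sin (real n * \<theta>))"]
    show ?thesis by (simp add: ang_kernel_def power_mult_distrib mult_ac)
  qed
  have nb: "norm (?f k \<theta>) \<le> indicator {-pi..pi} \<theta> * (?A powr (- a) * (?c k * q ^ k))" for k \<theta>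
  proof -
    have e: "2 ^ k * ?A powr (- a - real k) = ?A powr (- a) * q ^ k"
      using c1 by (simp add: powr_diff powr_realpow q_def power_mult_distrib power_divide field_simps)
    have b: "\<bar>cos \<theta> ^ k * sin \<theta> * sin (real n * \<theta>)\<bar> \<le> 1"
      unfolding abs_mult by (intro mult_le_one mult_nonneg_nonneg) (auto simp: power_abs power_le_one)
    have p: "0 \<le> ?c k * (?A powr (- a) * q ^ k)" by (intro mult_nonneg_nonneg less_imp_le[OF cpos]) (use q in auto)
    have f: "?f k \<theta> = indicator {-pi..pi} \<theta> * (cos \<theta> ^ k * sin \<theta> * sin (real n * \<theta>)) * (?c k * (?A powr (- a) * q ^ k))"
      unfolding e[symmetric] by (simp only: mult.assoc)
    have "norm (?f k \<theta>) = indicator {-pi..pi} \<theta> * (\<bar>cos \<theta> ^ k * sin \<theta> * sin (real n * \<theta>)\<bar> * (?c k * (?A powr (- a) * q ^ k)))"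
      unfolding f real_norm_def abs_mult[of _ "?c k * _"] abs_mult[of "indicator _ _"] abs_of_nonneg[OF p] abs_indicator
      by (simp only: mult.assoc)
    also have "\<dots> \<le> indicator {-pi..pi} \<theta> * (1 * (?c k * (?A powr (- a) * q ^ k)))"
      by (intro mult_left_mono mult_right_mono b p) auto
    finally show ?thesis by (simp add: mult_ac)
  qed
  have sm: "summable (\<lambda>k. ?A powr (- a) * (?c k * q ^ k))"
  proof -
    have "(\<lambda>k. ((-a) gchoose k) * (- q) ^ k) sums (1 + (- q)) powr (- a)"
      by (rule gen_binomial_real) (use q in auto)
    then show ?thesis unfolding gb by (intro summable_mult) (auto simp: sums_iff)
  qed
  have int: "integrable lborel (?f k)" for k
    by (intro integrable_mult_left integrable_indicator_continuous continuous_intros)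
  have "(\<lambda>k. integral\<^sup>L lborel (?f k)) sums (LINT \<theta>|lborel. (\<Sum>k. ?f k \<theta>))"
  proof (rule sums_integral[OF int])
    show "AE \<theta> in lborel. summable (\<lambda>k. norm (?f k \<theta>))"
    proof (intro AE_I2)
      fix \<theta> :: real
      show "summable (\<lambda>k. norm (?f k \<theta>))"
        by (rule summable_comparison_test'[OF summable_mult[OF sm, of "indicator {-pi..pi} \<theta>"], of 0])
          (use nb[where \<theta> = \<theta>] in auto)
    qed
    show "summable (\<lambda>k. LINT \<theta>|lborel. norm (?f k \<theta>))"
    proof (rule summable_comparison_test'[OF summable_mult[OF sm, of "2 * pi"], of 0])
      fix k :: nat
      have "(LINT \<theta>|lborel. norm (?f k \<theta>)) \<le> (LINT \<theta>|lborel. indicator {-pi..pi} \<theta> * (?A powr (- a) * (?c k * q ^ k)))"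
        by (intro integral_mono nb integrable_norm int integrable_mult_left)
          (simp add: integrable_indicator_iff)
      also have "\<dots> = 2 * pi * (?A powr (- a) * (?c k * q ^ k))" by simp
      finally show "norm (LINT \<theta>|lborel. norm (?f k \<theta>)) \<le> 2 * pi * (?A powr (- a) * (?c k * q ^ k))"
        by (simp add: integral_nonneg_AE)
    qed
  qed
  moreover have "(\<lambda>\<theta>. \<Sum>k. ?f k \<theta>) = ang_kernel a n u"
    using pw by (auto simp: sums_iff)
  moreover have "integral\<^sup>L lborel (?f k) = ?c k * 2 ^ k * ?A powr (- a - real k) * cos_moment k n" for k
    by (subst integral_mult_left_zero) (simp add: cos_moment_def)
  ultimately show ?thesis unfolding mode_kernel_def by (simp only:)
qed

text \<open>
  Used with \<open>k = n - 1\<close>, the first index with \<open>cos_moment k n > 0\<close>: this gives positivity of the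
  kernel and a lower bound that does not degenerate as \<open>u\<close> tends to \<open>0\<close>.
\<close>

lemma mode_kernel_lower:
  assumes u: "u \<noteq> 0" and a: "0 < a"
  shows "(pochhammer a k / fact k) * 2 ^ k * (2 * cosh u) powr (- a - real k) * cos_moment k n \<le> mode_kernel a n u"
proof -
  let ?t = "\<lambda>k. (pochhammer a k / fact k) * 2 ^ k * (2 * cosh u) powr (- a - real k) * cos_moment k n"
  have nn: "0 \<le> ?t k" for k
    using pochhammer_pos[OF a, of k] by (intro mult_nonneg_nonneg divide_nonneg_nonneg cos_moment_nonneg) auto
  have "sum ?t {k} \<le> suminf ?t"
    by (rule sum_le_suminf) (use mode_kernel_sums[OF assms, of n] nn in \<open>auto simp: sums_iff\<close>)
  then show ?thesis using mode_kernel_sums[OF assms, of n] by (simp add: sums_iff)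
qed

lemma mode_kernel_pos:
  assumes u: "u \<noteq> 0" and a: "0 < a" and n: "n > 0"
  shows "0 < mode_kernel a n u"
proof -
  obtain k where k: "n = Suc k" using n by (cases n) auto
  have "0 < (pochhammer a k / fact k) * 2 ^ k * (2 * cosh u) powr (- a - real k) * cos_moment k n"
    unfolding k using pochhammer_pos[OF a, of k] cos_moment_pos[of k]
    by (intro mult_pos_pos divide_pos_pos) auto
  then show ?thesis using mode_kernel_lower[OF u a, of k n] by linarith
qed

lemma mode_kernel_bounded_away:
  assumes "\<bar>u\<bar> \<ge> 1" "0 \<le> a" shows "mode_kernel a n u \<le> 2 * pi * real n"
proof -
  have "mode_kernel a n u \<le> (LINT \<theta>|lborel. real n * (1\<^sup>2) powr (-a) * indicator {-pi..pi} \<theta>)"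
    unfolding mode_kernel_def
  proof (rule integral_mono)
    show "integrable lborel (ang_kernel a n u)" by (rule integrable_ang_kernel) (use assms in auto)
    show "integrable lborel (\<lambda>\<theta>. real n * (1\<^sup>2) powr (-a) * indicator {-pi..pi} \<theta>)"
      by (intro integrable_mult_right) (simp add: integrable_indicator_iff)
    show "ang_kernel a n u \<theta> \<le> real n * (1\<^sup>2) powr (-a) * indicator {-pi..pi} \<theta>" for \<theta>
      using abs_ang_kernel_le_powr[of 1 u a n \<theta>] assms by auto
  qed
  then show ?thesis by (simp add: mult_ac)
qed

text \<open>
  For \<open>n \<ge> 2\<close> the inequality \<open>sin (n \<theta>) < n sin \<theta>\<close> is strict for \<open>0 < \<theta> < \<pi>\<close>. For \<open>n = 1\<close>
  the two kernels coincide, and the construction of an unstable vortex breaks down.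
\<close>

lemma diff_kernel_zero_pos:
  assumes "1 \<le> a" "a \<le> 3/2" "n \<ge> 2" shows "0 < diff_kernel a n 0"
proof -
  let ?h = "\<lambda>\<theta>. real n * ang_kernel a 1 0 \<theta> - ang_kernel a n 0 \<theta>"
  have int: "integrable lborel ?h"
  proof (rule Bochner_Integration.integrable_bound[of _ "\<lambda>\<theta>. 2 * real n ^ 3 * indicator {-pi..pi} \<theta>"])
    show "integrable lborel (\<lambda>\<theta>. 2 * real n ^ 3 * indicator {-pi..pi} \<theta>)"
      by (intro integrable_mult_right) (simp add: integrable_indicator_iff)
    show "AE \<theta> in lborel. norm (?h \<theta>) \<le> norm (2 * real n ^ 3 * indicator {-pi..pi} \<theta>)"
      using diff_ang_kernel_bounds[OF assms(1,2), of n 0] by (intro AE_I2) auto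
  qed measurable
  have pos: "0 < ?h \<theta>" if "0 < \<theta>" "\<theta> < pi" for \<theta>
  proof -
    have s: "sin \<theta> > 0" using that by (rule sin_gt_zero)
    obtain k where k: "n = Suc k" "k \<ge> 1" using assms(3) that[of "n - 1"] by simp
    have c: "\<bar>cos \<theta>\<bar> < 1"
    proof -
      have "0 < (sin \<theta>)\<^sup>2" using s by simp
      then have "(cos \<theta>)\<^sup>2 < 1" using sin_cos_squared_add[of \<theta>] by linarith
      then show ?thesis by (simp only: abs_square_less_1)
    qed
    have "sin (real n * \<theta>) = sin (real k * \<theta>) * cos \<theta> + cos (real k * \<theta>) * sin \<theta>"
      unfolding k(1) by (simp add: algebra_simps sin_add)
    also have "\<dots> \<le> \<bar>sin (real k * \<theta>)\<bar> * \<bar>cos \<theta>\<bar> + \<bar>cos (real k * \<theta>)\<bar> * sin \<theta>"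
      using s by (intro add_mono mult_right_mono) (auto simp flip: abs_mult)
    also have "\<dots> \<le> (real k * sin \<theta>) * \<bar>cos \<theta>\<bar> + 1 * sin \<theta>"
      using s abs_sin_mult_le[of k \<theta>] by (intro add_mono mult_right_mono) auto
    also have "\<dots> < (real k * sin \<theta>) * 1 + 1 * sin \<theta>"
      using s c k(2) by (intro add_strict_right_mono mult_strict_left_mono) auto
    also have "\<dots> = real n * sin \<theta>" using k by (simp add: algebra_simps)
    finally have "0 < sin \<theta> * (real n * sin \<theta> - sin (real n * \<theta>))" using s by simp
    moreover have "chord 0 \<theta> > 0"
      using c by (simp add: chord_def)
    ultimately have "0 < sin \<theta> * (real n * sin \<theta> - sin (real n * \<theta>)) * chord 0 \<theta> powr (-a)"
      by simp
    moreover have "?h \<theta> = sin \<theta> * (real n * sin \<theta> - sin (real n * \<theta>)) * chord 0 \<theta> powr (-a)"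
      using that by (simp add: ang_kernel_def algebra_simps)
    ultimately show ?thesis by simp
  qed
  have "0 \<le> diff_kernel a n 0" unfolding diff_kernel_def
    using diff_ang_kernel_bounds(1)[OF assms(1,2)] by (intro integral_nonneg_AE AE_I2) auto
  moreover have "diff_kernel a n 0 \<noteq> 0"
  proof
    assume "diff_kernel a n 0 = 0"
    then have "AE \<theta> in lborel. ?h \<theta> = 0"
      using integral_nonneg_eq_0_iff_AE[OF int] diff_ang_kernel_bounds(1)[OF assms(1,2)]
      by (simp add: diff_kernel_def)
    then have "AE \<theta> in lborel. \<theta> \<notin> {0<..<pi}"
      by eventually_elim (use pos in force)
    then have "emeasure lborel {0<..<pi} = 0"
      by (subst (asm) AE_iff_measurable[of "{0<..<pi}"]) auto
    then show False by simp
  qed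
  ultimately show ?thesis by simp
qed

text \<open>
  The two inequalities say \<open>0 < \<phi> < G\<close> for the limit problem of two thin bumps at distance \<open>u\<close>.
  They hold immediately to the right of the last zero of \<open>\<phi>\<close>, because \<open>G > 0\<close> there.
\<close>

lemma exists_unstable_separation:
  assumes a: "1 \<le> a" "a \<le> 3/2" and n: "n \<ge> 2"
  obtains u where "u > 0" "0 < diff_kernel a n 0 * cosh (a * u) - real n * mode_kernel a 1 u"
    "diff_kernel a n 0 * cosh (a * u) - real n * mode_kernel a 1 u < mode_kernel a n u"
proof -
  let ?g = "diff_kernel a n 0"
  let ?\<phi> = "\<lambda>u. ?g * cosh (a * u) - real n * mode_kernel a 1 u"
  have g: "?g > 0" by (rule diff_kernel_zero_pos[OF a n])
  obtain k where k: "n = Suc k" using n by (cases n) auto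
  have cont: "continuous_on {0<..} ?\<phi>" "continuous_on {0<..} (mode_kernel a n)"
    using a by (auto intro!: continuous_intros continuous_on_subset[OF continuous_mode_kernel])
  \<comment> \<open>Near \<open>0\<close> the first two terms of \<open>\<phi> = g cosh (a u) - diff_kernel - mode_kernel a n\<close> cancel,
      and the third stays away from \<open>0\<close>.\<close>
  have "\<exists>u1>0. ?\<phi> u1 < 0"
  proof -
    let ?l = "\<lambda>u. (pochhammer a k / fact k) * 2 ^ k * (2 * cosh u) powr (- a - real k) * cos_moment k n"
    let ?r = "\<lambda>u. ?g * cosh (a * u) - diff_kernel a n u - ?l u"
    have l0: "0 < ?l 0"
      unfolding k using pochhammer_pos[of a k] a cos_moment_pos[of k]
      by (intro mult_pos_pos divide_pos_pos) auto
    have "isCont (diff_kernel a n) 0"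
      using continuous_diff_kernel[OF a, of n] by (simp add: continuous_on_eq_continuous_at)
    then have "isCont ?r 0" by (intro continuous_intros) auto
    moreover have "?r 0 < 0" using l0 by simp
    ultimately have "\<forall>\<^sub>F u in at 0. ?r u < 0"
      using order_tendstoD(2)[of ?r "?r 0" "at 0" 0] by (simp add: isCont_def)
    then have "\<forall>\<^sub>F u in at_right 0. ?r u < 0" by (simp add: eventually_at_split)
    moreover have "\<forall>\<^sub>F u in at_right 0. u > (0::real)" by (simp add: eventually_at_right_less)
    ultimately have "\<forall>\<^sub>F u in at_right 0. ?r u < 0 \<and> u > (0::real)" by eventually_elim simp
    then obtain u where u: "?r u < 0" "u > 0"
      using eventually_happens[of _ "at_right (0::real)"] by auto
    have "?\<phi> u = ?g * cosh (a * u) - diff_kernel a n u - mode_kernel a n u"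
      using diff_kernel_eq[of u a n] u a by simp
    also have "\<dots> \<le> ?r u" using mode_kernel_lower[of u a k n] u a by simp
    finally show ?thesis using u by (intro exI[of _ u]) auto
  qed
  then obtain u1 where u1: "u1 > 0" "?\<phi> u1 < 0" by auto
  \<comment> \<open>For large \<open>u\<close> the kernel is bounded and the hyperbolic cosine wins.\<close>
  have "\<exists>u2>u1. ?\<phi> u2 > 0"
  proof -
    obtain y where y: "y > (real n * (2 * pi)) / ?g" "y > 1" by (metis gt_ex less_trans max_less_iff_conj)
    let ?u = "u1 + y"
    have c: "y \<le> cosh (a * ?u)"
    proof -
      have "?u \<le> a * ?u" using a u1 y by simp
      then have "y \<le> a * ?u" using u1 by linarith
      also have "\<dots> \<le> 1 + (a * ?u)\<^sup>2 / 2" using sum_squares_bound[of 1 "a * ?u"] by simp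
      also have "\<dots> \<le> cosh (a * ?u)"
        using chord_lower[of "a * ?u" 0] by (simp add: chord_def)
      finally show ?thesis .
    qed
    have "real n * mode_kernel a 1 ?u \<le> real n * (2 * pi)"
      using mode_kernel_bounded_away[of ?u a 1] u1 y a by (intro mult_left_mono) auto
    also have "\<dots> < ?g * y" using y g by (simp add: field_simps)
    also have "\<dots> \<le> ?g * cosh (a * ?u)" using c g by (intro mult_left_mono) auto
    finally show ?thesis using y by (intro exI[of _ ?u]) auto
  qed
  then obtain u2 where u2: "u2 > u1" "?\<phi> u2 > 0" by auto
  define S where "S = {x \<in> {u1..u2}. ?\<phi> x \<le> 0}"
  have cl: "closed S" unfolding S_def
    by (intro continuous_on_closed_Collect_le continuous_on_subset[OF cont(1)] continuous_on_const) (use u1 in auto)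
  have "u1 \<in> S" using u1 u2 by (simp add: S_def)
  then have bS: "bdd_above S" "S \<noteq> {}" unfolding S_def by (auto intro!: bdd_aboveI[of _ u2])
  define m where "m = Sup S"
  have m: "m \<in> S" unfolding m_def using closed_contains_Sup[OF bS(2,1) cl] .
  have m2: "m < u2" "m > 0" using m u1 u2 by (auto simp: S_def intro: le_neq_trans)
  have after: "?\<phi> x > 0" if "m < x" "x \<le> u2" for x
  proof (rule ccontr)
    assume "\<not> ?\<phi> x > 0"
    then have "x \<in> S" using that m by (auto simp: S_def)
    then show False using cSup_upper[OF _ bS(1)] that unfolding m_def by fastforce
  qed
  have "isCont ?\<phi> m" "isCont (mode_kernel a n) m"
    using cont m2 by (auto simp: continuous_on_eq_continuous_at)
  then have "isCont (\<lambda>x. ?\<phi> x - mode_kernel a n x) m" by (rule isCont_diff)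
  moreover have "?\<phi> m - mode_kernel a n m < 0"
    using m mode_kernel_pos[of m a n] m2 a n by (auto simp: S_def)
  ultimately have "\<forall>\<^sub>F x in at m. ?\<phi> x - mode_kernel a n x < 0"
    using order_tendstoD(2)[of "\<lambda>x. ?\<phi> x - mode_kernel a n x" _ "at m" 0] by (simp add: isCont_def)
  then have "\<forall>\<^sub>F x in at_right m. ?\<phi> x - mode_kernel a n x < 0" by (simp add: eventually_at_split)
  moreover have "\<forall>\<^sub>F x in at_right m. x \<in> {m<..<u2}" by (rule eventually_at_rightI[OF _ m2(1)]) auto
  ultimately have "\<forall>\<^sub>F x in at_right m. ?\<phi> x - mode_kernel a n x < 0 \<and> x \<in> {m<..<u2}" by eventually_elim simp
  then obtain x where x: "?\<phi> x - mode_kernel a n x < 0" "x \<in> {m<..<u2}"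
    using eventually_happens[of _ "at_right m"] by auto
  show thesis by (rule that[of x]) (use x m2 after[of x] in auto)
qed

section \<open>Convolution with an integrable kernel\<close>

definition vanishes_beyond :: "real \<Rightarrow> (real \<Rightarrow> 'b::zero) \<Rightarrow> bool" where
  "vanishes_beyond L h \<longleftrightarrow> (\<forall>t. L < \<bar>t\<bar> \<longrightarrow> h t = 0)"

definition conv :: "(real \<Rightarrow> real) \<Rightarrow> (real \<Rightarrow> complex) \<Rightarrow> real \<Rightarrow> complex" where
  "conv \<gamma> h s = (LINT u|lborel. \<gamma> u *\<^sub>R h (s - u))"

lemma vanishes_beyond_mult:
  fixes f g :: "real \<Rightarrow> 'b::mult_zero"
  shows "vanishes_beyond L f \<Longrightarrow> vanishes_beyond L (\<lambda>t. f t * g t)"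
  "vanishes_beyond L g \<Longrightarrow> vanishes_beyond L (\<lambda>t. f t * g t)"
  by (auto simp: vanishes_beyond_def)

lemma vanishes_beyond_add:
  fixes f g :: "real \<Rightarrow> 'b::monoid_add"
  shows "vanishes_beyond L f \<Longrightarrow> vanishes_beyond L g \<Longrightarrow> vanishes_beyond L (\<lambda>t. f t + g t)"
  by (auto simp: vanishes_beyond_def)

lemma vanishes_beyond_derivative:
  assumes "vanishes_beyond L h" "\<And>t. (h has_vector_derivative h' t) (at t)"
  shows "vanishes_beyond L h'"
  unfolding vanishes_beyond_def
proof safe
  fix t assume t: "L < \<bar>t\<bar>"
  have o: "open {t. L < \<bar>t::real\<bar>}" by (intro open_Collect_less continuous_intros)
  have "((\<lambda>_. 0) has_vector_derivative h' t) (at t)"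
    by (rule has_vector_derivative_transform_within_open[OF assms(2) o])
      (use t assms(1) in \<open>auto simp: vanishes_beyond_def\<close>)
  from vector_derivative_unique_at[OF this has_vector_derivative_const] show "h' t = 0" .
qed

lemma vanishes_beyond_bounded:
  fixes h :: "real \<Rightarrow> complex"
  assumes "continuous_on UNIV h" "vanishes_beyond L h"
  obtains N where "N \<ge> 0" "\<And>t. norm (h t) \<le> N"
proof -
  have "compact (h ` {-L..L})"
    by (intro compact_continuous_image continuous_on_subset[OF assms(1)]) auto
  then obtain N where N: "\<And>x. x \<in> h ` {-L..L} \<Longrightarrow> norm x \<le> N"
    using compact_imp_bounded bounded_iff by metis
  show thesis
  proof (rule that[of "max 0 N"])
    show "norm (h t) \<le> max 0 N" for t
    proof (cases "\<bar>t\<bar> \<le> L")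
      case True then show ?thesis using N[of "h t"] by (auto simp: abs_le_iff intro!: imageI)
    next
      case False then show ?thesis using assms(2) by (simp add: vanishes_beyond_def)
    qed
  qed simp
qed

lemma integrable_vanishing_mult:
  fixes r g :: "real \<Rightarrow> complex"
  assumes "continuous_on UNIV r" "vanishes_beyond L r" "continuous_on UNIV g"
  shows "integrable lborel (\<lambda>t. r t * g t)"
proof -
  have "integrable lborel (\<lambda>t. indicator {-L..L} t *\<^sub>R (r t * g t))"
    by (intro borel_integrable_compact) (auto intro!: continuous_intros continuous_on_subset[OF assms(1)] continuous_on_subset[OF assms(3)])
  also have "(\<lambda>t. indicator {-L..L} t *\<^sub>R (r t * g t)) = (\<lambda>t. r t * g t)"
    using assms(2) by (auto simp: vanishes_beyond_def indicator_def fun_eq_iff abs_le_iff not_le)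
  finally show ?thesis .
qed

lemma has_vector_derivative_iff_quotient:
  fixes f :: "real \<Rightarrow> 'b::real_normed_vector"
  shows "(f has_vector_derivative D) (at x) \<longleftrightarrow> ((\<lambda>y. (f y - f x) /\<^sub>R (y - x)) \<longlongrightarrow> D) (at x)"
proof -
  have "((\<lambda>y. (f y - f x) /\<^sub>R (y - x)) \<longlongrightarrow> D) (at x)
      \<longleftrightarrow> ((\<lambda>y. norm ((f y - f x) /\<^sub>R (y - x) - D)) \<longlongrightarrow> 0) (at x)"
    by (simp add: tendsto_norm_zero_iff LIM_zero_iff)
  also have "\<dots> \<longleftrightarrow> ((\<lambda>y. norm (f y - f x - (y - x) *\<^sub>R D) / norm (y - x)) \<longlongrightarrow> 0) (at x)"
  proof (rule filterlim_cong[OF refl refl])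
    show "\<forall>\<^sub>F y in at x. norm ((f y - f x) /\<^sub>R (y - x) - D) = norm (f y - f x - (y - x) *\<^sub>R D) / norm (y - x)"
      unfolding eventually_at_filter
    proof (intro always_eventually allI impI)
      fix y assume "y \<noteq> x"
      then have "(f y - f x) /\<^sub>R (y - x) - D = (f y - f x - (y - x) *\<^sub>R D) /\<^sub>R (y - x)"
        by (simp add: scaleR_diff_right)
      then show "norm ((f y - f x) /\<^sub>R (y - x) - D) = norm (f y - f x - (y - x) *\<^sub>R D) / norm (y - x)"
        by (simp add: divide_inverse mult.commute)
    qed
  qed
  also have "\<dots> \<longleftrightarrow> (f has_vector_derivative D) (at x)"
    by (simp add: has_vector_derivative_def has_derivative_iff_norm bounded_linear_scaleR_left)
  finally show ?thesis by simp
qed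

context
  fixes \<gamma> :: "real \<Rightarrow> real"
  assumes \<gamma>: "integrable lborel \<gamma>"
begin

lemma \<gamma>_measurable: "\<gamma> \<in> borel_measurable borel"
  using \<gamma> by auto

lemma conv_integrable:
  fixes h :: "real \<Rightarrow> complex"
  assumes "continuous_on UNIV h" "\<And>t. norm (h t) \<le> N"
  shows "integrable lborel (\<lambda>u. \<gamma> u *\<^sub>R h (s - u))"
proof (rule Bochner_Integration.integrable_bound[where f = "\<lambda>u. \<gamma> u * N"])
  have [measurable]: "h \<in> borel_measurable borel" using assms(1) by (rule borel_measurable_continuous_onI)
  note \<gamma>_measurable[measurable]
  show "(\<lambda>u. \<gamma> u *\<^sub>R h (s - u)) \<in> borel_measurable lborel" by measurable
  show "AE u in lborel. norm (\<gamma> u *\<^sub>R h (s - u)) \<le> norm (\<gamma> u * N)"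
    by (intro AE_I2) (auto simp: abs_mult intro!: mult_left_mono order_trans[OF assms(2) abs_ge_self])
qed (use \<gamma> in auto)

lemma conv_bound:
  assumes "continuous_on UNIV h" "\<And>t. norm (h t) \<le> N"
  shows "norm (conv \<gamma> h s) \<le> (LINT u|lborel. \<bar>\<gamma> u\<bar>) * N"
proof -
  have "norm (conv \<gamma> h s) \<le> (LINT u|lborel. norm (\<gamma> u *\<^sub>R h (s - u)))"
    unfolding conv_def by (rule integral_norm_bound)
  also have "\<dots> \<le> (LINT u|lborel. \<bar>\<gamma> u\<bar> * N)"
    by (intro integral_mono integrable_norm conv_integrable[OF assms])
      (use \<gamma> assms in \<open>auto intro!: mult_left_mono\<close>)
  finally show ?thesis by simp
qed

lemma conv_diff:
  assumes "continuous_on UNIV h1" "\<And>t. norm (h1 t) \<le> N1" "continuous_on UNIV h2" "\<And>t. norm (h2 t) \<le> N2"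
  shows "conv \<gamma> (\<lambda>t. h1 t - h2 t) s = conv \<gamma> h1 s - conv \<gamma> h2 s"
  unfolding conv_def using conv_integrable[OF assms(1,2)] conv_integrable[OF assms(3,4)]
  by (simp add: scaleR_diff_right)

lemma conv_add:
  assumes "continuous_on UNIV h1" "\<And>t. norm (h1 t) \<le> N1" "continuous_on UNIV h2" "\<And>t. norm (h2 t) \<le> N2"
  shows "conv \<gamma> (\<lambda>t. h1 t + h2 t) s = conv \<gamma> h1 s + conv \<gamma> h2 s"
  unfolding conv_def using conv_integrable[OF assms(1,2)] conv_integrable[OF assms(3,4)]
  by (simp add: scaleR_add_right)

lemma continuous_conv:
  assumes h: "continuous_on UNIV h" "\<And>t. norm (h t) \<le> N"
  shows "continuous_on UNIV (conv \<gamma> h)"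
proof (rule continuous_at_imp_continuous_on, intro ballI)
  fix s :: real
  have [measurable]: "h \<in> borel_measurable borel" using h(1) by (rule borel_measurable_continuous_onI)
  note \<gamma>_measurable[measurable]
  show "isCont (conv \<gamma> h) s"
  proof (rule continuous_at_sequentiallyI)
    fix x :: "nat \<Rightarrow> real" assume x: "x \<longlonglongrightarrow> s"
    show "(\<lambda>i. conv \<gamma> h (x i)) \<longlonglongrightarrow> conv \<gamma> h s"
      unfolding conv_def
    proof (rule integral_dominated_convergence[where w = "\<lambda>u. \<bar>\<gamma> u\<bar> * N"])
      show "AE u in lborel. (\<lambda>i. \<gamma> u *\<^sub>R h (x i - u)) \<longlonglongrightarrow> \<gamma> u *\<^sub>R h (s - u)"
        by (intro AE_I2 tendsto_intros continuous_on_tendsto_compose[OF h(1)] x) auto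
      show "AE u in lborel. norm (\<gamma> u *\<^sub>R h (x i - u)) \<le> \<bar>\<gamma> u\<bar> * N" for i
        using h(2) by (auto intro!: mult_left_mono)
    qed (use \<gamma> in auto)
  qed
qed

lemma conv_has_vector_derivative:
  assumes h: "\<And>t. (h has_vector_derivative h' t) (at t)" "\<And>t. norm (h t) \<le> N"
    and h': "continuous_on UNIV h'" "\<And>t. norm (h' t) \<le> N'"
  shows "(conv \<gamma> h has_vector_derivative conv \<gamma> h' s) (at s)"
proof -
  have hc: "continuous_on UNIV h"
    using h(1) by (auto intro!: continuous_at_imp_continuous_on has_vector_derivative_continuous)
  have [measurable]: "h \<in> borel_measurable borel" "h' \<in> borel_measurable borel"
    using hc h'(1) by (auto intro: borel_measurable_continuous_onI)
  note \<gamma>_measurable[measurable]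
  have lip: "norm (h x - h y) \<le> N' * norm (x - y)" for x y
    by (rule differentiable_bound[of UNIV h "\<lambda>x v. v *\<^sub>R h' x"])
      (use h(1) h'(2) in \<open>auto simp: has_vector_derivative_def intro!: onorm_le mult_left_mono simp: mult.commute[of N']\<close>)
  let ?F = "conv \<gamma> h" and ?G = "conv \<gamma> h'"
  have "((\<lambda>y. (?F y - ?F s) /\<^sub>R (y - s)) \<longlongrightarrow> ?G s) (at s)"
    unfolding tendsto_at_iff_sequentially
  proof (intro allI impI)
    fix x :: "nat \<Rightarrow> real" assume x: "\<forall>i. x i \<in> UNIV - {s}" "x \<longlonglongrightarrow> s"
    let ?k = "\<lambda>i u. \<gamma> u *\<^sub>R ((h (x i - u) - h (s - u)) /\<^sub>R (x i - s))"
    have xs: "x i \<noteq> s" for i using x by auto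
    have "(\<lambda>i. LINT u|lborel. ?k i u) \<longlonglongrightarrow> (LINT u|lborel. \<gamma> u *\<^sub>R h' (s - u))"
    proof (rule integral_dominated_convergence[where w = "\<lambda>u. \<bar>\<gamma> u\<bar> * N'"])
      show "AE u in lborel. (\<lambda>i. ?k i u) \<longlonglongrightarrow> \<gamma> u *\<^sub>R h' (s - u)"
      proof (intro AE_I2 tendsto_intros)
        fix u
        have "((\<lambda>y. (h y - h (s - u)) /\<^sub>R (y - (s - u))) \<longlongrightarrow> h' (s - u)) (at (s - u))"
        proof -
          have "(h has_vector_derivative h' (s - u)) (at (s - u))" by (rule h)
          then show ?thesis by (simp only: has_vector_derivative_iff_quotient)
        qed
        then have "(\<lambda>i. (h (x i - u) - h (s - u)) /\<^sub>R ((x i - u) - (s - u))) \<longlonglongrightarrow> h' (s - u)"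
        proof (rule filterlim_compose)
          show "filterlim (\<lambda>i. x i - u) (at (s - u)) sequentially"
            using xs by (intro filterlim_atI tendsto_intros x) auto
        qed
        then show "(\<lambda>i. (h (x i - u) - h (s - u)) /\<^sub>R (x i - s)) \<longlonglongrightarrow> h' (s - u)" by simp
      qed
      show "AE u in lborel. norm (?k i u) \<le> \<bar>\<gamma> u\<bar> * N'" for i
      proof (intro AE_I2)
        fix u
        have "norm ((h (x i - u) - h (s - u)) /\<^sub>R (x i - s)) \<le> N'"
          using lip[of "x i - u" "s - u"] xs[of i] by (simp add: divide_simps mult.commute)
        then show "norm (?k i u) \<le> \<bar>\<gamma> u\<bar> * N'"
          unfolding norm_scaleR[of "\<gamma> u"] by (rule mult_left_mono) auto
      qed
    qed (use \<gamma> in auto)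
    moreover have "(LINT u|lborel. ?k i u) = (?F (x i) - ?F s) /\<^sub>R (x i - s)" for i
    proof -
      have "?k i = (\<lambda>u. (\<gamma> u *\<^sub>R h (x i - u) - \<gamma> u *\<^sub>R h (s - u)) /\<^sub>R (x i - s))"
        by (auto simp: scaleR_diff_right mult.commute)
      then show ?thesis
        unfolding conv_def using conv_integrable[OF hc h(2)] by simp
    qed
    ultimately show "((\<lambda>y. (?F y - ?F s) /\<^sub>R (y - s)) \<circ> x) \<longlonglongrightarrow> ?G s"
      by (simp add: o_def conv_def)
  qed
  then show ?thesis by (simp only: has_vector_derivative_iff_quotient)
qed

lemma Ck_conv:
  assumes "Ck k h" "vanishes_beyond L h"
  shows "Ck k (conv \<gamma> h)"
  using assms
proof (induction k arbitrary: h)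
  case 0
  then show ?case using vanishes_beyond_bounded[of h L] continuous_conv[of h] by (metis Ck.simps(1))
next
  case (Suc k)
  from Ck_Suc_vecE[OF Suc.prems(1)] obtain h' where
    h': "\<And>x. (h has_vector_derivative h' x) (at x)" "Ck k h'" by metis
  have v': "vanishes_beyond L h'" by (rule vanishes_beyond_derivative[OF Suc.prems(2) h'(1)])
  obtain N where N: "\<And>t. norm (h t) \<le> N"
    using vanishes_beyond_bounded[OF Ck_imp_continuous[OF Suc.prems(1)] Suc.prems(2)] by metis
  obtain N' where N': "\<And>t. norm (h' t) \<le> N'"
    using vanishes_beyond_bounded[OF Ck_imp_continuous[OF h'(2)] v'] by metis
  show ?case
    by (rule Ck_Suc_vec[OF conv_has_vector_derivative[OF h'(1) N Ck_imp_continuous[OF h'(2)] N']])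
      (rule Suc.IH[OF h'(2) v'])
qed

end

section \<open>Smooth solutions of a contractive integral equation\<close>

text \<open>
  The error of the derivatives of the iterates obeys such a recursion: a contraction, plus the
  geometrically small error of the iterates themselves.
\<close>

lemma affine_recursion_tendsto_zero:
  fixes e :: "nat \<Rightarrow> real"
  assumes "0 \<le> \<theta>" "\<theta> < 1" "0 \<le> K" "\<And>m. 0 \<le> e m" "\<And>m. e (Suc m) \<le> \<theta> * e m + K * \<theta> ^ m"
  shows "e \<longlonglongrightarrow> 0"
proof -
  define \<rho> where "\<rho> = (1 + \<theta>) / 2"
  have \<rho>: "\<theta> < \<rho>" "\<rho> < 1" "0 < \<rho>" using assms by (auto simp: \<rho>_def)
  define C where "C = max (e 0) (K / (\<rho> - \<theta>))"
  have C: "K \<le> C * (\<rho> - \<theta>)" "0 \<le> C"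
    using \<rho> assms(3) assms(4)[of 0] by (auto simp: C_def field_simps max_def)
  have "e m \<le> C * \<rho> ^ m" for m
  proof (induction m)
    case 0 show ?case by (simp add: C_def)
  next
    case (Suc m)
    have "e (Suc m) \<le> \<theta> * (C * \<rho> ^ m) + K * \<rho> ^ m"
      using assms(5)[of m] mult_left_mono[OF Suc assms(1)] mult_left_mono[OF power_mono[of \<theta> \<rho> m] assms(3)] \<rho> assms(1) by linarith
    also have "\<dots> = (\<theta> * C + K) * \<rho> ^ m" by (simp add: algebra_simps)
    also have "\<dots> \<le> (C * \<rho>) * \<rho> ^ m" using C \<rho> by (intro mult_right_mono) (auto simp: algebra_simps)
    finally show ?case by simp
  qed
  moreover have "(\<lambda>m. C * \<rho> ^ m) \<longlonglongrightarrow> C * 0" by (intro tendsto_intros LIMSEQ_realpow_zero) (use \<rho> in auto)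
  ultimately show ?thesis
    by (intro tendsto_sandwich[of "\<lambda>_. 0" e sequentially "\<lambda>m. C * \<rho> ^ m" 0]) (use assms(4) in auto)
qed

text \<open>
  The operators \<open>g \<mapsto> A (\<gamma> * (q g)) + B \<integral> r g\<close>, a convolution between two cut-offs plus a term of
  rank one, that shrink the supremum norm. This class is closed under the formal differentiation of
  the equation \<open>f = T f + b\<close>: the new terms have the same shape and only enter the source.
\<close>

locale contraction_operator =
  fixes \<gamma> :: "real \<Rightarrow> real" and A B q r :: "real \<Rightarrow> complex" and L \<theta> :: real
  assumes \<gamma>: "integrable lborel \<gamma>"
    and smooth: "\<And>k. Ck k A" "\<And>k. Ck k B" "\<And>k. Ck k q" "\<And>k. Ck k r"
    and vanish: "vanishes_beyond L A" "vanishes_beyond L B" "vanishes_beyond L q" "vanishes_beyond L r"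
    and \<theta>: "0 \<le> \<theta>" "\<theta> < 1"
    and contr: "\<And>g N s. continuous_on UNIV g \<Longrightarrow> (\<And>t. norm (g t) \<le> N) \<Longrightarrow>
      norm (A s * conv \<gamma> (\<lambda>t. q t * g t) s + B s * (LINT t|lborel. r t * g t)) \<le> \<theta> * N"
begin

definition T :: "(real \<Rightarrow> complex) \<Rightarrow> real \<Rightarrow> complex" where
  "T g s = A s * conv \<gamma> (\<lambda>t. q t * g t) s + B s * (LINT t|lborel. r t * g t)"

lemma T_bound:
  "continuous_on UNIV g \<Longrightarrow> (\<And>t. norm (g t) \<le> N) \<Longrightarrow> norm (T g s) \<le> \<theta> * N"
  unfolding T_def by (rule contr)

lemma mult_bounded:
  fixes p :: "real \<Rightarrow> complex"
  assumes "continuous_on UNIV p" "vanishes_beyond L p"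
  obtains M where "0 \<le> M" "\<And>g N t. norm (g t) \<le> N \<Longrightarrow> norm (p t * g t :: complex) \<le> M * N"
proof -
  obtain M where M: "0 \<le> M" "\<And>t. norm (p t) \<le> M" using vanishes_beyond_bounded[OF assms] by metis
  show thesis
    by (rule that[OF M(1)]) (auto simp: norm_mult intro!: mult_mono M)
qed

lemma conv_mult_cont:
  assumes "continuous_on UNIV p" "vanishes_beyond L p" "continuous_on UNIV g"
  shows "continuous_on UNIV (conv \<gamma> (\<lambda>t. p t * g t))"
proof -
  obtain N where "\<And>t. norm (p t * g t) \<le> N"
    using vanishes_beyond_bounded[of "\<lambda>t. p t * g t" L] assms
    by (auto intro: vanishes_beyond_mult continuous_intros)
  then show ?thesis using assms by (intro continuous_conv[OF \<gamma>]) (auto intro: continuous_intros)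
qed

lemma conv_mult_diff:
  assumes "continuous_on UNIV p" "vanishes_beyond L p" "continuous_on UNIV g" "continuous_on UNIV h"
  shows "conv \<gamma> (\<lambda>t. p t * (g t - h t)) s = conv \<gamma> (\<lambda>t. p t * g t) s - conv \<gamma> (\<lambda>t. p t * h t) s"
proof -
  obtain N where "\<And>t. norm (p t * g t) \<le> N"
    using vanishes_beyond_bounded[of "\<lambda>t. p t * g t" L] assms
    by (auto intro: vanishes_beyond_mult continuous_intros)
  moreover obtain N' where "\<And>t. norm (p t * h t) \<le> N'"
    using vanishes_beyond_bounded[of "\<lambda>t. p t * h t" L] assms
    by (auto intro: vanishes_beyond_mult continuous_intros)
  ultimately show ?thesis unfolding right_diff_distrib
    using assms by (intro conv_diff[OF \<gamma>]) (auto intro: continuous_intros)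
qed

lemma int_mult_diff:
  assumes "continuous_on UNIV p" "vanishes_beyond L p" "continuous_on UNIV g" "continuous_on UNIV h"
  shows "(LINT t|lborel. p t * (g t - h t)) = (LINT t|lborel. p t * g t) - (LINT t|lborel. p t * (h t :: complex))"
  unfolding right_diff_distrib
  by (intro Bochner_Integration.integral_diff integrable_vanishing_mult[of _ L] assms)

lemma conv_mult_bound:
  assumes "continuous_on UNIV p" "vanishes_beyond L p"
  obtains M where "0 \<le> M"
    "\<And>g N s. continuous_on UNIV g \<Longrightarrow> (\<And>t. norm (g t) \<le> N) \<Longrightarrow> norm (conv \<gamma> (\<lambda>t. p t * g t) s) \<le> M * N"
proof -
  obtain M where M: "0 \<le> M" "\<And>g N t. norm (g t) \<le> N \<Longrightarrow> norm (p t * g t :: complex) \<le> M * N"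
    using mult_bounded[OF assms] by metis
  show thesis
  proof (rule that[of "(LINT u|lborel. \<bar>\<gamma> u\<bar>) * M"])
    fix g :: "real \<Rightarrow> complex" and N s assume g: "continuous_on UNIV g" "\<And>t. norm (g t) \<le> N"
    have "norm (conv \<gamma> (\<lambda>t. p t * g t) s) \<le> (LINT u|lborel. \<bar>\<gamma> u\<bar>) * (M * N)"
      by (rule conv_bound[OF \<gamma>]) (use assms g M in \<open>auto intro: continuous_intros\<close>)
    then show "norm (conv \<gamma> (\<lambda>t. p t * g t) s) \<le> (LINT u|lborel. \<bar>\<gamma> u\<bar>) * M * N" by (simp add: mult.assoc)
  qed (use M in \<open>auto intro!: mult_nonneg_nonneg integral_nonneg_AE\<close>)
qed

lemma int_mult_bound:
  assumes "continuous_on UNIV p" "vanishes_beyond L p"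
  obtains M where "0 \<le> M"
    "\<And>g N. continuous_on UNIV g \<Longrightarrow> (\<And>t. norm (g t :: complex) \<le> N) \<Longrightarrow> norm (LINT t|lborel. p t * g t) \<le> M * N"
proof (rule that[of "LINT t|lborel. norm (p t)"])
  fix g :: "real \<Rightarrow> complex" and N assume g: "continuous_on UNIV g" "\<And>t. norm (g t) \<le> N"
  have i: "integrable lborel p"
    using integrable_vanishing_mult[OF assms continuous_on_const[of _ 1]] by simp
  have "norm (LINT t|lborel. p t * g t) \<le> (LINT t|lborel. norm (p t * g t))" by (rule integral_norm_bound)
  also have "\<dots> \<le> (LINT t|lborel. norm (p t) * N)"
    using g by (intro integral_mono integrable_norm integrable_vanishing_mult[OF assms g(1)])
      (auto simp: norm_mult intro!: mult_left_mono i integrable_mult_left)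
  finally show "norm (LINT t|lborel. p t * g t) \<le> (LINT t|lborel. norm (p t)) * N" by simp
qed simp

lemma T_cont: "continuous_on UNIV g \<Longrightarrow> continuous_on UNIV (T g)"
  unfolding T_def[abs_def]
  by (intro continuous_intros conv_mult_cont Ck_imp_continuous[OF smooth(1)] Ck_imp_continuous[OF smooth(2)]
    Ck_imp_continuous[OF smooth(3)] vanish)

lemma T_diff:
  assumes "continuous_on UNIV g" "continuous_on UNIV h"
  shows "T (\<lambda>t. g t - h t) s = T g s - T h s"
  unfolding T_def conv_mult_diff[OF Ck_imp_continuous[OF smooth(3)] vanish(3) assms]
    int_mult_diff[OF Ck_imp_continuous[OF smooth(4)] vanish(4) assms]
  by (simp add: algebra_simps)

lemma solution_exists:
  assumes "continuous_on UNIV b" "\<And>t. norm (b t) \<le> N"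
  obtains f where "continuous_on UNIV f" "bounded (range f)" "\<And>s. f s = T f s + b s"
proof -
  have mem: "(\<lambda>s. T (apply_bcontfun g) s + b s) \<in> bcontfun" for g
  proof (rule bcontfun_normI)
    show "continuous_on UNIV (\<lambda>s. T (apply_bcontfun g) s + b s)"
      by (intro continuous_intros T_cont assms) auto
    show "norm (T (apply_bcontfun g) s + b s) \<le> \<theta> * norm g + N" for s
      by (intro norm_triangle_mono T_bound assms norm_bounded) auto
  qed
  define \<Phi> where "\<Phi> g = Bcontfun (\<lambda>s. T (apply_bcontfun g) s + b s)" for g
  have app: "apply_bcontfun (\<Phi> g) s = T (apply_bcontfun g) s + b s" for g s
    unfolding \<Phi>_def using mem by (simp add: Bcontfun_inverse)
  have "dist (\<Phi> g) (\<Phi> h) \<le> \<theta> * dist g h" for g h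
  proof (rule dist_bound)
    fix s
    have "dist (\<Phi> g s) (\<Phi> h s) = norm (T (\<lambda>t. g t - h t) s)"
      by (subst T_diff) (auto simp: app dist_norm)
    also have "\<dots> \<le> \<theta> * dist g h"
      by (rule T_bound) (auto intro!: continuous_intros simp: dist_bounded simp flip: dist_norm)
    finally show "dist (\<Phi> g s) (\<Phi> h s) \<le> \<theta> * dist g h" .
  qed
  then obtain f where f: "\<Phi> f = f" using banach_fix_type[of \<theta> \<Phi>] \<theta> by auto
  show thesis
  proof (rule that[of "apply_bcontfun f"])
    show "bounded (range (apply_bcontfun f))"
      using norm_bounded[of f] by (auto simp: bounded_iff)
    show "continuous_on UNIV (apply_bcontfun f)" by (rule continuous_on_apply_bcontfun)
    show "apply_bcontfun f s = T (apply_bcontfun f) s + b s" for s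
      using app[of f s] unfolding f .
  qed
qed

text \<open>
  An approximate fixed point of the homogeneous equation is small; applied to differences, this gives
  the dependence of the solution on parameters.
\<close>

lemma solution_bound:
  assumes "continuous_on UNIV f" "bounded (range f)" "\<And>s. norm (f s - T f s) \<le> e"
  shows "norm (f s) \<le> e / (1 - \<theta>)"
proof -
  define M where "M = (SUP t. norm (f t))"
  have bdd: "bdd_above (range (\<lambda>t. norm (f t)))"
    using assms(2) by (auto simp: bounded_iff bdd_above_def)
  have M: "norm (f t) \<le> M" for t unfolding M_def by (intro cSUP_upper bdd) auto
  have "norm (f t) \<le> \<theta> * M + e" for t
    using T_bound[OF assms(1) M, of t] assms(3)[of t] norm_triangle_ineq[of "T f t" "f t - T f t"] by simp
  then have "M \<le> \<theta> * M + e" unfolding M_def[symmetric]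
    by (subst M_def) (intro cSUP_least, auto)
  then have "M \<le> e / (1 - \<theta>)" using \<theta> by (simp add: field_simps)
  then show ?thesis using M[of s] by simp
qed

text \<open>
  Differentiating \<open>f = T f + b\<close> formally and integrating by parts in the rank-one term gives
  \<open>f' = T f' + b1 f\<close>, where \<open>b1 f\<close> contains \<open>f\<close> but no derivative of it. So \<open>f'\<close> should be the
  solution \<open>g\<close> of \<open>g = T g + b1 f\<close>, which exists because \<open>T\<close> is a contraction. That \<open>g\<close> is the
  derivative follows by approximation: the iterates \<open>F m\<close> of \<open>w \<mapsto> T w + b\<close> from \<open>0\<close> are
  differentiable, they tend to \<open>f\<close>, and their derivatives \<open>F' m\<close> obey the corresponding recursion and
  tend to \<open>g\<close> uniformly. Induction on \<open>k\<close> then applies to the equation for \<open>g\<close>.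
\<close>

lemma solution_Ck:
  assumes "Ck k b" "vanishes_beyond L b"
    and "continuous_on UNIV f" "bounded (range f)" "\<And>s. f s = T f s + b s"
  shows "Ck k f"
proof -
  have "\<forall>s. f s = T f s + b s" using assms(5) by blast
  with assms(1-4) show ?thesis
proof (induction k arbitrary: f b)
  case 0
  show ?case using 0(3) by simp
next
  case (Suc k)
  obtain A' where A': "\<And>x. (A has_vector_derivative A' x) (at x)" "Ck k A'"
    by (rule Ck_Suc_vecE[OF smooth(1)[of "Suc k"]]) blast
  obtain B' where B': "\<And>x. (B has_vector_derivative B' x) (at x)" "Ck k B'"
    by (rule Ck_Suc_vecE[OF smooth(2)[of "Suc k"]]) blast
  obtain q' where q': "\<And>x. (q has_vector_derivative q' x) (at x)" "Ck k q'"
    by (rule Ck_Suc_vecE[OF smooth(3)[of "Suc k"]]) blast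
  obtain r' where r': "\<And>x. (r has_vector_derivative r' x) (at x)" "Ck k r'"
    by (rule Ck_Suc_vecE[OF smooth(4)[of "Suc k"]]) blast
  obtain b' where b': "\<And>x. (b has_vector_derivative b' x) (at x)" "Ck k b'"
    by (rule Ck_Suc_vecE[OF Suc.prems(1)]) blast
  note f_cont = Suc.prems(3)
  have f_eq: "f s = T f s + b s" for s using Suc.prems(5) by blast
  note v' = vanishes_beyond_derivative[OF vanish(1) A'(1)] vanishes_beyond_derivative[OF vanish(2) B'(1)]
    vanishes_beyond_derivative[OF vanish(3) q'(1)] vanishes_beyond_derivative[OF vanish(4) r'(1)]
    vanishes_beyond_derivative[OF Suc.prems(2) b'(1)]
  note c = Ck_imp_continuous[OF smooth(1)] Ck_imp_continuous[OF smooth(2)] Ck_imp_continuous[OF smooth(3)]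
     Ck_imp_continuous[OF smooth(4)] Ck_imp_continuous[OF Suc.prems(1)]
  note c' = Ck_imp_continuous[OF A'(2)] Ck_imp_continuous[OF B'(2)] Ck_imp_continuous[OF q'(2)]
     Ck_imp_continuous[OF r'(2)] Ck_imp_continuous[OF b'(2)]
  have Ckf: "Ck k f"
    by (rule Suc.IH[OF Ck_SucD[OF Suc.prems(1)] Suc.prems(2-)])
  \<comment> \<open>By parts, the last but one term is \<open>- B \<integral> r w'\<close>. It removes the rank-one term of \<open>T w'\<close>,
      which the derivative of \<open>T w\<close> does not contain.\<close>
  define b1 where "b1 w s = A' s * conv \<gamma> (\<lambda>t. q t * w t) s + A s * conv \<gamma> (\<lambda>t. q' t * w t) s
      + B' s * (LINT t|lborel. r t * w t) + B s * (LINT t|lborel. r' t * w t) + b' s" for w s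
  have b1_cont: "continuous_on UNIV (b1 w)" if "continuous_on UNIV w" for w
    unfolding b1_def[abs_def]
    by (intro continuous_intros conv_mult_cont c c' that vanish v')
  have b1_v: "vanishes_beyond L (b1 w)" for w
    unfolding b1_def[abs_def] by (intro vanishes_beyond_add vanishes_beyond_mult(1) vanish v')
  have b1_Ck: "Ck k (b1 f)"
    unfolding b1_def[abs_def]
    by (intro Ck_add Ck_mult Ck_conv[OF \<gamma>, of k _ L] Ck_const A' B' q' r' b' smooth Ckf vanishes_beyond_mult(1) vanish v')
  have b1_diff: "\<exists>K\<ge>0. \<forall>w e s. continuous_on UNIV w \<longrightarrow> (\<forall>t. norm (w t - f t) \<le> e) \<longrightarrow> norm (b1 w s - b1 f s) \<le> K * e"
  proof -
    obtain MA where MA: "0 \<le> MA" "\<And>s. norm (A s) \<le> MA" using vanishes_beyond_bounded[OF c(1) vanish(1)] by metis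
    obtain MA' where MA': "0 \<le> MA'" "\<And>s. norm (A' s) \<le> MA'" using vanishes_beyond_bounded[OF c'(1) v'(1)] by metis
    obtain MB where MB: "0 \<le> MB" "\<And>s. norm (B s) \<le> MB" using vanishes_beyond_bounded[OF c(2) vanish(2)] by metis
    obtain MB' where MB': "0 \<le> MB'" "\<And>s. norm (B' s) \<le> MB'" using vanishes_beyond_bounded[OF c'(2) v'(2)] by metis
    obtain m1 where m1: "0 \<le> m1" "\<And>g N s. continuous_on UNIV g \<Longrightarrow> (\<And>t. norm (g t) \<le> N) \<Longrightarrow> norm (conv \<gamma> (\<lambda>t. q t * g t) s) \<le> m1 * N"
      using conv_mult_bound[OF c(3) vanish(3)] by metis
    obtain m2 where m2: "0 \<le> m2" "\<And>g N s. continuous_on UNIV g \<Longrightarrow> (\<And>t. norm (g t) \<le> N) \<Longrightarrow> norm (conv \<gamma> (\<lambda>t. q' t * g t) s) \<le> m2 * N"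
      using conv_mult_bound[OF c'(3) v'(3)] by metis
    obtain m3 where m3: "0 \<le> m3" "\<And>g N. continuous_on UNIV g \<Longrightarrow> (\<And>t. norm (g t :: complex) \<le> N) \<Longrightarrow> norm (LINT t|lborel. r t * g t) \<le> m3 * N"
      using int_mult_bound[OF c(4) vanish(4)] by metis
    obtain m4 where m4: "0 \<le> m4" "\<And>g N. continuous_on UNIV g \<Longrightarrow> (\<And>t. norm (g t :: complex) \<le> N) \<Longrightarrow> norm (LINT t|lborel. r' t * g t) \<le> m4 * N"
      using int_mult_bound[OF c'(4) v'(4)] by metis
    show ?thesis
    proof (intro exI[of _ "MA' * m1 + MA * m2 + MB' * m3 + MB * m4"] conjI allI impI)
      show "0 \<le> MA' * m1 + MA * m2 + MB' * m3 + MB * m4"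
        by (intro add_nonneg_nonneg mult_nonneg_nonneg MA MA' MB MB' m1 m2 m3 m4)
      fix w e s assume w: "continuous_on UNIV w" "\<forall>t. norm (w t - f t) \<le> (e::real)"
      have d: "continuous_on UNIV (\<lambda>t. w t - f t)" by (intro continuous_intros w Suc.prems)
      have w2: "\<And>t. norm (w t - f t) \<le> e" using w by auto
      have e: "b1 w s - b1 f s = A' s * conv \<gamma> (\<lambda>t. q t * (w t - f t)) s + A s * conv \<gamma> (\<lambda>t. q' t * (w t - f t)) s
        + B' s * (LINT t|lborel. r t * (w t - f t)) + B s * (LINT t|lborel. r' t * (w t - f t))"
        unfolding b1_def conv_mult_diff[OF c(3) vanish(3) w(1) f_cont] conv_mult_diff[OF c'(3) v'(3) w(1) f_cont]
          int_mult_diff[OF c(4) vanish(4) w(1) f_cont] int_mult_diff[OF c'(4) v'(4) w(1) f_cont]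
        by (simp add: algebra_simps)
      have "norm (b1 w s - b1 f s) \<le> MA' * (m1 * e) + MA * (m2 * e) + MB' * (m3 * e) + MB * (m4 * e)"
        unfolding e by (intro norm_triangle_mono)
         (auto simp: norm_mult intro!: mult_mono MA MA' MB MB' m1 m2 m3 m4 d w2)
      then show "norm (b1 w s - b1 f s) \<le> (MA' * m1 + MA * m2 + MB' * m3 + MB * m4) * e"
        by (simp add: algebra_simps)
    qed
  qed
  then obtain K where K: "K \<ge> 0" "\<And>w e s. continuous_on UNIV w \<Longrightarrow> (\<And>t. norm (w t - f t) \<le> e) \<Longrightarrow> norm (b1 w s - b1 f s) \<le> K * e"
    by metis
  obtain N1 where "\<And>t. norm (b1 f t) \<le> N1"
    using vanishes_beyond_bounded[OF b1_cont[OF f_cont] b1_v] by metis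
  then obtain g where g: "continuous_on UNIV g" "bounded (range g)" "\<And>s. g s = T g s + b1 f s"
    using solution_exists[OF b1_cont[OF f_cont]] by metis
  have Ckg: "Ck k g" by (rule Suc.IH[OF b1_Ck b1_v g(1) g(2)]) (use g(3) in blast)
  define F where "F = rec_nat (\<lambda>_. 0) (\<lambda>m w s. T w s + b s)"
  have F: "F 0 = (\<lambda>_. 0)" "F (Suc m) = (\<lambda>s. T (F m) s + b s)" for m by (auto simp: F_def)
  define F' where "F' = rec_nat (\<lambda>_. 0) (\<lambda>m w s. T w s + b1 (F m) s)"
  have F': "F' 0 = (\<lambda>_. 0)" "F' (Suc m) = (\<lambda>s. T (F' m) s + b1 (F m) s)" for m by (auto simp: F'_def)
  have cF: "continuous_on UNIV (F m)" for m
    by (induction m) (auto simp: F intro!: continuous_intros T_cont c)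
  have cF': "continuous_on UNIV (F' m)" for m
    by (induction m) (auto simp: F' intro!: continuous_intros T_cont c b1_cont cF)
  have dF: "(F m has_vector_derivative F' m s) (at s)" for m s
  proof (induction m arbitrary: s)
    case 0 then show ?case by (simp add: F F')
  next
    case (Suc m)
    let ?w = "F m" and ?w' = "F' m"
    have dq: "((\<lambda>t. q t * ?w t) has_vector_derivative q t * ?w' t + q' t * ?w t) (at t)" for t
      by (rule has_vector_derivative_mult[OF q'(1) Suc])
    have vq: "vanishes_beyond L (\<lambda>t. q t * ?w t)" by (intro vanishes_beyond_mult vanish)
    have vq': "vanishes_beyond L (\<lambda>t. q t * ?w' t + q' t * ?w t)"
      by (intro vanishes_beyond_add vanishes_beyond_mult(1) vanish v')
    have cq: "continuous_on UNIV (\<lambda>t. q t * ?w t)" "continuous_on UNIV (\<lambda>t. q t * ?w' t + q' t * ?w t)"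
      by (intro continuous_intros c c' cF cF')+
    obtain M1 where M1: "\<And>t. norm (q t * ?w t) \<le> M1" using vanishes_beyond_bounded[OF cq(1) vq] by metis
    obtain M2 where M2: "\<And>t. norm (q t * ?w' t + q' t * ?w t) \<le> M2" using vanishes_beyond_bounded[OF cq(2) vq'] by metis
    have v1: "vanishes_beyond L (\<lambda>t. q t * ?w' t)" "vanishes_beyond L (\<lambda>t. q' t * ?w t)"
      by (intro vanishes_beyond_mult(1) vanish v')+
    have c1: "continuous_on UNIV (\<lambda>t. q t * ?w' t)" "continuous_on UNIV (\<lambda>t. q' t * ?w t)"
      by (intro continuous_intros c c' cF cF')+
    obtain M3 where M3: "\<And>t. norm (q t * ?w' t) \<le> M3" using vanishes_beyond_bounded[OF c1(1) v1(1)] by metis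
    obtain M4 where M4: "\<And>t. norm (q' t * ?w t) \<le> M4" using vanishes_beyond_bounded[OF c1(2) v1(2)] by metis
    have dc: "(conv \<gamma> (\<lambda>t. q t * ?w t) has_vector_derivative
       conv \<gamma> (\<lambda>t. q t * ?w' t) s + conv \<gamma> (\<lambda>t. q' t * ?w t) s) (at s)"
      using conv_has_vector_derivative[OF \<gamma> dq M1 cq(2) M2]
      unfolding conv_add[OF \<gamma> c1(1) M3 c1(2) M4] .
    have ibp: "(LINT t|lborel. r t * ?w' t) + (LINT t|lborel. r' t * ?w t) = 0"
    proof -
      let ?h = "\<lambda>t. r t * ?w' t + r' t * ?w t"
      have d: "((\<lambda>t. r t * ?w t) has_vector_derivative ?h t) (at t)" for t
        by (rule has_vector_derivative_mult[OF r'(1) Suc])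
      have ch: "continuous_on UNIV ?h" by (intro continuous_intros c c' cF cF')
      have "(LINT t|lborel. indicator {-L-1..L+1} t *\<^sub>R ?h t) = r (L+1) * ?w (L+1) - r (-L-1) * ?w (-L-1)"
        if "L \<ge> 0"
        by (intro integral_FTC_Icc) (use that d ch in \<open>auto intro: has_vector_derivative_at_within continuous_on_subset\<close>)
      moreover have "(\<lambda>t. indicator {-L-1..L+1} t *\<^sub>R ?h t) = ?h" if "L \<ge> 0"
        using vanish(4) v'(4) by (auto simp: vanishes_beyond_def indicator_def fun_eq_iff)
      moreover have "?h t = 0" if "L < 0" for t
        using vanish(4) v'(4) that by (auto simp: vanishes_beyond_def)
      moreover have "L \<ge> 0 \<Longrightarrow> r (L+1) = 0" "L \<ge> 0 \<Longrightarrow> r (-L-1) = 0" using vanish(4) by (auto simp: vanishes_beyond_def)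
      ultimately have "(LINT t|lborel. ?h t) = 0" by (cases "L \<ge> 0") auto
      moreover have "(LINT t|lborel. ?h t) = (LINT t|lborel. r t * ?w' t) + (LINT t|lborel. r' t * ?w t)"
        by (intro Bochner_Integration.integral_add integrable_vanishing_mult[of _ L] c c' cF cF' vanish v')
      ultimately show ?thesis by simp
    qed
    have "((\<lambda>s. T ?w s + b s) has_vector_derivative
      (A s * (conv \<gamma> (\<lambda>t. q t * ?w' t) s + conv \<gamma> (\<lambda>t. q' t * ?w t) s) + A' s * conv \<gamma> (\<lambda>t. q t * ?w t) s)
       + B' s * (LINT t|lborel. r t * ?w t) + b' s) (at s)"
      unfolding T_def
      by (intro has_vector_derivative_add has_vector_derivative_mult has_vector_derivative_mult_left A' B' b' dc)
    also have "(A s * (conv \<gamma> (\<lambda>t. q t * ?w' t) s + conv \<gamma> (\<lambda>t. q' t * ?w t) s) + A' s * conv \<gamma> (\<lambda>t. q t * ?w t) s)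
       + B' s * (LINT t|lborel. r t * ?w t) + b' s = T ?w' s + b1 ?w s"
    proof -
      have "(LINT t|lborel. r' t * ?w t) = - (LINT t|lborel. r t * ?w' t)" using ibp by (simp add: eq_neg_iff_add_eq_0 add.commute)
      then show ?thesis unfolding T_def b1_def by (simp add: algebra_simps)
    qed
    finally show ?case by (simp add: F F')
  qed
  obtain Nf where Nf: "\<And>t. norm (f t) \<le> Nf" using Suc.prems(4) by (auto simp: bounded_iff)
  obtain Ng where Ng: "\<And>t. norm (g t) \<le> Ng" using g(2) by (auto simp: bounded_iff)
  have Nf0: "0 \<le> Nf" "0 \<le> Ng" using order_trans[OF norm_ge_zero Nf] order_trans[OF norm_ge_zero Ng] by auto
  have Ff: "norm (F m t - f t) \<le> Nf * \<theta> ^ m" for m t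
  proof (induction m arbitrary: t)
    case 0 then show ?case using Nf by (simp add: F)
  next
    case (Suc m)
    have "F (Suc m) t - f t = T (\<lambda>t. F m t - f t) t"
      unfolding T_diff[OF cF f_cont] F by (subst f_eq) simp
    also have "norm \<dots> \<le> \<theta> * (Nf * \<theta> ^ m)"
      by (rule T_bound) (intro continuous_intros cF f_cont, rule Suc)
    finally show ?case by (simp add: mult_ac)
  qed
  define e where "e = rec_nat Ng (\<lambda>m x. \<theta> * x + K * Nf * \<theta> ^ m)"
  have e: "e 0 = Ng" "e (Suc m) = \<theta> * e m + K * Nf * \<theta> ^ m" for m by (auto simp: e_def)
  have e0: "0 \<le> e m" for m by (induction m) (use K Nf0 \<theta> in \<open>auto simp: e\<close>)
  have Fg: "norm (F' m t - g t) \<le> e m" for m t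
  proof (induction m arbitrary: t)
    case 0 then show ?case using Ng by (simp add: F' e)
  next
    case (Suc m)
    have "F' (Suc m) t - g t = T (\<lambda>t. F' m t - g t) t + (b1 (F m) t - b1 f t)"
      unfolding T_diff[OF cF' g(1)] F' by (subst g(3)) simp
    also have "norm \<dots> \<le> \<theta> * e m + K * (Nf * \<theta> ^ m)"
      by (intro norm_triangle_mono T_bound K continuous_intros cF cF' g Ff Suc)
    finally show ?case by (simp add: e mult_ac)
  qed
  have elim: "e \<longlonglongrightarrow> 0"
    by (rule affine_recursion_tendsto_zero[OF \<theta>, of "K * Nf"]) (use K Nf0 e0 e in auto)
  have "\<exists>h. \<forall>x\<in>UNIV. (\<lambda>m. F m x) \<longlonglongrightarrow> h x \<and> (h has_derivative (\<lambda>v. v *\<^sub>R g x)) (at x within UNIV)"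
  proof (rule has_derivative_sequence[where f' = "\<lambda>m x v. v *\<^sub>R F' m x" and ?x0.0 = 0 and l = "f 0"])
    show "(F m has_derivative (\<lambda>v. v *\<^sub>R F' m x)) (at x within UNIV)" for m x
      using dF by (simp add: has_vector_derivative_def)
    show "\<forall>\<^sub>F m in sequentially. \<forall>x\<in>UNIV. \<forall>h. norm (h *\<^sub>R F' m x - h *\<^sub>R g x) \<le> \<epsilon> * norm h" if "\<epsilon> > 0" for \<epsilon> :: real
      using order_tendstoD(2)[OF elim that]
    proof eventually_elim
      case (elim m)
      show ?case
      proof (intro ballI allI)
        fix x h :: real
        have "norm (h *\<^sub>R F' m x - h *\<^sub>R g x) = \<bar>h\<bar> * norm (F' m x - g x)"
          by (simp flip: scaleR_diff_right)
        also have "\<dots> \<le> \<bar>h\<bar> * \<epsilon>" using Fg[of m x] elim by (intro mult_left_mono) auto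
        finally show "norm (h *\<^sub>R F' m x - h *\<^sub>R g x) \<le> \<epsilon> * norm h" by (simp add: mult.commute)
      qed
    qed
    show "(\<lambda>m. F m 0) \<longlonglongrightarrow> f 0"
    proof (rule LIM_zero_cancel, rule tendsto_norm_zero_cancel, rule tendsto_sandwich[of "\<lambda>_. 0" _ _ "\<lambda>m. Nf * \<theta> ^ m"])
      have "(\<lambda>m. Nf * \<theta> ^ m) \<longlonglongrightarrow> Nf * 0" by (intro tendsto_intros LIMSEQ_realpow_zero \<theta>)
      then show "(\<lambda>m. Nf * \<theta> ^ m) \<longlonglongrightarrow> 0" by simp
    qed (use Ff in auto)
  qed auto
  then obtain h where h: "\<And>x. (\<lambda>m. F m x) \<longlonglongrightarrow> h x" "\<And>x. (h has_vector_derivative g x) (at x)"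
    by (auto simp: has_vector_derivative_def)
  have "(\<lambda>m. F m x) \<longlonglongrightarrow> f x" for x
  proof (rule LIM_zero_cancel, rule tendsto_norm_zero_cancel, rule tendsto_sandwich[of "\<lambda>_. 0" _ _ "\<lambda>m. Nf * \<theta> ^ m"])
    have "(\<lambda>m. Nf * \<theta> ^ m) \<longlonglongrightarrow> Nf * 0" by (intro tendsto_intros LIMSEQ_realpow_zero \<theta>)
    then show "(\<lambda>m. Nf * \<theta> ^ m) \<longlonglongrightarrow> 0" by simp
  qed (use Ff in auto)
  then have "h = f" using h(1) LIMSEQ_unique by blast
  then show ?case using Ck_Suc_vec[OF h(2) Ckg] by simp
qed
qed

end

section \<open>The eigenvalue problem for two thin bumps\<close>

text \<open>
  Evaluating the hypothesis near a point where \<open>norm (f s)\<close> is almost maximal cancels the weight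
  \<open>M\<close> and leaves only the margin \<open>\<delta>\<close>. The bound is independent of the size of \<open>M\<close>, which matters
  because the self-interaction of a bump need not stay bounded when its width shrinks.
\<close>

lemma weighted_maximum_principle:
  fixes f :: "'a \<Rightarrow> complex" and M :: "'a \<Rightarrow> real"
  assumes bdd: "\<And>s. s \<in> S \<Longrightarrow> norm (f s) \<le> N0" and \<delta>: "0 < \<delta>" and e: "0 \<le> e"
    and M: "\<And>s. s \<in> S \<Longrightarrow> 0 \<le> M s" "\<And>s. s \<in> S \<Longrightarrow> M s \<le> Mmax"
    and step: "\<And>N s. (\<And>t. t \<in> S \<Longrightarrow> norm (f t) \<le> N) \<Longrightarrow> s \<in> S \<Longrightarrow> norm (f s) * (M s + \<delta>) \<le> M s * N + e"
    and s: "s \<in> S"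
  shows "norm (f s) \<le> e / \<delta>"
proof -
  define N where "N = (SUP t\<in>S. norm (f t))"
  have b: "bdd_above ((\<lambda>t. norm (f t)) ` S)" using bdd by (auto simp: bdd_above_def)
  have N: "norm (f t) \<le> N" if "t \<in> S" for t unfolding N_def by (rule cSUP_upper[OF that b])
  have "\<delta> * N \<le> e"
  proof (rule ccontr)
    assume "\<not> \<delta> * N \<le> e"
    then have pos: "\<delta> * N - e > 0" by simp
    have Mm: "Mmax + \<delta> > 0" using M(1)[OF s] M(2)[OF s] \<delta> by linarith
    have "norm (f t) \<le> N - (\<delta> * N - e) / (Mmax + \<delta>)" if t: "t \<in> S" for t
    proof -
      have p: "0 < M t + \<delta>" using M(1)[OF t] \<delta> by linarith
      have "norm (f t) * (M t + \<delta>) \<le> N * (M t + \<delta>) - (\<delta> * N - e)"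
        using step[OF N t] by (simp add: algebra_simps)
      then have "norm (f t) \<le> (N * (M t + \<delta>) - (\<delta> * N - e)) / (M t + \<delta>)"
        using p by (simp add: pos_le_divide_eq)
      also have "\<dots> = N - (\<delta> * N - e) / (M t + \<delta>)" using p by (simp add: diff_divide_distrib)
      also have "\<dots> \<le> N - (\<delta> * N - e) / (Mmax + \<delta>)"
        using pos p M(2)[OF t] by (intro diff_left_mono divide_left_mono) auto
      finally show ?thesis .
    qed
    then have "N \<le> N - (\<delta> * N - e) / (Mmax + \<delta>)"
      unfolding N_def[symmetric] by (subst N_def) (intro cSUP_least, use s in auto)
    then show False using divide_pos_pos[OF pos Mm] by linarith
  qed
  then have "N \<le> e / \<delta>" using \<delta> by (simp add: field_simps)
  then show ?thesis using N[OF s] by linarith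
qed

lemma conv_flip: "conv \<gamma> h s = (LINT t|lborel. \<gamma> (s - t) *\<^sub>R h t)"
proof -
  have "(LINT t|lborel. \<gamma> (s - t) *\<^sub>R h t) = (LINT u|lborel. \<gamma> (s - (s + (-1) * u)) *\<^sub>R h (s + (-1) * u))"
    using lborel_integral_real_affine[of "-1" "\<lambda>t. \<gamma> (s - t) *\<^sub>R h t" s] by simp
  then show ?thesis by (simp add: conv_def)
qed

lemma conv_flip_integrable:
  fixes h :: "real \<Rightarrow> complex"
  shows "integrable lborel (\<lambda>u. \<gamma> u *\<^sub>R h (s - u)) \<longleftrightarrow> integrable lborel (\<lambda>t. \<gamma> (s - t) *\<^sub>R h t)"
  using lborel_integrable_real_affine_iff[of "-1" "\<lambda>t. \<gamma> (s - t) *\<^sub>R h t" s] by simp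

text \<open>
  The kernel \<open>\<gamma>\<close> stands for \<open>k\<^sub>n\<close>, and \<open>\<chi>1\<close>, \<open>\<chi>2\<close> are cut-offs equal to one on the supports of the
  bumps \<open>\<eta>1\<close>, \<open>\<eta>2\<close>. The numbers \<open>m\<close>, \<open>\<phi>\<close>, \<open>G\<close> are the coefficients of the limit problem, and
  \<open>tol\<close> measures its accuracy: by \<open>near1\<close>, \<open>near2\<close> the function \<open>\<Omega>\<close> is up to \<open>tol\<close> a constant plus
  the self-interaction on the first bump and a constant minus it on the second, and by
  \<open>cross12\<close>, \<open>cross21\<close> the interaction between the bumps is the constant \<open>G\<close> up to \<open>tol\<close>.
\<close>

locale two_bump =
  fixes \<gamma> \<eta>1 \<eta>2 \<chi>1 \<chi>2 \<Omega> :: "real \<Rightarrow> real" and a L m \<phi> G tol :: real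
  assumes \<gamma>: "integrable lborel \<gamma>" "\<And>u. 0 \<le> \<gamma> u"
    and smooth: "\<And>k. Ck k \<eta>1" "\<And>k. Ck k \<eta>2" "\<And>k. Ck k \<chi>1" "\<And>k. Ck k \<chi>2" "\<And>k. Ck k \<Omega>"
    and vanish: "vanishes_beyond L \<eta>1" "vanishes_beyond L \<eta>2" "vanishes_beyond L \<chi>1" "vanishes_beyond L \<chi>2"
    and nonneg: "\<And>t. 0 \<le> \<eta>1 t" "\<And>t. 0 \<le> \<eta>2 t" "\<And>t. 0 \<le> \<chi>1 t" "\<And>t. 0 \<le> \<chi>2 t"
    and le1: "\<And>t. \<chi>1 t \<le> 1" "\<And>t. \<chi>2 t \<le> 1"
    and one: "\<And>t. \<eta>1 t \<noteq> 0 \<Longrightarrow> \<chi>1 t = 1" "\<And>t. \<eta>2 t \<noteq> 0 \<Longrightarrow> \<chi>2 t = 1"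
    and disj: "\<And>t. \<chi>1 t = 0 \<or> \<chi>2 t = 0"
    and mass: "(LINT t|lborel. \<eta>1 t) = 1" "(LINT t|lborel. \<eta>2 t) = 1"
    and params: "0 < \<phi>" "\<phi> < G" "0 < tol"
    and near1: "\<And>s. \<chi>1 s \<noteq> 0 \<Longrightarrow> \<bar>\<Omega> s - (LINT t|lborel. exp (- a * s) * exp (- a * t) * \<gamma> (s - t) * \<eta>1 t) - (m + \<phi>)\<bar> \<le> tol"
    and near2: "\<And>s. \<chi>2 s \<noteq> 0 \<Longrightarrow> \<bar>\<Omega> s + (LINT t|lborel. exp (- a * s) * exp (- a * t) * \<gamma> (s - t) * \<eta>2 t) - (m - \<phi>)\<bar> \<le> tol"
    and cross12: "\<And>s t. \<chi>1 s \<noteq> 0 \<Longrightarrow> \<eta>2 t \<noteq> 0 \<Longrightarrow> \<bar>exp (- a * s) * exp (- a * t) * \<gamma> (s - t) - G\<bar> \<le> tol"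
    and cross21: "\<And>s t. \<chi>2 s \<noteq> 0 \<Longrightarrow> \<eta>1 t \<noteq> 0 \<Longrightarrow> \<bar>exp (- a * s) * exp (- a * t) * \<gamma> (s - t) - G\<bar> \<le> tol"
    and tol_small: "tol \<le> 1" "64 * (G + 1) * tol \<le> \<phi>\<^sup>2"
begin

definition K :: "real \<Rightarrow> real \<Rightarrow> real" where "K s t = exp (- a * s) * exp (- a * t) * \<gamma> (s - t)"

text \<open>
  Among all \<open>g\<close> with values in the closed unit disc the constant \<open>1\<close> maximises the modulus of
  \<open>pot \<eta> g\<close>, and the maximum is \<open>M \<eta>\<close>.
\<close>

definition pot :: "(real \<Rightarrow> real) \<Rightarrow> (real \<Rightarrow> complex) \<Rightarrow> real \<Rightarrow> complex" where
  "pot \<eta> g s = (LINT t|lborel. of_real (K s t * \<eta> t) * g t)"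

definition M :: "(real \<Rightarrow> real) \<Rightarrow> real \<Rightarrow> real" where
  "M \<eta> s = (LINT t|lborel. K s t * \<eta> t)"

text \<open>
  Here \<open>\<delta>\<close> is the margin of the maximum principle, and \<open>c0\<close> with imaginary part \<open>- \<omega>\<close> is the
  eigenvalue of the limit problem. The eigenvalue sought lies in the disc of radius \<open>\<rho>\<close> around it, in
  the lower half plane. The weight \<open>\<kappa>\<close> rescales the unknown on the second bump: it divides the
  coupling of the first bump to the second by \<open>\<kappa>\<close>, at the price of multiplying the opposite coupling
  by \<open>\<kappa>\<close>. Of the latter only a remainder of size \<open>tol\<close> is left in the contraction, so that \<open>\<kappa>\<close> may
  be large.
\<close>

definition \<delta> :: real where "\<delta> = \<phi> / 4"
definition \<kappa> :: real where "\<kappa> = 8 * (G + 1) / \<phi>"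
definition \<omega> :: real where "\<omega> = sqrt (G\<^sup>2 - \<phi>\<^sup>2)"
definition \<rho> :: real where "\<rho> = min (\<phi> / 2) (\<omega> / 2)"
definition c0 :: complex where "c0 = Complex m (- \<omega>)"

definition weight :: "(real \<Rightarrow> real) \<Rightarrow> bool" where
  "weight \<eta> \<longleftrightarrow> continuous_on UNIV \<eta> \<and> vanishes_beyond L \<eta> \<and> (\<forall>t. 0 \<le> \<eta> t)"

lemma G_pos: "0 < G" using params by simp
lemma \<delta>_pos: "0 < \<delta>" using params by (simp add: \<delta>_def)
lemma \<kappa>_pos: "0 < \<kappa>" using params by (simp add: \<kappa>_def)
lemma \<omega>_pos: "0 < \<omega>" using params unfolding \<omega>_def by (simp add: power_strict_mono)
lemma \<rho>_pos: "0 < \<rho>" using params \<omega>_pos by (simp add: \<rho>_def)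
lemma \<omega>_le: "\<omega> \<le> G"
  unfolding \<omega>_def using params by (intro real_le_lsqrt) auto
lemma \<kappa>_tol: "\<kappa> * tol \<le> \<delta> / 2"
  using tol_small(2) params by (simp add: \<kappa>_def \<delta>_def field_simps power2_eq_square)
lemma tol_le: "tol \<le> \<delta>"
proof -
  have "tol * \<phi> \<le> tol * (16 * (G + 1))" using params by (intro mult_left_mono) auto
  also have "4 * \<dots> \<le> \<phi> * \<phi>" using tol_small(2) by (simp add: power2_eq_square algebra_simps)
  finally have "(4 * tol) * \<phi> \<le> \<phi> * \<phi>" using params by (simp add: mult_left_mono)
  then show ?thesis using params by (simp add: \<delta>_def)
qed
lemma cross_\<kappa>: "(G + tol) / \<kappa> \<le> \<delta> / 2"
  using params tol_small by (simp add: \<kappa>_def \<delta>_def field_simps)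

lemma weights: "weight \<eta>1" "weight \<eta>2"
  using smooth vanish nonneg by (auto simp: weight_def intro: Ck_imp_continuous)

lemma K_nonneg: "0 \<le> K s t" using \<gamma> by (simp add: K_def)

lemma pot_conv: "pot \<eta> g s = of_real (exp (- a * s)) * conv \<gamma> (\<lambda>t. of_real (exp (- a * t) * \<eta> t) * g t) s"
proof -
  have "of_real (exp (- a * s)) * conv \<gamma> (\<lambda>t. of_real (exp (- a * t) * \<eta> t) * g t) s
    = (LINT t|lborel. of_real (exp (- a * s)) * (\<gamma> (s - t) *\<^sub>R (of_real (exp (- a * t) * \<eta> t) * g t)))"
    unfolding conv_flip by (rule integral_mult_right_zero[symmetric])
  also have "\<dots> = pot \<eta> g s"
    unfolding pot_def K_def by (intro Bochner_Integration.integral_cong refl) (simp add: scaleR_conv_of_real mult_ac)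
  finally show ?thesis ..
qed

lemma weight_mult_bounded:
  assumes "weight \<eta>" "continuous_on UNIV (g :: real \<Rightarrow> complex)"
  obtains N where "\<And>t. norm (of_real (exp (- a * t) * \<eta> t) * g t) \<le> N"
proof -
  have c: "continuous_on UNIV (\<lambda>t. of_real (exp (- a * t) * \<eta> t) * g t)"
    using assms by (auto simp: weight_def intro!: continuous_intros)
  have v: "vanishes_beyond L (\<lambda>t. of_real (exp (- a * t) * \<eta> t) * g t)"
    using assms by (auto simp: weight_def vanishes_beyond_def)
  show thesis by (rule vanishes_beyond_bounded[OF c v]) (rule that)
qed

lemma pot_integrable:
  assumes "weight \<eta>" "continuous_on UNIV g"
  shows "integrable lborel (\<lambda>t. of_real (K s t * \<eta> t) * (g t :: complex))"
proof -
  obtain N where N: "\<And>t. norm (of_real (exp (- a * t) * \<eta> t) * g t) \<le> N"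
    using weight_mult_bounded[OF assms] by metis
  have c: "continuous_on UNIV (\<lambda>t. of_real (exp (- a * t) * \<eta> t) * g t)"
    using assms by (auto simp: weight_def intro!: continuous_intros)
  have "integrable lborel (\<lambda>t. of_real (exp (- a * s)) * (\<gamma> (s - t) *\<^sub>R (of_real (exp (- a * t) * \<eta> t) * g t)))"
    by (intro integrable_mult_right conv_flip_integrable[THEN iffD1] conv_integrable[OF \<gamma>(1) c N])
  then show ?thesis
    by (rule Bochner_Integration.integrable_cong[THEN iffD1, rotated 2])
      (auto simp: K_def scaleR_conv_of_real mult_ac)
qed

lemma M_integrable:
  assumes "weight \<eta>" shows "integrable lborel (\<lambda>t. K s t * \<eta> t)"
  using pot_integrable[OF assms continuous_on_const[of _ 1], of s] by (simp add: complex_of_real_integrable_eq del: of_real_mult)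

lemma M_pot: "of_real (M \<eta> s) = pot \<eta> (\<lambda>_. 1) s"
  unfolding M_def pot_def by (simp del: of_real_mult)

lemma M_nonneg: "weight \<eta> \<Longrightarrow> 0 \<le> M \<eta> s"
  unfolding M_def using K_nonneg by (auto simp: weight_def intro!: integral_nonneg_AE)

lemma pot_diff:
  assumes "weight \<eta>" "continuous_on UNIV g" "continuous_on UNIV h"
  shows "pot \<eta> (\<lambda>t. g t - h t) s = pot \<eta> g s - pot \<eta> h s"
  unfolding pot_def right_diff_distrib
  by (intro Bochner_Integration.integral_diff pot_integrable assms)

lemma pot_cmult: "pot \<eta> (\<lambda>t. c * g t) s = c * pot \<eta> g s"
proof -
  have "pot \<eta> (\<lambda>t. c * g t) s = (LINT t|lborel. c * (of_real (K s t * \<eta> t) * g t))"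
    unfolding pot_def by (simp add: mult_ac)
  then show ?thesis by (simp add: pot_def)
qed

lemma pot_bound:
  assumes "weight \<eta>" "continuous_on UNIV g" "\<And>t. \<eta> t \<noteq> 0 \<Longrightarrow> norm (g t) \<le> N"
  shows "norm (pot \<eta> g s) \<le> M \<eta> s * N"
proof -
  have "norm (pot \<eta> g s) \<le> (LINT t|lborel. norm (of_real (K s t * \<eta> t) * g t))"
    unfolding pot_def by (rule integral_norm_bound)
  also have "\<dots> \<le> (LINT t|lborel. (K s t * \<eta> t) * N)"
  proof (intro integral_mono integrable_norm pot_integrable integrable_mult_left M_integrable assms)
    fix t
    have p: "0 \<le> K s t * \<eta> t" using assms K_nonneg by (auto simp: weight_def)
    have "(K s t * \<eta> t) * norm (g t) \<le> (K s t * \<eta> t) * N"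
      using assms(3)[of t] p by (cases "\<eta> t = 0") (auto intro!: mult_left_mono)
    then show "norm (of_real (K s t * \<eta> t) * g t) \<le> (K s t * \<eta> t) * N"
      unfolding norm_mult[of "of_real _"] norm_of_real abs_of_nonneg[OF p] .
  qed
  finally show ?thesis by (simp add: M_def)
qed

lemma M_bounded:
  assumes "weight \<eta>" obtains B where "0 \<le> B" "\<And>s. \<bar>s\<bar> \<le> L \<Longrightarrow> M \<eta> s \<le> B"
proof -
  have c: "continuous_on UNIV (\<lambda>t. complex_of_real (exp (- a * t) * \<eta> t))"
    using assms by (auto simp: weight_def intro!: continuous_intros)
  obtain N where N: "\<And>t. norm (complex_of_real (exp (- a * t) * \<eta> t)) \<le> N"
    using weight_mult_bounded[OF assms continuous_on_const[of _ 1]] by (metis mult.right_neutral)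
  have "continuous_on UNIV (\<lambda>s. of_real (exp (- a * s)) * conv \<gamma> (\<lambda>t. of_real (exp (- a * t) * \<eta> t)) s)"
    by (intro continuous_intros continuous_conv[OF \<gamma>(1) c N])
  then have "continuous_on {-L..L} (\<lambda>s. pot \<eta> (\<lambda>_. 1) s)"
    unfolding pot_conv by (auto intro: continuous_on_subset)
  then have "bounded ((\<lambda>s. pot \<eta> (\<lambda>_. 1) s) ` {-L..L})"
    by (intro compact_imp_bounded compact_continuous_image) auto
  then obtain B where "\<forall>x\<in>(\<lambda>s. pot \<eta> (\<lambda>_. 1) s) ` {-L..L}. norm x \<le> B" unfolding bounded_iff ..
  then have B: "norm (pot \<eta> (\<lambda>_. 1) s) \<le> B" if "s \<in> {-L..L}" for s using that by blast
  show thesis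
  proof (rule that[of "max 0 B"])
    show "M \<eta> s \<le> max 0 B" if "\<bar>s\<bar> \<le> L" for s
      using B[of s] that M_nonneg[OF assms, of s] by (simp flip: M_pot add: abs_le_iff)
  qed simp
qed

lemma weight_integrable:
  assumes "weight \<eta>" "continuous_on UNIV g"
  shows "integrable lborel (\<lambda>t. of_real (\<eta> t) * (g t :: complex))"
  by (rule integrable_vanishing_mult[of _ L]) (use assms in \<open>auto simp: weight_def vanishes_beyond_def intro!: continuous_intros\<close>)

lemma weight_integrable_real:
  assumes "weight \<eta>" shows "integrable lborel \<eta>"
  using weight_integrable[OF assms continuous_on_const[of _ 1]] by (simp add: complex_of_real_integrable_eq)

lemma average_bound:
  assumes "weight \<eta>" "(LINT t|lborel. \<eta> t) = 1" "continuous_on UNIV g" "\<And>t. \<eta> t \<noteq> 0 \<Longrightarrow> norm (g t) \<le> N"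
  shows "norm (LINT t|lborel. of_real (\<eta> t) * (g t :: complex)) \<le> N"
proof -
  have "norm (LINT t|lborel. of_real (\<eta> t) * g t) \<le> (LINT t|lborel. norm (of_real (\<eta> t) * g t))"
    by (rule integral_norm_bound)
  also have "\<dots> \<le> (LINT t|lborel. \<eta> t * N)"
  proof (rule integral_mono)
    show "integrable lborel (\<lambda>t. norm (of_real (\<eta> t) * g t))"
      by (intro integrable_norm weight_integrable assms)
    show "integrable lborel (\<lambda>t. \<eta> t * N)"
      by (intro integrable_mult_left weight_integrable_real assms)
    show "norm (of_real (\<eta> t) * g t) \<le> \<eta> t * N" for t
      using assms(1,4) by (cases "\<eta> t = 0") (auto simp: norm_mult weight_def intro!: mult_left_mono)
  qed
  finally show ?thesis using assms(2) by simp
qed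

text \<open>
  On the other bump \<open>K\<close> is constant up to \<open>tol\<close>, so a potential generated there is nearly \<open>G\<close> times
  an average.
\<close>

lemma cross_bound:
  assumes "weight \<eta>" "(LINT t|lborel. \<eta> t) = 1" "continuous_on UNIV g" "\<And>t. norm (g t) \<le> N"
    and "\<And>t. \<eta> t \<noteq> 0 \<Longrightarrow> \<bar>K s t - G\<bar> \<le> tol"
  shows "norm (pot \<eta> g s - of_real G * (LINT t|lborel. of_real (\<eta> t) * g t)) \<le> tol * N"
proof -
  have N: "0 \<le> N" using order_trans[OF norm_ge_zero assms(4)] .
  have "pot \<eta> g s - of_real G * (LINT t|lborel. of_real (\<eta> t) * g t)
     = (LINT t|lborel. of_real (K s t * \<eta> t) * g t - of_real G * (of_real (\<eta> t) * g t))"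
    unfolding pot_def using pot_integrable[OF assms(1,3)] weight_integrable[OF assms(1,3)] by simp
  also have "norm \<dots> \<le> (LINT t|lborel. norm (of_real (K s t * \<eta> t) * g t - of_real G * (of_real (\<eta> t) * g t)))"
    by (rule integral_norm_bound)
  also have "\<dots> \<le> (LINT t|lborel. \<eta> t * (tol * N))"
  proof (intro integral_mono)
    show "integrable lborel (\<lambda>t. norm (of_real (K s t * \<eta> t) * g t - of_real G * (of_real (\<eta> t) * g t)))"
      by (intro integrable_norm Bochner_Integration.integrable_diff integrable_mult_right pot_integrable weight_integrable assms)
    show "integrable lborel (\<lambda>t. \<eta> t * (tol * N))"
      by (intro integrable_mult_left weight_integrable_real assms)
    fix t
    have "of_real (K s t * \<eta> t) * g t - of_real G * (of_real (\<eta> t) * g t) = of_real (\<eta> t) * (of_real (K s t - G) * g t)"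
      by (simp add: algebra_simps)
    also have "norm \<dots> = \<eta> t * (\<bar>K s t - G\<bar> * norm (g t))"
      using assms(1) unfolding norm_mult norm_of_real by (simp add: weight_def)
    also have "\<dots> \<le> \<eta> t * (tol * N)"
      using assms(1,5) params N by (cases "\<eta> t = 0") (auto simp: weight_def intro!: mult_left_mono mult_mono assms(4))
    finally show "norm (of_real (K s t * \<eta> t) * g t - of_real G * (of_real (\<eta> t) * g t)) \<le> \<eta> t * (tol * N)" .
  qed
  finally show ?thesis using assms(2) by simp
qed

text \<open>
  With the ansatz \<open>w = (\<eta>1 - \<kappa> \<eta>2) f\<close> the eigenvalue equation determines \<open>f\<close> on the two bumps, and
  the cut-offs extend it to the line. In the operator with coefficients \<open>opA\<close>, \<open>opB\<close>, \<open>opq\<close>, \<open>opr\<close>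
  the rank-one term \<open>\<kappa> G \<integral> \<eta>2 f\<close> cancels, up to \<open>tol\<close>, the coupling of the second bump to the
  first. The source \<open>src\<close> replaces this coupling by that of a function with \<open>\<kappa> \<integral> \<eta>2 f = 1\<close>.
\<close>

definition den :: "complex \<Rightarrow> real \<Rightarrow> complex" where "den c s = of_real (\<Omega> s) - c"

definition opA :: "complex \<Rightarrow> real \<Rightarrow> complex" where
  "opA c s = of_real ((\<chi>1 s + \<chi>2 s / \<kappa>) * exp (- a * s)) * inverse (den c s)"
definition opB :: "complex \<Rightarrow> real \<Rightarrow> complex" where
  "opB c s = of_real (\<chi>1 s * (G * \<kappa>)) * inverse (den c s)"
definition src :: "complex \<Rightarrow> real \<Rightarrow> complex" where
  "src c s = of_real (- (\<chi>1 s * G)) * inverse (den c s)"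
definition opq :: "real \<Rightarrow> complex" where
  "opq t = of_real ((\<eta>1 t - \<kappa> * \<eta>2 t) * exp (- a * t))"
definition opr :: "real \<Rightarrow> complex" where "opr t = of_real (\<eta>2 t)"

lemma op_raw:
  assumes "continuous_on UNIV g"
  shows "opA c s * conv \<gamma> (\<lambda>t. opq t * g t) s + opB c s * (LINT t|lborel. opr t * g t)
    = inverse (den c s) * (of_real (\<chi>1 s + \<chi>2 s / \<kappa>) * (pot \<eta>1 g s - of_real \<kappa> * pot \<eta>2 g s)
        + of_real (\<chi>1 s * (G * \<kappa>)) * (LINT t|lborel. of_real (\<eta>2 t) * g t))"
proof -
  let ?h1 = "\<lambda>t. of_real (exp (- a * t) * \<eta>1 t) * g t" and ?h2 = "\<lambda>t. of_real (exp (- a * t) * \<eta>2 t) * g t"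
  obtain N1 where N1: "\<And>t. norm (?h1 t) \<le> N1" using weight_mult_bounded[OF weights(1) assms] by metis
  obtain N2 where N2: "\<And>t. norm (?h2 t) \<le> N2" using weight_mult_bounded[OF weights(2) assms] by metis
  have c: "continuous_on UNIV ?h1" "continuous_on UNIV (\<lambda>t. of_real \<kappa> * ?h2 t)"
    using weights assms by (auto simp: weight_def intro!: continuous_intros)
  have N2': "norm (of_real \<kappa> * ?h2 t) \<le> \<kappa> * N2" for t
    using N2[of t] \<kappa>_pos unfolding norm_mult norm_of_real by (simp add: mult_left_mono)
  have "conv \<gamma> (\<lambda>t. opq t * g t) s = conv \<gamma> (\<lambda>t. ?h1 t - of_real \<kappa> * ?h2 t) s"
    by (intro arg_cong[of _ _ "\<lambda>h. conv \<gamma> h s"] ext) (simp add: opq_def algebra_simps)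
  also have "\<dots> = conv \<gamma> ?h1 s - conv \<gamma> (\<lambda>t. of_real \<kappa> * ?h2 t) s"
    by (rule conv_diff[OF \<gamma>(1) c(1) N1 c(2) N2'])
  also have "conv \<gamma> (\<lambda>t. of_real \<kappa> * ?h2 t) s = of_real \<kappa> * conv \<gamma> ?h2 s"
    unfolding conv_def by (subst integral_mult_right_zero[symmetric]) (simp add: scaleR_conv_of_real mult_ac)
  finally have cq: "conv \<gamma> (\<lambda>t. opq t * g t) s = conv \<gamma> ?h1 s - of_real \<kappa> * conv \<gamma> ?h2 s" .
  have e: "of_real (exp (- a * s)) * conv \<gamma> (\<lambda>t. opq t * g t) s = pot \<eta>1 g s - of_real \<kappa> * pot \<eta>2 g s"
    unfolding pot_conv cq right_diff_distrib by (simp only: mult.left_commute)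
  have "opA c s * conv \<gamma> (\<lambda>t. opq t * g t) s
      = inverse (den c s) * (of_real (\<chi>1 s + \<chi>2 s / \<kappa>) * (pot \<eta>1 g s - of_real \<kappa> * pot \<eta>2 g s))"
    unfolding e[symmetric] opA_def of_real_mult by (simp only: mult_ac)
  moreover have "opB c s * (LINT t|lborel. opr t * g t)
      = inverse (den c s) * (of_real (\<chi>1 s * (G * \<kappa>)) * (LINT t|lborel. of_real (\<eta>2 t) * g t))"
    unfolding opB_def opr_def by (simp only: mult_ac)
  ultimately show ?thesis by (simp only: distrib_left)
qed

lemma Re_ball: assumes "c \<in> cball c0 \<rho>" shows "\<bar>Re c - m\<bar> \<le> 2 * \<delta>"
  using assms abs_Re_le_cmod[of "c0 - c"] by (auto simp: c0_def \<rho>_def \<delta>_def dist_norm abs_minus_commute)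

lemma \<phi>_eq: "\<phi> = 4 * \<delta>" by (simp add: \<delta>_def)

lemma near1': "\<chi>1 s \<noteq> 0 \<Longrightarrow> \<bar>\<Omega> s - M \<eta>1 s - (m + \<phi>)\<bar> \<le> tol"
  using near1 by (simp add: M_def K_def)
lemma near2': "\<chi>2 s \<noteq> 0 \<Longrightarrow> \<bar>\<Omega> s + M \<eta>2 s - (m - \<phi>)\<bar> \<le> tol"
  using near2 by (simp add: M_def K_def)

text \<open>
  On the first bump \<open>\<Omega>\<close> is the self-interaction plus \<open>m + \<phi>\<close>, and on the second, where \<open>p\<close> is
  negative, minus the self-interaction plus \<open>m - \<phi>\<close>. The signs of \<open>\<plusminus> \<phi>\<close> push \<open>\<Omega> - Re c\<close> away
  from zero in both cases.
\<close>

lemma den_lower1: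
  assumes "c \<in> cball c0 \<rho>" "\<chi>1 s \<noteq> 0"
  shows "M \<eta>1 s + \<delta> \<le> norm (den c s)"
proof -
  have "M \<eta>1 s + \<delta> \<le> Re (den c s)"
    using tol_le Re_ball[OF assms(1)] near1'[OF assms(2)] \<phi>_eq unfolding den_def minus_complex.sel Re_complex_of_real
    by linarith
  then show ?thesis using complex_Re_le_cmod[of "den c s"] by linarith
qed

lemma den_lower2:
  assumes "c \<in> cball c0 \<rho>" "\<chi>2 s \<noteq> 0"
  shows "M \<eta>2 s + \<delta> \<le> norm (den c s)"
proof -
  have "M \<eta>2 s + \<delta> \<le> - Re (den c s)"
    using tol_le Re_ball[OF assms(1)] near2'[OF assms(2)] \<phi>_eq unfolding den_def minus_complex.sel Re_complex_of_real
    by linarith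
  then show ?thesis using abs_Re_le_cmod[of "den c s"] by linarith
qed

lemma Im_ball: assumes "c \<in> cball c0 \<rho>" shows "Im c \<le> - \<omega> / 2"
  using assms abs_Im_le_cmod[of "c0 - c"] by (auto simp: c0_def \<rho>_def dist_norm)

lemma den_lower: assumes "c \<in> cball c0 \<rho>" shows "\<omega> / 2 \<le> norm (den c s)"
  using Im_ball[OF assms] abs_Im_le_cmod[of "den c s"] by (simp add: den_def)

lemma den_nonzero: "c \<in> cball c0 \<rho> \<Longrightarrow> den c s \<noteq> 0"
  using den_lower[of c s] \<omega>_pos by auto

lemma op_bound1:
  assumes "c \<in> cball c0 \<rho>" "continuous_on UNIV g" "\<And>t. norm (g t) \<le> N" "\<chi>1 s \<noteq> 0"
  shows "norm (of_real (\<chi>1 s + \<chi>2 s / \<kappa>) * (pot \<eta>1 g s - of_real \<kappa> * pot \<eta>2 g s)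
        + of_real (\<chi>1 s * (G * \<kappa>)) * (LINT t|lborel. of_real (\<eta>2 t) * g t)) \<le> (M \<eta>1 s + \<delta> / 2) * N"
proof -
  let ?l = "LINT t|lborel. of_real (\<eta>2 t) * g t"
  have N: "0 \<le> N" using order_trans[OF norm_ge_zero assms(3)] .
  have c2: "\<chi>2 s = 0" using disj[of s] assms(4) by auto
  have "of_real (\<chi>1 s + \<chi>2 s / \<kappa>) * (pot \<eta>1 g s - of_real \<kappa> * pot \<eta>2 g s)
        + of_real (\<chi>1 s * (G * \<kappa>)) * ?l = of_real (\<chi>1 s) * (pot \<eta>1 g s - of_real \<kappa> * (pot \<eta>2 g s - of_real G * ?l))"
    by (simp add: c2 algebra_simps)
  also have "norm \<dots> = \<chi>1 s * norm (pot \<eta>1 g s - of_real \<kappa> * (pot \<eta>2 g s - of_real G * ?l))"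
    using nonneg(3)[of s] by (simp add: norm_mult)
  also have "\<dots> \<le> 1 * norm (pot \<eta>1 g s - of_real \<kappa> * (pot \<eta>2 g s - of_real G * ?l))"
    by (intro mult_right_mono le1) auto
  also have "\<dots> \<le> norm (pot \<eta>1 g s) + norm (of_real \<kappa> * (pot \<eta>2 g s - of_real G * ?l))"
    using norm_triangle_ineq4 by auto
  also have "norm (of_real \<kappa> * (pot \<eta>2 g s - of_real G * ?l)) \<le> \<kappa> * (tol * N)"
    using cross_bound[OF weights(2) mass(2) assms(2,3), of s] cross12[OF assms(4)] \<kappa>_pos
    unfolding norm_mult by (auto simp: K_def intro!: mult_left_mono)
  also have "\<kappa> * (tol * N) \<le> \<delta> / 2 * N" using mult_right_mono[OF \<kappa>_tol N] by (simp add: mult.assoc)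
  also have "norm (pot \<eta>1 g s) \<le> M \<eta>1 s * N" by (rule pot_bound[OF weights(1) assms(2,3)])
  finally show ?thesis by (simp add: algebra_simps)
qed

lemma op_bound2:
  assumes "c \<in> cball c0 \<rho>" "continuous_on UNIV g" "\<And>t. norm (g t) \<le> N" "\<chi>2 s \<noteq> 0"
  shows "norm (of_real (\<chi>1 s + \<chi>2 s / \<kappa>) * (pot \<eta>1 g s - of_real \<kappa> * pot \<eta>2 g s)
        + of_real (\<chi>1 s * (G * \<kappa>)) * (LINT t|lborel. of_real (\<eta>2 t) * g t)) \<le> (M \<eta>2 s + \<delta> / 2) * N"
proof -
  let ?l = "LINT t|lborel. of_real (\<eta>1 t) * g t"
  have N: "0 \<le> N" using order_trans[OF norm_ge_zero assms(3)] .
  have c1: "\<chi>1 s = 0" using disj[of s] assms(4) by auto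
  have "of_real (\<chi>1 s + \<chi>2 s / \<kappa>) * (pot \<eta>1 g s - of_real \<kappa> * pot \<eta>2 g s)
        + of_real (\<chi>1 s * (G * \<kappa>)) * (LINT t|lborel. of_real (\<eta>2 t) * g t)
      = of_real (\<chi>2 s) * (pot \<eta>1 g s / of_real \<kappa> - pot \<eta>2 g s)"
    using \<kappa>_pos by (simp add: c1 field_simps)
  also have "norm \<dots> = \<chi>2 s * norm (pot \<eta>1 g s / of_real \<kappa> - pot \<eta>2 g s)"
    using nonneg(4)[of s] by (simp add: norm_mult)
  also have "\<dots> \<le> 1 * norm (pot \<eta>1 g s / of_real \<kappa> - pot \<eta>2 g s)"
    by (intro mult_right_mono le1) auto
  also have "\<dots> \<le> norm (pot \<eta>1 g s / of_real \<kappa>) + norm (pot \<eta>2 g s)"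
    using norm_triangle_ineq4 by auto
  also have "norm (pot \<eta>1 g s / of_real \<kappa>) \<le> (G + tol) / \<kappa> * N"
  proof -
    have "norm (pot \<eta>1 g s) \<le> norm (pot \<eta>1 g s - of_real G * ?l) + norm (of_real G * ?l)"
      using norm_triangle_ineq[of "pot \<eta>1 g s - of_real G * ?l" "of_real G * ?l"] by simp
    also have "norm (pot \<eta>1 g s - of_real G * ?l) \<le> tol * N"
      using cross_bound[OF weights(1) mass(1) assms(2,3), of s] cross21[OF assms(4)] by (auto simp: K_def)
    also have "norm (of_real G * ?l) \<le> G * N"
      using average_bound[OF weights(1) mass(1) assms(2,3)] G_pos unfolding norm_mult by (auto intro!: mult_left_mono)
    finally have "norm (pot \<eta>1 g s) \<le> (G + tol) * N" by (simp add: algebra_simps)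
    then show ?thesis using \<kappa>_pos by (simp add: norm_divide divide_right_mono)
  qed
  also have "(G + tol) / \<kappa> * N \<le> \<delta> / 2 * N" by (rule mult_right_mono[OF cross_\<kappa> N])
  also have "norm (pot \<eta>2 g s) \<le> M \<eta>2 s * N" by (rule pot_bound[OF weights(2) assms(2,3)])
  finally show ?thesis by (simp add: algebra_simps)
qed

text \<open>
  The numerators are at most \<open>(M + \<delta>/2) sup \<bar>g\<bar>\<close> and the denominators at least \<open>M + \<delta>\<close> with the
  same \<open>M\<close>; the quotient stays below one because \<open>M\<close> is bounded for fixed bumps. The contraction
  factor depends on the width of the bumps, but no other estimate involves it except the modulus of
  continuity in \<open>c\<close>.
\<close>

lemma uniform_contraction:
  "\<exists>\<theta>. 0 \<le> \<theta> \<and> \<theta> < 1 \<and> (\<forall>c\<in>cball c0 \<rho>. contraction_operator \<gamma> (opA c) (opB c) opq opr L \<theta>)"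
proof -
  obtain B1 where B1: "0 \<le> B1" "\<And>s. \<bar>s\<bar> \<le> L \<Longrightarrow> M \<eta>1 s \<le> B1" using M_bounded[OF weights(1)] by metis
  obtain B2 where B2: "0 \<le> B2" "\<And>s. \<bar>s\<bar> \<le> L \<Longrightarrow> M \<eta>2 s \<le> B2" using M_bounded[OF weights(2)] by metis
  define B where "B = max B1 B2"
  have B: "0 \<le> B" "\<And>s. \<bar>s\<bar> \<le> L \<Longrightarrow> M \<eta>1 s \<le> B" "\<And>s. \<bar>s\<bar> \<le> L \<Longrightarrow> M \<eta>2 s \<le> B"
    using B1 B2 by (auto simp: B_def le_max_iff_disj)
  define \<theta> where "\<theta> = 1 - (\<delta> / 2) / (B + \<delta>)"
  have \<theta>: "0 \<le> \<theta>" "\<theta> < 1" using B(1) \<delta>_pos by (auto simp: \<theta>_def field_simps)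
  have frac: "(x + \<delta> / 2) * N / (x + \<delta>) \<le> \<theta> * N" if "0 \<le> x" "x \<le> B" "0 \<le> N" for x N
  proof -
    have "(x + \<delta> / 2) / (x + \<delta>) = 1 - (\<delta> / 2) / (x + \<delta>)" using that \<delta>_pos by (simp add: field_simps)
    also have "\<dots> \<le> \<theta>" unfolding \<theta>_def using that \<delta>_pos by (intro diff_left_mono divide_left_mono) auto
    finally show ?thesis using mult_right_mono[OF _ that(3)] by fastforce
  qed
  have "contraction_operator \<gamma> (opA c) (opB c) opq opr L \<theta>" if c: "c \<in> cball c0 \<rho>" for c
  proof
    have Cd: "Ck k (\<lambda>s. inverse (den c s))" for k
      using den_nonzero[OF c] unfolding den_def by (intro Ck_inverse Ck_diff Ck_of_real Ck_const smooth) auto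
    have Ce: "Ck k (\<lambda>s. exp (- a * s))" for k by (rule Ck_exp)
    show "Ck k (opA c)" for k
      unfolding opA_def[abs_def] divide_inverse
      by (intro Ck_mult Ck_of_real Ck_add Ck_const Ce smooth Cd)
    show "Ck k (opB c)" for k
      unfolding opB_def[abs_def] by (intro Ck_mult Ck_of_real Ck_const smooth Cd)
    show "Ck k opq" for k
      unfolding opq_def[abs_def] by (intro Ck_mult Ck_of_real Ck_diff Ck_const Ce smooth)
    show "Ck k opr" for k
      unfolding opr_def[abs_def] by (intro Ck_of_real smooth)
    show "vanishes_beyond L (opA c)" "vanishes_beyond L (opB c)" "vanishes_beyond L opq" "vanishes_beyond L opr"
      using vanish by (auto simp: vanishes_beyond_def opA_def opB_def opq_def opr_def)
    fix g :: "real \<Rightarrow> complex" and N s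
    assume g: "continuous_on UNIV g" "\<And>t. norm (g t) \<le> N"
    have N: "0 \<le> N" using order_trans[OF norm_ge_zero g(2)] .
    let ?num = "of_real (\<chi>1 s + \<chi>2 s / \<kappa>) * (pot \<eta>1 g s - of_real \<kappa> * pot \<eta>2 g s)
        + of_real (\<chi>1 s * (G * \<kappa>)) * (LINT t|lborel. of_real (\<eta>2 t) * g t)"
    have est: "norm (inverse (den c s) * ?num) \<le> \<theta> * N"
      if x: "norm ?num \<le> (x + \<delta> / 2) * N" "x + \<delta> \<le> norm (den c s)" "0 \<le> x" "x \<le> B" for x
    proof -
      have "norm (inverse (den c s) * ?num) = norm ?num / norm (den c s)"
        by (simp add: norm_mult norm_inverse divide_inverse mult.commute)
      also have "\<dots> \<le> (x + \<delta> / 2) * N / (x + \<delta>)"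
        using x \<delta>_pos N by (intro frac_le) auto
      also have "\<dots> \<le> \<theta> * N" by (rule frac[OF x(3,4) N])
      finally show ?thesis .
    qed
    consider "\<chi>1 s \<noteq> 0" | "\<chi>2 s \<noteq> 0" | "\<chi>1 s = 0" "\<chi>2 s = 0" by auto
    then show "norm (opA c s * conv \<gamma> (\<lambda>t. opq t * g t) s + opB c s * (LINT t|lborel. opr t * g t)) \<le> \<theta> * N"
      unfolding op_raw[OF g(1)]
    proof cases
      case 1
      then have "\<bar>s\<bar> \<le> L" using vanish(3) by (auto simp: vanishes_beyond_def not_less[symmetric])
      then show "norm (inverse (den c s) * ?num) \<le> \<theta> * N"
        by (intro est[OF op_bound1[OF c g 1] den_lower1[OF c 1] M_nonneg[OF weights(1)] B(2)])
    next
      case 2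
      then have "\<bar>s\<bar> \<le> L" using vanish(4) by (auto simp: vanishes_beyond_def not_less[symmetric])
      then show "norm (inverse (den c s) * ?num) \<le> \<theta> * N"
        by (intro est[OF op_bound2[OF c g 2] den_lower2[OF c 2] M_nonneg[OF weights(2)] B(3)])
    next
      case 3
      then show "norm (inverse (den c s) * ?num) \<le> \<theta> * N" using \<theta> N by simp
    qed
  qed (use \<gamma> \<theta> in auto)
  then show ?thesis using \<theta> by blast
qed

end

text \<open>
  A bound for the distance of the exact problem from the limit problem, per unit of \<open>tol\<close>. It depends
  only on \<open>\<phi>\<close> and \<open>G\<close>, so the bumps can be chosen after it.
\<close>

definition err_const :: "real \<Rightarrow> real \<Rightarrow> real" where
  "err_const \<phi> G = (let d = \<phi> / 4; N = G / (d / 2); y = G / (2 * d) in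
     (N + G * ((y + 8 * (G + 1) / \<phi> * N) / d) + G * y / (2 * d)) / d)"

context two_bump begin

definition num :: "(real \<Rightarrow> complex) \<Rightarrow> real \<Rightarrow> complex" where
  "num g s = of_real (\<chi>1 s + \<chi>2 s / \<kappa>) * (pot \<eta>1 g s - of_real \<kappa> * pot \<eta>2 g s)
        + of_real (\<chi>1 s * (G * \<kappa>)) * (LINT t|lborel. of_real (\<eta>2 t) * g t)"

definition is_sol :: "complex \<Rightarrow> (real \<Rightarrow> complex) \<Rightarrow> bool" where
  "is_sol c f \<longleftrightarrow> continuous_on UNIV f \<and> bounded (range f) \<and>
     (\<forall>s. f s = inverse (den c s) * (num f s - of_real (\<chi>1 s * G)))"

definition sol :: "complex \<Rightarrow> real \<Rightarrow> complex" where "sol c = (SOME f. is_sol c f)"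

lemma src_Ck: assumes "c \<in> cball c0 \<rho>" shows "Ck k (src c)"
proof -
  have "Ck k (\<lambda>s. inverse (den c s))"
    using den_nonzero[OF assms] unfolding den_def by (intro Ck_inverse Ck_diff Ck_of_real Ck_const smooth) auto
  then show ?thesis unfolding src_def[abs_def]
    by (intro Ck_mult Ck_of_real Ck_minus Ck_const smooth)
qed

lemma src_vanish: "vanishes_beyond L (src c)"
  using vanish(3) by (auto simp: vanishes_beyond_def src_def)

lemma fixed_point_form:
  assumes "contraction_operator \<gamma> (opA c) (opB c) opq opr L \<theta>" "continuous_on UNIV f"
  shows "inverse (den c s) * (num f s - of_real (\<chi>1 s * G)) = contraction_operator.T \<gamma> (opA c) (opB c) opq opr f s + src c s"
  unfolding contraction_operator.T_def[OF assms(1)] op_raw[OF assms(2)] num_def src_def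
  by (simp add: right_diff_distrib)

lemma sol_is_sol: assumes c: "c \<in> cball c0 \<rho>" shows "is_sol c (sol c)"
proof -
  obtain \<theta> where "contraction_operator \<gamma> (opA c) (opB c) opq opr L \<theta>" using uniform_contraction c by blast
  then interpret op: contraction_operator \<gamma> "opA c" "opB c" opq opr L \<theta> .
  have sc: "continuous_on UNIV (src c)" using src_Ck[OF c] by (rule Ck_imp_continuous)
  obtain N where N: "\<And>t. norm (src c t) \<le> N" using vanishes_beyond_bounded[OF sc src_vanish] by metis
  obtain f where f: "continuous_on UNIV f" "bounded (range f)" "\<And>s. f s = op.T f s + src c s"
    by (rule op.solution_exists[OF sc N]) blast
  have "is_sol c f" unfolding is_sol_def
  proof (intro conjI f(1) f(2) allI)
    fix s show "f s = inverse (den c s) * (num f s - of_real (\<chi>1 s * G))"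
      unfolding fixed_point_form[OF op.contraction_operator_axioms f(1)] by (rule f(3))
  qed
  then show ?thesis unfolding sol_def by (rule someI[of "is_sol c"])
qed

lemma sol_cont: assumes "c \<in> cball c0 \<rho>" shows "continuous_on UNIV (sol c)"
  using sol_is_sol[OF assms] unfolding is_sol_def by blast

lemma sol_bdd: assumes "c \<in> cball c0 \<rho>" shows "bounded (range (sol c))"
  using sol_is_sol[OF assms] unfolding is_sol_def by blast

lemma sol_eq: assumes "c \<in> cball c0 \<rho>" shows "den c s * sol c s = num (sol c) s - of_real (\<chi>1 s * G)"
proof -
  have e: "sol c s = inverse (den c s) * (num (sol c) s - of_real (\<chi>1 s * G))"
    using sol_is_sol[OF assms] unfolding is_sol_def by blast
  have "den c s * (inverse (den c s) * z) = z" for z using den_nonzero[OF assms] by simp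
  from this[of "num (sol c) s - of_real (\<chi>1 s * G)"] show ?thesis unfolding e[symmetric] .
qed

lemma sol_Ck: assumes c: "c \<in> cball c0 \<rho>" shows "Ck k (sol c)"
proof -
  obtain \<theta> where "contraction_operator \<gamma> (opA c) (opB c) opq opr L \<theta>" using uniform_contraction c by blast
  then interpret op: contraction_operator \<gamma> "opA c" "opB c" opq opr L \<theta> .
  show ?thesis
  proof (rule op.solution_Ck[OF src_Ck[OF c] src_vanish sol_cont[OF c] sol_bdd[OF c]])
    fix s show "sol c s = op.T (sol c) s + src c s"
      using sol_is_sol[OF c] fixed_point_form[OF op.contraction_operator_axioms sol_cont[OF c], of s]
      unfolding is_sol_def by metis
  qed
qed

definition Nf :: real where "Nf = G / (\<delta> / 2)"

lemma den_norm: "norm (den c s * z) = norm z * norm (den c s)" by (simp add: norm_mult)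

text \<open>
  Unlike the bound that the contraction factor gives, this one is independent of the width of the
  bumps.
\<close>

lemma sol_norm: assumes c: "c \<in> cball c0 \<rho>" shows "norm (sol c s) \<le> Nf"
proof -
  obtain N0 where N0: "\<And>t. norm (sol c t) \<le> N0" using sol_bdd[OF c] unfolding bounded_iff by blast
  obtain B1 where B1: "0 \<le> B1" "\<And>s. \<bar>s\<bar> \<le> L \<Longrightarrow> M \<eta>1 s \<le> B1" using M_bounded[OF weights(1)] by metis
  obtain B2 where B2: "0 \<le> B2" "\<And>s. \<bar>s\<bar> \<le> L \<Longrightarrow> M \<eta>2 s \<le> B2" using M_bounded[OF weights(2)] by metis
  define MM where "MM s = (if \<chi>1 s \<noteq> 0 then M \<eta>1 s else if \<chi>2 s \<noteq> 0 then M \<eta>2 s else 0) + \<delta> / 2" for s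
  have L1: "\<chi>1 s \<noteq> 0 \<Longrightarrow> \<bar>s\<bar> \<le> L" "\<chi>2 s \<noteq> 0 \<Longrightarrow> \<bar>s\<bar> \<le> L" for s
    using vanish(3,4) by (auto simp: vanishes_beyond_def not_less[symmetric])
  show ?thesis unfolding Nf_def
  proof (rule weighted_maximum_principle[where S = UNIV and M = MM and f = "sol c" and ?N0.0 = N0 and Mmax = "max B1 B2 + \<delta> / 2"])
  show "norm (sol c t) \<le> N0" for t by (rule N0)
  show "0 \<le> MM s" for s using M_nonneg weights \<delta>_pos by (auto simp: MM_def)
  show "MM s \<le> max B1 B2 + \<delta> / 2" for s
    using B1 B2 L1[of s] by (auto simp: MM_def le_max_iff_disj)
  show "norm (sol c s) * (MM s + \<delta> / 2) \<le> MM s * N + G"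
    if N: "\<And>t. t \<in> UNIV \<Longrightarrow> norm (sol c t) \<le> N" for s N
  proof -
    have N': "\<And>t. norm (sol c t) \<le> N" using N by simp
    have N0: "0 \<le> N" using order_trans[OF norm_ge_zero N'] .
    have srcb: "norm (of_real (\<chi>1 s * G) :: complex) \<le> G"
      using nonneg(3)[of s] le1(1)[of s] G_pos unfolding norm_of_real abs_mult by (simp add: mult_left_le_one_le)
    have key: ?thesis if x: "MM s = x + \<delta> / 2" "norm (num (sol c) s) \<le> (x + \<delta> / 2) * N" "x + \<delta> \<le> norm (den c s)" for x
    proof -
      have "norm (sol c s) * (MM s + \<delta> / 2) \<le> norm (sol c s) * norm (den c s)"
        using x by (intro mult_left_mono) auto
      also have "\<dots> = norm (num (sol c) s - of_real (\<chi>1 s * G))"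
        by (simp only: den_norm[symmetric] sol_eq[OF c])
      also have "\<dots> \<le> (x + \<delta> / 2) * N + G"
        by (rule order_trans[OF norm_triangle_ineq4 add_mono[OF x(2) srcb]])
      finally show ?thesis using x(1) by simp
    qed
    consider "\<chi>1 s \<noteq> 0" | "\<chi>2 s \<noteq> 0" "\<chi>1 s = 0" | "\<chi>1 s = 0" "\<chi>2 s = 0" by auto
    then show ?thesis
    proof cases
      case 1 show ?thesis
        by (rule key[of "M \<eta>1 s"]) (use 1 op_bound1[OF c sol_cont[OF c] N' 1] den_lower1[OF c 1] in \<open>auto simp: MM_def num_def\<close>)
    next
      case 2 show ?thesis
        by (rule key[of "M \<eta>2 s"]) (use 2 op_bound2[OF c sol_cont[OF c] N' 2(1)] den_lower2[OF c 2(1)] in \<open>auto simp: MM_def num_def\<close>)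
    next
      case 3
      have "den c s * sol c s = 0" unfolding sol_eq[OF c] num_def by (simp add: 3)
      then have "sol c s = 0" using den_nonzero[OF c] by simp
      then show ?thesis using 3 N0 \<delta>_pos G_pos by (simp add: MM_def)
    qed
  qed
qed (use \<delta>_pos G_pos in auto)
qed

text \<open>
  The solution for the parameter \<open>d\<close> solves the equation for \<open>c\<close> up to an error of order \<open>c - d\<close>.
\<close>

lemma sol_lipschitz:
  "\<exists>C. \<forall>c\<in>cball c0 \<rho>. \<forall>d\<in>cball c0 \<rho>. \<forall>s. norm (sol c s - sol d s) \<le> C * norm (c - d)"
proof -
  obtain \<theta> where \<theta>: "0 \<le> \<theta>" "\<theta> < 1" "\<And>c. c \<in> cball c0 \<rho> \<Longrightarrow> contraction_operator \<gamma> (opA c) (opB c) opq opr L \<theta>"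
    using uniform_contraction by blast
  show ?thesis
  proof (intro exI[of _ "Nf / (\<omega> / 2) / (1 - \<theta>)"] ballI allI)
    fix c d s assume c: "c \<in> cball c0 \<rho>" and d: "d \<in> cball c0 \<rho>"
    interpret op: contraction_operator \<gamma> "opA c" "opB c" opq opr L \<theta> by (rule \<theta>(3)[OF c])
    let ?e = "\<lambda>t. sol c t - sol d t"
    have "norm (?e s) \<le> (Nf / (\<omega> / 2) * norm (c - d)) / (1 - \<theta>)"
    proof (rule op.solution_bound)
      show "continuous_on UNIV ?e" by (intro continuous_on_diff sol_cont c d)
      show "bounded (range ?e)" by (rule bounded_minus_comp[OF sol_bdd[OF c] sol_bdd[OF d]])
      fix t
      have 1: "sol c t = op.T (sol c) t + src c t"
        using sol_is_sol[OF c] fixed_point_form[OF op.contraction_operator_axioms sol_cont[OF c], of t]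
        unfolding is_sol_def by metis
      have 2: "op.T (sol d) t + src c t = inverse (den c t) * (den d t * sol d t)"
        unfolding fixed_point_form[OF op.contraction_operator_axioms sol_cont[OF d], symmetric] sol_eq[OF d] ..
      have "?e t - op.T ?e t = (sol c t - op.T (sol c) t) - sol d t + op.T (sol d) t"
        unfolding op.T_diff[OF sol_cont[OF c] sol_cont[OF d]] by simp
      also have "\<dots> = inverse (den c t) * (den d t * sol d t) - sol d t"
      proof -
        have 3: "sol c t - op.T (sol c) t = src c t" by (subst 1) simp
        show ?thesis unfolding 3 2[symmetric] by simp
      qed
      also have "inverse (den c t) * (den d t * sol d t) - sol d t = inverse (den c t) * ((c - d) * sol d t)"
      proof -
        have dn: "den d t = den c t + (c - d)" by (simp add: den_def)
        show ?thesis unfolding dn using den_nonzero[OF c, of t] by (simp add: field_simps)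
      qed
      finally have e: "?e t - op.T ?e t = inverse (den c t) * ((c - d) * sol d t)" .
      have "norm (?e t - op.T ?e t) = norm (sol d t) / norm (den c t) * norm (c - d)"
        unfolding e by (simp add: norm_mult norm_inverse divide_inverse)
      also have "\<dots> \<le> Nf / (\<omega> / 2) * norm (c - d)"
      proof (rule mult_right_mono)
        show "norm (sol d t) / norm (den c t) \<le> Nf / (\<omega> / 2)"
          by (rule frac_le[OF order_trans[OF norm_ge_zero sol_norm[OF d]] sol_norm[OF d] _ den_lower[OF c]])
            (use \<omega>_pos in simp)
      qed simp
      finally show "norm (?e t - op.T ?e t) \<le> Nf / (\<omega> / 2) * norm (c - d)" .
    qed
    then show "norm (?e s) \<le> Nf / (\<omega> / 2) / (1 - \<theta>) * norm (c - d)" by simp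
  qed
qed

text \<open>
  If \<open>ell c = 1\<close>, the source cancels the rank-one term, and \<open>sol c\<close> gives an eigenfunction.
\<close>

definition ell :: "complex \<Rightarrow> complex" where
  "ell c = of_real \<kappa> * (LINT t|lborel. of_real (\<eta>2 t) * sol c t)"

lemma ell_cont: "continuous_on (cball c0 \<rho>) ell"
proof -
  obtain C where C: "\<And>c d s. c \<in> cball c0 \<rho> \<Longrightarrow> d \<in> cball c0 \<rho> \<Longrightarrow> norm (sol c s - sol d s) \<le> C * norm (c - d)"
    using sol_lipschitz by blast
  have lip: "norm (ell c - ell d) \<le> (\<kappa> * C) * norm (c - d)" if c: "c \<in> cball c0 \<rho>" and d: "d \<in> cball c0 \<rho>" for c d
  proof -
    have e: "ell c - ell d = of_real \<kappa> * (LINT t|lborel. of_real (\<eta>2 t) * (sol c t - sol d t))"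
      unfolding ell_def using weight_integrable[OF weights(2) sol_cont[OF c]] weight_integrable[OF weights(2) sol_cont[OF d]]
      by (simp add: right_diff_distrib)
    have "norm (ell c - ell d) = \<kappa> * norm (LINT t|lborel. of_real (\<eta>2 t) * (sol c t - sol d t))"
      unfolding e using \<kappa>_pos by (simp add: norm_mult)
    also have "\<dots> \<le> \<kappa> * (C * norm (c - d))"
      using \<kappa>_pos by (intro mult_left_mono average_bound weights mass continuous_on_diff sol_cont c d C) auto
    finally show ?thesis by simp
  qed
  show ?thesis
  proof (rule continuous_onI)
    fix x and e :: real assume x: "x \<in> cball c0 \<rho>" and e: "0 < e"
    define k where "k = \<bar>\<kappa> * C\<bar> + 1"
    have k: "k > 0" "\<kappa> * C \<le> k" by (auto simp: k_def)
    show "\<exists>d>0. \<forall>x'\<in>cball c0 \<rho>. dist x' x < d \<longrightarrow> dist (ell x') (ell x) \<le> e"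
    proof (intro exI[of _ "e / k"] conjI ballI impI)
      fix y assume y: "y \<in> cball c0 \<rho>" "dist y x < e / k"
      have "dist (ell y) (ell x) \<le> (\<kappa> * C) * norm (y - x)" unfolding dist_norm by (rule lip[OF y(1) x])
      also have "\<dots> \<le> k * (e / k)" using y(2) k by (intro mult_mono) (auto simp: dist_norm)
      finally show "dist (ell y) (ell x) \<le> e" using k by simp
    qed (use e k in auto)
  qed
qed

text \<open>
  The solution of the limit problem: \<open>z1 y1 = - G\<close> on the first bump and \<open>z2 y2 = G y1\<close> on the
  second, where \<open>y2\<close> includes the weight \<open>\<kappa>\<close>. The constants \<open>Y1\<close>, \<open>Y2\<close> bound it, and \<open>D1\<close>, \<open>D2\<close> will
  bound its distance from the exact solution.
\<close>

definition z1 :: "complex \<Rightarrow> complex" where "z1 c = of_real (m + \<phi>) - c"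
definition z2 :: "complex \<Rightarrow> complex" where "z2 c = of_real (m - \<phi>) - c"
definition y1 :: "complex \<Rightarrow> complex" where "y1 c = - of_real G / z1 c"
definition y2 :: "complex \<Rightarrow> complex" where "y2 c = of_real G * y1 c / z2 c"
definition Y1 :: real where "Y1 = G / (2 * \<delta>)"
definition Y2 :: real where "Y2 = G * Y1 / (2 * \<delta>)"
definition D1 :: real where "D1 = tol * (Y1 + \<kappa> * Nf) / \<delta>"
definition D2 :: real where "D2 = (tol * Nf + G * D1 + tol * Y2) / \<delta>"

lemma z_lower:
  assumes c: "c \<in> cball c0 \<rho>" shows "2 * \<delta> \<le> norm (z1 c)" "2 * \<delta> \<le> norm (z2 c)"
proof -
  have "2 * \<delta> \<le> Re (z1 c)" "2 * \<delta> \<le> - Re (z2 c)"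
    using Re_ball[OF c] \<phi>_eq unfolding z1_def z2_def minus_complex.sel Re_complex_of_real by linarith+
  then show "2 * \<delta> \<le> norm (z1 c)" "2 * \<delta> \<le> norm (z2 c)"
    using complex_Re_le_cmod[of "z1 c"] abs_Re_le_cmod[of "z2 c"] by linarith+
qed

lemma z_nonzero: assumes "c \<in> cball c0 \<rho>" shows "z1 c \<noteq> 0" "z2 c \<noteq> 0"
  using z_lower[OF assms] \<delta>_pos by auto

lemma y1_le: assumes c: "c \<in> cball c0 \<rho>" shows "norm (y1 c) \<le> Y1"
  using z_lower(1)[OF c] \<delta>_pos G_pos unfolding y1_def Y1_def norm_divide by (auto intro!: frac_le)

lemma y2_le: assumes c: "c \<in> cball c0 \<rho>" shows "norm (y2 c) \<le> Y2"
  using z_lower(2)[OF c] \<delta>_pos G_pos y1_le[OF c] order_trans[OF norm_ge_zero y1_le[OF c]]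
  unfolding y2_def Y2_def norm_divide norm_mult
  by (auto intro!: frac_le mult_left_mono mult_nonneg_nonneg)

lemma nonneg_consts: "0 \<le> Nf" "0 \<le> Y1" "0 \<le> Y2" "0 \<le> D1" "0 \<le> D2"
proof -
  show n: "0 \<le> Nf" "0 \<le> Y1" using G_pos \<delta>_pos by (auto simp: Nf_def Y1_def)
  then show y: "0 \<le> Y2" using G_pos \<delta>_pos by (auto simp: Y2_def)
  show d: "0 \<le> D1" using n \<kappa>_pos \<delta>_pos params by (auto simp: D1_def)
  then show "0 \<le> D2" using n y G_pos \<delta>_pos params by (auto simp: D2_def)
qed

lemma chi_L: "\<chi>1 s \<noteq> 0 \<Longrightarrow> \<bar>s\<bar> \<le> L" "\<chi>2 s \<noteq> 0 \<Longrightarrow> \<bar>s\<bar> \<le> L"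
  using vanish(3,4) by (auto simp: vanishes_beyond_def not_less[symmetric])

text \<open>
  The difference \<open>sol c - y1 c\<close> solves the equation of the first bump with a source of order \<open>tol\<close>, and
  the maximum principle applies to it; in the same way for the second bump below.
\<close>

lemma sol_near_y1:
  assumes c: "c \<in> cball c0 \<rho>" and s: "\<eta>1 s \<noteq> 0"
  shows "norm (sol c s - y1 c) \<le> D1"
proof -
  obtain B1 where B1: "0 \<le> B1" "\<And>s. \<bar>s\<bar> \<le> L \<Longrightarrow> M \<eta>1 s \<le> B1" using M_bounded[OF weights(1)] by metis
  show ?thesis
  unfolding D1_def
proof (rule weighted_maximum_principle[where S = "{s. \<eta>1 s \<noteq> 0}" and M = "M \<eta>1" and ?N0.0 = "Nf + Y1" and Mmax = B1 and f = "\<lambda>s. sol c s - y1 c"])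
  show "norm (sol c t - y1 c) \<le> Nf + Y1" for t
    by (rule order_trans[OF norm_triangle_ineq4 add_mono[OF sol_norm[OF c] y1_le[OF c]]])
  show "M \<eta>1 t \<le> B1" if "t \<in> {s. \<eta>1 s \<noteq> 0}" for t
    using that one(1)[of t] chi_L(1)[of t] B1(2)[of t] by simp
  show "norm (sol c t - y1 c) * (M \<eta>1 t + \<delta>) \<le> M \<eta>1 t * N + tol * (Y1 + \<kappa> * Nf)"
    if N: "\<And>t. t \<in> {s. \<eta>1 s \<noteq> 0} \<Longrightarrow> norm (sol c t - y1 c) \<le> N" and t: "t \<in> {s. \<eta>1 s \<noteq> 0}" for N t
  proof -
    have x1: "\<chi>1 t = 1" using one(1) t by simp
    have x2: "\<chi>2 t = 0" using disj[of t] x1 by simp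
    let ?l = "LINT t|lborel. of_real (\<eta>2 t) * sol c t"
    let ?E = "pot \<eta>2 (sol c) t - of_real G * ?l"
    have eq: "den c t * sol c t = pot \<eta>1 (sol c) t - of_real \<kappa> * ?E - of_real G"
      unfolding sol_eq[OF c] num_def by (simp add: x1 x2 algebra_simps)
    have p: "pot \<eta>1 (\<lambda>t. sol c t - y1 c) t = pot \<eta>1 (sol c) t - y1 c * of_real (M \<eta>1 t)"
      using pot_diff[OF weights(1) sol_cont[OF c] continuous_on_const, of "y1 c" t] pot_cmult[of \<eta>1 "y1 c" "\<lambda>_. 1" t]
      by (simp add: M_pot)
    have g: "y1 c * z1 c = - of_real G" using z_nonzero(1)[OF c] by (simp add: y1_def)
    have "den c t * (sol c t - y1 c) = pot \<eta>1 (\<lambda>t. sol c t - y1 c) t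
        - (of_real (\<Omega> t - M \<eta>1 t - (m + \<phi>)) * y1 c + of_real \<kappa> * ?E)"
    proof -
      have "den c t * y1 c = of_real (\<Omega> t - M \<eta>1 t - (m + \<phi>)) * y1 c + of_real (M \<eta>1 t) * y1 c + y1 c * z1 c"
        by (simp add: den_def z1_def algebra_simps)
      then show ?thesis unfolding g right_diff_distrib[of "den c t"] eq p by (simp add: mult.commute)
    qed
    then have "norm (den c t * (sol c t - y1 c)) \<le> norm (pot \<eta>1 (\<lambda>t. sol c t - y1 c) t)
        + norm (of_real (\<Omega> t - M \<eta>1 t - (m + \<phi>)) * y1 c + of_real \<kappa> * ?E)"
      by (simp only: norm_triangle_ineq4)
    also have "norm (pot \<eta>1 (\<lambda>t. sol c t - y1 c) t) \<le> M \<eta>1 t * N"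
      by (rule pot_bound[OF weights(1)]) (use N in \<open>auto intro!: continuous_on_diff sol_cont c\<close>)
    also have "norm (of_real (\<Omega> t - M \<eta>1 t - (m + \<phi>)) * y1 c + of_real \<kappa> * ?E) \<le> tol * Y1 + \<kappa> * (tol * Nf)"
    proof (rule norm_triangle_mono)
      show "norm (of_real (\<Omega> t - M \<eta>1 t - (m + \<phi>)) * y1 c) \<le> tol * Y1"
        unfolding norm_mult norm_of_real using near1'[of t] x1 params y1_le[OF c] by (intro mult_mono) auto
      show "norm (of_real \<kappa> * ?E) \<le> \<kappa> * (tol * Nf)"
        unfolding norm_mult norm_of_real
        using cross_bound[OF weights(2) mass(2) sol_cont[OF c] sol_norm[OF c], of t] cross12[of t] x1 \<kappa>_pos
        by (auto simp: K_def intro!: mult_left_mono)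
    qed
    finally have "norm (den c t * (sol c t - y1 c)) \<le> M \<eta>1 t * N + tol * (Y1 + \<kappa> * Nf)"
      by (simp add: algebra_simps)
    moreover have "norm (sol c t - y1 c) * (M \<eta>1 t + \<delta>) \<le> norm (sol c t - y1 c) * norm (den c t)"
      using den_lower1[OF c, of t] x1 by (intro mult_left_mono) auto
    ultimately show ?thesis unfolding den_norm by linarith
  qed
qed (use s \<delta>_pos M_nonneg[OF weights(1)] nonneg_consts \<kappa>_pos params in auto)
qed

lemma sol_near_y2:
  assumes c: "c \<in> cball c0 \<rho>" and s: "\<eta>2 s \<noteq> 0"
  shows "norm (of_real \<kappa> * sol c s - y2 c) \<le> D2"
proof -
  obtain B1 where B1: "0 \<le> B1" "\<And>s. \<bar>s\<bar> \<le> L \<Longrightarrow> M \<eta>2 s \<le> B1" using M_bounded[OF weights(2)] by metis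
  show ?thesis
  unfolding D2_def
proof (rule weighted_maximum_principle[where S = "{s. \<eta>2 s \<noteq> 0}" and M = "M \<eta>2" and ?N0.0 = "\<kappa> * Nf + Y2" and Mmax = B1 and f = "\<lambda>s. of_real \<kappa> * sol c s - y2 c"])
  show "norm (of_real \<kappa> * sol c t - y2 c) \<le> \<kappa> * Nf + Y2" for t
    using order_trans[OF norm_triangle_ineq4 add_mono[OF _ y2_le[OF c]], of "of_real \<kappa> * sol c t" "\<kappa> * Nf"]
      sol_norm[OF c, of t] \<kappa>_pos by (simp add: norm_mult)
  show "M \<eta>2 t \<le> B1" if "t \<in> {s. \<eta>2 s \<noteq> 0}" for t
    using that one(2)[of t] chi_L(2)[of t] B1(2)[of t] by simp
  show "norm (of_real \<kappa> * sol c t - y2 c) * (M \<eta>2 t + \<delta>) \<le> M \<eta>2 t * N + (tol * Nf + G * D1 + tol * Y2)"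
    if N: "\<And>t. t \<in> {s. \<eta>2 s \<noteq> 0} \<Longrightarrow> norm (of_real \<kappa> * sol c t - y2 c) \<le> N" and t: "t \<in> {s. \<eta>2 s \<noteq> 0}" for N t
  proof -
    have x2: "\<chi>2 t = 1" using one(2) t by simp
    have x1: "\<chi>1 t = 0" using disj[of t] x2 by simp
    let ?l = "LINT t|lborel. of_real (\<eta>1 t) * sol c t"
    let ?f2 = "\<lambda>t. of_real \<kappa> * sol c t"
    have f2c: "continuous_on UNIV ?f2" by (intro continuous_intros sol_cont c)
    have eq: "den c t * ?f2 t = pot \<eta>1 (sol c) t - pot \<eta>2 ?f2 t"
    proof -
      have "den c t * ?f2 t = of_real \<kappa> * (den c t * sol c t)" by simp
      then show ?thesis unfolding sol_eq[OF c] num_def pot_cmult using \<kappa>_pos by (simp add: x1 x2)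
    qed
    have p: "pot \<eta>2 (\<lambda>t. ?f2 t - y2 c) t = pot \<eta>2 ?f2 t - y2 c * of_real (M \<eta>2 t)"
      using pot_diff[OF weights(2) f2c continuous_on_const, of "y2 c" t] pot_cmult[of \<eta>2 "y2 c" "\<lambda>_. 1" t]
      by (simp add: M_pot)
    have g: "y2 c * z2 c = of_real G * y1 c" using z_nonzero(2)[OF c] by (simp add: y2_def)
    let ?E = "pot \<eta>1 (sol c) t - of_real G * ?l"
    have l: "?l - y1 c = (LINT t|lborel. of_real (\<eta>1 t) * (sol c t - y1 c))"
    proof -
      have "(LINT t|lborel. of_real (\<eta>1 t) * (sol c t - y1 c)) = ?l - (LINT t|lborel. of_real (\<eta>1 t) * y1 c)"
        unfolding right_diff_distrib using weight_integrable[OF weights(1) sol_cont[OF c]]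
          weight_integrable[OF weights(1) continuous_on_const[of _ "y1 c"]] by (rule Bochner_Integration.integral_diff)
      also have "(LINT t|lborel. of_real (\<eta>1 t) * y1 c) = y1 c"
        using mass(1) by simp
      finally show ?thesis ..
    qed
    have "den c t * (?f2 t - y2 c) = - pot \<eta>2 (\<lambda>t. ?f2 t - y2 c) t
        + (?E + of_real G * (?l - y1 c) - of_real (\<Omega> t + M \<eta>2 t - (m - \<phi>)) * y2 c)"
    proof -
      have "den c t * y2 c = of_real (\<Omega> t + M \<eta>2 t - (m - \<phi>)) * y2 c - of_real (M \<eta>2 t) * y2 c + y2 c * z2 c"
        by (simp add: den_def z2_def algebra_simps)
      then show ?thesis unfolding g right_diff_distrib[of "den c t"] eq p by (simp add: algebra_simps)
    qed
    then have "norm (den c t * (?f2 t - y2 c)) \<le> norm (pot \<eta>2 (\<lambda>t. ?f2 t - y2 c) t)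
        + (norm ?E + norm (of_real G * (?l - y1 c)) + norm (of_real (\<Omega> t + M \<eta>2 t - (m - \<phi>)) * y2 c))"
      by (smt (verit) norm_minus_cancel norm_triangle_ineq norm_triangle_ineq4)
    also have "norm (pot \<eta>2 (\<lambda>t. ?f2 t - y2 c) t) \<le> M \<eta>2 t * N"
      by (rule pot_bound[OF weights(2)]) (use N f2c in \<open>auto intro!: continuous_on_diff\<close>)
    also have "norm ?E \<le> tol * Nf"
      using cross_bound[OF weights(1) mass(1) sol_cont[OF c] sol_norm[OF c], of t] cross21[of t] x2 by (auto simp: K_def)
    also have "norm (of_real G * (?l - y1 c)) \<le> G * D1"
      unfolding norm_mult l norm_of_real using G_pos
      by (simp, intro average_bound[OF weights(1) mass(1)] sol_near_y1[OF c]) (auto intro!: continuous_on_diff sol_cont c)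
    also have "norm (of_real (\<Omega> t + M \<eta>2 t - (m - \<phi>)) * y2 c) \<le> tol * Y2"
      unfolding norm_mult norm_of_real using near2'[of t] x2 params y2_le[OF c] by (intro mult_mono) auto
    finally have "norm (den c t * (?f2 t - y2 c)) \<le> M \<eta>2 t * N + (tol * Nf + G * D1 + tol * Y2)" by simp
    moreover have "norm (?f2 t - y2 c) * (M \<eta>2 t + \<delta>) \<le> norm (?f2 t - y2 c) * norm (den c t)"
      using den_lower2[OF c, of t] x2 by (intro mult_left_mono) auto
    ultimately show ?thesis unfolding den_norm by linarith
  qed
qed (use s \<delta>_pos M_nonneg[OF weights(2)] nonneg_consts G_pos params in auto)
qed

lemma ell_near_y2: assumes c: "c \<in> cball c0 \<rho>" shows "norm (ell c - y2 c) \<le> D2"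
proof -
  have "ell c - y2 c = (LINT t|lborel. of_real (\<eta>2 t) * (of_real \<kappa> * sol c t)) - (LINT t|lborel. of_real (\<eta>2 t) * y2 c)"
    unfolding ell_def using mass(2) by (simp add: mult.left_commute flip: integral_mult_right_zero)
  also have "\<dots> = (LINT t|lborel. of_real (\<eta>2 t) * (of_real \<kappa> * sol c t) - of_real (\<eta>2 t) * y2 c)"
    by (intro Bochner_Integration.integral_diff[symmetric] weight_integrable weights continuous_intros sol_cont c)
  finally have e: "ell c - y2 c = (LINT t|lborel. of_real (\<eta>2 t) * (of_real \<kappa> * sol c t - y2 c))"
    by (simp only: right_diff_distrib)
  show ?thesis unfolding e
    by (intro average_bound weights mass sol_near_y2 c continuous_intros sol_cont)
qed

text \<open>
  It remains to solve \<open>ell c = 1\<close>. In the limit problem \<open>ell\<close> is \<open>- G\<^sup>2 / (z1 z2)\<close> with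
  \<open>z1 z2 = (m - c)\<^sup>2 - \<phi>\<^sup>2\<close>. With \<open>E = - ell z1 z2 / G\<^sup>2\<close>, which is close to \<open>1\<close>, the equation becomes
  \<open>(m - c)\<^sup>2 = \<phi>\<^sup>2 - G\<^sup>2 E\<close>, that is \<open>c = m - i sqrt (G\<^sup>2 E - \<phi>\<^sup>2)\<close>. The right-hand side is a continuous
  map of the disc around \<open>c0\<close> into itself, and Brouwer's theorem gives a fixed point.
\<close>

lemma eigenfunction_exists:
  assumes \<nu>: "\<And>z. norm (z - 1) \<le> \<nu> \<Longrightarrow> 0 < Re (of_real (G\<^sup>2) * z - of_real (\<phi>\<^sup>2)) \<and>
       norm (csqrt (of_real (G\<^sup>2) * z - of_real (\<phi>\<^sup>2)) - of_real \<omega>) \<le> \<rho>"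
    and small: "9 * D2 \<le> \<nu>"
  obtains c w where "Im c < 0" "\<And>k. Ck k w" "\<And>s. \<eta>1 s = 0 \<Longrightarrow> \<eta>2 s = 0 \<Longrightarrow> w s = 0" "\<exists>s. w s \<noteq> 0"
    "\<And>s. (of_real (\<Omega> s) - c) * w s = of_real (\<eta>1 s - \<eta>2 s) * (LINT t|lborel. of_real (K s t) * w t)"
proof -
  define E where "E c = - ell c * (z1 c * z2 c) / of_real (G\<^sup>2)" for c
  have z_upper: "norm (z1 c) \<le> 3 * G" "norm (z2 c) \<le> 3 * G" if c: "c \<in> cball c0 \<rho>" for c
  proof -
    have "norm (of_real m - c) \<le> norm (of_real m - c0) + norm (c0 - c)"
      using norm_triangle_ineq[of "of_real m - c0" "c0 - c"] by simp
    also have "norm (of_real m - c0) = \<omega>" using \<omega>_pos by (simp add: c0_def complex_eq_iff cmod_def)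
    also have "norm (c0 - c) \<le> G" using c params by (auto simp: dist_norm \<rho>_def)
    finally have b: "norm (of_real m - c) \<le> 2 * G" using \<omega>_le by simp
    have "z1 c = of_real \<phi> + (of_real m - c)" "z2 c = (of_real m - c) - of_real \<phi>" by (auto simp: z1_def z2_def)
    then show "norm (z1 c) \<le> 3 * G" "norm (z2 c) \<le> 3 * G"
      using norm_triangle_ineq[of "of_real \<phi>" "of_real m - c"] norm_triangle_ineq4[of "of_real m - c" "of_real \<phi>"] b params
      by auto
  qed
  have E_near: "norm (E c - 1) \<le> \<nu>" if c: "c \<in> cball c0 \<rho>" for c
  proof -
    have "y2 c * (z1 c * z2 c) = - of_real (G\<^sup>2)"
      using z_nonzero[OF c] by (simp add: y2_def y1_def power2_eq_square)
    then have "E c - 1 = - (ell c - y2 c) * (z1 c * z2 c) / of_real (G\<^sup>2)"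
      using G_pos by (simp add: E_def field_simps)
    then have "norm (E c - 1) = norm (ell c - y2 c) * (norm (z1 c) * norm (z2 c)) / G\<^sup>2"
      by (simp add: norm_mult norm_divide norm_power norm_minus_commute)
    also have "\<dots> \<le> D2 * ((3 * G) * (3 * G)) / G\<^sup>2"
      using G_pos nonneg_consts by (intro divide_right_mono mult_mono ell_near_y2 z_upper c) auto
    also have "\<dots> = 9 * D2" using G_pos by (simp add: power2_eq_square)
    finally show ?thesis using small by linarith
  qed
  define F where "F c = of_real m - \<i> * csqrt (of_real (G\<^sup>2) * E c - of_real (\<phi>\<^sup>2))" for c
  have Fc: "continuous_on (cball c0 \<rho>) F"
  proof -
    have 1: "continuous_on (cball c0 \<rho>) (\<lambda>c. of_real (G\<^sup>2) * E c - of_real (\<phi>\<^sup>2))"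
      unfolding E_def z1_def z2_def using G_pos by (intro continuous_intros ell_cont) auto
    have 2: "(\<lambda>c. of_real (G\<^sup>2) * E c - of_real (\<phi>\<^sup>2)) ` cball c0 \<rho> \<subseteq> - \<real>\<^sub>\<le>\<^sub>0"
      using \<nu>[OF E_near] by (force simp: complex_nonpos_Reals_iff)
    show ?thesis unfolding F_def
      by (intro continuous_on_diff continuous_on_mult continuous_on_const continuous_on_compose2[OF continuous_on_csqrt 1 2])
  qed
  have Fm: "F \<in> cball c0 \<rho> \<rightarrow> cball c0 \<rho>"
  proof (intro Pi_I)
    fix c assume c: "c \<in> cball c0 \<rho>"
    have "c0 = of_real m - \<i> * of_real \<omega>" by (simp add: c0_def complex_eq_iff)
    then have "c0 - F c = \<i> * (csqrt (of_real (G\<^sup>2) * E c - of_real (\<phi>\<^sup>2)) - of_real \<omega>)"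
      by (simp add: F_def algebra_simps)
    then have "norm (c0 - F c) = norm (csqrt (of_real (G\<^sup>2) * E c - of_real (\<phi>\<^sup>2)) - of_real \<omega>)"
      by (simp add: norm_mult)
    then show "F c \<in> cball c0 \<rho>" using \<nu>[OF E_near[OF c]] by (simp add: dist_norm)
  qed
  obtain c where c: "c \<in> cball c0 \<rho>" "F c = c" by (rule brouwer_ball[OF \<rho>_pos Fc Fm])
  have "ell c = 1"
  proof -
    have "(of_real m - c) ^ 2 = (\<i> * csqrt (of_real (G\<^sup>2) * E c - of_real (\<phi>\<^sup>2)))\<^sup>2"
      using c(2) by (simp add: F_def algebra_simps)
    also have "\<dots> = - (of_real (G\<^sup>2) * E c - of_real (\<phi>\<^sup>2))" by (simp add: power_mult_distrib)
    finally have "of_real (G\<^sup>2) * E c = - ((of_real m - c)\<^sup>2 - of_real (\<phi>\<^sup>2))" by simp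
    also have "(of_real m - c)\<^sup>2 - of_real (\<phi>\<^sup>2) = z1 c * z2 c"
      by (simp add: z1_def z2_def power2_eq_square algebra_simps)
    also have "of_real (G\<^sup>2) * E c = - ell c * (z1 c * z2 c)" using G_pos by (simp add: E_def)
    finally show ?thesis using z_nonzero[OF c(1)] by simp
  qed
  then have ell1: "of_real \<kappa> * (LINT t|lborel. of_real (\<eta>2 t) * sol c t) = 1" by (simp add: ell_def)
  \<comment> \<open>On the second bump the factor \<open>- \<kappa>\<close> agrees with the sign of \<open>p\<close> there.\<close>
  define w where "w s = of_real (\<eta>1 s - \<kappa> * \<eta>2 s) * sol c s" for s
  have e12: "\<eta>1 s = 0 \<or> \<eta>2 s = 0" for s using one[of s] disj[of s] by fastforce
  have Kw: "(LINT t|lborel. of_real (K s t) * w t) = pot \<eta>1 (sol c) s - of_real \<kappa> * pot \<eta>2 (sol c) s" for s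
  proof -
    have "(LINT t|lborel. of_real (K s t) * w t)
       = (LINT t|lborel. of_real (K s t * \<eta>1 t) * sol c t - of_real \<kappa> * (of_real (K s t * \<eta>2 t) * sol c t))"
      by (intro Bochner_Integration.integral_cong refl) (simp add: w_def algebra_simps)
    also have "\<dots> = pot \<eta>1 (sol c) s - of_real \<kappa> * pot \<eta>2 (sol c) s"
      unfolding pot_def using pot_integrable[OF weights(1) sol_cont[OF c(1)]] pot_integrable[OF weights(2) sol_cont[OF c(1)]]
      by (subst Bochner_Integration.integral_diff) (auto simp del: of_real_mult)
    finally show ?thesis .
  qed
  show thesis
  proof (rule that[of c w])
    show "Im c < 0" using Im_ball[OF c(1)] \<omega>_pos by linarith
    show "Ck k w" for k unfolding w_def
      by (intro Ck_mult Ck_of_real Ck_diff Ck_const smooth sol_Ck c)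
    show "w s = 0" if "\<eta>1 s = 0" "\<eta>2 s = 0" for s using that by (simp add: w_def)
    show "\<exists>s. w s \<noteq> 0"
    proof (rule ccontr)
      assume "\<not> (\<exists>s. w s \<noteq> 0)"
      then have w0: "w s = 0" for s by blast
      have z: "of_real (\<eta>2 s) * sol c s = 0" for s
        using e12[of s] w0[of s] \<kappa>_pos by (cases "\<eta>2 s = 0") (simp_all add: w_def)
      show False using ell1 unfolding z by simp
    qed
    show "(of_real (\<Omega> s) - c) * w s = of_real (\<eta>1 s - \<eta>2 s) * (LINT t|lborel. of_real (K s t) * w t)" for s
    proof -
      have eq: "den c s * sol c s = num (sol c) s - of_real (\<chi>1 s * G)" by (rule sol_eq[OF c(1)])
      consider "\<eta>1 s \<noteq> 0" | "\<eta>2 s \<noteq> 0" | "\<eta>1 s = 0" "\<eta>2 s = 0" by auto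
      then show ?thesis
      proof cases
        case 1
        have x: "\<chi>1 s = 1" "\<chi>2 s = 0" "\<eta>2 s = 0" using one(1)[OF 1] disj[of s] e12[of s] 1 by auto
        have "num (sol c) s = (LINT t|lborel. of_real (K s t) * w t) + of_real G * (of_real \<kappa> * (LINT t|lborel. of_real (\<eta>2 t) * sol c t))"
          unfolding Kw num_def by (simp add: x)
        then have "den c s * sol c s = (LINT t|lborel. of_real (K s t) * w t)" unfolding eq ell1 by (simp add: x)
        then show ?thesis by (simp add: w_def x flip: den_def)
      next
        case 2
        have x: "\<chi>2 s = 1" "\<chi>1 s = 0" "\<eta>1 s = 0" using one(2)[OF 2] disj[of s] e12[of s] 2 by auto
        have "of_real \<kappa> * num (sol c) s = (LINT t|lborel. of_real (K s t) * w t)"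
          unfolding Kw num_def using \<kappa>_pos by (simp add: x)
        then have "of_real \<kappa> * (den c s * sol c s) = (LINT t|lborel. of_real (K s t) * w t)" unfolding eq by (simp add: x)
        then show ?thesis by (simp add: w_def x flip: den_def) (simp add: mult_ac)
      next
        case 3 then show ?thesis by (simp add: w_def)
      qed
    qed
  qed
qed

lemma D2_eq: "D2 = tol * err_const \<phi> G"
proof -
  have "D2 = tol * ((Nf + G * ((Y1 + \<kappa> * Nf) / \<delta>) + Y2) / \<delta>)"
    unfolding D2_def D1_def by (simp add: add_divide_distrib distrib_left mult.left_commute)
  then show ?thesis
    unfolding err_const_def Let_def Nf_def Y1_def Y2_def \<kappa>_def \<delta>_def .
qed

end

section \<open>Existence of an unstable profile\<close>

text \<open>
  The principal square root is continuous at the positive number \<open>G\<^sup>2 - \<phi>\<^sup>2\<close>.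
\<close>

lemma csqrt_perturbation:
  assumes "0 < \<phi>" "\<phi> < G"
  defines "\<omega> \<equiv> sqrt (G\<^sup>2 - \<phi>\<^sup>2)"
  assumes "0 < \<rho>"
  obtains \<nu> where "0 < \<nu>" "\<And>z. norm (z - 1) \<le> \<nu> \<Longrightarrow> 0 < Re (of_real (G\<^sup>2) * z - of_real (\<phi>\<^sup>2)) \<and>
       norm (csqrt (of_real (G\<^sup>2) * z - of_real (\<phi>\<^sup>2)) - of_real \<omega>) \<le> \<rho>"
proof -
  let ?h = "\<lambda>z::complex. of_real (G\<^sup>2) * z - of_real (\<phi>\<^sup>2)"
  have lt: "\<phi>\<^sup>2 < G\<^sup>2" using assms(1,2) by (simp add: power_strict_mono)
  have h1: "?h 1 = of_real (G\<^sup>2 - \<phi>\<^sup>2)" by simp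
  have pos: "0 < Re (?h 1)" unfolding h1 using lt by simp
  have val: "csqrt (?h 1) = of_real \<omega>"
    unfolding h1 \<omega>_def using lt by (simp add: csqrt_of_real_nonneg)
  have ch: "isCont ?h 1" by (intro continuous_intros)
  have "isCont csqrt (?h 1)"
    by (rule continuous_at_csqrt) (use pos in \<open>auto simp: complex_nonpos_Reals_iff\<close>)
  then have cs: "isCont (\<lambda>z. csqrt (?h z)) 1" by (rule isCont_o2[OF ch])
  have ch': "(?h \<longlongrightarrow> ?h 1) (nhds 1)"
    using ch tendsto_at_iff_tendsto_nhds[of ?h 1] unfolding isCont_def by blast
  have cs': "((\<lambda>z. csqrt (?h z)) \<longlongrightarrow> csqrt (?h 1)) (nhds 1)"
    using cs tendsto_at_iff_tendsto_nhds[of "\<lambda>z. csqrt (?h z)" 1] unfolding isCont_def by blast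
  have "((\<lambda>z. Re (?h z)) \<longlongrightarrow> Re (?h 1)) (nhds 1)"
    by (rule tendsto_Re[OF ch'])
  then have e1: "\<forall>\<^sub>F z in nhds 1. 0 < Re (?h z)" using pos by (rule order_tendstoD(1))
  have "((\<lambda>z. norm (csqrt (?h z) - of_real \<omega>)) \<longlongrightarrow> norm (csqrt (?h 1) - of_real \<omega>)) (nhds 1)"
    by (intro tendsto_norm tendsto_diff tendsto_const cs')
  then have e2: "\<forall>\<^sub>F z in nhds 1. norm (csqrt (?h z) - of_real \<omega>) < \<rho>"
    by (rule order_tendstoD(2)) (unfold val, use assms(4) in simp)
  obtain d where d: "d > 0" "\<And>z. dist z 1 < d \<Longrightarrow> 0 < Re (?h z) \<and> norm (csqrt (?h z) - of_real \<omega>) < \<rho>"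
    using eventually_conj[OF e1 e2] unfolding eventually_nhds_metric by blast
  show thesis
  proof (rule that[of "d / 2"])
    fix z :: complex assume "norm (z - 1) \<le> d / 2"
    then have "dist z 1 < d" using d(1) by (simp add: dist_norm)
    from d(2)[OF this] show "0 < Re (?h z) \<and> norm (csqrt (?h z) - of_real \<omega>) \<le> \<rho>" by simp
  qed (use d in simp)
qed

lemma shifted_kernel_near:
  fixes h :: "real \<Rightarrow> real"
  assumes "isCont h (s0 - t0)" "0 < e"
  obtains d where "0 < d" "\<And>s t. \<bar>s - s0\<bar> < d \<Longrightarrow> \<bar>t - t0\<bar> < d \<Longrightarrow>
    \<bar>exp (- a * s) * exp (- a * t) * h (s - t) - exp (- a * s0) * exp (- a * t0) * h (s0 - t0)\<bar> < e"
proof -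
  let ?F = "\<lambda>z. exp (- a * fst z) * exp (- a * snd z) * h (fst z - snd z)"
  have "isCont (\<lambda>z::real \<times> real. h (fst z - snd z)) (s0, t0)"
    by (rule isCont_o2[of "(s0,t0)" "\<lambda>z. fst z - snd z" h]) (use assms in \<open>auto intro!: continuous_intros\<close>)
  then have "isCont ?F (s0, t0)" by (intro continuous_intros)
  then obtain d where d: "d > 0" "\<And>z. dist z (s0, t0) < d \<Longrightarrow> dist (?F z) (?F (s0, t0)) < e"
    using assms(2) unfolding continuous_at_eps_delta by blast
  show thesis
  proof (rule that[of "d / 2"])
    fix s t assume "\<bar>s - s0\<bar> < d / 2" "\<bar>t - t0\<bar> < d / 2"
    then have "dist (s, t) (s0, t0) < d"
      using sqrt_sum_squares_le_sum_abs[of "s - s0" "t - t0"] by (simp add: dist_prod_def dist_real_def)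
    from d(2)[OF this] show "\<bar>exp (- a * s) * exp (- a * t) * h (s - t) - exp (- a * s0) * exp (- a * t0) * h (s0 - t0)\<bar> < e"
      by (simp add: dist_real_def)
  qed (use d in simp)
qed

lemma integral_average_near:
  fixes F \<eta> :: "real \<Rightarrow> real"
  assumes "integrable lborel (\<lambda>t. F t * \<eta> t)" "integrable lborel \<eta>" "(LINT t|lborel. \<eta> t) = 1"
    "\<And>t. 0 \<le> \<eta> t" "\<And>t. \<eta> t \<noteq> 0 \<Longrightarrow> \<bar>F t - F0\<bar> \<le> e"
  shows "\<bar>(LINT t|lborel. F t * \<eta> t) - F0\<bar> \<le> e"
proof -
  have "(LINT t|lborel. F t * \<eta> t) - F0 = (LINT t|lborel. F t * \<eta> t - F0 * \<eta> t)"
    using assms(1-3) by (simp add: Bochner_Integration.integral_diff)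
  also have "\<bar>\<dots>\<bar> \<le> (LINT t|lborel. \<bar>F t * \<eta> t - F0 * \<eta> t\<bar>)"
    using integral_norm_bound[of lborel "\<lambda>t. F t * \<eta> t - F0 * \<eta> t"] by simp
  also have "\<dots> \<le> (LINT t|lborel. e * \<eta> t)"
  proof (rule integral_mono)
    show "integrable lborel (\<lambda>t. \<bar>F t * \<eta> t - F0 * \<eta> t\<bar>)"
      by (intro integrable_abs Bochner_Integration.integrable_diff integrable_mult_right assms)
    show "integrable lborel (\<lambda>t. e * \<eta> t)" by (intro integrable_mult_right assms)
    fix t
    have "\<bar>F t * \<eta> t - F0 * \<eta> t\<bar> = \<bar>F t - F0\<bar> * \<eta> t"
      using assms(4)[of t] by (simp flip: left_diff_distrib add: abs_mult)
    also have "\<dots> \<le> e * \<eta> t" using assms(4,5)[of t] by (cases "\<eta> t = 0") (auto intro!: mult_right_mono)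
    finally show "\<bar>F t * \<eta> t - F0 * \<eta> t\<bar> \<le> e * \<eta> t" .
  qed
  finally show ?thesis using assms(3) by simp
qed

lemma integrable_kernel_product:
  fixes h \<eta> :: "real \<Rightarrow> real"
  assumes "integrable lborel h" "continuous_on UNIV \<eta>" "vanishes_beyond L \<eta>"
  shows "integrable lborel (\<lambda>t. exp (- a * s) * exp (- a * t) * h (s - t) * \<eta> t)"
proof -
  let ?g = "\<lambda>t. complex_of_real (exp (- a * t) * \<eta> t)"
  have c: "continuous_on UNIV ?g" using assms by (intro continuous_intros)
  have v: "vanishes_beyond L ?g" using assms by (auto simp: vanishes_beyond_def)
  obtain N where N: "\<And>t. norm (?g t) \<le> N" using vanishes_beyond_bounded[OF c v] by metis
  have "integrable lborel (\<lambda>t. Re (h (s - t) *\<^sub>R ?g t))"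
    by (intro integrable_Re conv_flip_integrable[THEN iffD1] conv_integrable[OF assms(1) c N])
  then have "integrable lborel (\<lambda>t. exp (- a * s) * Re (h (s - t) *\<^sub>R ?g t))" by (rule integrable_mult_right)
  then show ?thesis by (simp add: mult_ac)
qed

lemma Ck_kernel_potential:
  fixes h \<eta> :: "real \<Rightarrow> real"
  assumes "integrable lborel h" "Ck k \<eta>" "vanishes_beyond L \<eta>"
  shows "Ck k (\<lambda>s. LINT t|lborel. exp (- a * s) * exp (- a * t) * h (s - t) * \<eta> t)"
proof -
  let ?g = "\<lambda>t. complex_of_real (exp (- a * t) * \<eta> t)"
  have v: "vanishes_beyond L ?g" using assms by (auto simp: vanishes_beyond_def)
  have "Ck k (\<lambda>s. Re (of_real (exp (- a * s)) * conv h ?g s))"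
    by (intro Ck_compose_linear[OF bounded_linear_Re] Ck_mult Ck_of_real Ck_exp Ck_conv[OF assms(1) _ v] assms)
  then show ?thesis
  proof (rule Ck_cong)
    fix s
    have "of_real (exp (- a * s)) * conv h ?g s = (LINT t|lborel. of_real (exp (- a * s)) * (h (s - t) *\<^sub>R ?g t))"
      unfolding conv_flip by (rule integral_mult_right_zero[symmetric])
    also have "\<dots> = (LINT t|lborel. of_real (exp (- a * s) * exp (- a * t) * h (s - t) * \<eta> t))"
      by (intro Bochner_Integration.integral_cong refl) (simp add: scaleR_conv_of_real)
    also have "\<dots> = of_real (LINT t|lborel. exp (- a * s) * exp (- a * t) * h (s - t) * \<eta> t)"
      by (rule integral_complex_of_real)
    finally show "Re (of_real (exp (- a * s)) * conv h ?g s) = (LINT t|lborel. exp (- a * s) * exp (- a * t) * h (s - t) * \<eta> t)"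
      by simp
  qed
qed

lemma mode_kernel_even: "mode_kernel a n (- u) = mode_kernel a n u"
  by (simp add: mode_kernel_def ang_kernel_def chord_def)

lemma bump_family:
  obtains bump cut :: "real \<Rightarrow> real \<Rightarrow> real \<Rightarrow> real" where
    "\<And>e x k. 0 < e \<Longrightarrow> Ck k (bump e x)" "\<And>e x k. 0 < e \<Longrightarrow> Ck k (cut e x)"
    "\<And>e x t. 0 < e \<Longrightarrow> 0 \<le> bump e x t" "\<And>e x t. 0 \<le> cut e x t" "\<And>e x t. cut e x t \<le> 1"
    "\<And>e x t. 0 < e \<Longrightarrow> bump e x t \<noteq> 0 \<Longrightarrow> \<bar>t - x\<bar> < e"
    "\<And>e x t. 0 < e \<Longrightarrow> cut e x t \<noteq> 0 \<Longrightarrow> \<bar>t - x\<bar> < 2 * e"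
    "\<And>e x t. 0 < e \<Longrightarrow> \<bar>t - x\<bar> \<le> e \<Longrightarrow> cut e x t = 1"
    "\<And>e x. 0 < e \<Longrightarrow> (LINT t|lborel. bump e x t) = 1"
proof -
  obtain H \<eta> :: "real \<Rightarrow> real" where H: "\<And>k. Ck k H" "\<And>k. Ck k \<eta>"
    "\<And>x. (H has_vector_derivative \<eta> x) (at x)" "\<And>x. x \<le> -1 \<Longrightarrow> H x = 0" "\<And>x. x \<ge> 1 \<Longrightarrow> H x = 1"
    "\<And>x. 0 \<le> \<eta> x" "\<And>x. \<bar>x\<bar> \<ge> 1 \<Longrightarrow> \<eta> x = 0" "\<And>x. 0 \<le> H x" "\<And>x. H x \<le> 1"
    by (rule smooth_step) blast
  define bump where "bump e x t = \<eta> ((t - x) / e) / e" for e x t :: real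
  define cut where "cut e x t = H (3 + 2 * ((t - x) / e)) * H (3 + (-2) * ((t - x) / e))" for e x t :: real
  have int1: "(LINT t|lborel. \<eta> t) = 1"
  proof -
    have "(LINT t|lborel. \<eta> t) = (LINT t|lborel. \<eta> t * indicator {-1..1} t)"
    proof (intro Bochner_Integration.integral_cong refl)
      show "\<eta> x = \<eta> x * indicator {-1..1} x" for x
        by (cases "x \<in> {-1..1}") (auto intro!: H(7))
    qed
    also have "\<dots> = H 1 - H (-1)"
    proof (rule integral_FTC_Icc_real)
      show "(H has_real_derivative \<eta> x) (at x)" for x
        using H(3) by (simp add: has_real_derivative_iff_has_vector_derivative)
      show "isCont \<eta> x" for x using Ck_imp_continuous[OF H(2)] by (simp add: continuous_on_eq_continuous_at)
    qed simp
    finally show ?thesis using H(4,5) by simp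
  qed
  show thesis
  proof (rule that[of bump cut])
    fix e x t :: real and k assume e: "0 < e"
    have aff: "Ck k (\<lambda>t. f (y + c * ((t - x) / e)))" if "Ck k f" for f :: "real \<Rightarrow> real" and y c
      using Ck_affine[OF that, of "c / e" "y - c * x / e"]
      by (rule Ck_cong) (simp add: algebra_simps diff_divide_distrib)
    show "Ck k (bump e x)" unfolding bump_def[abs_def] divide_inverse[of _ e]
      using aff[OF H(2), of 0 1] by (intro Ck_mult Ck_const) (simp add: divide_inverse)
    show "Ck k (cut e x)" unfolding cut_def[abs_def]
      by (intro Ck_mult aff[OF H(1)])
    show "0 \<le> bump e x t" using e H(6) by (simp add: bump_def)
    show "\<bar>t - x\<bar> < e" if "bump e x t \<noteq> 0"
      using that H(7)[of "(t - x) / e"] e by (auto simp: bump_def not_le[symmetric] le_divide_eq)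
    define z where "z = (t - x) / e"
    have tz: "\<bar>t - x\<bar> = \<bar>z\<bar> * e" using e by (simp add: z_def abs_mult)
    show "\<bar>t - x\<bar> < 2 * e" if "cut e x t \<noteq> 0"
    proof -
      have "H (3 + 2 * z) \<noteq> 0" "H (3 + (-2) * z) \<noteq> 0" using that by (auto simp: cut_def z_def)
      then have "\<not> 3 + 2 * z \<le> -1" "\<not> 3 + (-2) * z \<le> -1" using H(4) by auto
      then have "\<bar>z\<bar> < 2" by linarith
      then show ?thesis unfolding tz using e by simp
    qed
    show "cut e x t = 1" if "\<bar>t - x\<bar> \<le> e"
    proof -
      have "\<bar>z\<bar> \<le> 1" using that e unfolding tz by simp
      then have "3 + 2 * z \<ge> 1" "3 + (-2) * z \<ge> 1" by linarith+
      then show ?thesis using H(5) unfolding cut_def z_def[symmetric] by simp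
    qed
    show "(LINT t|lborel. bump e x t) = 1"
      using lborel_integral_real_affine[of e "bump e x" x] e int1 by (simp add: bump_def)
  next
    fix e x t :: real
    show "0 \<le> cut e x t" using H(8) by (simp add: cut_def)
    show "cut e x t \<le> 1" using H(8,9) by (auto simp: cut_def intro!: mult_le_one)
  qed
qed

text \<open>
  The data of the limit problem are fixed first, then the accuracy \<open>tol\<close>, and finally the width \<open>e\<close>
  of the bumps. The approximation hypotheses of \<open>two_bump\<close> are the continuity of \<open>diff_kernel\<close> at
  \<open>0\<close> for a bump and itself, and of the kernels at the distance of the bumps for the cross terms.
\<close>

lemma unstable_profile_exists:
  assumes a: "1 \<le> a" "a \<le> 3/2" and n: "n \<ge> 2"
  obtains p :: "real \<Rightarrow> real" and w :: "real \<Rightarrow> complex" and c :: complex and L :: real where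
    "0 < L" "\<And>k. Ck k p" "vanishes_beyond L p" "(LINT t|lborel. p t) = 0"
    "Im c < 0" "\<And>k. Ck k w" "\<And>s. p s = 0 \<Longrightarrow> w s = 0" "\<exists>s. w s \<noteq> 0"
    "\<And>s. (of_real (LINT t|lborel. exp (- a * s) * exp (- a * t) * (real n * mode_kernel a 1 (s - t)) * p t) - c) * w s
       = of_real (p s) * (LINT t|lborel. of_real (exp (- a * s) * exp (- a * t) * mode_kernel a n (s - t)) * w t)"
proof -
  obtain u where u: "u > 0" "0 < diff_kernel a n 0 * cosh (a * u) - real n * mode_kernel a 1 u"
    "diff_kernel a n 0 * cosh (a * u) - real n * mode_kernel a 1 u < mode_kernel a n u"
    using exists_unstable_separation[OF a n] by metis
  define g where "g = diff_kernel a n 0"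
  define G where "G = mode_kernel a n u"
  define N1 where "N1 = real n * mode_kernel a 1 u"
  define \<phi> where "\<phi> = g * cosh (a * u) - N1"
  define m where "m = g * sinh (a * u)"
  define \<tau> where "\<tau> = u / 2"
  have \<tau>: "\<tau> > 0" using u by (simp add: \<tau>_def)
  have \<phi>: "0 < \<phi>" "\<phi> < G" using u by (auto simp: \<phi>_def g_def G_def N1_def)
  have m1: "m + \<phi> = exp (a * u) * g - N1" "m - \<phi> = - (exp (- a * u) * g) + N1"
    by (simp_all add: m_def \<phi>_def sinh_field_def cosh_field_def algebra_simps)
      (simp_all add: field_simps)
  define om where "om = sqrt (G\<^sup>2 - \<phi>\<^sup>2)"
  define rh where "rh = min (\<phi> / 2) (om / 2)"
  have rh: "rh > 0" using \<phi> by (auto simp: rh_def om_def power_strict_mono)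
  obtain \<nu> where \<nu>: "0 < \<nu>" "\<And>z. norm (z - 1) \<le> \<nu> \<Longrightarrow> 0 < Re (of_real (G\<^sup>2) * z - of_real (\<phi>\<^sup>2)) \<and>
       norm (csqrt (of_real (G\<^sup>2) * z - of_real (\<phi>\<^sup>2)) - of_real om) \<le> rh"
    using csqrt_perturbation[OF \<phi> rh] unfolding om_def by metis
  \<comment> \<open>The three entries of \<open>tol\<close> serve the smallness assumptions of \<open>two_bump\<close> and the estimate of \<open>D2\<close>.\<close>
  define Ce where "Ce = \<bar>err_const \<phi> G\<bar> + 1"
  define tol where "tol = min 1 (min (\<phi>\<^sup>2 / (64 * (G + 1))) (\<nu> / (9 * Ce)))"
  have Gp: "G > 0" using \<phi> by simp
  have Ce: "Ce > 0" "err_const \<phi> G \<le> Ce" by (auto simp: Ce_def)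
  have tol: "0 < tol" "tol \<le> 1" "64 * (G + 1) * tol \<le> \<phi>\<^sup>2" "9 * (tol * err_const \<phi> G) \<le> \<nu>"
  proof -
    show t: "0 < tol" using \<phi> Gp \<nu>(1) Ce by (simp add: tol_def)
    show "tol \<le> 1" by (simp add: tol_def)
    have "tol \<le> \<phi>\<^sup>2 / (64 * (G + 1))" by (simp add: tol_def)
    then show "64 * (G + 1) * tol \<le> \<phi>\<^sup>2" using Gp by (simp add: field_simps)
    have "tol \<le> \<nu> / (9 * Ce)" by (simp add: tol_def)
    then have "9 * (tol * Ce) \<le> \<nu>" using Ce by (simp add: field_simps)
    moreover have "tol * err_const \<phi> G \<le> tol * Ce" using t Ce by (intro mult_left_mono) auto
    ultimately show "9 * (tol * err_const \<phi> G) \<le> \<nu>" by linarith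
  qed
  \<comment> \<open>The value at \<open>0\<close> is set to \<open>0\<close> so that positivity holds everywhere; the integrals do not see it.\<close>
  define gam where "gam v = (if v = 0 then 0 else mode_kernel a n v)" for v
  define gam1 where "gam1 v = real n * mode_kernel a 1 v" for v
  define dk where "dk = diff_kernel a n"
  have gam_AE: "AE v in lborel. gam v = mode_kernel a n v"
    using AE_lborel_neq[of 0] by eventually_elim (simp add: gam_def)
  have mk_meas: "mode_kernel a n \<in> borel_measurable borel" using integrable_mode_kernel[OF a, of n] by auto
  have gam_meas: "gam \<in> borel_measurable lborel"
    using mk_meas unfolding gam_def[abs_def] by (intro measurable_If) auto
  have gam_int: "integrable lborel gam"
    by (rule integrable_cong_AE[THEN iffD2, OF _ _ gam_AE integrable_mode_kernel[OF a]])
      (use gam_meas mk_meas in auto)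
  have gam1_int: "integrable lborel gam1"
    unfolding gam1_def[abs_def] by (intro integrable_mult_right integrable_mode_kernel a)
  have gam_nn: "0 \<le> gam v" for v
    using mode_kernel_pos[of v a n] a n by (auto simp: gam_def intro: less_imp_le)
  have dk_eq: "gam1 v = dk v + gam v" if "v \<noteq> 0" for v
    using diff_kernel_eq[OF that, of a n] a that by (simp add: gam_def gam1_def dk_def)
  have mkc: "isCont (mode_kernel a j) v" if "v \<noteq> 0" for v j
    using continuous_mode_kernel[of a j] a that by (auto simp: continuous_on_eq_continuous_at open_Compl)
  have gam_c: "isCont gam v" if "v \<noteq> 0" for v
  proof -
    have "continuous_on (-{0}) gam"
      by (rule continuous_on_eq[OF continuous_mode_kernel[of a n]]) (use a in \<open>auto simp: gam_def\<close>)
    then show ?thesis using that by (auto simp: continuous_on_eq_continuous_at open_Compl)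
  qed
  have gam1_c: "isCont gam1 v" if "v \<noteq> 0" for v
    unfolding gam1_def[abs_def] by (intro continuous_intros mkc that)
  have dk_c: "isCont dk v" for v
    using continuous_diff_kernel[OF a, of n] by (simp add: dk_def continuous_on_eq_continuous_at)
  have ut: "- \<tau> - \<tau> = - u" "\<tau> - (- \<tau>) = u" "- \<tau> - \<tau> \<noteq> 0" "\<tau> - (- \<tau>) \<noteq> 0" using u by (auto simp: \<tau>_def)
  have t2: "tol / 2 > 0" using tol by simp
  obtain d1 where d1: "0 < d1" "\<And>s t. \<bar>s - (-\<tau>)\<bar> < d1 \<Longrightarrow> \<bar>t - (-\<tau>)\<bar> < d1 \<Longrightarrow>
    \<bar>exp (- a * s) * exp (- a * t) * dk (s - t) - exp (- a * -\<tau>) * exp (- a * -\<tau>) * dk (-\<tau> - (-\<tau>))\<bar> < tol / 2"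
    using shifted_kernel_near[OF dk_c t2] by metis
  obtain d2 where d2: "0 < d2" "\<And>s t. \<bar>s - \<tau>\<bar> < d2 \<Longrightarrow> \<bar>t - \<tau>\<bar> < d2 \<Longrightarrow>
    \<bar>exp (- a * s) * exp (- a * t) * dk (s - t) - exp (- a * \<tau>) * exp (- a * \<tau>) * dk (\<tau> - \<tau>)\<bar> < tol / 2"
    using shifted_kernel_near[OF dk_c t2] by metis
  obtain d3 where d3: "0 < d3" "\<And>s t. \<bar>s - (-\<tau>)\<bar> < d3 \<Longrightarrow> \<bar>t - \<tau>\<bar> < d3 \<Longrightarrow>
    \<bar>exp (- a * s) * exp (- a * t) * gam1 (s - t) - exp (- a * -\<tau>) * exp (- a * \<tau>) * gam1 (-\<tau> - \<tau>)\<bar> < tol / 2"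
    using shifted_kernel_near[OF gam1_c[OF ut(3)] t2] by metis
  obtain d4 where d4: "0 < d4" "\<And>s t. \<bar>s - \<tau>\<bar> < d4 \<Longrightarrow> \<bar>t - (-\<tau>)\<bar> < d4 \<Longrightarrow>
    \<bar>exp (- a * s) * exp (- a * t) * gam1 (s - t) - exp (- a * \<tau>) * exp (- a * -\<tau>) * gam1 (\<tau> - (-\<tau>))\<bar> < tol / 2"
    using shifted_kernel_near[OF gam1_c[OF ut(4)] t2] by metis
  obtain d5 where d5: "0 < d5" "\<And>s t. \<bar>s - (-\<tau>)\<bar> < d5 \<Longrightarrow> \<bar>t - \<tau>\<bar> < d5 \<Longrightarrow>
    \<bar>exp (- a * s) * exp (- a * t) * gam (s - t) - exp (- a * -\<tau>) * exp (- a * \<tau>) * gam (-\<tau> - \<tau>)\<bar> < tol / 2"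
    using shifted_kernel_near[OF gam_c[OF ut(3)] t2] by metis
  obtain d6 where d6: "0 < d6" "\<And>s t. \<bar>s - \<tau>\<bar> < d6 \<Longrightarrow> \<bar>t - (-\<tau>)\<bar> < d6 \<Longrightarrow>
    \<bar>exp (- a * s) * exp (- a * t) * gam (s - t) - exp (- a * \<tau>) * exp (- a * -\<tau>) * gam (\<tau> - (-\<tau>))\<bar> < tol / 2"
    using shifted_kernel_near[OF gam_c[OF ut(4)] t2] by metis
  have vals: "exp (- a * -\<tau>) * exp (- a * -\<tau>) * dk (-\<tau> - (-\<tau>)) = exp (a * u) * g"
    "exp (- a * \<tau>) * exp (- a * \<tau>) * dk (\<tau> - \<tau>) = exp (- a * u) * g"
    "exp (- a * -\<tau>) * exp (- a * \<tau>) * gam1 (-\<tau> - \<tau>) = N1"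
    "exp (- a * \<tau>) * exp (- a * -\<tau>) * gam1 (\<tau> - (-\<tau>)) = N1"
    "exp (- a * -\<tau>) * exp (- a * \<tau>) * gam (-\<tau> - \<tau>) = G"
    "exp (- a * \<tau>) * exp (- a * -\<tau>) * gam (\<tau> - (-\<tau>)) = G"
    unfolding ut using u(1)
    by (simp_all add: dk_def g_def gam1_def gam_def N1_def G_def mode_kernel_even flip: exp_add) (simp_all add: \<tau>_def)
  obtain bump cut :: "real \<Rightarrow> real \<Rightarrow> real \<Rightarrow> real" where B:
    "\<And>e x k. 0 < e \<Longrightarrow> Ck k (bump e x)" "\<And>e x k. 0 < e \<Longrightarrow> Ck k (cut e x)"
    "\<And>e x t. 0 < e \<Longrightarrow> 0 \<le> bump e x t" "\<And>e x t. 0 \<le> cut e x t" "\<And>e x t. cut e x t \<le> 1"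
    "\<And>e x t. 0 < e \<Longrightarrow> bump e x t \<noteq> 0 \<Longrightarrow> \<bar>t - x\<bar> < e"
    "\<And>e x t. 0 < e \<Longrightarrow> cut e x t \<noteq> 0 \<Longrightarrow> \<bar>t - x\<bar> < 2 * e"
    "\<And>e x t. 0 < e \<Longrightarrow> \<bar>t - x\<bar> \<le> e \<Longrightarrow> cut e x t = 1"
    "\<And>e x. 0 < e \<Longrightarrow> (LINT t|lborel. bump e x t) = 1"
    by (rule bump_family) blast
  \<comment> \<open>The cut-offs live on twice the width; the first entry keeps those of the two bumps apart.\<close>
  define e where "e = min (\<tau> / 4) (min (min (min d1 d2) (min d3 d4)) (min d5 d6) / 2)"
  have e: "0 < e" "2 * e \<le> d1" "2 * e \<le> d2" "2 * e \<le> d3" "2 * e \<le> d4" "2 * e \<le> d5" "2 * e \<le> d6" "4 * e \<le> \<tau>"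
    using \<tau> d1(1) d2(1) d3(1) d4(1) d5(1) d6(1) by (auto simp: e_def min_def)
  define \<eta>1 where "\<eta>1 = bump e (- \<tau>)"
  define \<eta>2 where "\<eta>2 = bump e \<tau>"
  define \<chi>1 where "\<chi>1 = cut e (- \<tau>)"
  define \<chi>2 where "\<chi>2 = cut e \<tau>"
  define L where "L = 2 * \<tau>"
  define p where "p t = \<eta>1 t - \<eta>2 t" for t
  define \<Omega> where "\<Omega> s = (LINT t|lborel. exp (- a * s) * exp (- a * t) * gam1 (s - t) * p t)" for s
  have S: "Ck k \<eta>1" "Ck k \<eta>2" "Ck k \<chi>1" "Ck k \<chi>2" for k
    using B(1,2) e(1) by (auto simp: \<eta>1_def \<eta>2_def \<chi>1_def \<chi>2_def)
  have supp: "\<eta>1 t \<noteq> 0 \<Longrightarrow> \<bar>t - (-\<tau>)\<bar> < e" "\<eta>2 t \<noteq> 0 \<Longrightarrow> \<bar>t - \<tau>\<bar> < e"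
    "\<chi>1 t \<noteq> 0 \<Longrightarrow> \<bar>t - (-\<tau>)\<bar> < 2 * e" "\<chi>2 t \<noteq> 0 \<Longrightarrow> \<bar>t - \<tau>\<bar> < 2 * e" for t
    unfolding \<eta>1_def \<eta>2_def \<chi>1_def \<chi>2_def by (fact B(6)[OF e(1)] B(7)[OF e(1)])+
  have nn: "0 \<le> \<eta>1 t" "0 \<le> \<eta>2 t" "0 \<le> \<chi>1 t" "0 \<le> \<chi>2 t" "\<chi>1 t \<le> 1" "\<chi>2 t \<le> 1" for t
    using B(3,4,5) e(1) by (auto simp: \<eta>1_def \<eta>2_def \<chi>1_def \<chi>2_def)
  have V: "vanishes_beyond L \<eta>1" "vanishes_beyond L \<eta>2" "vanishes_beyond L \<chi>1" "vanishes_beyond L \<chi>2"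
    unfolding vanishes_beyond_def L_def
  proof safe
    fix t assume t: "2 * \<tau> < \<bar>t\<bar>"
    show "\<eta>1 t = 0" by (rule ccontr, drule supp(1)) (use t e(1,8) in linarith)
    show "\<eta>2 t = 0" by (rule ccontr, drule supp(2)) (use t e(1,8) in linarith)
    show "\<chi>1 t = 0" by (rule ccontr, drule supp(3)) (use t e(1,8) in linarith)
    show "\<chi>2 t = 0" by (rule ccontr, drule supp(4)) (use t e(1,8) in linarith)
  qed
  have mass: "(LINT t|lborel. \<eta>1 t) = 1" "(LINT t|lborel. \<eta>2 t) = 1"
    using B(9) e(1) by (auto simp: \<eta>1_def \<eta>2_def)
  have ei: "integrable lborel \<eta>1" "integrable lborel \<eta>2"
    using mass not_integrable_integral_eq by (metis zero_neq_one)+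
  have Sp: "Ck k p" for k unfolding p_def[abs_def] by (intro Ck_diff S)
  have Vp: "vanishes_beyond L p" using V(1,2) by (auto simp: vanishes_beyond_def p_def)
  have S\<Omega>: "Ck k \<Omega>" for k unfolding \<Omega>_def[abs_def] by (rule Ck_kernel_potential[OF gam1_int Sp Vp])
  note cts = Ck_imp_continuous[OF S(1)] Ck_imp_continuous[OF S(2)]
  have I1: "integrable lborel (\<lambda>t. exp (- a * s) * exp (- a * t) * gam1 (s - t) * \<eta>1 t)"
     "integrable lborel (\<lambda>t. exp (- a * s) * exp (- a * t) * gam1 (s - t) * \<eta>2 t)"
     "integrable lborel (\<lambda>t. exp (- a * s) * exp (- a * t) * gam (s - t) * \<eta>1 t)"
     "integrable lborel (\<lambda>t. exp (- a * s) * exp (- a * t) * gam (s - t) * \<eta>2 t)" for s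
    by (intro integrable_kernel_product[of _ _ L] gam1_int gam_int cts V)+
  have \<Omega>_split: "\<Omega> s = (LINT t|lborel. exp (- a * s) * exp (- a * t) * gam1 (s - t) * \<eta>1 t)
       - (LINT t|lborel. exp (- a * s) * exp (- a * t) * gam1 (s - t) * \<eta>2 t)" for s
    unfolding \<Omega>_def p_def right_diff_distrib by (rule Bochner_Integration.integral_diff[OF I1(1,2)])
  have dk_int: "integrable lborel (\<lambda>t. exp (- a * s) * exp (- a * t) * dk (s - t) * \<eta> t)"
    and dk_val: "(LINT t|lborel. exp (- a * s) * exp (- a * t) * gam1 (s - t) * \<eta> t)
      = (LINT t|lborel. exp (- a * s) * exp (- a * t) * gam (s - t) * \<eta> t) + (LINT t|lborel. exp (- a * s) * exp (- a * t) * dk (s - t) * \<eta> t)"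
    if \<eta>: "\<eta> = \<eta>1 \<or> \<eta> = \<eta>2" for \<eta> s
  proof -
    have i: "integrable lborel (\<lambda>t. exp (- a * s) * exp (- a * t) * gam1 (s - t) * \<eta> t)"
      "integrable lborel (\<lambda>t. exp (- a * s) * exp (- a * t) * gam (s - t) * \<eta> t)"
      using I1 \<eta> by auto
    have c: "continuous_on UNIV \<eta>" "vanishes_beyond L \<eta>" using \<eta> cts V by auto
    have dkc: "continuous_on UNIV dk" using dk_c by (simp add: continuous_at_imp_continuous_on)
    have dm: "(\<lambda>t. exp (- a * s) * exp (- a * t) * dk (s - t) * \<eta> t) \<in> borel_measurable lborel"
      by (simp, intro borel_measurable_continuous_onI continuous_intros c continuous_on_compose2[OF dkc]) auto
    have ae: "AE t in lborel. exp (- a * s) * exp (- a * t) * gam1 (s - t) * \<eta> t - exp (- a * s) * exp (- a * t) * gam (s - t) * \<eta> t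
        = exp (- a * s) * exp (- a * t) * dk (s - t) * \<eta> t"
      using AE_lborel_neq[of s] by eventually_elim (subst dk_eq, auto simp: algebra_simps)
    note d = Bochner_Integration.integrable_diff[OF i]
    show "integrable lborel (\<lambda>t. exp (- a * s) * exp (- a * t) * dk (s - t) * \<eta> t)"
      by (rule integrable_cong_AE[THEN iffD1, OF _ dm ae d]) (use d in auto)
    have "(LINT t|lborel. exp (- a * s) * exp (- a * t) * dk (s - t) * \<eta> t)
       = (LINT t|lborel. exp (- a * s) * exp (- a * t) * gam1 (s - t) * \<eta> t - exp (- a * s) * exp (- a * t) * gam (s - t) * \<eta> t)"
      by (rule integral_cong_AE[symmetric, OF _ dm ae]) (use d in auto)
    also have "\<dots> = (LINT t|lborel. exp (- a * s) * exp (- a * t) * gam1 (s - t) * \<eta> t) - (LINT t|lborel. exp (- a * s) * exp (- a * t) * gam (s - t) * \<eta> t)"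
      by (rule Bochner_Integration.integral_diff[OF i])
    finally show "(LINT t|lborel. exp (- a * s) * exp (- a * t) * gam1 (s - t) * \<eta> t)
      = (LINT t|lborel. exp (- a * s) * exp (- a * t) * gam (s - t) * \<eta> t) + (LINT t|lborel. exp (- a * s) * exp (- a * t) * dk (s - t) * \<eta> t)"
      by simp
  qed
  interpret two_bump gam \<eta>1 \<eta>2 \<chi>1 \<chi>2 \<Omega> a L m \<phi> G tol
  proof (unfold_locales; (fact gam_int gam_nn S S\<Omega> V nn mass \<phi> tol)?)
    show "\<chi>1 t = 1" if "\<eta>1 t \<noteq> 0" for t using supp(1)[OF that] B(8)[OF e(1), of t "-\<tau>"] by (simp add: \<chi>1_def)
    show "\<chi>2 t = 1" if "\<eta>2 t \<noteq> 0" for t using supp(2)[OF that] B(8)[OF e(1), of t \<tau>] by (simp add: \<chi>2_def)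
    show "\<chi>1 t = 0 \<or> \<chi>2 t = 0" for t
    proof (rule ccontr)
      assume "\<not> (\<chi>1 t = 0 \<or> \<chi>2 t = 0)"
      then show False using supp(3,4)[of t] e(1,8) by auto
    qed
    show "\<bar>\<Omega> s - (LINT t|lborel. exp (- a * s) * exp (- a * t) * gam (s - t) * \<eta>1 t) - (m + \<phi>)\<bar> \<le> tol" if s: "\<chi>1 s \<noteq> 0" for s
    proof -
      have sd: "\<bar>s - (-\<tau>)\<bar> < d1" "\<bar>s - (-\<tau>)\<bar> < d3" using supp(3)[OF s] e by linarith+
      have "\<bar>(LINT t|lborel. exp (- a * s) * exp (- a * t) * dk (s - t) * \<eta>1 t) - exp (a * u) * g\<bar> \<le> tol / 2"
      proof (rule integral_average_near[OF dk_int ei(1) mass(1) nn(1)])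
        fix t assume "\<eta>1 t \<noteq> 0"
        then have "\<bar>t - (-\<tau>)\<bar> < d1" using supp(1)[of t] e(1,2) by linarith
        from d1(2)[OF sd(1) this] show "\<bar>exp (- a * s) * exp (- a * t) * dk (s - t) - exp (a * u) * g\<bar> \<le> tol / 2"
          unfolding vals by simp
      qed simp
      moreover have "\<bar>(LINT t|lborel. exp (- a * s) * exp (- a * t) * gam1 (s - t) * \<eta>2 t) - N1\<bar> \<le> tol / 2"
      proof (rule integral_average_near[OF I1(2) ei(2) mass(2) nn(2)])
        fix t assume "\<eta>2 t \<noteq> 0"
        then have "\<bar>t - \<tau>\<bar> < d3" using supp(2)[of t] e(1,4) by linarith
        from d3(2)[OF sd(2) this] show "\<bar>exp (- a * s) * exp (- a * t) * gam1 (s - t) - N1\<bar> \<le> tol / 2"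
          unfolding vals by simp
      qed
      moreover have "\<Omega> s - (LINT t|lborel. exp (- a * s) * exp (- a * t) * gam (s - t) * \<eta>1 t)
         = (LINT t|lborel. exp (- a * s) * exp (- a * t) * dk (s - t) * \<eta>1 t) - (LINT t|lborel. exp (- a * s) * exp (- a * t) * gam1 (s - t) * \<eta>2 t)"
        unfolding \<Omega>_split using dk_val[of \<eta>1 s] by simp
      ultimately show ?thesis unfolding m1 by linarith
    qed
    show "\<bar>\<Omega> s + (LINT t|lborel. exp (- a * s) * exp (- a * t) * gam (s - t) * \<eta>2 t) - (m - \<phi>)\<bar> \<le> tol" if s: "\<chi>2 s \<noteq> 0" for s
    proof -
      have sd: "\<bar>s - \<tau>\<bar> < d2" "\<bar>s - \<tau>\<bar> < d4" using supp(4)[OF s] e by linarith+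
      have "\<bar>(LINT t|lborel. exp (- a * s) * exp (- a * t) * dk (s - t) * \<eta>2 t) - exp (- a * u) * g\<bar> \<le> tol / 2"
      proof (rule integral_average_near[OF dk_int ei(2) mass(2) nn(2)])
        fix t assume "\<eta>2 t \<noteq> 0"
        then have "\<bar>t - \<tau>\<bar> < d2" using supp(2)[of t] e(1,3) by linarith
        from d2(2)[OF sd(1) this] show "\<bar>exp (- a * s) * exp (- a * t) * dk (s - t) - exp (- a * u) * g\<bar> \<le> tol / 2"
          unfolding vals by simp
      qed simp
      moreover have "\<bar>(LINT t|lborel. exp (- a * s) * exp (- a * t) * gam1 (s - t) * \<eta>1 t) - N1\<bar> \<le> tol / 2"
      proof (rule integral_average_near[OF I1(1) ei(1) mass(1) nn(1)])
        fix t assume "\<eta>1 t \<noteq> 0"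
        then have "\<bar>t - (-\<tau>)\<bar> < d4" using supp(1)[of t] e(1,5) by linarith
        from d4(2)[OF sd(2) this] show "\<bar>exp (- a * s) * exp (- a * t) * gam1 (s - t) - N1\<bar> \<le> tol / 2"
          unfolding vals by simp
      qed
      moreover have "\<Omega> s + (LINT t|lborel. exp (- a * s) * exp (- a * t) * gam (s - t) * \<eta>2 t)
         = (LINT t|lborel. exp (- a * s) * exp (- a * t) * gam1 (s - t) * \<eta>1 t) - (LINT t|lborel. exp (- a * s) * exp (- a * t) * dk (s - t) * \<eta>2 t)"
        unfolding \<Omega>_split using dk_val[of \<eta>2 s] by simp
      ultimately show ?thesis unfolding m1 by linarith
    qed
    show "\<bar>exp (- a * s) * exp (- a * t) * gam (s - t) - G\<bar> \<le> tol" if "\<chi>1 s \<noteq> 0" "\<eta>2 t \<noteq> 0" for s t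
    proof -
      have "\<bar>s - (-\<tau>)\<bar> < d5" "\<bar>t - \<tau>\<bar> < d5" using supp(3)[OF that(1)] supp(2)[OF that(2)] e(1,6) by linarith+
      from d5(2)[OF this] show ?thesis unfolding vals using tol(1) by linarith
    qed
    show "\<bar>exp (- a * s) * exp (- a * t) * gam (s - t) - G\<bar> \<le> tol" if "\<chi>2 s \<noteq> 0" "\<eta>1 t \<noteq> 0" for s t
    proof -
      have "\<bar>s - \<tau>\<bar> < d6" "\<bar>t - (-\<tau>)\<bar> < d6" using supp(4)[OF that(1)] supp(1)[OF that(2)] e(1,7) by linarith+
      from d6(2)[OF this] show ?thesis unfolding vals using tol(1) by linarith
    qed
  qed
  obtain c w where cw: "Im c < 0" "\<And>k. Ck k w" "\<And>s. \<eta>1 s = 0 \<Longrightarrow> \<eta>2 s = 0 \<Longrightarrow> w s = 0" "\<exists>s. w s \<noteq> 0"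
    "\<And>s. (of_real (\<Omega> s) - c) * w s = of_real (\<eta>1 s - \<eta>2 s) * (LINT t|lborel. of_real (K s t) * w t)"
  proof (rule eigenfunction_exists[of \<nu>])
    fix z :: complex assume "norm (z - 1) \<le> \<nu>"
    from \<nu>(2)[OF this] show "0 < Re (of_real (G\<^sup>2) * z - of_real (\<phi>\<^sup>2)) \<and>
       norm (csqrt (of_real (G\<^sup>2) * z - of_real (\<phi>\<^sup>2)) - of_real \<omega>) \<le> \<rho>"
      by (simp only: om_def rh_def \<omega>_def \<rho>_def)
  next
    show "9 * D2 \<le> \<nu>" unfolding D2_eq by (rule tol)
  qed blast
  show thesis
  proof (rule that[of L p c w])
    show "0 < L" using \<tau> by (simp add: L_def)
    show "(LINT t|lborel. p t) = 0" unfolding p_def using ei mass by simp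
    show "w s = 0" if "p s = 0" for s
    proof (rule cw(3))
      have "\<eta>1 s = 0 \<or> \<eta>2 s = 0" using supp(1,2)[of s] e(1,8) by fastforce
      then show "\<eta>1 s = 0" "\<eta>2 s = 0" using that by (auto simp: p_def)
    qed
    show "(of_real (LINT t|lborel. exp (- a * s) * exp (- a * t) * (real n * mode_kernel a 1 (s - t)) * p t) - c) * w s
       = of_real (p s) * (LINT t|lborel. of_real (exp (- a * s) * exp (- a * t) * mode_kernel a n (s - t)) * w t)" for s
    proof -
      have wm: "w \<in> borel_measurable borel" by (rule borel_measurable_continuous_onI[OF Ck_imp_continuous[OF cw(2)]])
      have [measurable]: "w \<in> borel_measurable borel" "gam \<in> borel_measurable borel" "mode_kernel a n \<in> borel_measurable borel"
        using wm gam_meas mk_meas by auto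
      have "(LINT t|lborel. of_real (K s t) * w t) = (LINT t|lborel. of_real (exp (- a * s) * exp (- a * t) * mode_kernel a n (s - t)) * w t)"
      proof (rule integral_cong_AE)
        show "AE t in lborel. of_real (K s t) * w t = of_real (exp (- a * s) * exp (- a * t) * mode_kernel a n (s - t)) * w t"
          using AE_lborel_neq[of s] by eventually_elim (simp add: K_def gam_def)
        show "(\<lambda>t. of_real (K s t) * w t) \<in> borel_measurable lborel" unfolding K_def by measurable
        show "(\<lambda>t. of_real (exp (- a * s) * exp (- a * t) * mode_kernel a n (s - t)) * w t) \<in> borel_measurable lborel"
          by measurable
      qed
      then show ?thesis using cw(5)[of s] unfolding \<Omega>_def gam1_def p_def by simp
    qed
  qed (fact Sp Vp cw)+
qed

section \<open>Logarithmic polar coordinates\<close>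

lemma vector2_eq: "(vector [a, b] :: real^2) = a *\<^sub>R axis 1 1 + b *\<^sub>R axis 2 1"
  by (simp add: vec_eq_iff forall_2 axis_def)

lemma polar_nth [simp]: "polar R \<phi> $ 1 = R * cos \<phi>" "polar R \<phi> $ 2 = R * sin \<phi>"
  by (simp_all add: polar_def)

lemma polar_continuous: "continuous_on UNIV (\<lambda>z::real\<times>real. polar (exp (fst z)) (\<phi>0 + snd z))"
  unfolding polar_def vector2_eq by (intro continuous_intros)

lemma polar_measurable[measurable]: "(\<lambda>z::real\<times>real. polar (exp (fst z)) (\<phi>0 + snd z)) \<in> borel_measurable borel"
  by (rule borel_measurable_continuous_onI[OF polar_continuous])

lemma polar_measurable_pair[measurable]: "(\<lambda>z. polar (exp (fst z)) (\<phi>0 + snd z)) \<in> (lborel \<Otimes>\<^sub>M lborel) \<rightarrow>\<^sub>M borel"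
  using polar_measurable by (simp add: lborel_prod)

lemma prod_Basis_real2: "(\<Prod>b\<in>Basis. (x::real^2) \<bullet> b) = x $ 1 * x $ 2"
proof -
  have B: "(Basis :: (real^2) set) = {axis 1 1, axis 2 1}"
    by (auto simp: Basis_vec_def UNIV_2)
  have "axis 1 1 \<noteq> (axis 2 1 :: real^2)" by (simp add: axis_eq_axis)
  then show ?thesis unfolding B by (simp add: inner_axis)
qed

lemma box_real2: "Y \<in> box l u \<longleftrightarrow> l $ 1 < Y $ 1 \<and> Y $ 1 < u $ 1 \<and> l $ 2 < Y $ 2 \<and> Y $ 2 < (u :: real^2) $ 2"
  by (auto simp: mem_box_cart forall_2)

lemma lborel_real2: "(lborel :: (real^2) measure) = distr (lborel \<Otimes>\<^sub>M lborel) borel (\<lambda>z. vector [fst z, snd z])"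
proof (rule lborel_eqI)
  have [measurable]: "(\<lambda>z. vector [fst z, snd z] :: real^2) \<in> (lborel \<Otimes>\<^sub>M lborel) \<rightarrow>\<^sub>M borel"
    unfolding vector2_eq by measurable
  fix l u :: "real^2" assume le: "\<And>b. b \<in> Basis \<Longrightarrow> l \<bullet> b \<le> u \<bullet> b"
  have le': "l $ 1 \<le> u $ 1" "l $ 2 \<le> u $ 2"
    using le[of "axis 1 1"] le[of "axis 2 1"] by (auto simp: inner_axis)
  have "(\<lambda>z. vector [fst z, snd z] :: real^2) -` box l u \<inter> space (lborel \<Otimes>\<^sub>M lborel) = {l$1<..<u$1} \<times> {l$2<..<u$2}"
    by (auto simp: box_real2 space_pair_measure)
  then have "emeasure (distr (lborel \<Otimes>\<^sub>M lborel) borel (\<lambda>z. vector [fst z, snd z])) (box l u)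
      = emeasure (lborel \<Otimes>\<^sub>M lborel) ({l$1<..<u$1} \<times> {l$2<..<u$2})"
    by (simp add: emeasure_distr)
  also have "\<dots> = ennreal ((u$1 - l$1) * (u$2 - l$2))"
    by (subst lborel.emeasure_pair_measure_Times) (use le' in \<open>auto simp: ennreal_mult\<close>)
  finally show "emeasure (distr (lborel \<Otimes>\<^sub>M lborel) borel (\<lambda>z. vector [fst z, snd z])) (box l u) = (\<Prod>b\<in>Basis. (u - l) \<bullet> b)"
    by (simp add: prod_Basis_real2)
qed simp

text \<open>
  The reference angle \<open>\<phi>0\<close> allows angles to be measured from the point at which a velocity is
  evaluated.
\<close>

definition log_polar_map :: "real \<Rightarrow> real^2 \<Rightarrow> real^2" where
  "log_polar_map \<phi>0 X = polar (exp (X $ 1)) (\<phi>0 + X $ 2)"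

lemma log_polar_map_derivative:
  "(log_polar_map \<phi>0 has_derivative (\<lambda>h. (exp (X$1) * (h$1 * cos (\<phi>0 + X$2) - h$2 * sin (\<phi>0 + X$2))) *\<^sub>R axis 1 1
      + (exp (X$1) * (h$1 * sin (\<phi>0 + X$2) + h$2 * cos (\<phi>0 + X$2))) *\<^sub>R axis 2 1)) (at X within S)"
proof -
  have nth: "((\<lambda>X::real^2. X $ i) has_derivative (\<lambda>h. h $ i)) (at X within S)" for i
    by (rule bounded_linear_imp_has_derivative[OF bounded_linear_vec_nth])
  show ?thesis
    unfolding log_polar_map_def[abs_def] polar_def vector2_eq
    by (auto intro!: derivative_eq_intros nth simp: algebra_simps)
qed

lemma log_polar_map_det:
  "\<bar>det (matrix (\<lambda>h::real^2. (exp (X$1) * (h$1 * cos c - h$2 * sin c)) *\<^sub>R axis 1 1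
      + (exp (X$1) * (h$1 * sin c + h$2 * cos c)) *\<^sub>R (axis 2 1 :: real^2)))\<bar> = exp (2 * X $ 1)"
proof -
  have "det (matrix (\<lambda>h::real^2. (exp (X$1) * (h$1 * cos c - h$2 * sin c)) *\<^sub>R axis 1 1
      + (exp (X$1) * (h$1 * sin c + h$2 * cos c)) *\<^sub>R (axis 2 1 :: real^2)))
    = exp (X$1) * exp (X$1) * (cos c * cos c + sin c * sin c)"
    by (simp add: det_2 matrix_def axis_def del: sin_cos_squared_add3) algebra
  also have "\<dots> = exp (2 * X $ 1)"
    by (simp add: sin_cos_squared_add3 flip: exp_add)
  finally show ?thesis by simp
qed

lemma norm_polar: "norm (polar R \<phi>) = \<bar>R\<bar>"
proof -
  have "(norm (polar R \<phi>))\<^sup>2 = R\<^sup>2"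
    unfolding power2_norm_eq_inner inner_vec_def
    by (simp add: sum_2 power2_eq_square) (metis (no_types, opaque_lifting) distrib_left mult.assoc mult.commute mult.right_neutral sin_cos_squared_add3)
  then show ?thesis by (metis abs_norm_cancel power2_eq_iff abs_minus_cancel)
qed

lemma log_polar_map_inj: "inj_on (log_polar_map \<phi>0) {X. -pi < X $ 2 \<and> X $ 2 < pi}"
proof (rule inj_onI)
  fix X Y assume X: "X \<in> {X. -pi < X $ 2 \<and> X $ 2 < pi}" and Y: "Y \<in> {X. -pi < X $ 2 \<and> X $ 2 < pi}"
    and eq: "log_polar_map \<phi>0 X = log_polar_map \<phi>0 Y"
  have "norm (log_polar_map \<phi>0 X) = norm (log_polar_map \<phi>0 Y)" using eq by simp
  then have 1: "X $ 1 = Y $ 1" by (simp add: log_polar_map_def norm_polar)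
  have "log_polar_map \<phi>0 X $ 1 = log_polar_map \<phi>0 Y $ 1" "log_polar_map \<phi>0 X $ 2 = log_polar_map \<phi>0 Y $ 2"
    using eq by simp_all
  then have "sin (\<phi>0 + X $ 2) = sin (\<phi>0 + Y $ 2) \<and> cos (\<phi>0 + X $ 2) = cos (\<phi>0 + Y $ 2)"
    by (simp add: log_polar_map_def 1)
  then obtain k :: int where k: "\<phi>0 + X $ 2 = \<phi>0 + Y $ 2 + 2 * pi * k" unfolding sin_cos_eq_iff by blast
  have "\<bar>2 * pi * k\<bar> < 2 * pi" using X Y k by auto
  then have "\<bar>real_of_int k\<bar> < 1" by (simp add: abs_mult)
  then have "k = 0" by simp
  then have "X $ 2 = Y $ 2" using k by simp
  then show "X = Y" using 1 by (simp add: vec_eq_iff forall_2)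
qed

lemma log_polar_map_surj:
  assumes "(- sin \<phi>0) * Y $ 1 + cos \<phi>0 * Y $ 2 \<noteq> 0"
  obtains X where "-pi < X $ 2" "X $ 2 < pi" "Y = log_polar_map \<phi>0 X"
proof -
  have Y0: "Y \<noteq> 0" using assms by auto
  define r where "r = norm Y"
  have r: "r > 0" using Y0 by (simp add: r_def)
  have r2: "(Y$1)\<^sup>2 + (Y$2)\<^sup>2 = r\<^sup>2"
    unfolding r_def power2_norm_eq_inner inner_vec_def by (simp add: sum_2 power2_eq_square)
  define x where "x = (cos \<phi>0 * Y $ 1 + sin \<phi>0 * Y $ 2) / r"
  define y where "y = ((- sin \<phi>0) * Y $ 1 + cos \<phi>0 * Y $ 2) / r"
  have "(cos \<phi>0 * Y $ 1 + sin \<phi>0 * Y $ 2)\<^sup>2 + ((- sin \<phi>0) * Y $ 1 + cos \<phi>0 * Y $ 2)\<^sup>2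
     = ((sin \<phi>0)\<^sup>2 + (cos \<phi>0)\<^sup>2) * ((Y$1)\<^sup>2 + (Y$2)\<^sup>2)"
    by algebra
  then have xy: "x\<^sup>2 + y\<^sup>2 = 1" using r r2 by (simp add: x_def y_def power_divide flip: add_divide_distrib)
  obtain t where t: "0 \<le> t" "t < 2 * pi" "x = cos t" "y = sin t" using sincos_total_2pi[OF xy] by metis
  have "t \<noteq> pi" using assms r t by (auto simp: y_def)
  define \<theta> where "\<theta> = (if t < pi then t else t - 2 * pi)"
  have \<theta>: "-pi < \<theta>" "\<theta> < pi" "x = cos \<theta>" "y = sin \<theta>"
    using t \<open>t \<noteq> pi\<close> by (auto simp: \<theta>_def cos_diff sin_diff)
  have rx: "r * x = cos \<phi>0 * Y $ 1 + sin \<phi>0 * Y $ 2" "r * y = (- sin \<phi>0) * Y $ 1 + cos \<phi>0 * Y $ 2"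
    using r by (simp_all add: x_def y_def)
  have "r * cos (\<phi>0 + \<theta>) = cos \<phi>0 * (r * x) - sin \<phi>0 * (r * y)" by (simp add: cos_add \<theta> algebra_simps)
  also have "\<dots> = ((sin \<phi>0)\<^sup>2 + (cos \<phi>0)\<^sup>2) * Y $ 1" unfolding rx by algebra
  finally have 1: "r * cos (\<phi>0 + \<theta>) = Y $ 1" by simp
  have "r * sin (\<phi>0 + \<theta>) = sin \<phi>0 * (r * x) + cos \<phi>0 * (r * y)" by (simp add: sin_add \<theta> algebra_simps)
  also have "\<dots> = ((sin \<phi>0)\<^sup>2 + (cos \<phi>0)\<^sup>2) * Y $ 2" unfolding rx by algebra
  finally have 2: "r * sin (\<phi>0 + \<theta>) = Y $ 2" by simp
  show thesis
    by (rule that[of "vector [ln r, \<theta>]"])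
      (use \<theta> r 1 2 in \<open>auto simp: log_polar_map_def vec_eq_iff forall_2\<close>)
qed

lemma log_polar_nn_integral_box:
  assumes "l $ 1 \<le> u $ 1" "l $ 2 \<le> u $ 2"
  shows "(\<integral>\<^sup>+ z. ennreal (indicator {-pi<..<pi} (snd z) * exp (2 * fst z)) * indicator (box l u) (polar (exp (fst z)) (\<phi>0 + snd z)) \<partial>(lborel \<Otimes>\<^sub>M lborel))
    = ennreal ((u$1 - l$1) * (u$2 - l$2))"
proof -
  let ?f = "log_polar_map \<phi>0"
  define S where "S = {X. -pi < X $ 2 \<and> X $ 2 < pi \<and> ?f X \<in> box l u}"
  have fm[measurable]: "?f \<in> borel_measurable borel"
    unfolding log_polar_map_def[abs_def] polar_def vector2_eq
    by (intro borel_measurable_continuous_onI continuous_intros)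
  have Sb: "S \<in> sets borel"
  proof -
    have "S = {X. -pi < X $ 2} \<inter> {X. X $ 2 < pi} \<inter> (?f -` box l u \<inter> space borel)"
      by (auto simp: S_def)
    moreover have "open {X::real^2. -pi < X $ 2}" "open {X::real^2. X $ 2 < pi}"
      by (intro open_Collect_less continuous_intros)+
    ultimately show ?thesis using measurable_sets[OF fm, of "box l u"] by auto
  qed
  let ?N = "{Y::real^2. vector [- sin \<phi>0, cos \<phi>0] \<bullet> Y = 0}"
  have N: "negligible ?N"
  proof (rule negligible_hyperplane)
    show "(vector [- sin \<phi>0, cos \<phi>0] :: real^2) \<noteq> 0 \<or> (0::real) \<noteq> 0"
      by (auto simp: vec_eq_iff forall_2 dest: sin_zero_norm_cos_one)
  qed
  have img: "(box l u - ?f ` S) \<union> (?f ` S - box l u) \<subseteq> ?N"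
  proof
    fix Y assume "Y \<in> (box l u - ?f ` S) \<union> (?f ` S - box l u)"
    then have Y: "Y \<in> box l u" "Y \<notin> ?f ` S" by (auto simp: S_def)
    show "Y \<in> ?N"
    proof (rule ccontr)
      assume "Y \<notin> ?N"
      then have "(- sin \<phi>0) * Y $ 1 + cos \<phi>0 * Y $ 2 \<noteq> 0" by (simp add: inner_vec_def sum_2)
      then obtain X where "-pi < X $ 2" "X $ 2 < pi" "Y = ?f X" by (rule log_polar_map_surj)
      then show False using Y by (auto simp: S_def)
    qed
  qed
  have neg: "negligible ((box l u - ?f ` S) \<union> (?f ` S - box l u))" by (rule negligible_subset[OF N img])
  have "?f ` S \<in> lmeasurable \<and> measure lebesgue (?f ` S) = measure lebesgue (box l u)"
    using lmeasurable_negligible_symdiff[OF lmeasurable_box neg] measure_negligible_symdiff[OF lmeasurable_box neg] by simp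
  moreover have "measure lebesgue (box l u) = (u$1 - l$1) * (u$2 - l$2)"
  proof -
    have "\<forall>b\<in>Basis. l \<bullet> b \<le> u \<bullet> b" using assms by (auto simp: Basis_vec_def inner_axis UNIV_2)
    then show ?thesis by (simp add: measure_lborel_box_eq prod_Basis_real2)
  qed
  ultimately have "?f ` S \<in> lmeasurable \<and> measure lebesgue (?f ` S) = (u$1 - l$1) * (u$2 - l$2)" by simp
  then have hi: "((\<lambda>X. exp (2 * X $ 1)) has_integral (u$1 - l$1) * (u$2 - l$2)) S"
    by (subst (asm) has_measure_differentiable_image[OF _ log_polar_map_derivative])
      (use Sb in \<open>auto simp: log_polar_map_det S_def intro: inj_on_subset[OF log_polar_map_inj]\<close>)
  have nn: "(\<integral>\<^sup>+ X. ennreal (indicator S X * exp (2 * X $ 1)) \<partial>lborel) = ennreal ((u$1 - l$1) * (u$2 - l$2))"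
  proof (rule nn_integral_has_integral_lborel)
    show "(\<lambda>X. indicator S X * exp (2 * X $ 1)) \<in> borel_measurable borel"
      using Sb by measurable
    have "(\<lambda>X. indicator S X * exp (2 * X $ 1)) = (\<lambda>X. if X \<in> S then exp (2 * X $ 1) else (0::real))"
      by (auto simp: indicator_def)
    then show "((\<lambda>X. indicator S X * exp (2 * X $ 1)) has_integral (u$1 - l$1) * (u$2 - l$2)) UNIV"
      using hi by (simp add: has_integral_restrict_UNIV)
  qed simp
  have *: "(\<integral>\<^sup>+ z. ennreal (indicator S (vector [fst z, snd z]) * exp (2 * fst z)) \<partial>(lborel \<Otimes>\<^sub>M lborel)) = ennreal ((u$1 - l$1) * (u$2 - l$2))"
  proof -
    have [measurable]: "(\<lambda>z. vector [fst z, snd z] :: real^2) \<in> (lborel \<Otimes>\<^sub>M lborel) \<rightarrow>\<^sub>M borel"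
      unfolding vector2_eq by measurable
    have "(\<integral>\<^sup>+ X. ennreal (indicator S X * exp (2 * X $ 1)) \<partial>lborel)
        = (\<integral>\<^sup>+ z. ennreal (indicator S (vector [fst z, snd z]) * exp (2 * vector [fst z, snd z] $ 1)) \<partial>(lborel \<Otimes>\<^sub>M lborel))"
      unfolding lborel_real2 by (subst nn_integral_distr) (use Sb in simp_all)
    then show ?thesis using nn by simp
  qed
  show ?thesis unfolding *[symmetric]
    by (intro nn_integral_cong) (auto simp: S_def log_polar_map_def indicator_def)
qed

text \<open>
  The change of variables \<open>dX = e^(2 s) ds d\<theta>\<close>, with the angle measured from \<open>\<phi>0\<close>. It is enough to
  compare the measures on boxes; the half line with angle \<open>\<phi>0 + \<pi>\<close> that the map misses is negligible.
\<close>

lemma lborel_log_polar: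
  "(lborel :: (real^2) measure) = distr (density (lborel \<Otimes>\<^sub>M lborel) (\<lambda>z. ennreal (indicator {-pi<..<pi} (snd z) * exp (2 * fst z))))
     borel (\<lambda>z. polar (exp (fst z)) (\<phi>0 + snd z))"
proof (rule lborel_eqI)
  fix l u :: "real^2" assume le: "\<And>b. b \<in> Basis \<Longrightarrow> l \<bullet> b \<le> u \<bullet> b"
  have le': "l $ 1 \<le> u $ 1" "l $ 2 \<le> u $ 2"
    using le[of "axis 1 1"] le[of "axis 2 1"] by (auto simp: inner_axis)
  let ?d = "\<lambda>z::real\<times>real. ennreal (indicator {-pi<..<pi} (snd z) * exp (2 * fst z))"
  let ?M = "density (lborel \<Otimes>\<^sub>M lborel) ?d"
  let ?p = "\<lambda>z::real\<times>real. polar (exp (fst z)) (\<phi>0 + snd z)"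
  have "emeasure (distr ?M borel ?p) (box l u) = emeasure ?M (?p -` box l u \<inter> space ?M)"
    by (rule emeasure_distr) auto
  also have "\<dots> = (\<integral>\<^sup>+ z. ?d z * indicator (?p -` box l u \<inter> space ?M) z \<partial>(lborel \<Otimes>\<^sub>M lborel))"
    by (rule emeasure_density) (use measurable_sets[OF polar_measurable_pair, of "box l u" \<phi>0] in auto)
  also have "\<dots> = (\<integral>\<^sup>+ z. ?d z * indicator (box l u) (?p z) \<partial>(lborel \<Otimes>\<^sub>M lborel))"
    by (intro nn_integral_cong) (auto simp: indicator_def space_pair_measure)
  also have "\<dots> = ennreal ((u$1 - l$1) * (u$2 - l$2))" by (rule log_polar_nn_integral_box[OF le'])
  finally show "emeasure (distr ?M borel ?p) (box l u) = (\<Prod>b\<in>Basis. (u - l) \<bullet> b)"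
    by (simp add: prod_Basis_real2)
qed simp

lemma integral_log_polar:
  fixes f :: "real^2 \<Rightarrow> complex"
  assumes [measurable]: "f \<in> borel_measurable borel"
  shows "(LINT Y|lborel. f Y) = (LINT z|(lborel \<Otimes>\<^sub>M lborel). (indicator {-pi<..<pi} (snd z) * exp (2 * fst z)) *\<^sub>R f (polar (exp (fst z)) (\<phi>0 + snd z)))"
    and "integrable lborel f \<longleftrightarrow> integrable (lborel \<Otimes>\<^sub>M lborel) (\<lambda>z. (indicator {-pi<..<pi} (snd z) * exp (2 * fst z)) *\<^sub>R f (polar (exp (fst z)) (\<phi>0 + snd z)))"
proof -
  let ?d = "\<lambda>z::real\<times>real. indicator {-pi<..<pi} (snd z) * exp (2 * fst z) :: real"
  have dm[measurable]: "?d \<in> borel_measurable (lborel \<Otimes>\<^sub>M lborel)" by measurable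
  show "(LINT Y|lborel. f Y) = (LINT z|(lborel \<Otimes>\<^sub>M lborel). ?d z *\<^sub>R f (polar (exp (fst z)) (\<phi>0 + snd z)))"
    by (subst lborel_log_polar[of \<phi>0], subst integral_distr) (auto simp: integral_density)
  show "integrable lborel f \<longleftrightarrow> integrable (lborel \<Otimes>\<^sub>M lborel) (\<lambda>z. ?d z *\<^sub>R f (polar (exp (fst z)) (\<phi>0 + snd z)))"
    by (subst lborel_log_polar[of \<phi>0], subst integrable_distr_eq) (auto simp: integrable_density)
qed

section \<open>The velocity as an absolutely convergent integral\<close>

text \<open>
  The derivative is a parameter, so that the explicit gradient of a radial function can be supplied for
  it in the velocity formula.
\<close>

definition C1_compact :: "(real^2 \<Rightarrow> complex) \<Rightarrow> (real^2 \<Rightarrow> real^2 \<Rightarrow> complex) \<Rightarrow> bool" where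
  "C1_compact \<Theta> \<Theta>' \<longleftrightarrow> (\<forall>Y. (\<Theta> has_derivative \<Theta>' Y) (at Y)) \<and> (\<forall>v. continuous_on UNIV (\<lambda>Y. \<Theta>' Y v))
     \<and> (\<exists>B. \<forall>Y. B < norm Y \<longrightarrow> \<Theta> Y = 0)"

lemma perp_nth [simp]: "perp x $ 1 = - (x $ 2)" "perp x $ 2 = x $ 1"
  by (simp_all add: perp_def)

lemma norm_perp: "norm (perp x) = norm x"
  by (simp add: norm_eq_sqrt_inner inner_vec_def sum_2)

lemma inner_real2: "(x::real^2) \<bullet> y = x $ 1 * y $ 1 + x $ 2 * y $ 2"
  by (simp add: inner_vec_def sum_2)

lemma perp_continuous [continuous_intros]: "continuous_on S f \<Longrightarrow> continuous_on S (\<lambda>x. perp (f x))"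
  unfolding perp_def vector2_eq by (intro continuous_intros)

lemma C1_compact_expand:
  assumes "C1_compact \<Theta> \<Theta>'"
  shows "\<Theta>' Y v = (v $ 1) *\<^sub>R \<Theta>' Y (axis 1 1) + (v $ 2) *\<^sub>R \<Theta>' Y (axis 2 1)"
proof -
  have "bounded_linear (\<Theta>' Y)" using assms has_derivative_bounded_linear unfolding C1_compact_def by blast
  then interpret bounded_linear "\<Theta>' Y" .
  have "v = (v $ 1) *\<^sub>R axis 1 1 + (v $ 2) *\<^sub>R axis 2 1"
    by (simp add: vec_eq_iff forall_2 axis_def)
  then have "\<Theta>' Y v = \<Theta>' Y ((v $ 1) *\<^sub>R axis 1 1 + (v $ 2) *\<^sub>R axis 2 1)" by simp
  then show ?thesis by (simp add: add scaleR)
qed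

lemma C1_compact_bounds:
  assumes C: "C1_compact \<Theta> \<Theta>'"
  obtains M B where "0 \<le> M" "0 < B" "\<And>Y. norm (\<Theta> Y) \<le> M" "\<And>Y v. norm (\<Theta>' Y v) \<le> M * norm v"
    "\<And>Y. B < norm Y \<Longrightarrow> \<Theta> Y = 0" "\<And>Y v. B < norm Y \<Longrightarrow> \<Theta>' Y v = 0"
proof -
  have d: "(\<Theta> has_derivative \<Theta>' Y) (at Y)" and c: "continuous_on UNIV (\<lambda>Y. \<Theta>' Y v)" for Y v
    using C by (auto simp: C1_compact_def)
  obtain B0 where B0: "\<And>Y. B0 < norm Y \<Longrightarrow> \<Theta> Y = 0" using C by (auto simp: C1_compact_def)
  define B where "B = max B0 1"
  have B: "0 < B" "\<And>Y. B < norm Y \<Longrightarrow> \<Theta> Y = 0" using B0 by (auto simp: B_def)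
  have d0: "\<Theta>' Y v = 0" if Y: "B < norm Y" for Y v
  proof -
    have "((\<lambda>_. 0) has_derivative \<Theta>' Y) (at Y)"
      by (rule has_derivative_transform_within_open[OF d, where s = "{Y. B < norm Y}"])
        (use Y B in \<open>auto intro!: open_Collect_less continuous_intros\<close>)
    then have "\<Theta>' Y = (\<lambda>_. 0)" by (rule has_derivative_unique) (rule has_derivative_const)
    then show ?thesis by simp
  qed
  have cT: "continuous_on UNIV \<Theta>"
    using d by (auto intro!: continuous_at_imp_continuous_on has_derivative_continuous)
  have bd: "\<exists>M. \<forall>Y. norm (g Y) \<le> M" if g: "continuous_on UNIV g" "\<And>Y. B < norm Y \<Longrightarrow> g Y = (0::complex)" for g :: "real^2 \<Rightarrow> complex"
  proof -
    have "bounded (g ` cball 0 B)" by (intro compact_imp_bounded compact_continuous_image continuous_on_subset[OF g(1)]) auto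
    then obtain M where M: "\<forall>x\<in>g ` cball 0 B. norm x \<le> M" unfolding bounded_iff ..
    have "norm (g Y) \<le> max M 0" for Y
      using M g(2)[of Y] by (cases "norm Y \<le> B") (auto simp: le_max_iff_disj)
    then show ?thesis by blast
  qed
  obtain M0 where M0: "\<And>Y. norm (\<Theta> Y) \<le> M0" using bd[OF cT B(2)] by blast
  obtain M1 where M1: "\<And>Y. norm (\<Theta>' Y (axis 1 1)) \<le> M1" using bd[OF c d0] by blast
  obtain M2 where M2: "\<And>Y. norm (\<Theta>' Y (axis 2 1)) \<le> M2" using bd[OF c d0] by blast
  have Mp: "0 \<le> M0" "0 \<le> M1" "0 \<le> M2" using order_trans[OF norm_ge_zero] M0 M1 M2 by blast+
  show thesis
  proof (rule that[of "M0 + M1 + M2" B])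
    show "norm (\<Theta> Y) \<le> M0 + M1 + M2" for Y using M0[of Y] Mp by linarith
    show "norm (\<Theta>' Y v) \<le> (M0 + M1 + M2) * norm v" for Y v
    proof -
      have "norm (\<Theta>' Y v) \<le> \<bar>v $ 1\<bar> * norm (\<Theta>' Y (axis 1 1)) + \<bar>v $ 2\<bar> * norm (\<Theta>' Y (axis 2 1))"
        unfolding C1_compact_expand[OF C, of Y v] by (rule order_trans[OF norm_triangle_ineq]) simp
      also have "\<dots> \<le> norm v * M1 + norm v * M2"
        using M1[of Y] M2[of Y] by (intro add_mono mult_mono component_le_norm_cart) auto
      also have "\<dots> \<le> (M0 + M1 + M2) * norm v" using Mp by (simp add: algebra_simps)
      finally show ?thesis .
    qed
  qed (use Mp B d0 in auto)
qed

lemma C1_compact_measurable: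
  assumes C: "C1_compact \<Theta> \<Theta>'"
  shows "\<Theta> \<in> borel_measurable borel" "(\<lambda>Y. \<Theta>' Y v) \<in> borel_measurable borel"
    "continuous_on UNIV \<Theta>"
proof -
  show c: "continuous_on UNIV \<Theta>"
    using C by (auto simp: C1_compact_def intro!: continuous_at_imp_continuous_on intro: has_derivative_continuous)
  then show "\<Theta> \<in> borel_measurable borel" by (rule borel_measurable_continuous_onI)
  show "(\<lambda>Y. \<Theta>' Y v) \<in> borel_measurable borel"
    using C by (auto simp: C1_compact_def intro: borel_measurable_continuous_onI)
qed

lemma integral_translate:
  fixes f :: "real^2 \<Rightarrow> complex"
  assumes [measurable]: "f \<in> borel_measurable borel"
  shows "(LINT Y|lborel. f Y) = (LINT Z|lborel. f (X + Z))"
    and "integrable lborel f \<longleftrightarrow> integrable lborel (\<lambda>Z. f (X + Z))"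
proof -
  have *: "lborel = distr lborel borel ((+) X)" by (simp add: lborel_distr_plus)
  show "(LINT Y|lborel. f Y) = (LINT Z|lborel. f (X + Z))"
    by (subst *, subst integral_distr) auto
  show "integrable lborel f \<longleftrightarrow> integrable lborel (\<lambda>Z. f (X + Z))"
    by (subst *, subst integrable_distr_eq) auto
qed

lemma integrable_bounded_support:
  fixes f :: "real^2 \<Rightarrow> complex"
  assumes "f \<in> borel_measurable borel" "\<And>Y. norm (f Y) \<le> M" "\<And>Y. B < norm Y \<Longrightarrow> f Y = 0"
  shows "integrable lborel f"
proof (rule Bochner_Integration.integrable_bound[where f = "\<lambda>Y. M * indicator (cball 0 B) Y"])
  show "integrable lborel (\<lambda>Y::real^2. M * indicator (cball 0 B) Y)"
    using emeasure_lborel_cball_finite[of "0::real^2" B]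
    by (intro integrable_mult_right) (simp add: integrable_indicator_iff)
  show "AE Y in lborel. norm (f Y) \<le> norm (M * indicator (cball 0 B) Y)"
  proof (intro AE_I2)
    fix Y :: "real^2"
    show "norm (f Y) \<le> norm (M * indicator (cball 0 B) Y)"
      using assms(2)[of Y] assms(3)[of Y] by (cases "norm Y \<le> B") (auto simp: indicator_def)
  qed
qed (use assms in simp)

lemma integral_angular_by_parts:
  fixes g g' :: "real \<Rightarrow> complex" and e q :: "real \<Rightarrow> real"
  assumes g: "\<And>\<theta>. (g has_vector_derivative g' \<theta>) (at \<theta>)" "continuous_on UNIV g'"
    and e: "\<And>\<theta>. (e has_real_derivative - q \<theta>) (at \<theta>)" "continuous_on UNIV q"
    and per: "g pi = g (-pi)" "e pi = e (-pi)"
  shows "(LINT \<theta>|lborel. indicator {-pi<..<pi} \<theta> *\<^sub>R (of_real (q \<theta>) * g \<theta>))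
    = (LINT \<theta>|lborel. indicator {-pi<..<pi} \<theta> *\<^sub>R (of_real (e \<theta>) * g' \<theta>))"
proof -
  have gc: "continuous_on UNIV g" using g(1) by (auto intro!: continuous_at_imp_continuous_on has_vector_derivative_continuous)
  have ec: "continuous_on UNIV e" using e(1) by (auto intro!: continuous_at_imp_continuous_on DERIV_isCont)
  let ?a = "\<lambda>\<theta>. of_real (q \<theta>) * g \<theta>" and ?b = "\<lambda>\<theta>. of_real (e \<theta>) * g' \<theta>"
  have op: "(LINT \<theta>|lborel. indicator {-pi<..<pi} \<theta> *\<^sub>R f \<theta>) = (LINT \<theta>|lborel. indicator {-pi..pi} \<theta> *\<^sub>R f \<theta>)"
    if "continuous_on UNIV f" for f :: "real \<Rightarrow> complex"
  proof (rule integral_cong_AE)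
    have [measurable]: "f \<in> borel_measurable borel" using that by (rule borel_measurable_continuous_onI)
    show "(\<lambda>\<theta>. indicator {-pi<..<pi} \<theta> *\<^sub>R f \<theta>) \<in> borel_measurable lborel" by measurable
    show "(\<lambda>\<theta>. indicator {-pi..pi} \<theta> *\<^sub>R f \<theta>) \<in> borel_measurable lborel" by measurable
    show "AE \<theta> in lborel. indicator {-pi<..<pi} \<theta> *\<^sub>R f \<theta> = indicator {-pi..pi} \<theta> *\<^sub>R f \<theta>"
      using AE_lborel_neq[of pi] AE_lborel_neq[of "-pi"] by eventually_elim (auto simp: indicator_def)
  qed
  have c: "continuous_on UNIV ?a" "continuous_on UNIV ?b" by (intro continuous_intros gc ec g e)+
  have i: "integrable lborel (\<lambda>\<theta>. indicator {-pi..pi} \<theta> *\<^sub>R f \<theta>)" if "continuous_on UNIV f" for f :: "real \<Rightarrow> complex"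
    by (intro borel_integrable_compact continuous_on_subset[OF that]) auto
  have "(LINT \<theta>|lborel. indicator {-pi..pi} \<theta> *\<^sub>R (?b \<theta> - ?a \<theta>)) = of_real (e pi) * g pi - of_real (e (-pi)) * g (-pi)"
  proof (rule integral_FTC_Icc)
    fix \<theta>
    have "(e has_vector_derivative - q \<theta>) (at \<theta>)" using e(1) by (simp add: has_real_derivative_iff_has_vector_derivative)
    then have "((\<lambda>\<theta>. complex_of_real (e \<theta>)) has_vector_derivative of_real (- q \<theta>)) (at \<theta>)"
      by (rule bounded_linear.has_vector_derivative[OF bounded_linear_of_real])
    from has_vector_derivative_mult[OF this g(1)]
    have "((\<lambda>\<theta>. complex_of_real (e \<theta>) * g \<theta>) has_vector_derivative ?b \<theta> - ?a \<theta>) (at \<theta>)" by simp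
    then show "((\<lambda>\<theta>. complex_of_real (e \<theta>) * g \<theta>) has_vector_derivative ?b \<theta> - ?a \<theta>) (at \<theta> within {-pi..pi})"
      by (rule has_vector_derivative_at_within)
  next
    show "continuous_on {-pi..pi} (\<lambda>\<theta>. ?b \<theta> - ?a \<theta>)"
      by (rule continuous_on_subset[OF continuous_on_diff[OF c(2,1)]]) simp
  qed simp
  also have "\<dots> = 0" using per by simp
  finally have "(LINT \<theta>|lborel. indicator {-pi..pi} \<theta> *\<^sub>R ?b \<theta>) - (LINT \<theta>|lborel. indicator {-pi..pi} \<theta> *\<^sub>R ?a \<theta>) = 0"
    unfolding scaleR_diff_right using i[OF c(1)] i[OF c(2)] by (simp add: Bochner_Integration.integral_diff)
  then show ?thesis unfolding op[OF c(1)] op[OF c(2)] by simp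
qed

lemma polar_periodic: "polar r pi = polar r (-pi)"
  by (simp add: vec_eq_iff forall_2)

lemma polar_angle_derivative: "((\<lambda>\<theta>. polar r \<theta>) has_vector_derivative perp (polar r \<theta>)) (at \<theta>)"
proof -
  have "((\<lambda>\<theta>. (r * cos \<theta>) *\<^sub>R axis 1 1 + (r * sin \<theta>) *\<^sub>R (axis 2 1 :: real^2)) has_vector_derivative
     (r * - sin \<theta>) *\<^sub>R axis 1 1 + (r * cos \<theta>) *\<^sub>R axis 2 1) (at \<theta>)"
    by (auto intro!: derivative_eq_intros simp: mult.commute simp flip: has_real_derivative_iff_has_vector_derivative)
  moreover have "perp (polar r \<theta>) = (r * - sin \<theta>) *\<^sub>R axis 1 1 + (r * cos \<theta>) *\<^sub>R axis 2 1"
    by (simp add: vec_eq_iff forall_2 axis_def)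
  ultimately show ?thesis by (simp add: polar_def vector2_eq)
qed

lemma exhaust2: "(j::2) = 1 \<or> j = 2" using exhaust_2 by blast

text \<open>
  The Biot--Savart integrand after integration by parts along the circles around \<open>X\<close>. The angular
  derivative of \<open>\<Theta>\<close> contributes a factor of order \<open>norm Z\<close>, so the singularity is of order \<open>- \<alpha>\<close>
  instead of \<open>- 1 - \<alpha>\<close>, and the integral converges absolutely for all \<open>\<alpha> < 2\<close>.
\<close>

definition kern :: "real \<Rightarrow> (real^2 \<Rightarrow> real^2 \<Rightarrow> complex) \<Rightarrow> real^2 \<Rightarrow> 2 \<Rightarrow> real^2 \<Rightarrow> complex" where
  "kern \<alpha> \<Theta>' X j Z = of_real (Z $ j / norm Z powr (2 + \<alpha>)) * \<Theta>' (X + Z) (perp Z)"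

lemma kern_measurable:
  assumes C: "C1_compact \<Theta> \<Theta>'"
  shows "kern \<alpha> \<Theta>' X j \<in> borel_measurable borel"
proof -
  have [measurable]: "(\<lambda>Y. \<Theta>' Y v) \<in> borel_measurable borel" for v by (rule C1_compact_measurable[OF C])
  have nm[measurable]: "(\<lambda>Z::real^2. Z $ i) \<in> borel_measurable borel" for i
    by (intro borel_measurable_continuous_onI continuous_intros)
  have [measurable]: "(\<lambda>Z::real^2. \<Theta>' (X + Z) v) \<in> borel_measurable borel" for v
    by (rule measurable_compose[of "\<lambda>Z. X + Z" borel borel]) measurable
  show ?thesis
    unfolding kern_def[abs_def] C1_compact_expand[OF C, of _ "perp _"] perp_nth
    by measurable
qed

lemma norm_of_real_divide_mult:
  "0 \<le> y \<Longrightarrow> norm (of_real (x / y) * w :: complex) = \<bar>x\<bar> / y * norm w"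
  by (simp add: norm_mult norm_divide)

lemma truncated_integrable:
  assumes C: "C1_compact \<Theta> \<Theta>'" and \<epsilon>: "0 < \<epsilon>" and \<alpha>: "0 \<le> \<alpha>"
  shows "integrable lborel (\<lambda>Z. indicator {Z. \<epsilon> < norm Z} Z *\<^sub>R (of_real (perp (- Z) $ j / norm Z powr (2 + \<alpha>)) * \<Theta> (X + Z)))"
    (is "integrable lborel ?A")
proof -
  obtain M B where MB: "0 \<le> M" "0 < B" "\<And>Y. norm (\<Theta> Y) \<le> M" "\<And>Y v. norm (\<Theta>' Y v) \<le> M * norm v"
    "\<And>Y. B < norm Y \<Longrightarrow> \<Theta> Y = 0" "\<And>Y v. B < norm Y \<Longrightarrow> \<Theta>' Y v = 0"
    using C1_compact_bounds[OF C] by metis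
  note m[measurable] = C1_compact_measurable(1)[OF C]
  have om[measurable]: "{Z::real^2. \<epsilon> < norm Z} \<in> sets borel"
    by (intro borel_open open_Collect_less continuous_intros)
  have [measurable]: "(\<lambda>Z. perp (- Z) $ j) \<in> borel_measurable borel"
    by (intro borel_measurable_continuous_onI continuous_intros)
  have Am: "?A \<in> borel_measurable borel" by measurable
  have pw: "norm Z powr (2 + \<alpha>) \<ge> \<epsilon> powr (2 + \<alpha>)" if "\<epsilon> < norm Z" for Z :: "real^2"
    using that \<epsilon> \<alpha> by (intro powr_mono2) auto
  have e0: "\<epsilon> powr (2 + \<alpha>) > 0" using \<epsilon> by simp
  have supp: "B < norm (X + Z)" if "B + norm X < norm Z" for Z
    using norm_triangle_ineq4[of "X + Z" X] that by simp
  show ?thesis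
    proof (rule integrable_bounded_support[OF Am, of "(B + norm X) / \<epsilon> powr (2 + \<alpha>) * M" "B + norm X"])
      fix Z :: "real^2"
      show z: "?A Z = 0" if "B + norm X < norm Z" using MB(5)[OF supp[OF that]] by simp
      show "norm (?A Z) \<le> (B + norm X) / \<epsilon> powr (2 + \<alpha>) * M"
      proof (cases "\<epsilon> < norm Z \<and> norm Z \<le> B + norm X")
        case True
        have "\<bar>perp (- Z) $ j\<bar> \<le> norm Z" using component_le_norm_cart[of "perp (-Z)" j] by (simp add: norm_perp)
        then have "\<bar>perp (- Z) $ j\<bar> / norm Z powr (2 + \<alpha>) \<le> (B + norm X) / \<epsilon> powr (2 + \<alpha>)"
          using True pw[of Z] e0 by (intro frac_le) auto
        then have "\<bar>perp (- Z) $ j\<bar> / norm Z powr (2 + \<alpha>) * norm (\<Theta> (X + Z)) \<le> (B + norm X) / \<epsilon> powr (2 + \<alpha>) * M"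
          by (rule mult_mono) (use MB(1,2) MB(3)[of "X + Z"] e0 in auto)
        moreover have "?A Z = of_real (perp (- Z) $ j / norm Z powr (2 + \<alpha>)) * \<Theta> (X + Z)" using True by simp
        ultimately show ?thesis by (simp only: norm_of_real_divide_mult powr_ge_zero)
      next
        case False
        then have z0: "?A Z = 0" using z by (cases "\<epsilon> < norm Z") (auto simp: indicator_def not_le)
        have "0 \<le> (B + norm X) / \<epsilon> powr (2 + \<alpha>) * M"
          using MB(1,2) e0 by (intro mult_nonneg_nonneg divide_nonneg_pos) auto
        then show ?thesis by (simp only: z0 norm_zero)
      qed
    qed
qed

text \<open>
  The truncation removes a disc, so it only sees full circles around \<open>X\<close>. On each of them the kernel is
  the angular derivative of \<open>- Z / norm Z powr (2 + \<alpha>)\<close>, and the boundary terms cancel by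
  periodicity.
\<close>

lemma truncated_velocity_by_parts:
  assumes C: "C1_compact \<Theta> \<Theta>'" and \<epsilon>: "0 < \<epsilon>" and \<alpha>: "0 \<le> \<alpha>"
  shows "(LINT Y:{Y. \<epsilon> < dist X Y}|lebesgue. BS_integrand \<alpha> \<Theta> X j Y)
    = (LINT Z|lborel. indicator {Z. \<epsilon> < norm Z} Z *\<^sub>R kern \<alpha> \<Theta>' X j Z)"
proof -
  obtain M B where MB: "0 \<le> M" "0 < B" "\<And>Y. norm (\<Theta> Y) \<le> M" "\<And>Y v. norm (\<Theta>' Y v) \<le> M * norm v"
    "\<And>Y. B < norm Y \<Longrightarrow> \<Theta> Y = 0" "\<And>Y v. B < norm Y \<Longrightarrow> \<Theta>' Y v = 0"
    using C1_compact_bounds[OF C] by metis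
  note m[measurable] = C1_compact_measurable(1,2)[OF C]
  have nm[measurable]: "(\<lambda>Z::real^2. Z $ i) \<in> borel_measurable borel" for i
    by (intro borel_measurable_continuous_onI continuous_intros)
  have pm[measurable]: "(\<lambda>Z::real^2. perp Z $ i) \<in> borel_measurable borel" for i
    by (intro borel_measurable_continuous_onI continuous_intros)
  have om[measurable]: "{Z::real^2. \<epsilon> < norm Z} \<in> sets borel"
    by (intro borel_open open_Collect_less continuous_intros)
  let ?AA = "\<lambda>Y. indicator {Y. \<epsilon> < dist X Y} Y *\<^sub>R BS_integrand \<alpha> \<Theta> X j Y"
  let ?A = "\<lambda>Z. indicator {Z. \<epsilon> < norm Z} Z *\<^sub>R (of_real (perp (- Z) $ j / norm Z powr (2 + \<alpha>)) * \<Theta> (X + Z))"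
  let ?B = "\<lambda>Z. indicator {Z. \<epsilon> < norm Z} Z *\<^sub>R kern \<alpha> \<Theta>' X j Z"
  have A0m: "?AA \<in> borel_measurable borel"
  proof -
    have "open {Y. \<epsilon> < dist X Y}" by (intro open_Collect_less continuous_intros)
    then have [measurable]: "{Y. \<epsilon> < dist X Y} \<in> sets borel" by simp
    have [measurable]: "(\<lambda>Y. perp (X - Y) $ j) \<in> borel_measurable borel"
      by (intro borel_measurable_continuous_onI continuous_intros)
    show ?thesis unfolding BS_integrand_def by measurable
  qed
  have "(LINT Y:{Y. \<epsilon> < dist X Y}|lebesgue. BS_integrand \<alpha> \<Theta> X j Y) = (LINT Y|lborel. ?AA Y)"
    unfolding set_lebesgue_integral_def by (rule integral_completion) (use A0m in simp)
  also have "\<dots> = (LINT Z|lborel. ?AA (X + Z))" by (rule integral_translate(1)[OF A0m])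
  also have "\<dots> = (LINT Z|lborel. ?A Z)"
    by (simp add: BS_integrand_def indicator_def dist_norm)
  also have "\<dots> = (LINT Z|lborel. ?B Z)"
  proof -
    have Am: "?A \<in> borel_measurable borel"
    proof -
      have [measurable]: "(\<lambda>Z. perp (- Z) $ j) \<in> borel_measurable borel"
        by (intro borel_measurable_continuous_onI continuous_intros)
      show ?thesis by measurable
    qed
    have Bm: "?B \<in> borel_measurable borel" using kern_measurable[OF C] by measurable
    have pw: "norm Z powr (2 + \<alpha>) \<ge> \<epsilon> powr (2 + \<alpha>)" if "\<epsilon> < norm Z" for Z :: "real^2"
      using that \<epsilon> \<alpha> by (intro powr_mono2) auto
    have e0: "\<epsilon> powr (2 + \<alpha>) > 0" using \<epsilon> by simp
    have supp: "B < norm (X + Z)" if "B + norm X < norm Z" for Z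
      using norm_triangle_ineq4[of "X + Z" X] that by simp
    have Ai: "integrable lborel ?A" by (rule truncated_integrable[OF C \<epsilon> \<alpha>])
    have Bi: "integrable lborel ?B"
    proof (rule integrable_bounded_support[OF Bm, of "(B + norm X) / \<epsilon> powr (2 + \<alpha>) * (M * (B + norm X))" "B + norm X"])
      fix Z :: "real^2"
      show z: "?B Z = 0" if "B + norm X < norm Z" using MB(6)[OF supp[OF that]] by (simp add: kern_def)
      show "norm (?B Z) \<le> (B + norm X) / \<epsilon> powr (2 + \<alpha>) * (M * (B + norm X))"
      proof (cases "\<epsilon> < norm Z \<and> norm Z \<le> B + norm X")
        case True
        have "\<bar>Z $ j\<bar> \<le> norm Z" by (rule component_le_norm_cart)
        then have 1: "\<bar>Z $ j\<bar> / norm Z powr (2 + \<alpha>) \<le> (B + norm X) / \<epsilon> powr (2 + \<alpha>)"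
          using True pw[of Z] e0 by (intro frac_le) auto
        have "norm (\<Theta>' (X + Z) (perp Z)) \<le> M * norm Z" using MB(4)[of "X + Z" "perp Z"] by (simp add: norm_perp)
        also have "\<dots> \<le> M * (B + norm X)" using True MB(1) by (intro mult_left_mono) auto
        finally have 2: "norm (\<Theta>' (X + Z) (perp Z)) \<le> M * (B + norm X)" .
        have "?B Z = of_real (Z $ j / norm Z powr (2 + \<alpha>)) * \<Theta>' (X + Z) (perp Z)"
          using True by (simp add: kern_def)
        then have "norm (?B Z) = \<bar>Z $ j\<bar> / norm Z powr (2 + \<alpha>) * norm (\<Theta>' (X + Z) (perp Z))"
          by (simp only: norm_of_real_divide_mult powr_ge_zero)
        also have "\<dots> \<le> (B + norm X) / \<epsilon> powr (2 + \<alpha>) * (M * (B + norm X))"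
          by (rule mult_mono[OF 1 2]) (use MB(2) e0 in auto)
        finally show ?thesis .
      next
        case False
        then have z0: "?B Z = 0" using z by (cases "\<epsilon> < norm Z") (auto simp: indicator_def not_le)
        have "0 \<le> (B + norm X) / \<epsilon> powr (2 + \<alpha>) * (M * (B + norm X))"
          using MB(1,2) e0 by (intro mult_nonneg_nonneg divide_nonneg_pos) auto
        then show ?thesis by (simp only: z0 norm_zero)
      qed
    qed
    let ?P = "\<lambda>f z. (indicator {-pi<..<pi} (snd z) * exp (2 * fst z)) *\<^sub>R (f :: real^2 \<Rightarrow> complex) (polar (exp (fst z)) (0 + snd z))"
    have fub: "(LINT Z|lborel. f Z) = (LINT t|lborel. LINT \<theta>|lborel. ?P f (t, \<theta>))"
      if f: "f \<in> borel_measurable borel" "integrable lborel f" for f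
    proof -
      have "integrable (lborel \<Otimes>\<^sub>M lborel) (?P f)" using f(2) unfolding integral_log_polar(2)[OF f(1), of 0] .
      then have "(LINT t|lborel. LINT \<theta>|lborel. ?P f (t, \<theta>)) = (LINT z|(lborel \<Otimes>\<^sub>M lborel). ?P f z)"
        by (rule lborel_pair.integral_fst')
      then show ?thesis by (simp only: integral_log_polar(1)[OF f(1), of 0])
    qed
    have inner: "(LINT \<theta>|lborel. ?P ?A (t, \<theta>)) = (LINT \<theta>|lborel. ?P ?B (t, \<theta>))" for t
    proof -
      let ?r = "exp t"
      let ?k = "indicator {r. \<epsilon> < r} ?r * exp (2 * t) * (?r / ?r powr (2 + \<alpha>)) :: real"
      \<comment> \<open>The components of the unit vector and of minus its rotation, so that \<open>e' = - q\<close>.\<close>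
      define e q :: "real \<Rightarrow> real" where "e = (if j = 1 then cos else sin)" and "q = (if j = 1 then sin else (\<lambda>\<theta>. - cos \<theta>))"
      let ?g = "\<lambda>\<theta>. \<Theta> (X + polar ?r \<theta>)" and ?g' = "\<lambda>\<theta>. \<Theta>' (X + polar ?r \<theta>) (perp (polar ?r \<theta>))"
      have ej: "polar r \<theta> $ j = r * e \<theta>" "perp (- polar r \<theta>) $ j = r * q \<theta>" for r \<theta>
        using exhaust2[of j] by (auto simp: e_def q_def)
      have pA: "?P ?A (t, \<theta>) = of_real ?k * (indicator {-pi<..<pi} \<theta> *\<^sub>R (of_real (q \<theta>) * ?g \<theta>))" for \<theta>
        by (simp add: ej norm_polar indicator_def scaleR_conv_of_real del: perp_nth polar_nth)
      have pB: "?P ?B (t, \<theta>) = of_real ?k * (indicator {-pi<..<pi} \<theta> *\<^sub>R (of_real (e \<theta>) * ?g' \<theta>))" for \<theta>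
        by (simp add: kern_def ej norm_polar indicator_def scaleR_conv_of_real del: perp_nth polar_nth)
      have c: "(LINT \<theta>|lborel. indicator {-pi<..<pi} \<theta> *\<^sub>R (of_real (q \<theta>) * ?g \<theta>))
         = (LINT \<theta>|lborel. indicator {-pi<..<pi} \<theta> *\<^sub>R (of_real (e \<theta>) * ?g' \<theta>))"
      proof (rule integral_angular_by_parts)
        show "(?g has_vector_derivative ?g' \<theta>) (at \<theta>)" for \<theta>
        proof -
          have "((\<lambda>\<theta>. X + polar ?r \<theta>) has_vector_derivative perp (polar ?r \<theta>)) (at \<theta>)"
            using has_vector_derivative_add[OF has_vector_derivative_const polar_angle_derivative] by simp
          then have d1: "((\<lambda>\<theta>. X + polar ?r \<theta>) has_derivative (\<lambda>h. h *\<^sub>R perp (polar ?r \<theta>))) (at \<theta>)"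
            by (simp add: has_vector_derivative_def)
          have d2: "(\<Theta> has_derivative \<Theta>' Y) (at Y)" for Y using C by (auto simp: C1_compact_def)
          interpret bounded_linear "\<Theta>' (X + polar ?r \<theta>)" using d2 by (rule has_derivative_bounded_linear)
          show ?thesis
            using has_derivative_compose[OF d1 d2] by (simp add: has_vector_derivative_def scaleR)
        qed
        have pc: "continuous_on UNIV (\<lambda>\<theta>. polar ?r \<theta>)"
          unfolding polar_def vector2_eq by (intro continuous_intros)
        have Tc: "continuous_on UNIV (\<lambda>Y. \<Theta>' Y v)" for v using C by (auto simp: C1_compact_def)
        show "continuous_on UNIV ?g'"
          unfolding C1_compact_expand[OF C, of _ "perp _"]
          by (intro continuous_intros pc continuous_on_compose2[OF Tc]) auto
        show "(e has_real_derivative - q \<theta>) (at \<theta>)" for \<theta>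
          by (auto simp: e_def q_def intro!: derivative_eq_intros)
        show "continuous_on UNIV q" by (auto simp: q_def intro!: continuous_intros)
        show "e pi = e (- pi)" by (simp add: e_def)
      qed (simp add: polar_periodic)
      show ?thesis by (simp only: pA pB integral_mult_right_zero c)
    qed
    show ?thesis unfolding fub[OF Am Ai] fub[OF Bm Bi] inner ..
  qed
  finally show ?thesis .
qed

lemma integrable_exp_lower: "b > 0 \<Longrightarrow> integrable lborel (\<lambda>t::real. indicator {..c} t * exp (b * t))"
proof -
  assume b: "b > 0"
  have "(\<lambda>x. exp (- b * x)) absolutely_integrable_on {-c..}"
    by (intro nonnegative_absolutely_integrable_1 integrable_on_exp_minus_to_infinity b) auto
  then have "set_integrable lborel {-c..} (\<lambda>x. exp (- b * x))"
    unfolding set_integrable_def by (subst (asm) integrable_completion) auto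
  then have 1: "integrable lborel (\<lambda>x. indicator {-c..} x * exp (- b * x))" by (simp add: set_integrable_def)
  have "integrable lborel (\<lambda>x. indicator {-c..} (0 + (-1) * x) * exp (- b * (0 + (-1) * x)))"
    by (rule lborel_integrable_real_affine[OF 1]) simp
  then show ?thesis by (simp add: indicator_def)
qed

lemma kern_integrable:
  assumes C: "C1_compact \<Theta> \<Theta>'" and \<alpha>: "0 \<le> \<alpha>" "\<alpha> \<le> 1"
  shows "integrable lborel (kern \<alpha> \<Theta>' X j)"
proof -
  obtain M B where MB: "0 \<le> M" "0 < B" "\<And>Y. norm (\<Theta> Y) \<le> M" "\<And>Y v. norm (\<Theta>' Y v) \<le> M * norm v"
    "\<And>Y. B < norm Y \<Longrightarrow> \<Theta> Y = 0" "\<And>Y v. B < norm Y \<Longrightarrow> \<Theta>' Y v = 0"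
    using C1_compact_bounds[OF C] by metis
  note km = kern_measurable[OF C, of \<alpha> X j]
  define c where "c = ln (B + norm X)"
  have Bp: "B + norm X > 0" using MB(2) by (simp add: add_pos_nonneg)
  show ?thesis
    unfolding integral_log_polar(2)[OF km, where ?\<phi>0.0 = 0]
  proof (rule Bochner_Integration.integrable_bound)
    show "integrable (lborel \<Otimes>\<^sub>M lborel) (\<lambda>(t,\<theta>). (M * (indicator {..c} t * exp ((2 - \<alpha>) * t))) * indicator {-pi<..<pi} \<theta>)"
      using \<alpha> by (intro integrable_prod_mult integrable_mult_right integrable_exp_lower) (auto simp: integrable_indicator_iff)
    show "(\<lambda>z. (indicator {-pi<..<pi} (snd z) * exp (2 * fst z)) *\<^sub>R kern \<alpha> \<Theta>' X j (polar (exp (fst z)) (0 + snd z))) \<in> borel_measurable (lborel \<Otimes>\<^sub>M lborel)"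
      using km by measurable
    show "AE z in lborel \<Otimes>\<^sub>M lborel. norm ((indicator {-pi<..<pi} (snd z) * exp (2 * fst z)) *\<^sub>R kern \<alpha> \<Theta>' X j (polar (exp (fst z)) (0 + snd z)))
      \<le> norm (case z of (t,\<theta>) \<Rightarrow> (M * (indicator {..c} t * exp ((2 - \<alpha>) * t))) * indicator {-pi<..<pi} \<theta>)"
    proof (intro AE_I2)
      fix z :: "real \<times> real"
      obtain t \<theta> where z: "z = (t, \<theta>)" by (cases z)
      let ?Z = "polar (exp t) \<theta>"
      have nZ: "norm ?Z = exp t" by (simp add: norm_polar)
      have "norm (kern \<alpha> \<Theta>' X j ?Z) \<le> indicator {..c} t * (exp t / exp t powr (2 + \<alpha>) * (M * exp t))"
      proof (cases "t \<le> c")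
        case True
        have 1: "\<bar>?Z $ j\<bar> / exp t powr (2 + \<alpha>) \<le> exp t / exp t powr (2 + \<alpha>)"
          using component_le_norm_cart[of ?Z j] by (intro divide_right_mono) (auto simp: nZ)
        have 2: "norm (\<Theta>' (X + ?Z) (perp ?Z)) \<le> M * exp t" using MB(4)[of "X + ?Z" "perp ?Z"] by (simp add: norm_perp nZ)
        have "norm (kern \<alpha> \<Theta>' X j ?Z) = \<bar>?Z $ j\<bar> / exp t powr (2 + \<alpha>) * norm (\<Theta>' (X + ?Z) (perp ?Z))"
          unfolding kern_def norm_of_real_divide_mult[OF powr_ge_zero] nZ ..
        also have "\<dots> \<le> exp t / exp t powr (2 + \<alpha>) * (M * exp t)" by (rule mult_mono[OF 1 2]) auto
        finally show ?thesis using True by simp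
      next
        case False
        then have "exp c < exp t" by simp
        then have "B + norm X < exp t" using Bp by (simp add: c_def)
        then have "B < norm (X + ?Z)" using norm_triangle_ineq4[of "X + ?Z" X] by (simp add: nZ)
        then show ?thesis using False MB(6) by (simp add: kern_def)
      qed
      also have "exp t / exp t powr (2 + \<alpha>) * (M * exp t) = M * exp (- \<alpha> * t)"
        by (simp add: exp_powr_real flip: exp_add exp_diff) (simp add: mult.left_commute algebra_simps flip: exp_add exp_diff)
      finally have k: "norm (kern \<alpha> \<Theta>' X j ?Z) \<le> indicator {..c} t * (M * exp (- \<alpha> * t))" .
      have "norm ((indicator {-pi<..<pi} \<theta> * exp (2 * t)) *\<^sub>R kern \<alpha> \<Theta>' X j ?Z) = indicator {-pi<..<pi} \<theta> * exp (2 * t) * norm (kern \<alpha> \<Theta>' X j ?Z)"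
        by simp
      also have "\<dots> \<le> indicator {-pi<..<pi} \<theta> * exp (2 * t) * (indicator {..c} t * (M * exp (- \<alpha> * t)))"
        by (intro mult_left_mono k) auto
      also have "\<dots> = (M * (indicator {..c} t * exp ((2 - \<alpha>) * t))) * indicator {-pi<..<pi} \<theta>"
        by (simp add: algebra_simps exp_diff exp_minus divide_inverse)
      finally show "norm ((indicator {-pi<..<pi} (snd z) * exp (2 * fst z)) *\<^sub>R kern \<alpha> \<Theta>' X j (polar (exp (fst z)) (0 + snd z)))
        \<le> norm (case z of (t,\<theta>) \<Rightarrow> (M * (indicator {..c} t * exp ((2 - \<alpha>) * t))) * indicator {-pi<..<pi} \<theta>)"
        using MB(1) by (simp add: z)
    qed
  qed
qed

lemma truncated_velocity_tendsto:
  assumes C: "C1_compact \<Theta> \<Theta>'" and \<alpha>: "0 \<le> \<alpha>" "\<alpha> \<le> 1"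
  shows "((\<lambda>\<epsilon>. LINT Y:{Y. \<epsilon> < dist X Y}|lebesgue. BS_integrand \<alpha> \<Theta> X j Y) \<longlongrightarrow> (LINT Z|lborel. kern \<alpha> \<Theta>' X j Z)) (at_right 0)"
proof (rule tendsto_at_right_sequentially[where b = 1])
  fix S :: "nat \<Rightarrow> real" assume S: "\<And>n. 0 < S n" "S \<longlonglongrightarrow> 0"
  note km = kern_measurable[OF C]
  have "(\<lambda>n. LINT Z|lborel. indicator {Z. S n < norm Z} Z *\<^sub>R kern \<alpha> \<Theta>' X j Z) \<longlonglongrightarrow> (LINT Z|lborel. kern \<alpha> \<Theta>' X j Z)"
  proof (rule integral_dominated_convergence[where w = "\<lambda>Z. norm (kern \<alpha> \<Theta>' X j Z)"])
    have "{Z::real^2. S n < norm Z} \<in> sets borel" for n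
      by (intro borel_open open_Collect_less continuous_intros)
    then show "(\<lambda>Z. indicator {Z. S n < norm Z} Z *\<^sub>R kern \<alpha> \<Theta>' X j Z) \<in> borel_measurable lborel" for n
      using km by simp
    show "AE Z in lborel. (\<lambda>n. indicator {Z. S n < norm Z} Z *\<^sub>R kern \<alpha> \<Theta>' X j Z) \<longlonglongrightarrow> kern \<alpha> \<Theta>' X j Z"
    proof (intro AE_I2)
      fix Z :: "real^2"
      show "(\<lambda>n. indicator {Z. S n < norm Z} Z *\<^sub>R kern \<alpha> \<Theta>' X j Z) \<longlonglongrightarrow> kern \<alpha> \<Theta>' X j Z"
      proof (cases "Z = 0")
        case True then show ?thesis by (simp add: kern_def)
      next
        case False
        then have "eventually (\<lambda>n. S n < norm Z) sequentially" by (intro order_tendstoD[OF S(2)]) simp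
        then have "eventually (\<lambda>n. indicator {Z. S n < norm Z} Z *\<^sub>R kern \<alpha> \<Theta>' X j Z = kern \<alpha> \<Theta>' X j Z) sequentially"
          by eventually_elim simp
        then show ?thesis by (rule tendsto_eventually)
      qed
    qed
    show "AE Z in lborel. norm (indicator {Z. S n < norm Z} Z *\<^sub>R kern \<alpha> \<Theta>' X j Z) \<le> norm (kern \<alpha> \<Theta>' X j Z)" for n
      by (intro AE_I2) (simp add: indicator_def)
  qed (use km kern_integrable[OF C \<alpha>] in auto)
  then show "(\<lambda>n. LINT Y:{Y. S n < dist X Y}|lebesgue. BS_integrand \<alpha> \<Theta> X j Y) \<longlonglongrightarrow> (LINT Z|lborel. kern \<alpha> \<Theta>' X j Z)"
    by (simp add: truncated_velocity_by_parts[OF C S(1) \<alpha>(1)])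
qed simp

lemma velocity_eq_kern:
  assumes C: "C1_compact \<Theta> \<Theta>'" and \<alpha>: "0 \<le> \<alpha>" "\<alpha> \<le> 1"
  shows "velocity \<alpha> \<Theta> X $ j = of_real (C_const \<alpha>) * (LINT Z|lborel. kern \<alpha> \<Theta>' X j Z)"
  using tendsto_Lim[OF _ truncated_velocity_tendsto[OF assms]] by (simp add: velocity_def)

section \<open>Velocities of radial functions and of angular modes\<close>

lemma norm_polar_diff_sq:
  "(norm (polar (exp s) \<phi> - polar (exp t) (\<phi> + \<theta>)))\<^sup>2 = exp s * exp t * chord (s - t) \<theta>"
proof -
  let ?R = "exp s" and ?S = "exp t"
  have ch: "?R * ?S * (2 * cosh (s - t)) = ?R * ?R + ?S * ?S"
    by (simp add: cosh_field_def exp_diff exp_minus field_simps)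
  have c: "cos \<phi> * cos (\<phi> + \<theta>) + sin \<phi> * sin (\<phi> + \<theta>) = cos \<theta>"
    using cos_diff[of "\<phi> + \<theta>" \<phi>] by (simp add: mult.commute)
  have "(norm (polar ?R \<phi> - polar ?S (\<phi> + \<theta>)))\<^sup>2
     = (?R * cos \<phi> - ?S * cos (\<phi> + \<theta>))\<^sup>2 + (?R * sin \<phi> - ?S * sin (\<phi> + \<theta>))\<^sup>2"
    unfolding power2_norm_eq_inner inner_real2 by (simp add: power2_eq_square)
  also have "\<dots> = ?R * ?R * ((sin \<phi>)\<^sup>2 + (cos \<phi>)\<^sup>2) + ?S * ?S * ((sin (\<phi> + \<theta>))\<^sup>2 + (cos (\<phi> + \<theta>))\<^sup>2)
      - 2 * ?R * ?S * (cos \<phi> * cos (\<phi> + \<theta>) + sin \<phi> * sin (\<phi> + \<theta>))"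
    by algebra
  also have "\<dots> = ?R * ?R + ?S * ?S - 2 * ?R * ?S * cos \<theta>" unfolding c by simp
  also have "\<dots> = ?R * ?S * chord (s - t) \<theta>" unfolding chord_def right_diff_distrib ch by simp
  finally show ?thesis .
qed

lemma divide_norm_powr_polar:
  assumes a: "a = 1 + \<alpha> / 2"
  shows "x / norm (polar (exp s) \<phi> - polar (exp t) (\<phi> + \<theta>)) powr (2 + \<alpha>)
    = x * (exp (- a * s) * exp (- a * t) * chord (s - t) \<theta> powr (- a))"
proof -
  let ?n = "norm (polar (exp s) \<phi> - polar (exp t) (\<phi> + \<theta>))"
  have "?n powr (2 + \<alpha>) = (?n\<^sup>2) powr a"
  proof (cases "?n = 0")
    case False
    then have "?n > 0" by simp
    then have "(?n\<^sup>2) powr a = (?n powr 2) powr a" by simp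
    also have "\<dots> = ?n powr (2 + \<alpha>)" unfolding powr_powr a by (simp add: distrib_left)
    finally show ?thesis ..
  qed simp
  also have "\<dots> = exp (a * s) * exp (a * t) * chord (s - t) \<theta> powr a"
    unfolding norm_polar_diff_sq by (simp add: powr_mult chord_nonneg exp_powr_real mult.commute)
  finally have e: "?n powr (2 + \<alpha>) = exp (a * s) * exp (a * t) * chord (s - t) \<theta> powr a" .
  show ?thesis unfolding e by (simp add: exp_minus powr_minus divide_inverse)
qed

lemma mode_kernel_open:
  "mode_kernel a n u = (LINT \<theta>|lborel. indicator {-pi<..<pi} \<theta> * (sin \<theta> * sin (real n * \<theta>) * chord u \<theta> powr (- a)))"
  unfolding mode_kernel_def
proof (rule integral_cong_AE)
  show "AE \<theta> in lborel. ang_kernel a n u \<theta> = indicator {-pi<..<pi} \<theta> * (sin \<theta> * sin (real n * \<theta>) * chord u \<theta> powr (- a))"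
    using AE_lborel_neq[of pi] AE_lborel_neq[of "-pi"]
    by eventually_elim (auto simp: ang_kernel_def indicator_def)
qed measurable

lemma integral_reflect:
  fixes f :: "real \<Rightarrow> 'b::{banach,second_countable_topology}"
  shows "(LINT \<theta>|lborel. f (- \<theta>)) = (LINT \<theta>|lborel. f \<theta>)"
  using lborel_integral_real_affine[of "-1" f 0] by simp

lemma integral_odd:
  fixes f :: "real \<Rightarrow> 'b::{banach,second_countable_topology}"
  assumes "\<And>\<theta>. f (- \<theta>) = - f \<theta>"
  shows "(LINT \<theta>|lborel. f \<theta>) = 0"
proof -
  have "(LINT \<theta>|lborel. f \<theta>) = - (LINT \<theta>|lborel. f \<theta>)"
    using integral_reflect[of f] by (simp add: assms)
  then have "2 *\<^sub>R (LINT \<theta>|lborel. f \<theta>) = 0" by (simp add: scaleR_2 eq_neg_iff_add_eq_0)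
  then show ?thesis by simp
qed

lemma integral_odd_cis:
  fixes q :: "real \<Rightarrow> real"
  assumes odd: "\<And>\<theta>. q (- \<theta>) = - q \<theta>" and int: "integrable lborel q"
  shows "(LINT \<theta>|lborel. of_real (q \<theta>) * cis (real n * \<theta>)) = \<i> * of_real (LINT \<theta>|lborel. q \<theta> * sin (real n * \<theta>))"
proof -
  have m[measurable]: "q \<in> borel_measurable borel" using int by auto
  have "integrable lborel (\<lambda>\<theta>. of_real (q \<theta>) * cis (real n * \<theta>))"
  proof (rule Bochner_Integration.integrable_bound[OF int])
    have [measurable]: "(\<lambda>\<theta>. cis (real n * \<theta>)) \<in> borel_measurable borel"
      by (intro borel_measurable_continuous_onI continuous_intros)
    show "(\<lambda>\<theta>. of_real (q \<theta>) * cis (real n * \<theta>)) \<in> borel_measurable lborel" by measurable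
  qed (auto simp: norm_mult)
  then have 1: "Re (LINT \<theta>|lborel. of_real (q \<theta>) * cis (real n * \<theta>)) = (LINT \<theta>|lborel. q \<theta> * cos (real n * \<theta>))"
    "Im (LINT \<theta>|lborel. of_real (q \<theta>) * cis (real n * \<theta>)) = (LINT \<theta>|lborel. q \<theta> * sin (real n * \<theta>))"
    by (simp_all flip: integral_Re integral_Im)
  have "(LINT \<theta>|lborel. q \<theta> * cos (real n * \<theta>)) = 0" by (rule integral_odd) (simp add: odd)
  then show ?thesis by (simp add: complex_eq_iff 1)
qed

text \<open>
  In polar coordinates around the origin, starting from the angle of \<open>X\<close>, the derivative in
  \<open>kern\<close> of a radial function carries the factor \<open>sin \<theta>\<close>. A component of the velocity in an
  arbitrary direction \<open>c\<close> is kept, to be applied to the radial and the tangential one.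
\<close>

lemma radial_velocity_aux:
  assumes C: "C1_compact \<Theta> \<Theta>'" and \<alpha>: "0 \<le> \<alpha>" "\<alpha> \<le> 1" and a: "a = 1 + \<alpha> / 2"
    and grad: "\<And>t \<psi> v. \<Theta>' (polar (exp t) \<psi>) v = of_real (p t * exp (- 4 * t) * (polar (exp t) \<psi> \<bullet> v))"
    and X: "X = polar (exp s) \<phi>"
  shows "of_real (c $ 1) * (LINT Z|lborel. kern \<alpha> \<Theta>' X 1 Z) + of_real (c $ 2) * (LINT Z|lborel. kern \<alpha> \<Theta>' X 2 Z)
    = (LINT t|lborel. of_real (- (p t * exp (- t) * exp s * (exp (- a * s) * exp (- a * t)))) *
        (LINT \<theta>|lborel. of_real (indicator {-pi<..<pi} \<theta> * ((c \<bullet> (polar (exp t) (\<phi> + \<theta>) - X)) * sin \<theta> * chord (s - t) \<theta> powr (- a)))))"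
proof -
  let ?k = "\<lambda>Z. of_real (c $ 1) * kern \<alpha> \<Theta>' X 1 Z + of_real (c $ 2) * kern \<alpha> \<Theta>' X 2 Z"
  let ?f = "\<lambda>Y. ?k (Y - X)"
  have km: "?k \<in> borel_measurable borel" using kern_measurable[OF C, of \<alpha> X] by measurable
  have fm: "?f \<in> borel_measurable borel"
    by (rule measurable_compose[OF _ km]) measurable
  have ki: "integrable lborel ?k"
    by (intro Bochner_Integration.integrable_add integrable_mult_right kern_integrable[OF C \<alpha>])
  have fi: "integrable lborel ?f"
    using ki unfolding integral_translate(2)[OF fm, of X] by simp
  have "of_real (c $ 1) * (LINT Z|lborel. kern \<alpha> \<Theta>' X 1 Z) + of_real (c $ 2) * (LINT Z|lborel. kern \<alpha> \<Theta>' X 2 Z) = (LINT Z|lborel. ?k Z)"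
    using kern_integrable[OF C \<alpha>, of X] by simp
  also have "\<dots> = (LINT Y|lborel. ?f Y)" unfolding integral_translate(1)[OF fm, of X] by simp
  also have "\<dots> = (LINT z|(lborel \<Otimes>\<^sub>M lborel). (indicator {-pi<..<pi} (snd z) * exp (2 * fst z)) *\<^sub>R ?f (polar (exp (fst z)) (\<phi> + snd z)))"
    by (rule integral_log_polar(1)[OF fm])
  also have "\<dots> = (LINT t|lborel. LINT \<theta>|lborel. (indicator {-pi<..<pi} \<theta> * exp (2 * t)) *\<^sub>R ?f (polar (exp t) (\<phi> + \<theta>)))"
    using lborel_pair.integral_fst'[OF fi[unfolded integral_log_polar(2)[OF fm, of \<phi>]]] by simp
  also have "\<dots> = (LINT t|lborel. of_real (- (p t * exp (- t) * exp s * (exp (- a * s) * exp (- a * t)))) *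
        (LINT \<theta>|lborel. of_real (indicator {-pi<..<pi} \<theta> * ((c \<bullet> (polar (exp t) (\<phi> + \<theta>) - X)) * sin \<theta> * chord (s - t) \<theta> powr (- a)))))"
  proof (intro Bochner_Integration.integral_cong refl)
    fix t :: real
    have pt: "(indicator {-pi<..<pi} \<theta> * exp (2 * t)) *\<^sub>R ?f (polar (exp t) (\<phi> + \<theta>))
      = of_real (- (p t * exp (- t) * exp s * (exp (- a * s) * exp (- a * t)))) *
         of_real (indicator {-pi<..<pi} \<theta> * ((c \<bullet> (polar (exp t) (\<phi> + \<theta>) - X)) * sin \<theta> * chord (s - t) \<theta> powr (- a)))" for \<theta>
    proof -
      let ?Y = "polar (exp t) (\<phi> + \<theta>)"
      have n: "norm (?Y - X) = norm (polar (exp s) \<phi> - ?Y)" unfolding X by (rule norm_minus_commute)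
      have k: "kern \<alpha> \<Theta>' X j (?Y - X) = of_real ((?Y - X) $ j * (exp (- a * s) * exp (- a * t) * chord (s - t) \<theta> powr (- a)))
          * of_real (p t * exp (- 4 * t) * (?Y \<bullet> perp (?Y - X)))" for j
        unfolding kern_def n divide_norm_powr_polar[OF a] by (simp add: grad del: of_real_mult)
      have yp: "?Y \<bullet> perp (?Y - X) = - (exp s * exp t * sin \<theta>)"
      proof -
        have "?Y \<bullet> perp (?Y - X) = - (exp s * exp t * sin (\<phi> + \<theta> - \<phi>))"
          unfolding X inner_real2 sin_diff by (simp add: algebra_simps)
        then show ?thesis by simp
      qed
      have ex: "exp (2 * t) * exp (- 4 * t) * exp t = exp (- t)" by (simp flip: exp_add)
      have "?f ?Y = of_real ((c \<bullet> (?Y - X)) * (exp (- a * s) * exp (- a * t) * chord (s - t) \<theta> powr (- a))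
           * (p t * exp (- 4 * t) * - (exp s * exp t * sin \<theta>)))"
        unfolding k yp inner_real2[of c] by (simp add: algebra_simps)
      then have "(indicator {-pi<..<pi} \<theta> * exp (2 * t)) *\<^sub>R ?f ?Y
        = of_real (indicator {-pi<..<pi} \<theta> * exp (2 * t) * ((c \<bullet> (?Y - X)) * (exp (- a * s) * exp (- a * t) * chord (s - t) \<theta> powr (- a))
           * (p t * exp (- 4 * t) * - (exp s * exp t * sin \<theta>))))"
        unfolding scaleR_conv_of_real of_real_mult by (simp only: mult.assoc)
      also have "\<dots> = of_real (- (p t * (exp (2 * t) * exp (- 4 * t) * exp t) * exp s * (exp (- a * s) * exp (- a * t))) *
         (indicator {-pi<..<pi} \<theta> * ((c \<bullet> (?Y - X)) * sin \<theta> * chord (s - t) \<theta> powr (- a))))"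
        by (rule arg_cong[where f = of_real]) algebra
      finally show ?thesis unfolding ex of_real_mult .
    qed
    show "(LINT \<theta>|lborel. (indicator {-pi<..<pi} \<theta> * exp (2 * t)) *\<^sub>R ?f (polar (exp t) (\<phi> + \<theta>)))
      = of_real (- (p t * exp (- t) * exp s * (exp (- a * s) * exp (- a * t)))) *
        (LINT \<theta>|lborel. of_real (indicator {-pi<..<pi} \<theta> * ((c \<bullet> (polar (exp t) (\<phi> + \<theta>) - X)) * sin \<theta> * chord (s - t) \<theta> powr (- a))))"
      unfolding pt by (rule integral_mult_right_zero)
  qed
  finally show ?thesis .
qed

text \<open>
  By oddness in the angle the velocity has no radial component. The angular velocity is, up to a
  constant factor, a potential of \<open>p\<close> for the kernel of the first mode.
\<close>

lemma radial_velocity: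
  assumes C: "C1_compact \<Theta> \<Theta>'" and \<alpha>: "0 \<le> \<alpha>" "\<alpha> \<le> 1" and a: "a = 1 + \<alpha> / 2"
    and grad: "\<And>t \<psi> v. \<Theta>' (polar (exp t) \<psi>) v = of_real (p t * exp (- 4 * t) * (polar (exp t) \<psi> \<bullet> v))"
    and X: "X = polar (exp s) \<phi>"
  shows "(LINT Z|lborel. kern \<alpha> \<Theta>' X j Z)
     = - of_real ((LINT t|lborel. exp (- a * s) * exp (- a * t) * mode_kernel a 1 (s - t) * p t) * perp X $ j)"
proof -
  let ?K = "\<lambda>j. LINT Z|lborel. kern \<alpha> \<Theta>' X j Z"
  let ?J = "LINT t|lborel. exp (- a * s) * exp (- a * t) * mode_kernel a 1 (s - t) * p t"
  note aux = radial_velocity_aux[OF C \<alpha> a grad X]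
  have sn: "sin (\<phi> + \<theta>) * cos \<phi> - cos (\<phi> + \<theta>) * sin \<phi> = sin \<theta>" for \<theta> using sin_diff[of "\<phi> + \<theta>" \<phi>] by simp
  have cs: "cos (\<phi> + \<theta>) * cos \<phi> + sin (\<phi> + \<theta>) * sin \<phi> = cos \<theta>" for \<theta> using cos_diff[of "\<phi> + \<theta>" \<phi>] by simp
  have r: "of_real (X $ 1) * ?K 1 + of_real (X $ 2) * ?K 2 = 0"
  proof -
    have "(LINT \<theta>|lborel. of_real (indicator {-pi<..<pi} \<theta> * ((X \<bullet> (polar (exp t) (\<phi> + \<theta>) - X)) * sin \<theta> * chord (s - t) \<theta> powr (- a)))) = (0 :: complex)" for t
    proof (rule integral_odd)
      fix \<theta>
      have i: "X \<bullet> (polar (exp t) (\<phi> + \<theta>) - X) = exp s * exp t * cos \<theta> - X \<bullet> X" for \<theta>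
        unfolding inner_diff_right cs[of \<theta>, symmetric] by (simp add: X inner_real2 algebra_simps)
      have ch: "chord (s - t) (- \<theta>) = chord (s - t) \<theta>" by (simp add: chord_def)
      show "complex_of_real (indicator {-pi<..<pi} (- \<theta>) * ((X \<bullet> (polar (exp t) (\<phi> + - \<theta>) - X)) * sin (- \<theta>) * chord (s - t) (- \<theta>) powr (- a)))
       = - of_real (indicator {-pi<..<pi} \<theta> * ((X \<bullet> (polar (exp t) (\<phi> + \<theta>) - X)) * sin \<theta> * chord (s - t) \<theta> powr (- a)))"
        unfolding i ch by (auto simp: indicator_def)
    qed
    then show ?thesis unfolding aux by simp
  qed
  have ang: "of_real (perp X $ 1) * ?K 1 + of_real (perp X $ 2) * ?K 2 = - of_real (exp s * exp s * ?J)"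
  proof -
    have i: "perp X \<bullet> (polar (exp t) (\<phi> + \<theta>) - X) = exp s * exp t * sin \<theta>" for t \<theta>
      unfolding sn[of \<theta>, symmetric] by (simp add: X inner_real2 algebra_simps)
    have inner: "(LINT \<theta>|lborel. of_real (indicator {-pi<..<pi} \<theta> * ((perp X \<bullet> (polar (exp t) (\<phi> + \<theta>) - X)) * sin \<theta> * chord (s - t) \<theta> powr (- a))))
        = complex_of_real (exp s * exp t * mode_kernel a 1 (s - t))" for t
      unfolding i mode_kernel_open integral_complex_of_real
      by (subst integral_mult_right_zero[symmetric]) (simp add: mult_ac)
    have ex: "exp (- t) * exp t = (1::real)" for t by (simp flip: exp_add)
    have pt: "of_real (- (p t * exp (- t) * exp s * (exp (- a * s) * exp (- a * t)))) * complex_of_real (exp s * exp t * mode_kernel a 1 (s - t))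
       = of_real (- (exp s * exp s) * (exp (- a * s) * exp (- a * t) * mode_kernel a 1 (s - t) * p t))" for t
    proof -
      have "- (p t * exp (- t) * exp s * (exp (- a * s) * exp (- a * t))) * (exp s * exp t * mode_kernel a 1 (s - t))
        = - (exp s * exp s) * (exp (- a * s) * exp (- a * t) * mode_kernel a 1 (s - t) * p t)"
        using ex[of t] by algebra
      then show ?thesis unfolding of_real_mult[symmetric] by (rule arg_cong)
    qed
    show ?thesis unfolding aux inner pt unfolding integral_complex_of_real by simp
  qed
  have XX: "X $ 1 * X $ 1 + X $ 2 * X $ 2 = exp s * exp s"
    unfolding X polar_nth using sin_cos_squared_add3[of \<phi>] by algebra
  define E where "E = complex_of_real (exp s * exp s)"
  define x y where "x = complex_of_real (X $ 1)" and "y = complex_of_real (X $ 2)"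
  have E0: "E \<noteq> 0" by (simp add: E_def)
  have E: "x * x + y * y = E" unfolding x_def y_def E_def by (simp only: XX of_real_mult[symmetric] of_real_add[symmetric])
  have 1: "x * ?K 1 + y * ?K 2 = 0" using r by (simp add: x_def y_def)
  have 2: "- y * ?K 1 + x * ?K 2 = - (E * of_real ?J)" using ang by (simp add: x_def y_def E_def)
  have "E * ?K 1 = E * (y * of_real ?J)"
  proof -
    have "E * ?K 1 = x * (x * ?K 1 + y * ?K 2) - y * (- y * ?K 1 + x * ?K 2)" unfolding E[symmetric] by algebra
    then show ?thesis unfolding 1 2 by simp
  qed
  then have K1: "?K 1 = y * of_real ?J" using E0 by simp
  have "E * ?K 2 = E * - (x * of_real ?J)"
  proof -
    have "E * ?K 2 = y * (x * ?K 1 + y * ?K 2) + x * (- y * ?K 1 + x * ?K 2)" unfolding E[symmetric] by algebra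
    then show ?thesis unfolding 1 2 by simp
  qed
  then have K2: "?K 2 = - (x * of_real ?J)" by (rule iffD1[OF mult_left_cancel[OF E0]])
  show ?thesis using exhaust2[of j] K1 K2 by (auto simp: x_def y_def)
qed

text \<open>
  Only the radial component of the velocity of the perturbation acts on a radial vortex. It is
  computed from the truncated integrals before integration by parts: the radial part of
  \<open>perp (X - Y)\<close> already contains the factor \<open>sin \<theta>\<close> that makes the kernel integrable, so the
  truncation can be removed by dominated convergence.
\<close>

lemma mode_velocity:
  assumes C: "C1_compact W W'" and \<alpha>: "0 \<le> \<alpha>" "\<alpha> \<le> 1" and a: "a = 1 + \<alpha> / 2"
    and W: "\<And>t \<psi>. W (polar (exp t) \<psi>) = w t * of_real (exp (- 3 * t)) * cis (real n * \<psi>)"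
    and w: "continuous_on UNIV w" "vanishes_beyond L w"
    and X: "X = polar (exp s) \<phi>"
  shows "of_real (X $ 1) * (LINT Z|lborel. kern \<alpha> W' X 1 Z) + of_real (X $ 2) * (LINT Z|lborel. kern \<alpha> W' X 2 Z)
    = \<i> * cis (real n * \<phi>) * of_real (exp s) * (LINT t|lborel. of_real (exp (- a * s) * exp (- a * t) * mode_kernel a n (s - t)) * w t)"
proof -
  have a2: "1 \<le> a" "a \<le> 3/2" using \<alpha> by (auto simp: a)
  let ?T = "\<lambda>\<epsilon> j. LINT Y:{Y. \<epsilon> < dist X Y}|lebesgue. BS_integrand \<alpha> W X j Y"
  let ?lhs = "\<lambda>\<epsilon>. of_real (X $ 1) * ?T \<epsilon> 1 + of_real (X $ 2) * ?T \<epsilon> 2"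
  let ?c = "\<i> * cis (real n * \<phi>) * of_real (exp s)"
  let ?I = "\<lambda>t. of_real (exp (- a * s) * exp (- a * t) * mode_kernel a n (s - t)) * w t"
  have lim1: "(?lhs \<longlongrightarrow> of_real (X $ 1) * (LINT Z|lborel. kern \<alpha> W' X 1 Z) + of_real (X $ 2) * (LINT Z|lborel. kern \<alpha> W' X 2 Z)) (at_right 0)"
    by (intro tendsto_intros truncated_velocity_tendsto[OF C \<alpha>])
  have [measurable]: "w \<in> borel_measurable borel" using w(1) by (rule borel_measurable_continuous_onI)
  have Wm[measurable]: "W \<in> borel_measurable borel" by (rule C1_compact_measurable[OF C])
  \<comment> \<open>The angular kernel restricted to the points outside the disc of radius \<open>\<epsilon>\<close>; it equals
      \<open>mode_kernel a n (s - t)\<close> once \<open>\<epsilon>\<close> is smaller than the distance of the two circles.\<close>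
  define tr where "tr \<epsilon> t = (LINT \<theta>|lborel. indicator {-pi<..<pi} \<theta> * (indicator {\<theta>. \<epsilon> < norm (X - polar (exp t) (\<phi> + \<theta>))} \<theta> * (sin \<theta> * sin (real n * \<theta>) * chord (s - t) \<theta> powr (- a))))" for \<epsilon> t
  have trm: "tr \<epsilon> \<in> borel_measurable lborel" for \<epsilon>
  proof -
    have [measurable]: "(\<lambda>z. norm (X - polar (exp (fst z)) (\<phi> + snd z))) \<in> borel_measurable (lborel \<Otimes>\<^sub>M lborel)"
      using polar_measurable_pair[of \<phi>] by measurable
    have ind: "indicator {\<theta>. \<epsilon> < norm (X - polar (exp t) (\<phi> + \<theta>))} x = (indicator {\<epsilon><..} (norm (X - polar (exp t) (\<phi> + x))) :: real)" for t x
      by (simp add: indicator_def)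
    have "(\<lambda>t. tr \<epsilon> t) \<in> borel_measurable lborel"
      unfolding tr_def ind by (rule lborel.borel_measurable_lebesgue_integral) (unfold split_beta', measurable)
    then show ?thesis .
  qed
  have lhs_eq: "?lhs \<epsilon> = (LINT t|lborel. ?c * (of_real (exp (- a * s) * exp (- a * t) * tr \<epsilon> t) * w t))" if \<epsilon>: "0 < \<epsilon>" for \<epsilon>
  proof -
    let ?B = "\<lambda>j Y. indicator {Y. \<epsilon> < dist X Y} Y *\<^sub>R BS_integrand \<alpha> W X j Y"
    have Bm: "?B j \<in> borel_measurable borel" for j
    proof -
      have "open {Y. \<epsilon> < dist X Y}" by (intro open_Collect_less continuous_intros)
      then have [measurable]: "{Y. \<epsilon> < dist X Y} \<in> sets borel" by simp
      have [measurable]: "(\<lambda>Y. perp (X - Y) $ j) \<in> borel_measurable borel"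
        by (intro borel_measurable_continuous_onI continuous_intros)
      show ?thesis unfolding BS_integrand_def by measurable
    qed
    have Bi: "integrable lborel (?B j)" for j
    proof -
      have "integrable lborel (\<lambda>Z. ?B j (X + Z))"
        using truncated_integrable[OF C \<epsilon> \<alpha>(1), of j X] by (simp add: BS_integrand_def indicator_def dist_norm)
      then show ?thesis unfolding integral_translate(2)[OF Bm, of j X] .
    qed
    let ?f = "\<lambda>Y. of_real (X $ 1) * ?B 1 Y + of_real (X $ 2) * ?B 2 Y"
    have fm: "?f \<in> borel_measurable borel" using Bm by measurable
    have fi: "integrable lborel ?f" by (intro Bochner_Integration.integrable_add integrable_mult_right Bi)
    have T: "?T \<epsilon> j = (LINT Y|lborel. ?B j Y)" for j
      unfolding set_lebesgue_integral_def by (rule integral_completion) (use Bm in simp)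
    have "?lhs \<epsilon> = (LINT Y|lborel. ?f Y)"
      unfolding T Bochner_Integration.integral_add[OF integrable_mult_right[OF Bi] integrable_mult_right[OF Bi]]
        integral_mult_right_zero ..
    also have "\<dots> = (LINT z|(lborel \<Otimes>\<^sub>M lborel). (indicator {-pi<..<pi} (snd z) * exp (2 * fst z)) *\<^sub>R ?f (polar (exp (fst z)) (\<phi> + snd z)))"
      by (rule integral_log_polar(1)[OF fm])
    also have "\<dots> = (LINT t|lborel. LINT \<theta>|lborel. (indicator {-pi<..<pi} \<theta> * exp (2 * t)) *\<^sub>R ?f (polar (exp t) (\<phi> + \<theta>)))"
      using lborel_pair.integral_fst'[OF fi[unfolded integral_log_polar(2)[OF fm, of \<phi>]]] by simp
    also have "\<dots> = (LINT t|lborel. ?c * (of_real (exp (- a * s) * exp (- a * t) * tr \<epsilon> t) * w t))"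
    proof (rule integral_cong_AE)
      show "(\<lambda>t. LINT \<theta>|lborel. (indicator {-pi<..<pi} \<theta> * exp (2 * t)) *\<^sub>R ?f (polar (exp t) (\<phi> + \<theta>))) \<in> borel_measurable lborel"
        using borel_measurable_integrable[OF lborel_pair.integrable_fst'[OF fi[unfolded integral_log_polar(2)[OF fm, of \<phi>]]]] by simp
      note trm[of \<epsilon>, measurable]
      show "(\<lambda>t. ?c * (of_real (exp (- a * s) * exp (- a * t) * tr \<epsilon> t) * w t)) \<in> borel_measurable lborel" by measurable
      show "AE t in lborel. (LINT \<theta>|lborel. (indicator {-pi<..<pi} \<theta> * exp (2 * t)) *\<^sub>R ?f (polar (exp t) (\<phi> + \<theta>)))
          = ?c * (of_real (exp (- a * s) * exp (- a * t) * tr \<epsilon> t) * w t)"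
        using AE_lborel_neq[of s]
      proof eventually_elim
        case (elim t)
        let ?q = "\<lambda>\<theta>. indicator {-pi<..<pi} \<theta> * (indicator {\<theta>. \<epsilon> < norm (X - polar (exp t) (\<phi> + \<theta>))} \<theta> * (sin \<theta> * chord (s - t) \<theta> powr (- a))) :: real"
        have "exp (2 * t) * (exp s * exp t) * exp (- 3 * t) = exp s" by (simp flip: exp_add)
        then have ex: "exp (2 * t) * (exp s * exp t) * exp (- 3 * t) * z = exp s * z" for z by simp
        have pt: "(indicator {-pi<..<pi} \<theta> * exp (2 * t)) *\<^sub>R ?f (polar (exp t) (\<phi> + \<theta>))
          = (of_real (exp s * (exp (- a * s) * exp (- a * t))) * w t * cis (real n * \<phi>)) * (of_real (?q \<theta>) * cis (real n * \<theta>))" for \<theta>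
        proof -
          let ?Y = "polar (exp t) (\<phi> + \<theta>)"
          have i: "X $ 1 * perp (X - ?Y) $ 1 + X $ 2 * perp (X - ?Y) $ 2 = exp s * exp t * sin \<theta>"
          proof -
            have "X $ 1 * perp (X - ?Y) $ 1 + X $ 2 * perp (X - ?Y) $ 2 = exp s * exp t * sin (\<phi> + \<theta> - \<phi>)"
              unfolding X sin_diff by (simp add: algebra_simps)
            then show ?thesis by simp
          qed
          have b: "BS_integrand \<alpha> W X j ?Y = of_real (perp (X - ?Y) $ j * (exp (- a * s) * exp (- a * t) * chord (s - t) \<theta> powr (- a))) * W ?Y" for j
            unfolding BS_integrand_def X divide_norm_powr_polar[OF a] ..
          let ?ind = "indicator {\<theta>. \<epsilon> < norm (X - polar (exp t) (\<phi> + \<theta>))} \<theta> :: real"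
          have ind: "indicator {Y. \<epsilon> < dist X Y} ?Y = ?ind" by (simp add: indicator_def dist_norm)
          have "?f ?Y = of_real (?ind * ((X $ 1 * perp (X - ?Y) $ 1 + X $ 2 * perp (X - ?Y) $ 2) * (exp (- a * s) * exp (- a * t) * chord (s - t) \<theta> powr (- a)))) * W ?Y"
            unfolding ind b by (simp add: scaleR_conv_of_real algebra_simps del: perp_nth)
          also have "\<dots> = of_real (?ind * ((exp s * exp t * sin \<theta>) * (exp (- a * s) * exp (- a * t) * chord (s - t) \<theta> powr (- a))) * exp (- 3 * t)) * (w t * cis (real n * \<phi>) * cis (real n * \<theta>))"
            unfolding i W by (simp add: distrib_left cis_mult)
          finally have "(indicator {-pi<..<pi} \<theta> * exp (2 * t)) *\<^sub>R ?f ?Y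
            = of_real (indicator {-pi<..<pi} \<theta> * exp (2 * t) * (?ind * ((exp s * exp t * sin \<theta>) * (exp (- a * s) * exp (- a * t) * chord (s - t) \<theta> powr (- a))) * exp (- 3 * t))) * (w t * cis (real n * \<phi>) * cis (real n * \<theta>))"
            unfolding scaleR_conv_of_real of_real_mult by (simp only: mult.assoc)
          also have "indicator {-pi<..<pi} \<theta> * exp (2 * t) * (?ind * ((exp s * exp t * sin \<theta>) * (exp (- a * s) * exp (- a * t) * chord (s - t) \<theta> powr (- a))) * exp (- 3 * t))
             = exp (2 * t) * (exp s * exp t) * exp (- 3 * t) * ((exp (- a * s) * exp (- a * t)) * ?q \<theta>)" by algebra
          also have "\<dots> = exp s * ((exp (- a * s) * exp (- a * t)) * ?q \<theta>)" by (rule ex)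
          finally show ?thesis unfolding of_real_mult by (simp only: mult_ac)
        qed
        have odd: "?q (- \<theta>) = - ?q \<theta>" for \<theta>
        proof -
          have "norm (X - polar (exp t) (\<phi> + - \<theta>)) = norm (X - polar (exp t) (\<phi> + \<theta>))"
          proof -
            have "(norm (X - polar (exp t) (\<phi> + - \<theta>)))\<^sup>2 = (norm (X - polar (exp t) (\<phi> + \<theta>)))\<^sup>2"
              unfolding X norm_polar_diff_sq by (simp add: chord_def)
            then show ?thesis by simp
          qed
          then show ?thesis by (auto simp: indicator_def chord_def)
        qed
        have qi: "integrable lborel ?q"
        proof (rule Bochner_Integration.integrable_bound[where f = "\<lambda>\<theta>. ((s - t)\<^sup>2) powr (- a) * indicator {-pi<..<pi} \<theta>"])
          show "integrable lborel (\<lambda>\<theta>. ((s - t)\<^sup>2) powr (- a) * indicator {-pi<..<pi} \<theta> :: real)"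
            by (intro integrable_mult_right) (simp add: integrable_indicator_iff)
          have "(\<lambda>\<theta>. norm (X - polar (exp t) (\<phi> + \<theta>))) \<in> borel_measurable borel"
            unfolding polar_def vector2_eq by (intro borel_measurable_continuous_onI continuous_intros)
          then have [measurable]: "{\<theta>. \<epsilon> < norm (X - polar (exp t) (\<phi> + \<theta>))} \<in> sets borel" by measurable
          show "?q \<in> borel_measurable lborel" by measurable
          show "AE \<theta> in lborel. norm (?q \<theta>) \<le> norm (((s - t)\<^sup>2) powr (- a) * indicator {-pi<..<pi} \<theta> :: real)"
          proof (intro AE_I2)
            fix \<theta>
            have st: "0 < (s - t)\<^sup>2" using elim by simp
            have "(s - t)\<^sup>2 \<le> chord (s - t) \<theta>" using chord_lower[of "s - t" \<theta>] by (smt (verit) zero_le_power2)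
            then have "chord (s - t) \<theta> powr (- a) \<le> ((s - t)\<^sup>2) powr (- a)"
              by (intro powr_mono2') (use st a2 in auto)
            then have "\<bar>sin \<theta>\<bar> * chord (s - t) \<theta> powr (- a) \<le> 1 * ((s - t)\<^sup>2) powr (- a)"
              by (intro mult_mono) auto
            then show "norm (?q \<theta>) \<le> norm (((s - t)\<^sup>2) powr (- a) * indicator {-pi<..<pi} \<theta> :: real)"
              by (auto simp: indicator_def abs_mult)
          qed
        qed
        have "(LINT \<theta>|lborel. (indicator {-pi<..<pi} \<theta> * exp (2 * t)) *\<^sub>R ?f (polar (exp t) (\<phi> + \<theta>)))
          = (of_real (exp s * (exp (- a * s) * exp (- a * t))) * w t * cis (real n * \<phi>)) * (\<i> * of_real (LINT \<theta>|lborel. ?q \<theta> * sin (real n * \<theta>)))"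
          unfolding pt integral_mult_right_zero integral_odd_cis[OF odd qi] ..
        also have "(LINT \<theta>|lborel. ?q \<theta> * sin (real n * \<theta>)) = tr \<epsilon> t"
          unfolding tr_def by (intro Bochner_Integration.integral_cong refl) (simp add: mult_ac)
        finally show ?case by (simp add: mult_ac)
      qed
    qed
    finally show ?thesis .
  qed
  have tr_bound: "\<bar>tr \<epsilon> t\<bar> \<le> real n * mode_kernel a 1 (s - t)" if t: "t \<noteq> s" for \<epsilon> t
  proof -
    have i1: "integrable lborel (\<lambda>\<theta>. real n * ang_kernel a 1 (s - t) \<theta>)"
      by (intro integrable_mult_right integrable_ang_kernel) (use t a2 in auto)
    have "\<bar>tr \<epsilon> t\<bar> \<le> (LINT \<theta>|lborel. real n * ang_kernel a 1 (s - t) \<theta>)"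
      unfolding tr_def real_norm_def[symmetric]
    proof (rule Bochner_Integration.integral_norm_bound_integral)
      show "norm (indicator {-pi<..<pi} \<theta> * (indicator {\<theta>. \<epsilon> < norm (X - polar (exp t) (\<phi> + \<theta>))} \<theta> * (sin \<theta> * sin (real n * \<theta>) * chord (s - t) \<theta> powr (- a))))
         \<le> real n * ang_kernel a 1 (s - t) \<theta>" for \<theta>
      proof -
        have "\<bar>ang_kernel a n (s - t) \<theta>\<bar> \<le> real n * ang_kernel a 1 (s - t) \<theta>"
          using abs_ang_kernel_le[of a n "s - t" \<theta>] by (simp add: ang_kernel_def power2_eq_square)
        then show ?thesis
          by (auto simp: indicator_def ang_kernel_def abs_mult intro!: mult_nonneg_nonneg split: if_splits)
      qed
      show "integrable lborel (\<lambda>\<theta>. indicator {-pi<..<pi} \<theta> * (indicator {\<theta>. \<epsilon> < norm (X - polar (exp t) (\<phi> + \<theta>))} \<theta> * (sin \<theta> * sin (real n * \<theta>) * chord (s - t) \<theta> powr (- a))))"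
      proof (rule Bochner_Integration.integrable_bound[OF integrable_ang_kernel[of "s - t" a n]])
        have "(\<lambda>\<theta>. norm (X - polar (exp t) (\<phi> + \<theta>))) \<in> borel_measurable borel"
          unfolding polar_def vector2_eq by (intro borel_measurable_continuous_onI continuous_intros)
        then have [measurable]: "{\<theta>. \<epsilon> < norm (X - polar (exp t) (\<phi> + \<theta>))} \<in> sets borel" by measurable
        show "(\<lambda>\<theta>. indicator {-pi<..<pi} \<theta> * (indicator {\<theta>. \<epsilon> < norm (X - polar (exp t) (\<phi> + \<theta>))} \<theta> * (sin \<theta> * sin (real n * \<theta>) * chord (s - t) \<theta> powr (- a)))) \<in> borel_measurable lborel"
          by measurable
        show "AE \<theta> in lborel. norm (indicator {-pi<..<pi} \<theta> * (indicator {\<theta>. \<epsilon> < norm (X - polar (exp t) (\<phi> + \<theta>))} \<theta> * (sin \<theta> * sin (real n * \<theta>) * chord (s - t) \<theta> powr (- a))))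
           \<le> norm (ang_kernel a n (s - t) \<theta>)"
          by (intro AE_I2) (auto simp: indicator_def ang_kernel_def)
      qed (use t a2 in auto)
    qed (rule i1)
    then show ?thesis by (simp add: mode_kernel_def)
  qed
  have tr_eq: "tr \<epsilon> t = mode_kernel a n (s - t)" if "\<epsilon> < \<bar>exp s - exp t\<bar>" for \<epsilon> t
  proof -
    have "\<epsilon> < norm (X - polar (exp t) (\<phi> + \<theta>))" for \<theta>
      using norm_triangle_ineq3[of X "polar (exp t) (\<phi> + \<theta>)"] that by (simp add: X norm_polar)
    then show ?thesis unfolding tr_def mode_kernel_open by simp
  qed
  obtain N where N: "0 \<le> N" "\<And>t. norm (of_real (exp (- a * t)) * w t) \<le> N"
  proof -
    have "continuous_on UNIV (\<lambda>t. of_real (exp (- a * t)) * w t)" by (intro continuous_intros w)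
    moreover have "vanishes_beyond L (\<lambda>t. of_real (exp (- a * t)) * w t)" using w(2) by (auto simp: vanishes_beyond_def)
    ultimately show thesis using that by (rule vanishes_beyond_bounded)
  qed
  have km: "mode_kernel a j \<in> borel_measurable borel" for j using integrable_mode_kernel[OF a2, of j] by auto
  have lim2: "(?lhs \<longlongrightarrow> (LINT t|lborel. ?c * ?I t)) (at_right 0)"
  proof (rule tendsto_at_right_sequentially[where b = 1])
    fix S :: "nat \<Rightarrow> real" assume S: "\<And>n. 0 < S n" "S \<longlonglongrightarrow> 0"
    have "(\<lambda>i. LINT t|lborel. ?c * (of_real (exp (- a * s) * exp (- a * t) * tr (S i) t) * w t)) \<longlonglongrightarrow> (LINT t|lborel. ?c * ?I t)"
    proof (rule integral_dominated_convergence[where w = "\<lambda>t. exp s * exp (- a * s) * N * (real n * mode_kernel a 1 (s - t))"])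
      have [measurable]: "mode_kernel a n \<in> borel_measurable borel" by (rule km)
      show "(\<lambda>t. ?c * ?I t) \<in> borel_measurable lborel" by measurable
      show "integrable lborel (\<lambda>t. exp s * exp (- a * s) * N * (real n * mode_kernel a 1 (s - t)))"
        using lborel_integrable_real_affine[OF integrable_mode_kernel[OF a2, of 1], of "-1" s]
        by (intro integrable_mult_right) simp
      show "AE t in lborel. (\<lambda>i. ?c * (of_real (exp (- a * s) * exp (- a * t) * tr (S i) t) * w t)) \<longlonglongrightarrow> ?c * ?I t"
        using AE_lborel_neq[of s]
      proof eventually_elim
        case (elim t)
        then have "eventually (\<lambda>i. S i < \<bar>exp s - exp t\<bar>) sequentially" by (intro order_tendstoD[OF S(2)]) simp
        then have "eventually (\<lambda>i. ?c * (of_real (exp (- a * s) * exp (- a * t) * tr (S i) t) * w t) = ?c * ?I t) sequentially"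
          by eventually_elim (simp add: tr_eq)
        then show ?case by (rule tendsto_eventually)
      qed
      show "AE t in lborel. norm (?c * (of_real (exp (- a * s) * exp (- a * t) * tr (S i) t) * w t))
         \<le> exp s * exp (- a * s) * N * (real n * mode_kernel a 1 (s - t))" for i
        using AE_lborel_neq[of s]
      proof eventually_elim
        case (elim t)
        have "norm (?c * (of_real (exp (- a * s) * exp (- a * t) * tr (S i) t) * w t))
           = exp s * exp (- a * s) * (norm (of_real (exp (- a * t)) * w t) * \<bar>tr (S i) t\<bar>)"
          by (simp add: norm_mult abs_mult)
        also have "\<dots> \<le> exp s * exp (- a * s) * (N * (real n * mode_kernel a 1 (s - t)))"
          by (intro mult_left_mono mult_mono N tr_bound elim) auto
        finally show ?case by (simp add: mult.assoc)
      qed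
      show "(\<lambda>t. ?c * (of_real (exp (- a * s) * exp (- a * t) * tr (S i) t) * w t)) \<in> borel_measurable lborel" for i
        using trm[of "S i"] by measurable
    qed
    then show "(\<lambda>i. ?lhs (S i)) \<longlonglongrightarrow> (LINT t|lborel. ?c * ?I t)" by (simp only: lhs_eq[OF S(1)])
  qed simp
  have "of_real (X $ 1) * (LINT Z|lborel. kern \<alpha> W' X 1 Z) + of_real (X $ 2) * (LINT Z|lborel. kern \<alpha> W' X 2 Z) = (LINT t|lborel. ?c * ?I t)"
    by (rule tendsto_unique[OF _ lim1 lim2]) simp
  also have "\<dots> = ?c * (LINT t|lborel. ?I t)" by (rule integral_mult_right_zero)
  finally show ?thesis .
qed

section \<open>The unstable vortex\<close>

lemma Cc_infinityI:
  assumes "\<And>k. Ck k f" "\<And>x. B < norm x \<Longrightarrow> f x = 0"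
  shows "f \<in> Cc_infinity"
proof -
  have "{x. f x \<noteq> 0} \<subseteq> cball 0 B" using assms(2) by force
  then have "bounded {x. f x \<noteq> 0}" by (rule bounded_subset[OF bounded_cball])
  then show ?thesis using assms(1) by (simp add: Cc_infinity_def compact_closure)
qed

lemma square_integrableI:
  fixes f :: "real^2 \<Rightarrow> 'b::euclidean_space"
  assumes f: "continuous_on UNIV f" "\<And>X. B < norm X \<Longrightarrow> f X = 0"
  shows "square_integrable f"
proof -
  have m: "f \<in> borel_measurable borel" using f(1) by (rule borel_measurable_continuous_onI)
  have m2: "(\<lambda>X. (norm (f X))\<^sup>2) \<in> borel_measurable borel" using m by measurable
  have "compact (f ` cball 0 B)" by (intro compact_continuous_image continuous_on_subset[OF f(1)]) auto
  then obtain M where M: "\<And>X. X \<in> cball 0 B \<Longrightarrow> norm (f X) \<le> M"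
    using compact_imp_bounded bounded_iff by (metis imageI)
  have "integrable lborel (\<lambda>X. complex_of_real ((norm (f X))\<^sup>2))"
  proof (rule integrable_bounded_support)
    show "norm (complex_of_real ((norm (f X))\<^sup>2)) \<le> M\<^sup>2" for X
    proof (cases "norm X \<le> B")
      case True
      then have "(norm (f X))\<^sup>2 \<le> M\<^sup>2" using M[of X] by (intro power_mono) auto
      then show ?thesis by (simp add: norm_power)
    qed (use f(2) in simp)
    show "B < norm X \<Longrightarrow> complex_of_real ((norm (f X))\<^sup>2) = 0" for X using f(2) by simp
  qed (use m2 in measurable)
  then have "integrable lborel (\<lambda>X. (norm (f X))\<^sup>2)" by (simp only: complex_of_real_integrable_eq)
  then have "integrable lebesgue (\<lambda>X. (norm (f X))\<^sup>2)" using m2 by (simp add: integrable_completion)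
  then show ?thesis using m by (simp add: square_integrable_def measurable_completion)
qed

lemma C1_compactI:
  assumes f: "Ck (Suc 0) f" "\<And>Y. (f has_derivative f' Y) (at Y)" "\<And>Y. B < norm Y \<Longrightarrow> f Y = 0"
  shows "C1_compact f f'"
proof -
  have "f' Y = frechet_derivative f (at Y)" for Y by (rule frechet_derivative_at[OF f(2)])
  then show ?thesis using f by (auto simp: C1_compact_def)
qed

lemma polar_exists:
  fixes X :: "real^2"
  assumes "X \<noteq> 0"
  obtains s \<phi> where "X = polar (exp s) \<phi>"
proof -
  let ?z = "Complex (X $ 1) (X $ 2)"
  have "?z \<noteq> 0" using assms by (auto simp: complex_eq_iff vec_eq_iff forall_2)
  then have e: "exp (ln (cmod ?z)) = cmod ?z" by simp
  have z: "rcis (cmod ?z) (Arg ?z) = ?z" by (rule rcis_cmod_Arg)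
  have "X = polar (exp (ln (cmod ?z))) (Arg ?z)"
    unfolding e using arg_cong[OF z, of Re] arg_cong[OF z, of Im] by (simp add: vec_eq_iff forall_2)
  then show thesis by (rule that)
qed

lemma log_radial_real_derivative:
  fixes F :: "real \<Rightarrow> real"
  assumes "\<And>x. (F has_vector_derivative F' x) (at x)" "\<And>s. s \<le> l \<Longrightarrow> F s = 0"
  shows "((\<lambda>R. if R = 0 then 0 else F (ln (norm R))) has_real_derivative
     R * (if R = 0 then 0 else exp (- 2 * ln (norm R)) * F' (ln (norm R)))) (at R)"
proof -
  have eq: "(\<lambda>v. (R \<bullet> v) *\<^sub>R (if R = 0 then 0 else exp (- 2 * ln (norm R)) *\<^sub>R F' (ln (norm R))))
      = (*) (R * (if R = 0 then 0 else exp (- 2 * ln (norm R)) * F' (ln (norm R))))"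
    by (simp add: fun_eq_iff mult_ac)
  show ?thesis unfolding has_field_derivative_def eq[symmetric] by (rule has_derivative_log_radial[OF assms])
qed

text \<open>
  The profile is the antiderivative of \<open>p(s) e^(-2 s)\<close> in \<open>s = ln R\<close>, shifted to vanish for large \<open>R\<close>.
  Its derivative in \<open>R\<close> is \<open>p(ln R) R^-3\<close>. Integration by parts turns the integral of \<open>g R * R\<close> into
  \<open>- 1/2 \<integral> p\<close>, which vanishes.
\<close>

lemma vortex_of_profile:
  fixes p :: "real \<Rightarrow> real"
  assumes p: "\<And>k. Ck k p" "vanishes_beyond L p" "0 < L" "(LINT t|lborel. p t) = 0"
  obtains \<Theta> B where "\<And>k. Ck k \<Theta>" "\<And>Y. B < norm Y \<Longrightarrow> \<Theta> Y = 0" "\<Theta> \<in> U0"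
    "\<And>Y. (\<Theta> has_derivative (\<lambda>v. (if Y = 0 then 0 else p (ln (norm Y)) * exp (- 4 * ln (norm Y))) * (Y \<bullet> v))) (at Y)"
proof -
  \<comment> \<open>The function \<open>p\<close> also vanishes at the ends \<open>\<plusminus> M\<close> of the larger interval.\<close>
  define M where "M = L + 1"
  have M: "0 < M" "\<And>x. \<bar>x\<bar> \<ge> M \<Longrightarrow> p x = 0" using p(2,3) by (auto simp: M_def vanishes_beyond_def)
  let ?h = "\<lambda>t. exp (- 2 * t) * p t"
  have hC: "Ck k ?h" for k by (rule Ck_mult[OF Ck_exp p(1)])
  have h0: "\<And>x. \<bar>x\<bar> \<ge> M \<Longrightarrow> ?h x = 0" using M(2) by simp
  obtain P where P: "\<And>x. (P has_vector_derivative ?h x) (at x)" "\<And>x. x \<le> - M \<Longrightarrow> P x = 0" "\<And>x. x \<ge> M \<Longrightarrow> P x = P M"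
    by (rule compactly_supported_antiderivative[OF Ck_imp_continuous[OF hC[of 0]] h0 M(1)]) (assumption, rule that, assumption+)
  have pc: "continuous_on UNIV p" by (rule Ck_imp_continuous[OF p(1)[of 0]])
  obtain Q where Q: "\<And>x. (Q has_vector_derivative p x) (at x)" "\<And>x. x \<le> - M \<Longrightarrow> Q x = 0" "\<And>x. x \<ge> M \<Longrightarrow> Q x = Q M"
    by (rule compactly_supported_antiderivative[OF pc M(2,1)]) (assumption, rule that, assumption+)
  have QM: "Q M = 0"
  proof -
    have "integrable lborel (\<lambda>x. indicator {-M..M} x *\<^sub>R p x)"
      by (rule borel_integrable_compact) (auto intro: continuous_on_subset[OF pc])
    also have "(\<lambda>x. indicator {-M..M} x *\<^sub>R p x) = p"
      using M(2) by (force simp: indicator_def fun_eq_iff)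
    finally have 1: "(p has_integral 0) UNIV" using has_integral_integral_lborel[of p] p(4) by simp
    have "(p has_integral (Q M - Q (- M))) {-M..M}"
      by (rule fundamental_theorem_of_calculus) (use M(1) in simp, rule has_vector_derivative_at_within[OF Q(1)])
    then have "(p has_integral (Q M - Q (- M))) UNIV"
      by (rule has_integral_on_superset) (use M(2) in auto)
    from has_integral_unique[OF this 1] show ?thesis using Q(2)[of "- M"] by simp
  qed
  define g where "g R = (if R = 0 then 0 else P (ln (norm R))) - P M" for R :: real
  define \<Theta> where "\<Theta> Y = (if Y = 0 then 0 else P (ln (norm Y))) - P M" for Y :: "real^2"
  have lnM: "M \<le> ln r" if "exp M < r" for r
    using that by (metis exp_gt_zero ln_exp ln_le_cancel_iff less_eq_real_def less_trans)
  have PC: "Ck k P" for k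
    by (rule Ck_SucD) (rule Ck_Suc_vec[OF P(1) hC])
  have TC: "Ck k \<Theta>" for k
    unfolding \<Theta>_def[abs_def] by (rule Ck_diff[OF Ck_log_radial[OF PC P(2)] Ck_const])
  have T0: "\<Theta> Y = 0" if "exp M < norm Y" for Y
    using P(3)[OF lnM[OF that]] that by (auto simp: \<Theta>_def)
  have g0: "g R = 0" if "exp M < R" for R
    using P(3)[OF lnM[OF that]] that less_trans[OF exp_gt_zero that] by (auto simp: g_def)
  have Td: "(\<Theta> has_derivative (\<lambda>v. (if Y = 0 then 0 else p (ln (norm Y)) * exp (- 4 * ln (norm Y))) * (Y \<bullet> v))) (at Y)" for Y
  proof -
    have e: "exp (- 2 * x) * (exp (- 2 * x) * y) = y * exp (- 4 * x)" for x y :: real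
      by (simp add: mult_ac flip: exp_add)
    have eq: "(Y \<bullet> v) *\<^sub>R (if Y = 0 then 0 else exp (- 2 * ln (norm Y)) *\<^sub>R ?h (ln (norm Y))) - 0
      = (if Y = 0 then 0 else p (ln (norm Y)) * exp (- 4 * ln (norm Y))) * (Y \<bullet> v)" for v
      by (cases "Y = 0") (simp_all only: if_True if_False real_scaleR_def e diff_0_right mult_zero_right mult_zero_left simp_thms, rule mult.commute)
    show ?thesis
      unfolding \<Theta>_def[abs_def] eq[symmetric] by (rule has_derivative_diff[OF has_derivative_log_radial[OF P(1,2)] has_derivative_const])
  qed
  have "((\<lambda>R. g R * R) has_integral 0) {0..}"
  proof -
    \<comment> \<open>An antiderivative of \<open>g R * R\<close>; \<open>Q\<close>, the antiderivative of \<open>p\<close>, is subtracted because \<open>g'(R) R\<^sup>2 = p(ln R) / R\<close>.\<close>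
    let ?G = "\<lambda>R. g R * R\<^sup>2 / 2 - (if R = 0 then 0 else Q (ln (norm R))) / 2"
    have Gd: "(?G has_vector_derivative g R * R) (at R within {0..exp M})" for R
    proof -
      let ?g' = "R * (if R = 0 then 0 else exp (- 2 * ln (norm R)) * ?h (ln (norm R)))"
      let ?q' = "R * (if R = 0 then 0 else exp (- 2 * ln (norm R)) * p (ln (norm R)))"
      have gd': "(g has_real_derivative ?g') (at R)"
        unfolding g_def[abs_def]
        by (rule DERIV_cong[OF DERIV_diff[OF log_radial_real_derivative[OF P(1,2)] DERIV_const]]) (assumption, simp)
      have qd': "((\<lambda>R. if R = 0 then 0 else Q (ln (norm R))) has_real_derivative ?q') (at R)"
        by (rule log_radial_real_derivative[OF Q(1,2)])
      have "(?G has_real_derivative (?g' * R\<^sup>2 + g R * (2 * R)) / 2 - ?q' / 2) (at R)"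
        by (rule derivative_eq_intros gd' qd' refl | simp)+
      moreover have "(?g' * R\<^sup>2 + g R * (2 * R)) / 2 - ?q' / 2 = g R * R"
      proof -
        have gq: "?g' * R\<^sup>2 = ?q'"
        proof (cases "R = 0")
          case False
          then have "exp (- 2 * ln \<bar>R\<bar>) * R\<^sup>2 = 1"
            by (simp add: exp_minus exp_double)
          then have "exp (- 2 * ln \<bar>R\<bar>) * R\<^sup>2 * z = z" for z by simp
          then show ?thesis using False by (simp add: mult_ac)
        qed simp
        have "(x + g R * (2 * R)) / 2 - x / 2 = g R * R" for x by (simp add: field_simps)
        then show ?thesis unfolding gq .
      qed
      ultimately show ?thesis
        by (simp add: has_real_derivative_iff_has_vector_derivative has_vector_derivative_at_within)
    qed
    have "((\<lambda>R. g R * R) has_integral (?G (exp M) - ?G 0)) {0..exp M}"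
      by (rule fundamental_theorem_of_calculus) (use Gd in auto)
    moreover have "?G (exp M) - ?G 0 = 0" using QM by (simp add: g_def)
    ultimately have "((\<lambda>R. if R \<in> {0..exp M} then g R * R else 0) has_integral 0) UNIV"
      by (simp only: has_integral_restrict_UNIV)
    also have "(\<lambda>R. if R \<in> {0..exp M} then g R * R else 0) = (\<lambda>R. if R \<in> {0..} then g R * R else 0)"
      using g0 by (auto simp: fun_eq_iff not_le)
    finally show ?thesis by (simp only: has_integral_restrict_UNIV)
  qed
  moreover have "\<Theta> X = g (norm X)" for X by (simp add: \<Theta>_def g_def)
  moreover have "square_integrable \<Theta>"
    by (rule square_integrableI[OF Ck_imp_continuous[OF TC[of 0]] T0])
  ultimately have "\<Theta> \<in> U0" by (auto simp: U0_def)
  then show thesis using that TC T0 Td by blast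
qed

text \<open>
  The factor \<open>cis (N \<psi>)\<close> is made smooth across the origin by writing it as the \<open>N\<close>-th power of the
  complex coordinate, divided by \<open>R^N\<close>; the radial factor vanishes near the origin.
\<close>

lemma mode_of_profile:
  fixes w :: "real \<Rightarrow> complex"
  assumes w: "\<And>k. Ck k w" "vanishes_beyond L w" and N: "0 < N"
  obtains W where "\<And>k. Ck k W" "\<And>Y. exp L < norm Y \<Longrightarrow> W Y = 0" "\<And>Y. norm Y < exp (- L) \<Longrightarrow> W Y = 0"
    "\<And>t \<psi>. W (polar (exp t) \<psi>) = w t * of_real (exp (- 3 * t)) * cis (real N * \<psi>)"
proof -
  let ?F = "\<lambda>t. w t * of_real (exp (- (3 + real N) * t))"
  let ?z = "\<lambda>X::real^2. of_real (X $ 1) + \<i> * of_real (X $ 2)"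
  define W where "W X = (if X = 0 then 0 else ?F (ln (norm X))) * ?z X ^ N" for X :: "real^2"
  have zC: "Ck k ?z" for k
    by (intro Ck_add Ck_mult Ck_const Ck_of_real Ck_linear bounded_linear_vec_nth)
  have F0: "?F s = 0" if "s \<le> - L - 1 \<or> L < s \<or> s < - L" for s using w(2) that by (auto simp: vanishes_beyond_def)
  have "Ck k W" for k
    unfolding W_def[abs_def]
    by (intro Ck_mult Ck_power zC Ck_log_radial[where l = "- L - 1"] Ck_of_real Ck_exp w(1)) (use F0 in auto)
  moreover have "W Y = 0" if "exp L < norm Y" for Y
  proof -
    have "ln (exp L) < ln (norm Y)" using that less_trans[OF exp_gt_zero that] by (subst ln_less_cancel_iff) auto
    then show ?thesis using F0[of "ln (norm Y)"] by (auto simp: W_def)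
  qed
  moreover have "W Y = 0" if "norm Y < exp (- L)" for Y
  proof (cases "Y = 0")
    case False
    then have "ln (norm Y) < ln (exp (- L))" using that by (subst ln_less_cancel_iff) auto
    then show ?thesis using F0[of "ln (norm Y)"] by (auto simp: W_def)
  qed (use N in \<open>simp add: W_def\<close>)
  moreover have "W (polar (exp t) \<psi>) = w t * of_real (exp (- 3 * t)) * cis (real N * \<psi>)" for t \<psi>
  proof -
    have z: "?z (polar (exp t) \<psi>) ^ N = of_real (exp (real N * t)) * cis (real N * \<psi>)"
    proof -
      have "?z (polar (exp t) \<psi>) = of_real (exp t) * cis \<psi>" by (simp add: complex_eq_iff)
      then show ?thesis by (simp only: power_mult_distrib Complex.DeMoivre of_real_power[symmetric] exp_of_nat_mult[symmetric])
    qed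
    have e: "exp (- (3 + real N) * t) * exp (real N * t) = exp (- 3 * t)"
      by (simp add: algebra_simps flip: exp_add)
    have n: "norm (polar (exp t) \<psi>) = exp t" "polar (exp t) \<psi> \<noteq> 0"
      using norm_polar[of "exp t" \<psi>] by auto
    show ?thesis unfolding W_def n(1) z e[symmetric] using n(2) by (simp only: if_False ln_exp of_real_mult mult_ac)
  qed
  ultimately show thesis by (rule that)
qed

lemma angular_derivative_of_mode:
  assumes d: "(W has_derivative W') (at (polar r \<phi>))" and W: "\<And>\<psi>. W (polar r \<psi>) = b * cis (real N * \<psi>)"
  shows "W' (perp (polar r \<phi>)) = \<i> * of_nat N * W (polar r \<phi>)"
proof -
  have "((\<lambda>\<psi>. W (polar r \<psi>)) has_derivative (\<lambda>h. W' (h *\<^sub>R perp (polar r \<phi>)))) (at \<phi>)"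
    by (rule has_derivative_compose[OF polar_angle_derivative[unfolded has_vector_derivative_def] d])
  then have "((\<lambda>\<psi>. W (polar r \<psi>)) has_vector_derivative W' (perp (polar r \<phi>))) (at \<phi>)"
    by (simp add: has_vector_derivative_def linear_scale[OF has_derivative_linear[OF d]])
  moreover have "((\<lambda>\<psi>. W (polar r \<psi>)) has_vector_derivative \<i> * of_nat N * (b * cis (real N * \<phi>))) (at \<phi>)"
    unfolding W has_vector_derivative_def
    by (auto intro!: derivative_eq_intros simp: fun_eq_iff scaleR_conv_of_real mult_ac)
  ultimately show ?thesis unfolding W by (rule vector_derivative_unique_at)
qed

lemma grad_nth: "(f has_derivative f') (at X) \<Longrightarrow> grad f X $ j = f' (axis j 1)"
  using frechet_derivative_at[of f f' X] by (simp add: grad_def)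

text \<open>
  The vortex rotates the mode, which multiplies it by \<open>- i n\<close> times the angular velocity, and the radial
  velocity of the mode advects the vortex. Both terms carry the factor \<open>e^(-3 s) cis (N \<phi>)\<close>, and what
  remains is the one-dimensional equation.
\<close>

lemma L0_eigen_equation:
  assumes \<alpha>: "0 \<le> \<alpha>" "\<alpha> \<le> 1" and a: "a = 1 + \<alpha> / 2"
    and T: "C1_compact (\<lambda>Y. of_real (\<Theta> Y)) T'"
    and T': "\<And>t \<psi> v. T' (polar (exp t) \<psi>) v = of_real (p t * exp (- 4 * t) * (polar (exp t) \<psi> \<bullet> v))"
    and WC: "C1_compact W W'" and W: "\<And>t \<psi>. W (polar (exp t) \<psi>) = w t * of_real (exp (- 3 * t)) * cis (real N * \<psi>)"
    and w: "continuous_on UNIV w" "vanishes_beyond L w"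
    and eig: "(of_real (LINT t|lborel. exp (- a * s) * exp (- a * t) * (real N * mode_kernel a 1 (s - t)) * p t) - c) * w s
       = of_real (p s) * (LINT t|lborel. of_real (exp (- a * s) * exp (- a * t) * mode_kernel a N (s - t)) * w t)"
    and X: "X = polar (exp s) \<phi>"
  shows "L0 \<alpha> \<Theta> W X = \<i> * of_real (C_const \<alpha>) * c * W X"
proof -
  let ?C = "complex_of_real (C_const \<alpha>)"
  define J where "J = (LINT t|lborel. exp (- a * s) * exp (- a * t) * mode_kernel a 1 (s - t) * p t)"
  define I where "I = (LINT t|lborel. of_real (exp (- a * s) * exp (- a * t) * mode_kernel a N (s - t)) * w t)"
  define K where "K j = (LINT Z|lborel. kern \<alpha> W' X j Z)" for j
  have dT: "((\<lambda>Y. complex_of_real (\<Theta> Y)) has_derivative T' Y) (at Y)" for Y using T by (simp add: C1_compact_def)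
  have dW: "(W has_derivative W' Y) (at Y)" for Y using WC by (simp add: C1_compact_def)
  have vT: "velocity \<alpha> (\<lambda>Y. complex_of_real (\<Theta> Y)) X $ j = - (?C * of_real J * of_real (perp X $ j))" for j
    unfolding velocity_eq_kern[OF T \<alpha>] radial_velocity[OF T \<alpha> a T' X] J_def by simp
  have vW: "velocity \<alpha> W X $ j = ?C * K j" for j
    unfolding velocity_eq_kern[OF WC \<alpha>] K_def ..
  have "W' X (perp X) = \<i> * of_nat N * W X"
    unfolding X by (rule angular_derivative_of_mode[OF dW]) (rule W)
  then have pW: "of_real (perp X $ 1) * W' X (axis 1 1) + of_real (perp X $ 2) * W' X (axis 2 1) = \<i> * of_nat N * W X"
    unfolding C1_compact_expand[OF WC, of X "perp X"] scaleR_conv_of_real .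
  have 1: "cdot (velocity \<alpha> (\<lambda>Y. complex_of_real (\<Theta> Y)) X) (grad W X) = - (?C * of_real J * (\<i> * of_nat N * W X))"
    unfolding cdot_def sum_2 vT grad_nth[OF dW] pW[symmetric] by (simp add: algebra_simps)
  have gT: "grad (\<lambda>Y. complex_of_real (\<Theta> Y)) X $ j = of_real (p s * exp (- 4 * s)) * of_real (X $ j)" for j
    unfolding grad_nth[OF dT] X T' by (simp add: inner_axis)
  have I: "of_real (X $ 1) * K 1 + of_real (X $ 2) * K 2 = \<i> * cis (real N * \<phi>) * of_real (exp s) * I"
    unfolding K_def I_def by (rule mode_velocity[OF WC \<alpha> a W w X])
  have "cdot (velocity \<alpha> W X) (grad (\<lambda>Y. complex_of_real (\<Theta> Y)) X)
     = ?C * of_real (p s * exp (- 4 * s)) * (of_real (X $ 1) * K 1 + of_real (X $ 2) * K 2)"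
    unfolding cdot_def sum_2 vW gT by (simp only: algebra_simps)
  also have "\<dots> = ?C * \<i> * cis (real N * \<phi>) * of_real (exp (- 4 * s) * exp s) * (of_real (p s) * I)"
    unfolding I of_real_mult by (simp only: mult_ac)
  also have "exp (- 4 * s) * exp s = exp (- 3 * s)" by (simp flip: exp_add)
  also have "of_real (p s) * I = (of_nat N * of_real J - c) * w s"
  proof -
    have "(LINT t|lborel. exp (- a * s) * exp (- a * t) * (real N * mode_kernel a 1 (s - t)) * p t)
       = (LINT t|lborel. real N * (exp (- a * s) * exp (- a * t) * mode_kernel a 1 (s - t) * p t))"
      by (intro Bochner_Integration.integral_cong refl) (simp only: mult_ac)
    also have "\<dots> = real N * J" unfolding J_def by (rule integral_mult_right_zero)
    finally show ?thesis using eig unfolding I_def by simp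
  qed
  finally have 2: "cdot (velocity \<alpha> W X) (grad (\<lambda>Y. complex_of_real (\<Theta> Y)) X) = ?C * \<i> * (of_nat N * of_real J - c) * W X"
    unfolding X W by (simp only: mult_ac)
  show ?thesis unfolding L0_def 1 2 by (simp add: algebra_simps)
qed

theorem theorem3p3:
  fixes \<alpha> :: real and n :: int
  assumes "0 \<le> \<alpha>" and "\<alpha> \<le> 1" and "n \<ge> 2"
  shows "\<exists>\<Theta>bar \<in> Cc_infinity \<inter> U0. \<exists>\<mu>::complex. \<exists>W \<in> Cc_infinity \<inter> U n.
           Re \<mu> > 0 \<and> W \<noteq> (\<lambda>X. 0) \<and> (\<forall>X. L0 \<alpha> \<Theta>bar W X = \<mu> * W X)"
proof -
  define a where "a = 1 + \<alpha> / 2"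
  define N where "N = nat n"
  have a2: "1 \<le> a" "a \<le> 3/2" using assms by (auto simp: a_def)
  have N: "2 \<le> N" "real_of_int n = real N" using assms(3) by (auto simp: N_def)
  obtain p :: "real \<Rightarrow> real" and w :: "real \<Rightarrow> complex" and c :: complex and L :: real where
    L: "0 < L" and p: "\<And>k. Ck k p" "vanishes_beyond L p" "(LINT t|lborel. p t) = 0"
    and c: "Im c < 0" and w: "\<And>k. Ck k w" "\<And>s. p s = 0 \<Longrightarrow> w s = 0" "\<exists>s. w s \<noteq> 0"
    and eig: "\<And>s. (of_real (LINT t|lborel. exp (- a * s) * exp (- a * t) * (real N * mode_kernel a 1 (s - t)) * p t) - c) * w s
       = of_real (p s) * (LINT t|lborel. of_real (exp (- a * s) * exp (- a * t) * mode_kernel a N (s - t)) * w t)"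
    by (rule unstable_profile_exists[OF a2 N(1)]) blast
  have wL: "vanishes_beyond L w" using p(2) w(2) by (auto simp: vanishes_beyond_def)
  obtain \<Theta> B where \<Theta>: "\<And>k. Ck k \<Theta>" "\<And>Y. B < norm Y \<Longrightarrow> \<Theta> Y = 0" "\<Theta> \<in> U0"
    "\<And>Y. (\<Theta> has_derivative (\<lambda>v. (if Y = 0 then 0 else p (ln (norm Y)) * exp (- 4 * ln (norm Y))) * (Y \<bullet> v))) (at Y)"
    by (rule vortex_of_profile[OF p(1,2) L p(3)]) blast
  obtain W where W: "\<And>k. Ck k W" "\<And>Y. exp L < norm Y \<Longrightarrow> W Y = 0" "\<And>Y. norm Y < exp (- L) \<Longrightarrow> W Y = 0"
    "\<And>t \<psi>. W (polar (exp t) \<psi>) = w t * of_real (exp (- 3 * t)) * cis (real N * \<psi>)"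
    by (rule mode_of_profile[OF w(1) wL, of N]) (use N in auto)
  let ?T' = "\<lambda>Y v. complex_of_real ((if Y = 0 then 0 else p (ln (norm Y)) * exp (- 4 * ln (norm Y))) * (Y \<bullet> v))"
  have T: "C1_compact (\<lambda>Y. of_real (\<Theta> Y)) ?T'"
  proof (rule C1_compactI)
    show "Ck (Suc 0) (\<lambda>Y. complex_of_real (\<Theta> Y))" by (rule Ck_of_real[OF \<Theta>(1)])
    show "((\<lambda>Y. complex_of_real (\<Theta> Y)) has_derivative ?T' Y) (at Y)" for Y by (rule has_derivative_of_real[OF \<Theta>(4)])
    show "B < norm Y \<Longrightarrow> complex_of_real (\<Theta> Y) = 0" for Y using \<Theta>(2) by simp
  qed
  have T': "?T' (polar (exp t) \<psi>) v = of_real (p t * exp (- 4 * t) * (polar (exp t) \<psi> \<bullet> v))" for t \<psi> v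
  proof -
    have n: "norm (polar (exp t) \<psi>) = exp t" "polar (exp t) \<psi> \<noteq> 0"
      using norm_polar[of "exp t" \<psi>] by auto
    show ?thesis unfolding n(1) ln_exp if_not_P[OF n(2)] ..
  qed
  obtain W' where W': "\<And>Y. (W has_derivative W' Y) (at Y)" by (rule Ck_SucE[OF W(1)[of "Suc 0"]]) (rule that, assumption)
  have WC: "C1_compact W W'" by (rule C1_compactI[OF W(1) W' W(2)])
  define \<mu> where "\<mu> = \<i> * of_real (C_const \<alpha>) * c"
  have eq: "L0 \<alpha> \<Theta> W X = \<mu> * W X" for X
  proof (cases "X = 0")
    case False
    then obtain s \<phi> where X: "X = polar (exp s) \<phi>" by (rule polar_exists)
    show ?thesis unfolding \<mu>_def
      by (rule L0_eigen_equation[OF assms(1,2) a_def T T' WC W(4) Ck_imp_continuous[OF w(1)[of 0]] wL eig X])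
  next
    case True
    \<comment> \<open>At the origin both functions are locally constant, hence both gradients vanish.\<close>
    have "(W has_derivative (\<lambda>_. 0)) (at 0)"
      by (rule has_derivative_transform_within_open[OF has_derivative_const[of 0], where s = "ball 0 (exp (- L))"])
        (use W(3) in auto)
    then have "grad W 0 $ j = 0" for j by (simp add: grad_nth)
    moreover have "grad (\<lambda>Y. complex_of_real (\<Theta> Y)) 0 $ j = 0" for j
    proof -
      have "((\<lambda>Y. complex_of_real (\<Theta> Y)) has_derivative ?T' 0) (at 0)" using T unfolding C1_compact_def by blast
      from grad_nth[OF this, of j] show ?thesis by simp
    qed
    ultimately show ?thesis using W(3)[of 0] by (simp add: True L0_def cdot_def)
  qed
  have C: "C_const \<alpha> > 0"
    unfolding C_const_def using assms by (intro mult_pos_pos divide_pos_pos Gamma_real_pos) auto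
  have "Re \<mu> > 0" using mult_pos_neg[OF C c] by (simp add: \<mu>_def)
  moreover have "W \<noteq> (\<lambda>X. 0)"
  proof
    assume "W = (\<lambda>X. 0)"
    then have "w s = 0" for s using W(4)[of s 0] by simp
    with w(3) show False by simp
  qed
  moreover have "\<Theta> \<in> Cc_infinity \<inter> U0" using Cc_infinityI[OF \<Theta>(1,2)] \<Theta>(3) by simp
  moreover have "W \<in> Cc_infinity \<inter> U n"
  proof -
    have "W (polar R \<phi>) = w (ln R) * of_real (exp (- 3 * ln R)) * cis (of_int n * \<phi>)" if "R > 0" for R \<phi>
      using W(4)[of "ln R" \<phi>] that N(2) by simp
    then have "\<exists>w. \<forall>R>0. \<forall>\<phi>. W (polar R \<phi>) = w R * cis (of_int n * \<phi>)"
      by (intro exI[of _ "\<lambda>R. w (ln R) * of_real (exp (- 3 * ln R))"]) blast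
    moreover have "square_integrable W"
      by (rule square_integrableI[OF Ck_imp_continuous[OF W(1)[of 0]] W(2)])
    ultimately show ?thesis using Cc_infinityI[OF W(1,2)] by (simp add: U_def)
  qed
  ultimately show ?thesis using eq by blast
qed

end
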